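(* Let $K,\ell\in\mathbb N$ with $\ell$ even, and let $\mathsf R$ be a non-degenerate $(K,\ell)$-rule with $\mathrm{ex}(\mathsf R)<2K+2$. For $1\le k\le K$ let $Y_k(N)$ denote the number of vertices in $k$-components of $G_N^{\mathsf R}$ (started from the empty graph on $n$ vertices). For $k\in\mathrm{slow}(\mathsf R)$ let $d_k:=e^{c_k(\mathsf R)}/k$, where $c_k(\mathsf R):=\lim_{t\to\infty}(\mathrm{ex}(\mathsf R)\cdot t+\log z_k(t))$ and $(z_k)_{k\in S_K}$ is the solution of the differential equation system given in the context (this limit exists). Then the following hold. (a) For any $c\in\mathbb R$, with probability $1-o(1/\log n)$ as $n\to\infty$ we have for all $N\ge (n\log n+cn)/\mathrm{ex}(\mathsf R)$ and all $k\in\mathrm{fast}(\mathsf R)$ that $Y_k(N)=0$, and there is only one component with more than $K$ vertices in $G_N^{\mathsf R}$. (b) For any $c\in\mathbb R$, $$\lim_{n\to\infty}\Pr\left[T_{\mathrm{con}}^{\mathsf R}\le\frac{n\log n+cn}{\mathrm{ex}(\mathsf R)}\right]=\prod_{k\in\mathrm{slow}(\mathsf R)}e^{-d_ke^{-c}}.$$ (c) Let $\gamma=0.577\ldots$ be the Euler-Mascheroni constant and $c_0:=\log\left(\sum_{k\in\mathrm{slow}(\mathsf R)}d_k\right)$. Then $$\mathbb E[T_{\mathrm{con}}^{\mathsf R}]=\frac{n\log n+\gamma n+c_0n}{\mathrm{ex}(\mathsf R)}+o(n).$$ (d) For $k\in[K]$ let $T_k^{\mathsf R}:=\min\{T\mid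 \forall N\ge T:\ Y_k(N)=0\}$ be the time at which the last $k$-component vanishes. Then $\Pr[T_k^{\mathsf R}=T_{\mathrm{con}}^{\mathsf R}]\to 0$ as $n\to\infty$ for $k\in\mathrm{fast}(\mathsf R)$, and for $k\in\mathrm{slow}(\mathsf R)$, $$\Pr[T_k^{\mathsf R}=T_{\mathrm{con}}^{\mathsf R}]\xrightarrow{n\to\infty}\frac{d_k}{\sum_{i\in\mathrm{slow}(\mathsf R)}d_i}.$$
   Context: Rules and processes. $\mathbb N=\{1,2,3,\dots\}$, $\mathbb N_0=\{0,1,2,\dots\}$, $[m]=\{1,\dots,m\}$; $\log$ is the natural logarithm. Let $K,\ell\in\mathbb N$ with $\ell$ even, and $S_K=\{1,2,\dots,K,\omega\}$, where $\omega$ is a formal symbol standing for "larger than $K$". A $(K,\ell)$-rule is a map $\mathsf R:S_K^\ell\to[\ell/2]$. For a graph $G$ and a vertex $v$, let $c_K(G;v)$ be the number of vertices of the component of $G$ containing $v$ if this number is at most $K$, and $c_K(G;v)=\omega$ otherwise. The $\mathsf R$-process with $n$ vertices is the random graph sequence $(G_N^{\mathsf R})_{N\ge0}$: $G_0^{\mathsf R}$ has vertex set $[n]$ and no edges; in round $N\ge1$, $\ell$ vertices $v_1,\dots,v_\ell$ are chosen independently and uniformly at random from $[n]$ (repetitions allowed), and $G_N^{\mathsf R}$ is obtained from $G_{N-1}^{\mathsf R}$ by adding the edge $\{v_{2i-1},v_{2i}\}$, where $i=\mathsf R(c_K(G_{N-1}^{\mathsf R};v_1),\dots,c_K(G_{N-1}^{\mathsf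 R};v_\ell))$; loops and multiple edges are ignored. $T_{\mathrm{con}}^{\mathsf R}=T_{\mathrm{con}}^{\mathsf R}(n)$ is the smallest $N\in\mathbb N_0\cup\{\infty\}$ such that $G_N^{\mathsf R}$ is connected. A $k$-component is a component with exactly $k$ vertices. Extinction rates. For $\mu,\nu\in S_K$ let $$C_{\mu,\nu}(\mathsf R)=\{s=(s_1,\dots,s_\ell)\in S_K^\ell\mid \{s_{2i-1},s_{2i}\}=\{\mu,\nu\},\text{ where } i=\mathsf R(s)\}.$$ For $1\le k\le K$ let $$\mathrm{ex}_k(\mathsf R)=k\cdot\left|\{s\in C_{k,\omega}(\mathsf R)\mid \exists i\in[\ell]:\ s_i=k\text{ and }s_j=\omega\text{ for all }j\in[\ell]\setminus\{i\}\}\right|,$$ $\mathrm{ex}(\mathsf R)=\min_{1\le k\le K}\mathrm{ex}_k(\mathsf R)$, $\mathrm{slow}(\mathsf R)=\{k\in[K]\mid \mathrm{ex}_k(\mathsf R)=\mathrm{ex}(\mathsf R)\}$ and $\mathrm{fast}(\mathsf R)=[K]\setminus\mathrm{slow}(\mathsf R)$. The rule is degenerate if $\mathrm{ex}(\mathsf R)=0$ and non-degenerate otherwise. Differential equations. For $s\in S_K^\ell$ and $\mu,\nu\in S_K$ define polynomials in $(z_k)_{k\in S_K}$ by $P_s=\prod_{j=1}^\ell z_{s_j}$ and $P_{\mu,\nu}=\sum_{s\in C_{\mu,\nu}(\mathsf R)}P_s$. The system is $$\frac{dz_k}{dt}=f_k(z_1(t),\dots,z_K(t),z_\omega(t)),\quad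 k\in S_K,$$ with $z_1(0)=1$ and $z_k(0)=0$ for $k\in S_K\setminus\{1\}$, where for $k\in[K]$, $f_k=f_k^+-f_k^-$ with $$f_k^+=k\sum_{1\le\mu\le\nu,\ \mu+\nu=k}P_{\mu,\nu},\qquad f_k^-=2kP_{k,k}+k\sum_{\mu\in S_K\setminus\{k\}}P_{\mu,k},$$ and $$f_\omega=\sum_{1\le\mu\le\nu\le K,\ \mu+\nu>K}(\mu+\nu)P_{\mu,\nu}+\sum_{\mu=1}^K\mu P_{\mu,\omega}.$$ This system has a unique solution $(z_k(t))_{k\in S_K}$ for $t\ge0$. *)

theory Defs
  imports "HOL-Probability.Probability" "HOL-Library.Extended_Nat" "HOL-Library.Landau_Symbols"
begin

section \<open>Rules\<close>

text \<open>The formal symbol \<open>\<omega>\<close> (``larger than \<open>K\<close>'') is encoded as \<open>\<infinity> :: enat\<close>. Tuples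
  \<open>(s\<^sub>1, \<dots>, s\<^sub>l)\<close> are functions on the index set \<open>{1..l}\<close> that are \<open>undefined\<close> elsewhere.\<close>

definition SK :: "nat \<Rightarrow> enat set" where
  "SK K = enat ` {1..K} \<union> {\<infinity>}"

definition size_tuples :: "nat \<Rightarrow> nat \<Rightarrow> (nat \<Rightarrow> enat) set" where
  "size_tuples K l = {1..l} \<rightarrow>\<^sub>E SK K"

definition is_rule :: "nat \<Rightarrow> nat \<Rightarrow> ((nat \<Rightarrow> enat) \<Rightarrow> nat) \<Rightarrow> bool" where
  "is_rule K l R \<longleftrightarrow> R \<in> size_tuples K l \<rightarrow> {1..l div 2}"

section \<open>Graphs\<close>

text \<open>A graph is given by a vertex set \<open>V\<close> and a set \<open>E\<close> of two-element edges.\<close>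

definition component_of :: "'a set \<Rightarrow> 'a set set \<Rightarrow> 'a \<Rightarrow> 'a set" where
  "component_of V E v = {w \<in> V. (v, w) \<in> {(a, b). {a, b} \<in> E}\<^sup>*}"

definition graph_components :: "'a set \<Rightarrow> 'a set set \<Rightarrow> 'a set set" where
  "graph_components V E = component_of V E ` V"

definition graph_connected :: "'a set \<Rightarrow> 'a set set \<Rightarrow> bool" where
  "graph_connected V E \<longleftrightarrow> (\<forall>v\<in>V. \<forall>w\<in>V. w \<in> component_of V E v)"

definition trunc_size :: "nat \<Rightarrow> 'a set \<Rightarrow> 'a set set \<Rightarrow> 'a \<Rightarrow> enat" where
  "trunc_size K V E v =
     (if card (component_of V E v) \<le> K then enat (card (component_of V E v)) else \<infinity>)"

section \<open>The process\<close>

text \<open>A sample point \<open>v :: nat \<Rightarrow> nat \<Rightarrow> nat\<close> records all vertex choices: \<open>v N j\<close> is the \<open>j\<close>-th vertex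
  (\<open>1 \<le> j \<le> l\<close>) chosen in round \<open>N + 1\<close>. All choices are independent and uniform on \<open>{1..n}\<close>.\<close>

definition choice_space :: "nat \<Rightarrow> nat \<Rightarrow> (nat \<Rightarrow> nat \<Rightarrow> nat) measure" where
  "choice_space l n =
     (\<Pi>\<^sub>M N\<in>(UNIV :: nat set). \<Pi>\<^sub>M j\<in>{1..l}. uniform_count_measure {1..n})"

definition add_edge :: "'a \<Rightarrow> 'a \<Rightarrow> 'a set set \<Rightarrow> 'a set set" where
  "add_edge a b E = (if a = b then E else insert {a, b} E)"

text \<open>The edge set of the graph after \<open>N\<close> rounds; its vertex set is always \<open>{1..n}\<close>.\<close>

primrec process_edges ::
  "nat \<Rightarrow> nat \<Rightarrow> ((nat \<Rightarrow> enat) \<Rightarrow> nat) \<Rightarrow> nat \<Rightarrow> (nat \<Rightarrow> nat \<Rightarrow> nat) \<Rightarrow> nat \<Rightarrow> nat set set" where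
  "process_edges K l R n v 0 = {}"
| "process_edges K l R n v (Suc N) =
     (let E = process_edges K l R n v N;
          i = R (\<lambda>j\<in>{1..l}. trunc_size K {1..n} E (v N j))
      in add_edge (v N (2 * i - 1)) (v N (2 * i)) E)"

definition Y ::
  "nat \<Rightarrow> nat \<Rightarrow> ((nat \<Rightarrow> enat) \<Rightarrow> nat) \<Rightarrow> nat \<Rightarrow> nat \<Rightarrow> (nat \<Rightarrow> nat \<Rightarrow> nat) \<Rightarrow> nat \<Rightarrow> nat" where
  "Y K l R n k v N =
     card {u \<in> {1..n}. card (component_of {1..n} (process_edges K l R n v N) u) = k}"

definition large_components ::
  "nat \<Rightarrow> nat \<Rightarrow> ((nat \<Rightarrow> enat) \<Rightarrow> nat) \<Rightarrow> nat \<Rightarrow> (nat \<Rightarrow> nat \<Rightarrow> nat) \<Rightarrow> nat \<Rightarrow> nat set set" where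
  "large_components K l R n v N =
     {C \<in> graph_components {1..n} (process_edges K l R n v N). card C > K}"

text \<open>Both hitting times take values in \<open>enat\<close>; recall \<open>Inf {} = \<infinity>\<close> there.\<close>

definition T_con ::
  "nat \<Rightarrow> nat \<Rightarrow> ((nat \<Rightarrow> enat) \<Rightarrow> nat) \<Rightarrow> nat \<Rightarrow> (nat \<Rightarrow> nat \<Rightarrow> nat) \<Rightarrow> enat" where
  "T_con K l R n v = Inf (enat ` {N. graph_connected {1..n} (process_edges K l R n v N)})"

definition T_last ::
  "nat \<Rightarrow> nat \<Rightarrow> ((nat \<Rightarrow> enat) \<Rightarrow> nat) \<Rightarrow> nat \<Rightarrow> nat \<Rightarrow> (nat \<Rightarrow> nat \<Rightarrow> nat) \<Rightarrow> enat" where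
  "T_last K l R n k v = Inf (enat ` {T. \<forall>N\<ge>T. Y K l R n k v N = 0})"

section \<open>Extinction rates\<close>

definition C_set ::
  "nat \<Rightarrow> nat \<Rightarrow> ((nat \<Rightarrow> enat) \<Rightarrow> nat) \<Rightarrow> enat \<Rightarrow> enat \<Rightarrow> (nat \<Rightarrow> enat) set" where
  "C_set K l R \<mu> \<nu> = {s \<in> size_tuples K l. {s (2 * R s - 1), s (2 * R s)} = {\<mu>, \<nu>}}"

definition ex_k :: "nat \<Rightarrow> nat \<Rightarrow> ((nat \<Rightarrow> enat) \<Rightarrow> nat) \<Rightarrow> nat \<Rightarrow> nat" where
  "ex_k K l R k =
     k * card {s \<in> C_set K l R (enat k) \<infinity>.
                 \<exists>i\<in>{1..l}. s i = enat k \<and> (\<forall>j\<in>{1..l} - {i}. s j = \<infinity>)}"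

definition ex_rate :: "nat \<Rightarrow> nat \<Rightarrow> ((nat \<Rightarrow> enat) \<Rightarrow> nat) \<Rightarrow> nat" where
  "ex_rate K l R = Min (ex_k K l R ` {1..K})"

definition slow :: "nat \<Rightarrow> nat \<Rightarrow> ((nat \<Rightarrow> enat) \<Rightarrow> nat) \<Rightarrow> nat set" where
  "slow K l R = {k \<in> {1..K}. ex_k K l R k = ex_rate K l R}"

definition fast :: "nat \<Rightarrow> nat \<Rightarrow> ((nat \<Rightarrow> enat) \<Rightarrow> nat) \<Rightarrow> nat set" where
  "fast K l R = {1..K} - slow K l R"

definition degenerate :: "nat \<Rightarrow> nat \<Rightarrow> ((nat \<Rightarrow> enat) \<Rightarrow> nat) \<Rightarrow> bool" where
  "degenerate K l R \<longleftrightarrow> ex_rate K l R = 0"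

section \<open>The differential equations\<close>

definition P_tuple :: "nat \<Rightarrow> (nat \<Rightarrow> enat) \<Rightarrow> (enat \<Rightarrow> real) \<Rightarrow> real" where
  "P_tuple l s x = (\<Prod>j\<in>{1..l}. x (s j))"

definition P_pair ::
  "nat \<Rightarrow> nat \<Rightarrow> ((nat \<Rightarrow> enat) \<Rightarrow> nat) \<Rightarrow> enat \<Rightarrow> enat \<Rightarrow> (enat \<Rightarrow> real) \<Rightarrow> real" where
  "P_pair K l R \<mu> \<nu> x = (\<Sum>s\<in>C_set K l R \<mu> \<nu>. P_tuple l s x)"

definition f_plus ::
  "nat \<Rightarrow> nat \<Rightarrow> ((nat \<Rightarrow> enat) \<Rightarrow> nat) \<Rightarrow> nat \<Rightarrow> (enat \<Rightarrow> real) \<Rightarrow> real" where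
  "f_plus K l R k x =
     real k * (\<Sum>(\<mu>, \<nu>)\<in>{(\<mu>, \<nu>). 1 \<le> \<mu> \<and> \<mu> \<le> \<nu> \<and> \<mu> + \<nu> = k}. P_pair K l R (enat \<mu>) (enat \<nu>) x)"

definition f_minus ::
  "nat \<Rightarrow> nat \<Rightarrow> ((nat \<Rightarrow> enat) \<Rightarrow> nat) \<Rightarrow> nat \<Rightarrow> (enat \<Rightarrow> real) \<Rightarrow> real" where
  "f_minus K l R k x =
     2 * real k * P_pair K l R (enat k) (enat k) x
       + real k * (\<Sum>\<mu>\<in>SK K - {enat k}. P_pair K l R \<mu> (enat k) x)"

definition f_omega ::
  "nat \<Rightarrow> nat \<Rightarrow> ((nat \<Rightarrow> enat) \<Rightarrow> nat) \<Rightarrow> (enat \<Rightarrow> real) \<Rightarrow> real" where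
  "f_omega K l R x =
     (\<Sum>(\<mu>, \<nu>)\<in>{(\<mu>, \<nu>). 1 \<le> \<mu> \<and> \<mu> \<le> \<nu> \<and> \<nu> \<le> K \<and> \<mu> + \<nu> > K}.
        real (\<mu> + \<nu>) * P_pair K l R (enat \<mu>) (enat \<nu>) x)
     + (\<Sum>\<mu>=1..K. real \<mu> * P_pair K l R (enat \<mu>) \<infinity> x)"

definition ode_rhs ::
  "nat \<Rightarrow> nat \<Rightarrow> ((nat \<Rightarrow> enat) \<Rightarrow> nat) \<Rightarrow> enat \<Rightarrow> (enat \<Rightarrow> real) \<Rightarrow> real" where
  "ode_rhs K l R \<kappa> x =
     (case \<kappa> of enat k \<Rightarrow> f_plus K l R k x - f_minus K l R k x | \<infinity> \<Rightarrow> f_omega K l R x)"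

text \<open>\<open>z t \<kappa>\<close> is the value of the component \<open>z\<^sub>\<kappa>\<close> at time \<open>t\<close>; only \<open>t \<ge> 0\<close> and \<open>\<kappa> \<in> SK K\<close> matter.\<close>

definition ode_solution ::
  "nat \<Rightarrow> nat \<Rightarrow> ((nat \<Rightarrow> enat) \<Rightarrow> nat) \<Rightarrow> (real \<Rightarrow> enat \<Rightarrow> real) \<Rightarrow> bool" where
  "ode_solution K l R z \<longleftrightarrow>
     (\<forall>\<kappa>\<in>SK K. z 0 \<kappa> = (if \<kappa> = enat 1 then 1 else 0)) \<and>
     (\<forall>\<kappa>\<in>SK K. \<forall>t\<ge>0.
        ((\<lambda>u. z u \<kappa>) has_real_derivative ode_rhs K l R \<kappa> (z t)) (at t within {0..}))"

definition shifted_log ::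
  "nat \<Rightarrow> nat \<Rightarrow> ((nat \<Rightarrow> enat) \<Rightarrow> nat) \<Rightarrow> (real \<Rightarrow> enat \<Rightarrow> real) \<Rightarrow> nat \<Rightarrow> real \<Rightarrow> real" where
  "shifted_log K l R z k t = real (ex_rate K l R) * t + ln (z t (enat k))"

definition c_const ::
  "nat \<Rightarrow> nat \<Rightarrow> ((nat \<Rightarrow> enat) \<Rightarrow> nat) \<Rightarrow> (real \<Rightarrow> enat \<Rightarrow> real) \<Rightarrow> nat \<Rightarrow> real" where
  "c_const K l R z k = Lim at_top (shifted_log K l R z k)"

definition d_const ::
  "nat \<Rightarrow> nat \<Rightarrow> ((nat \<Rightarrow> enat) \<Rightarrow> nat) \<Rightarrow> (real \<Rightarrow> enat \<Rightarrow> real) \<Rightarrow> nat \<Rightarrow> real" where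
  "d_const K l R z k = exp (c_const K l R z k) / real k"

end

theory Submission
  imports Defs
begin

text \<open>Write \<open>ex\<close> for the extinction rate. For a small constant \<open>dl\<close> the process follows the
  differential equations up to time \<open>n1 = dl * n * ln n\<close>: the mean squared distance between the
  fractions of vertices in \<open>k\<close>-components and the solution \<open>z\<close> grows by a Gronwall argument by less
  than a small power of \<open>n\<close>, starting from \<open>1 / n\<close>. As \<open>z t k\<close> behaves like \<open>k * d k * exp (- ex * t)\<close>
  for slow \<open>k\<close>, there are about \<open>d k * n * exp (- ex * n1 / n)\<close> components of size \<open>k\<close> at that time.

  From then on only rounds with a single chosen vertex outside the large components matter. Each
  component of slow size vanishes with probability about \<open>ex / n\<close> per round, while fast sizes and
  superfluous large components vanish at a larger rate, for the latter because \<open>ex < 2 * K + 2\<close>.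
  Hence the joint generating function of the slow counts at a later time is, up to an error that is
  polynomially small, the one at time \<open>n1\<close> evaluated at \<open>1 - (1 - ex / n) ^ j * (1 - u)\<close>, where \<open>j\<close>
  is the number of rounds in between. At \<open>u = 0\<close> this gives the limit law of the connection time,
  and applied at two times the joint law of the vanishing times, from which the last vanishing size
  is obtained by a Riemann sum. For the expectation, the connection time exceeds \<open>n1\<close> by the
  maximum of \<open>m\<close> geometric variables of parameter \<open>ex / n\<close>, whose mean is about
  \<open>n / ex * harm m\<close>, where \<open>m\<close> is the number of slow components at time \<open>n1\<close>; a universal bound on
  the decay of the number of components controls the tail.\<close>

section \<open>Components\<close>

text \<open>The small components have to be followed down to the last one, at times of order
  \<open>n * ln n\<close>, where the differential equations have lost their precision. Generating
  functions bridge the gap: to first order a round only replaces a variable \<open>u\<close> by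
  \<open>u + ex / n * (1 - u)\<close>, with an error proportional to \<open>1 - u\<close>, which
  shrinks geometrically as the variable is pulled back. Second moments suffice everywhere. They give
  errors that are negative powers of \<open>n\<close>, and these survive the factor
  \<open>ln n\<close> lost by summing over \<open>O(n * ln n)\<close> rounds. Two starting times are
  needed because the sharp rate \<open>ex\<close> holds only once few small components are left.
  Before \<open>n0\<close> a crude rate valid for every graph is used; from \<open>n0\<close> to
  \<open>n1\<close> the decay at the sharp rate earns the power of \<open>n\<close> that pays for
  rounds hitting two small components. Nonnegativity of \<open>z\<close>, its total mass 1 and a
  first exponential decay of the mass outside \<open>z \<infinity>\<close> are not derived from the
  equations but read off from the process, whose mean fractions converge to
  \<open>z\<close>.\<close>

lemma component_of_self: "v \<in> V ==> v \<in> component_of V E v"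
  by (simp add: component_of_def)

lemma component_of_subset: "component_of V E v \<subseteq> V"
  by (auto simp: component_of_def)

lemma edge_rtrancl_sym: "(a, b) \<in> {(a, b). {a, b} \<in> E}\<^sup>* ==> (b, a) \<in> {(a, b). {a, b} \<in> E}\<^sup>*"
proof -
  have "sym {(a, b). {a, b} \<in> E}"
    by (auto simp: sym_def insert_commute)
  then have "sym ({(a, b). {a, b} \<in> E}\<^sup>*)" by (rule sym_rtrancl)
  then show "(a, b) \<in> {(a, b). {a, b} \<in> E}\<^sup>* ==> ?thesis" by (auto dest: symD)
qed

lemma component_of_eq: "w \<in> component_of V E v ==> component_of V E w = component_of V E v"
  unfolding component_of_def using edge_rtrancl_sym[of v w E]
  by (auto intro: rtrancl_trans[of w v] rtrancl_trans[of v w])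

lemma component_of_disjoint:
  "component_of V E v ~= component_of V E w ==> component_of V E v \<inter> component_of V E w = {}"
  by (metis component_of_eq disjoint_iff)

text \<open>By symmetry of the old closure a single crossing of the new edge is enough, so applying
  \<open>rtrancl_insert\<close> to both orientations leaves three kinds of paths. Loops and edges
  inside one component are covered too: the union is then the old component.\<close>

lemma component_of_add_edge:
  assumes "a \<in> V" "b \<in> V" "u \<in> V"
  shows "component_of V (add_edge a b E) u =
    (if u \<in> component_of V E a \<union> component_of V E b then component_of V E a \<union> component_of V E b
     else component_of V E u)"
proof (cases "a = b")
  case True
  then show ?thesis using component_of_eq[of u V E a] by (auto simp: add_edge_def)
next
  case False
  define r where "r = {(a, b). {a, b} \<in> E}"
  have r': "{(x, y). {x, y} \<in> add_edge a b E} = insert (a, b) (insert (b, a) r)"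
    using False by (auto simp: add_edge_def r_def doubleton_eq_iff)
  have sym: "(x, y) \<in> r\<^sup>* ==> (y, x) \<in> r\<^sup>*" for x y
    unfolding r_def by (rule edge_rtrancl_sym)
  have trans: "(x, y) \<in> r\<^sup>* ==> (y, z) \<in> r\<^sup>* ==> (x, z) \<in> r\<^sup>*" for x y z
    by (rule rtrancl_trans)
  have cl: "(x, y) \<in> {(x, y). {x, y} \<in> add_edge a b E}\<^sup>* \<longleftrightarrow>
      (x, y) \<in> r\<^sup>* | (x, a) \<in> r\<^sup>* & (b, y) \<in> r\<^sup>* | (x, b) \<in> r\<^sup>* & (a, y) \<in> r\<^sup>*" for x y
    unfolding r' rtrancl_insert using sym trans by blast
  show ?thesis
    unfolding component_of_def cl unfolding r_def[symmetric]
    by (simp add: set_eq_iff assms) (use sym trans in blast)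
qed

lemma graph_components_add_edge:
  assumes "a \<in> V" "b \<in> V"
  shows "graph_components V (add_edge a b E) =
    insert (component_of V E a \<union> component_of V E b)
      (graph_components V E - {component_of V E a, component_of V E b})" (is "?L = ?R")
proof
  show "?L \<subseteq> ?R"
  proof
    fix C assume "C \<in> ?L"
    then obtain u where u: "u \<in> V" "C = component_of V (add_edge a b E) u"
      by (auto simp: graph_components_def)
    show "C \<in> ?R"
      using u component_of_add_edge[OF assms u(1), of E] component_of_self[of u V E]
      by (auto simp: graph_components_def split: if_splits)
  qed
  show "?R \<subseteq> ?L"
  proof
    fix C assume "C \<in> ?R"
    then consider "C = component_of V E a \<union> component_of V E b"
      | u where "u \<in> V" "C = component_of V E u" "C ~= component_of V E a" "C ~= component_of V E b"
      by (auto simp: graph_components_def)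
    then show "C \<in> ?L"
    proof cases
      case 1
      then show ?thesis
        using component_of_add_edge[OF assms assms(1), of E] component_of_self[OF assms(1), of E] assms
        unfolding graph_components_def by (metis (no_types, lifting) UnI1 image_eqI)
    next
      case 2
      then have "u \<notin> component_of V E a \<union> component_of V E b"
        using component_of_eq by (metis Un_iff)
      then show ?thesis
        using component_of_add_edge[OF assms 2(1), of E] 2
        unfolding graph_components_def by (metis image_eqI)
    qed
  qed
qed

lemma finite_graph_components: "finite V ==> finite (graph_components V E)"
  by (simp add: graph_components_def)

text \<open>The counts used below (components or vertices of given sizes, and \<open>Q\<close>) are
  additive functionals of this kind, so the single update rule \<open>comp_sum_add_edge\<close>
  tells how a round changes any of them.\<close>

definition comp_sum :: "'a set => 'a set set => (nat => real) => real" where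
  "comp_sum V E g = (SUM C:graph_components V E. g (card C))"

lemma comp_sum_add_edge:
  assumes "finite V" "a \<in> V" "b \<in> V"
  shows "comp_sum V (add_edge a b E) g = comp_sum V E g +
    (if component_of V E a = component_of V E b then 0
     else g (card (component_of V E a) + card (component_of V E b))
        - g (card (component_of V E a)) - g (card (component_of V E b)))"
proof (cases "component_of V E a = component_of V E b")
  case True
  have "graph_components V (add_edge a b E) = graph_components V E"
    unfolding graph_components_add_edge[OF assms(2,3)] using True assms
    by (auto simp: graph_components_def)
  then show ?thesis using True by (simp add: comp_sum_def)
next
  case False
  let ?A = "component_of V E a" and ?B = "component_of V E b" and ?G = "graph_components V E"
  have dis: "?A \<inter> ?B = {}" using False by (rule component_of_disjoint)
  have fin: "finite ?A" "finite ?B"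
    using assms(1) component_of_subset[of V E] by (auto intro: finite_subset)
  have self: "a \<in> ?A" "b \<in> ?B" using assms by (auto intro: component_of_self)
  \<comment> \<open>Needed for \<open>sum.insert\<close>: a component containing both endpoints
    would equal the component of each of them, contrary to the case assumption.\<close>
  have nin: "?A \<union> ?B \<notin> ?G"
  proof
    assume "?A \<union> ?B \<in> ?G"
    then obtain u where "?A \<union> ?B = component_of V E u" by (auto simp: graph_components_def)
    then have "?A = ?A \<union> ?B" "?B = ?A \<union> ?B"
      using component_of_eq[of a V E u] component_of_eq[of b V E u] self by blast+
    then show False using False by simp
  qed
  have AB: "?A \<in> ?G" "?B \<in> ?G" using assms by (auto simp: graph_components_def)
  have "comp_sum V (add_edge a b E) g = g (card (?A \<union> ?B)) + (SUM C:?G - {?A, ?B}. g (card C))"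
    unfolding comp_sum_def graph_components_add_edge[OF assms(2,3)]
    using nin finite_graph_components[OF assms(1), of E] by (subst sum.insert) auto
  also have "(SUM C:?G - {?A, ?B}. g (card C)) = comp_sum V E g - (SUM C:{?A, ?B}. g (card C))"
    unfolding comp_sum_def using AB finite_graph_components[OF assms(1), of E]
    by (subst sum_diff) auto
  finally show ?thesis using False card_Un_disjoint[OF fin dis] by simp
qed

lemma sum_vertices_components:
  fixes h :: "nat => real"
  assumes "finite V"
  shows "(SUM u:V. h (card (component_of V E u))) = comp_sum V E (%j. real j * h j)"
proof -
  have "(SUM u:V. h (card (component_of V E u))) =
     (SUM C:graph_components V E. SUM u:{u\<in>V. component_of V E u = C}. h (card (component_of V E u)))"
    unfolding graph_components_def using assms by (rule sum.image_gen)
  also have "... = (SUM C:graph_components V E. real (card C) * h (card C))"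
  proof (rule sum.cong[OF refl])
    fix C assume "C \<in> graph_components V E"
    then have "{u \<in> V. component_of V E u = C} = C"
      using component_of_eq[of _ V E] component_of_self[of _ V E] component_of_subset[of V E]
      by (fastforce simp: graph_components_def)
    moreover have "(SUM u:{u\<in>V. component_of V E u = C}. h (card (component_of V E u))) =
      (SUM u:{u\<in>V. component_of V E u = C}. h (card C))" by (rule sum.cong) auto
    ultimately show "(SUM u:{u\<in>V. component_of V E u = C}. h (card (component_of V E u))) =
        real (card C) * h (card C)" by simp
  qed
  finally show ?thesis by (simp add: comp_sum_def)
qed

definition comp_count :: "'a set => 'a set set => nat set => nat" where
  "comp_count V E S = card {C \<in> graph_components V E. card C \<in> S}"

lemma comp_count_comp_sum:
  "finite V ==> real (comp_count V E S) = comp_sum V E (%j. if j \<in> S then 1 else 0)"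
  unfolding comp_count_def comp_sum_def
  by (simp add: sum.If_cases finite_graph_components Int_def)

lemma graph_component_card_pos:
  "finite V ==> C \<in> graph_components V E ==> card C >= 1"
  using component_of_self[of _ V E] component_of_subset[of V E]
  by (auto simp: graph_components_def Suc_le_eq card_gt_0_iff intro: finite_subset)

lemma comp_count_Un:
  "finite V ==> S \<inter> T = {} ==> comp_count V E (S \<union> T) = comp_count V E S + comp_count V E T"
  unfolding comp_count_def
  by (subst card_Un_disjoint[symmetric])
     (auto simp: finite_graph_components intro!: arg_cong[where f = card])

lemma comp_count_mono: "finite V ==> S \<subseteq> T ==> comp_count V E S <= comp_count V E T"
  unfolding comp_count_def by (intro card_mono) (auto simp: finite_graph_components)

lemma comp_count_0_UNIV: "finite V ==> comp_count V E (S \<inter> {1..}) = comp_count V E S"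
  unfolding comp_count_def using graph_component_card_pos[of V _ E]
  by (intro arg_cong[where f = card]) auto

lemma graph_connected_iff:
  assumes "finite V" "V ~= {}"
  shows "graph_connected V E \<longleftrightarrow> comp_count V E UNIV = 1"
proof
  assume "graph_connected V E"
  then have "component_of V E v = V" if "v \<in> V" for v
    using that component_of_subset[of V E v] by (auto simp: graph_connected_def)
  then have "graph_components V E = {V}" using assms by (auto simp: graph_components_def)
  then show "comp_count V E UNIV = 1" by (simp add: comp_count_def)
next
  assume "comp_count V E UNIV = 1"
  then obtain C where C: "graph_components V E = {C}"
    by (auto simp: comp_count_def card_1_singleton_iff)
  then have "component_of V E v = C" if "v \<in> V" for v using that by (auto simp: graph_components_def)
  then show "graph_connected V E"
    using component_of_self[of _ V E] by (auto simp: graph_connected_def)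
qed

section \<open>Rules and tuples of sizes\<close>

lemma finite_SK: "finite (SK K)"
  by (simp add: SK_def)

lemma infinity_in_SK: "\<infinity> \<in> SK K"
  by (simp add: SK_def)

lemma enat_in_SK: "enat k \<in> SK K \<longleftrightarrow> 1 <= k & k <= K"
  by (auto simp: SK_def)

lemma SK_split: "(SUM q:SK K. f q) = f \<infinity> + (\<Sum>k=1..K. f (enat k))"
proof -
  have "(SUM q:SK K. f q) = f \<infinity> + (SUM q:enat ` {1..K}. f q)"
    unfolding SK_def by (subst sum.union_disjoint) (auto simp: add.commute)
  also have "(SUM q:enat ` {1..K}. f q) = (\<Sum>k=1..K. f (enat k))"
    by (subst sum.reindex) (auto simp: inj_on_def)
  finally show ?thesis .
qed

lemma sum_UNION_le:
  fixes f :: "'a => real"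
  assumes "finite I" "!!i. i \<in> I ==> finite (A i)" "!!i a. i \<in> I ==> a \<in> A i ==> 0 <= f a"
  shows "(SUM a:(\<Union>i\<in>I. A i). f a) <= (SUM i:I. SUM a:A i. f a)"
  using assms
proof (induction I rule: finite_induct)
  case (insert i I)
  have "(SUM a:A i \<union> (\<Union>i\<in>I. A i). f a) <= (SUM a:A i. f a) + (SUM a:(\<Union>i\<in>I. A i). f a)"
    using insert by (subst sum_Un) (auto intro!: sum_nonneg)
  then show ?case using insert by fastforce
qed simp

locale size_rule =
  fixes K l :: nat and R :: "(nat => enat) => nat"
  assumes K1: "1 <= K" and l1: "1 <= l" and even_l: "even l" and rule: "is_rule K l R"
begin

lemma l2: "2 <= l"
  using l1 even_l by presburger

abbreviation ST where "ST \<equiv> size_tuples K l"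

definition "sel1 s = 2 * R s - 1"
definition "sel2 s = 2 * R s"

lemma R_range: "s \<in> ST ==> 1 <= R s & R s <= l div 2"
  using rule by (auto simp: is_rule_def)

lemma sel_range: "s \<in> ST ==> sel1 s \<in> {1..l} & sel2 s \<in> {1..l} & sel1 s ~= sel2 s"
  using R_range[of s] even_l by (auto simp: sel1_def sel2_def)

lemma finite_ST: "finite ST"
  unfolding size_tuples_def by (intro finite_PiE) (auto simp: finite_SK)

lemma ST_app: "s \<in> ST ==> j \<in> {1..l} ==> s j \<in> SK K"
  by (auto simp: size_tuples_def)

lemma ST_sel: "s \<in> ST ==> s (sel1 s) \<in> SK K" "s \<in> ST ==> s (sel2 s) \<in> SK K"
  using sel_range ST_app by auto

lemma C_set_def': "C_set K l R \<mu> \<nu> = {s \<in> ST. {s (sel1 s), s (sel2 s)} = {\<mu>, \<nu>}}"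
  by (simp add: C_set_def sel1_def sel2_def)

text \<open>The change of the number of vertices in components of size \<open>q\<close> when components of sizes
  \<open>\<alpha>\<close> and \<open>\<beta>\<close> merge. For \<open>q = \<infinity>\<close> vertices already in a large component do not count.\<close>

definition gain :: "enat => enat => enat => real" where
  "gain q \<alpha> \<beta> = (case q of
     enat k => real k * (of_bool (\<alpha> + \<beta> = enat k) - of_bool (\<alpha> = enat k) - of_bool (\<beta> = enat k))
   | \<infinity> => if \<alpha> + \<beta> > enat K then
       (case \<alpha> of enat i => real i | \<infinity> => 0) + (case \<beta> of enat i => real i | \<infinity> => 0) else 0)"

lemma P_pair_sum: "P_pair K l R \<mu> \<nu> x =
    (SUM s:ST. of_bool ({s (sel1 s), s (sel2 s)} = {\<mu>, \<nu>}) * P_tuple l s x)"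
  unfolding P_pair_def C_set_def'
  using finite_ST by (simp add: sum.inter_filter[symmetric] if_distrib cong: if_cong)
    (auto intro!: sum.cong)

lemma sum_of_bool_unique:
  assumes "finite A" "!!p q. p \<in> A ==> q \<in> A ==> P p ==> P q ==> p = q"
  shows "(SUM p:A. of_bool (P p) :: real) = of_bool (EX p:A. P p)"
proof (cases "EX p:A. P p")
  case True
  then obtain p where p: "p \<in> A" "P p" by blast
  have "(SUM q:A. of_bool (P q) :: real) = (SUM q:A. if q = p then 1 else 0)"
    using p assms(2) by (intro sum.cong) auto
  then show ?thesis using p assms(1) True by simp
next
  case False
  then show ?thesis by (auto intro: sum.neutral)
qed

text \<open>A tuple belongs to \<open>C_set\<close> for at most one pair
  \<open>\<mu> <= \<nu>\<close> with sum \<open>k\<close>, namely minimum and maximum of the two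
  selected sizes, so the sum over pairs collapses to an indicator.\<close>

lemma f_plus_tuple:
  assumes "1 <= k" "k <= K"
  shows "f_plus K l R k x =
    (SUM s:ST. real k * of_bool (s (sel1 s) + s (sel2 s) = enat k) * P_tuple l s x)"
proof -
  let ?I = "{(\<mu>, \<nu>). 1 <= \<mu> & \<mu> <= \<nu> & \<mu> + \<nu> = k}"
  have finI: "finite ?I" by (rule finite_subset[of _ "{..k} \<times> {..k}"]) auto
  have "(\<Sum>(\<mu>, \<nu>)\<in>?I. P_pair K l R (enat \<mu>) (enat \<nu>) x) =
     (SUM p:?I. SUM s:ST. of_bool ({s (sel1 s), s (sel2 s)} = {enat (fst p), enat (snd p)}) * P_tuple l s x)"
    unfolding P_pair_sum by (auto intro!: sum.cong)
  also have "... = (SUM s:ST. (SUM p:?I. of_bool ({s (sel1 s), s (sel2 s)} = {enat (fst p), enat (snd p)})) * P_tuple l s x)"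
    by (subst sum.swap) (simp add: sum_distrib_right)
  also have "... = (SUM s:ST. of_bool (s (sel1 s) + s (sel2 s) = enat k) * P_tuple l s x)"
  proof (rule sum.cong[OF refl])
    fix s assume s: "s \<in> ST"
    have "(SUM p:?I. of_bool ({s (sel1 s), s (sel2 s)} = {enat (fst p), enat (snd p)}) :: real)
        = of_bool (EX p:?I. {s (sel1 s), s (sel2 s)} = {enat (fst p), enat (snd p)})"
      using finI by (rule sum_of_bool_unique) (auto simp: doubleton_eq_iff)
    also have "(EX p:?I. {s (sel1 s), s (sel2 s)} = {enat (fst p), enat (snd p)}) \<longleftrightarrow>
        s (sel1 s) + s (sel2 s) = enat k"
    proof
      assume "EX p:?I. {s (sel1 s), s (sel2 s)} = {enat (fst p), enat (snd p)}"
      then show "s (sel1 s) + s (sel2 s) = enat k"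
        by (auto simp: doubleton_eq_iff add.commute)
    next
      assume sum: "s (sel1 s) + s (sel2 s) = enat k"
      then obtain i j where ij: "s (sel1 s) = enat i" "s (sel2 s) = enat j"
        by (cases "s (sel1 s)"; cases "s (sel2 s)") auto
      have "1 <= i" "1 <= j" using ST_sel[OF s] ij by (auto simp: enat_in_SK)
      then have "(min i j, max i j) \<in> ?I" using sum ij by auto
      then show "EX p:?I. {s (sel1 s), s (sel2 s)} = {enat (fst p), enat (snd p)}"
        using ij by (intro bexI[of _ "(min i j, max i j)"]) (auto simp: min_def max_def)
    qed
    finally show "(SUM p:?I. of_bool ({s (sel1 s), s (sel2 s)} = {enat (fst p), enat (snd p)})) * P_tuple l s x
       = of_bool (s (sel1 s) + s (sel2 s) = enat k) * P_tuple l s x" by simp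
  qed
  finally show ?thesis by (simp add: f_plus_def sum_distrib_left mult.assoc)
qed

text \<open>The coefficient 2 of the pair \<open>k, k\<close> and the coefficient 1 of the mixed
  pairs are both produced by adding the indicators of the two selected positions.\<close>

lemma f_minus_tuple:
  assumes "1 <= k" "k <= K"
  shows "f_minus K l R k x =
    (SUM s:ST. real k * (of_bool (s (sel1 s) = enat k) + of_bool (s (sel2 s) = enat k)) * P_tuple l s x)"
proof -
  have "(SUM \<mu>:SK K - {enat k}. P_pair K l R \<mu> (enat k) x) =
    (SUM s:ST. (SUM \<mu>:SK K - {enat k}. of_bool ({s (sel1 s), s (sel2 s)} = {\<mu>, enat k})) * P_tuple l s x)"
    unfolding P_pair_sum by (subst sum.swap) (simp add: sum_distrib_right)
  also have "... = (SUM s:ST. of_bool ((s (sel1 s) = enat k) ~= (s (sel2 s) = enat k)) * P_tuple l s x)"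
  proof (rule sum.cong[OF refl])
    fix s assume s: "s \<in> ST"
    have "(SUM \<mu>:SK K - {enat k}. of_bool ({s (sel1 s), s (sel2 s)} = {\<mu>, enat k}) :: real)
        = of_bool (EX \<mu>:SK K - {enat k}. {s (sel1 s), s (sel2 s)} = {\<mu>, enat k})"
      using finite_SK by (intro sum_of_bool_unique) (auto simp: doubleton_eq_iff)
    also have "(EX \<mu>:SK K - {enat k}. {s (sel1 s), s (sel2 s)} = {\<mu>, enat k}) \<longleftrightarrow>
        (s (sel1 s) = enat k) ~= (s (sel2 s) = enat k)"
      using ST_sel[OF s] by (auto simp: doubleton_eq_iff)
    finally show "(SUM \<mu>:SK K - {enat k}. of_bool ({s (sel1 s), s (sel2 s)} = {\<mu>, enat k})) * P_tuple l s x
       = of_bool ((s (sel1 s) = enat k) ~= (s (sel2 s) = enat k)) * P_tuple l s x" by simp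
  qed
  finally have "f_minus K l R k x = (SUM s:ST. real k *
      (2 * of_bool ({s (sel1 s), s (sel2 s)} = {enat k, enat k})
       + of_bool ((s (sel1 s) = enat k) ~= (s (sel2 s) = enat k))) * P_tuple l s x)"
    by (simp add: f_minus_def P_pair_sum sum_distrib_left sum.distrib[symmetric] algebra_simps)
  also have "... = (SUM s:ST. real k * (of_bool (s (sel1 s) = enat k) + of_bool (s (sel2 s) = enat k)) * P_tuple l s x)"
    by (intro sum.cong refl arg_cong2[where f = "(*)"]) auto
  finally show ?thesis .
qed

lemma gain_omega_pairs:
  assumes "\<alpha> \<in> SK K" "\<beta> \<in> SK K"
  shows "(SUM p:{(\<mu>, \<nu>). 1 <= \<mu> & \<mu> <= \<nu> & \<nu> <= K & \<mu> + \<nu> > K}.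
        real (fst p + snd p) * of_bool ({\<alpha>, \<beta>} = {enat (fst p), enat (snd p)}))
      + (\<Sum>\<mu>=1..K. real \<mu> * of_bool ({\<alpha>, \<beta>} = {enat \<mu>, \<infinity>})) = gain \<infinity> \<alpha> \<beta>"
    (is "?S1 + ?S2 = _")
proof -
  let ?I = "{(\<mu>, \<nu>). 1 <= \<mu> & \<mu> <= \<nu> & \<nu> <= K & \<mu> + \<nu> > K}"
  have finI: "finite ?I" by (rule finite_subset[of _ "{..K} \<times> {..K}"]) auto
  have S2_fin: "(\<Sum>\<mu>=1..K. real \<mu> * of_bool (\<mu> = i)) = real i" if "1 <= i" "i <= K" for i
  proof -
    have "(\<Sum>\<mu>=1..K. real \<mu> * of_bool (\<mu> = i)) = (\<Sum>\<mu>=1..K. if \<mu> = i then real i else 0)"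
      by (intro sum.cong) auto
    then show ?thesis using that by (simp add: sum.delta)
  qed
  show ?thesis
  proof (cases \<alpha>)
    case a: (enat i)
    then have i: "1 <= i" "i <= K" using assms by (auto simp: enat_in_SK)
    show ?thesis
    proof (cases \<beta>)
      case b: (enat j)
      then have j: "1 <= j" "j <= K" using assms by (auto simp: enat_in_SK)
      have "?S1 = (SUM p:?I. if p = (min i j, max i j) then real (i + j) else 0)"
      proof (intro sum.cong refl)
        fix p assume p: "p \<in> ?I"
        obtain \<mu> \<nu> where pm: "p = (\<mu>, \<nu>)" by (cases p)
        have "{\<alpha>, \<beta>} = {enat (fst p), enat (snd p)} \<longleftrightarrow> i = \<mu> & j = \<nu> | i = \<nu> & j = \<mu>"
          unfolding a b pm doubleton_eq_iff by simp
        also have "... \<longleftrightarrow> p = (min i j, max i j)"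
          using p unfolding pm by (cases "i <= j") auto
        finally show "real (fst p + snd p) * of_bool ({\<alpha>, \<beta>} = {enat (fst p), enat (snd p)})
            = (if p = (min i j, max i j) then real (i + j) else 0)"
          by (auto simp: min_def max_def)
      qed
      also have "... = (if (min i j, max i j) \<in> ?I then real (i + j) else 0)"
        using finI by (rule sum.delta)
      also have "... = (if i + j > K then real (i + j) else 0)"
        using i j by auto
      finally have "?S1 = (if i + j > K then real (i + j) else 0)" .
      moreover have "?S2 = 0" unfolding a b by (simp add: doubleton_eq_iff)
      ultimately show ?thesis by (simp add: a b gain_def)
    next
      case b: infinity
      have "?S1 = 0" unfolding a b by (intro sum.neutral) (simp add: doubleton_eq_iff)
      moreover have "?S2 = (\<Sum>\<mu>=1..K. real \<mu> * of_bool (\<mu> = i))"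
        unfolding a b by (intro sum.cong refl) (auto simp: doubleton_eq_iff)
      ultimately show ?thesis using S2_fin[OF i] by (simp add: a b gain_def)
    qed
  next
    case a: infinity
    show ?thesis
    proof (cases \<beta>)
      case b: (enat j)
      then have j: "1 <= j" "j <= K" using assms by (auto simp: enat_in_SK)
      have "?S1 = 0" unfolding a b by (intro sum.neutral) (simp add: doubleton_eq_iff)
      moreover have "?S2 = (\<Sum>\<mu>=1..K. real \<mu> * of_bool (\<mu> = j))"
        unfolding a b by (intro sum.cong refl) (auto simp: doubleton_eq_iff)
      ultimately show ?thesis using S2_fin[OF j] by (simp add: a b gain_def)
    next
      case b: infinity
      have "?S1 = 0" unfolding a b by (intro sum.neutral) (simp add: doubleton_eq_iff)
      moreover have "?S2 = 0" unfolding a b by (simp add: doubleton_eq_iff)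
      ultimately show ?thesis by (simp add: a b gain_def)
    qed
  qed
qed

lemma f_omega_tuple:
  "f_omega K l R x = (SUM s:ST. gain \<infinity> (s (sel1 s)) (s (sel2 s)) * P_tuple l s x)"
proof -
  let ?I = "{(\<mu>, \<nu>). 1 <= \<mu> & \<mu> <= \<nu> & \<nu> <= K & \<mu> + \<nu> > K}"
  let ?e = "%s p. {s (sel1 s), s (sel2 s)} = {enat (fst p), enat (snd p)}"
  let ?d = "%s \<mu>. {s (sel1 s), s (sel2 s)} = {enat \<mu>, \<infinity>}"
  have finI: "finite ?I" by (rule finite_subset[of _ "{..K} \<times> {..K}"]) auto
  have 1: "(\<Sum>(\<mu>, \<nu>)\<in>?I. real (\<mu> + \<nu>) * P_pair K l R (enat \<mu>) (enat \<nu>) x) =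
     (SUM s:ST. (SUM p:?I. real (fst p + snd p) * of_bool (?e s p)) * P_tuple l s x)"
  proof -
    have "(\<Sum>(\<mu>, \<nu>)\<in>?I. real (\<mu> + \<nu>) * P_pair K l R (enat \<mu>) (enat \<nu>) x) =
      (SUM p:?I. SUM s:ST. real (fst p + snd p) * of_bool (?e s p) * P_tuple l s x)"
      unfolding P_pair_sum by (auto intro!: sum.cong simp: sum_distrib_left mult.assoc)
    also have "... = (SUM s:ST. (SUM p:?I. real (fst p + snd p) * of_bool (?e s p)) * P_tuple l s x)"
      by (subst sum.swap) (simp only: sum_distrib_right)
    finally show ?thesis .
  qed
  have 2: "(\<Sum>\<mu>=1..K. real \<mu> * P_pair K l R (enat \<mu>) \<infinity> x) =
     (SUM s:ST. (\<Sum>\<mu>=1..K. real \<mu> * of_bool (?d s \<mu>)) * P_tuple l s x)"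
  proof -
    have "(\<Sum>\<mu>=1..K. real \<mu> * P_pair K l R (enat \<mu>) \<infinity> x) =
      (\<Sum>\<mu>=1..K. SUM s:ST. real \<mu> * of_bool (?d s \<mu>) * P_tuple l s x)"
      unfolding P_pair_sum by (auto intro!: sum.cong simp: sum_distrib_left mult.assoc)
    also have "... = (SUM s:ST. (\<Sum>\<mu>=1..K. real \<mu> * of_bool (?d s \<mu>)) * P_tuple l s x)"
      by (subst sum.swap) (simp only: sum_distrib_right)
    finally show ?thesis .
  qed
  have 3: "(SUM p:?I. real (fst p + snd p) * of_bool (?e s p)) + (\<Sum>\<mu>=1..K. real \<mu> * of_bool (?d s \<mu>))
      = gain \<infinity> (s (sel1 s)) (s (sel2 s))" if s: "s \<in> ST" for s
    by (rule gain_omega_pairs[OF ST_sel[OF s]])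
  show ?thesis
    unfolding f_omega_def 1 2 sum.distrib[symmetric] distrib_right[symmetric]
    by (intro sum.cong refl) (simp only: 3)
qed

text \<open>This form links the equations to the process: if \<open>x\<close> is the vector of
  vertex fractions, the weights \<open>P_tuple\<close> are the probabilities of the size tuples, and
  the right side is the mean gain of one round.\<close>

theorem ode_rhs_tuple:
  assumes "q \<in> SK K"
  shows "ode_rhs K l R q x = (SUM s:ST. gain q (s (sel1 s)) (s (sel2 s)) * P_tuple l s x)"
proof (cases q)
  case (enat k)
  then have k: "1 <= k" "k <= K" using assms by (auto simp: enat_in_SK)
  show ?thesis
    unfolding ode_rhs_def enat by (simp add: f_plus_tuple[OF k] f_minus_tuple[OF k] gain_def
        sum_subtractf[symmetric] algebra_simps)
next
  case infinity
  then show ?thesis by (simp add: ode_rhs_def f_omega_tuple)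
qed

lemma gain_bound: "\<alpha> \<in> SK K ==> \<beta> \<in> SK K ==> q \<in> SK K ==> \<bar>gain q \<alpha> \<beta>\<bar> <= 2 * real K"
proof -
  assume a: "\<alpha> \<in> SK K" "\<beta> \<in> SK K" "q \<in> SK K"
  show ?thesis
  proof (cases q)
    case (enat k)
    have "\<bar>of_bool (\<alpha> + \<beta> = enat k) - of_bool (\<alpha> = enat k) - of_bool (\<beta> = enat k) :: real\<bar> <= 2" by auto
    moreover have "real k <= real K" using a enat by (simp add: enat_in_SK)
    ultimately have "real k * \<bar>of_bool (\<alpha> + \<beta> = enat k) - of_bool (\<alpha> = enat k) - of_bool (\<beta> = enat k) :: real\<bar> <= real K * 2"
      by (intro mult_mono) auto
    then show ?thesis using enat by (simp add: gain_def abs_mult)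
  next
    case infinity
    then show ?thesis using a by (auto simp: gain_def enat_in_SK split: enat.splits)
  qed
qed

section \<open>Weighted sums over tuples of sizes\<close>

lemma sum_P_tuple_PiE:
  assumes "!!j. j \<in> {1..l} ==> finite (B j)"
  shows "(SUM s:(\<Pi>\<^sub>E j\<in>{1..l}. B j). P_tuple l s x) = (PROD j:{1..l}. SUM q:B j. x q)"
  unfolding P_tuple_def using assms by (subst prod_sum_PiE) auto

text \<open>With at least two positions outside the large components, these tuples have total weight
  quadratic in \<open>1 - x \<infinity>\<close>; they form the error term of every linearisation
  below.\<close>

definition multi :: "(nat => enat) => bool" where
  "multi s \<longleftrightarrow> (EX i:{1..l}. EX j:{1..l}. i ~= j & s i ~= \<infinity> & s j ~= \<infinity>)"

text \<open>The tuples counted by \<open>ex_k\<close>: the only small component that is hit gets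
  absorbed into a large one.\<close>

definition single :: "nat => (nat => enat) set" where
  "single k = {s \<in> C_set K l R (enat k) \<infinity>. EX i:{1..l}. s i = enat k & (ALL j:{1..l} - {i}. s j = \<infinity>)}"

abbreviation ex where "ex \<equiv> ex_rate K l R"

lemma ex_k_single: "ex_k K l R k = k * card (single k)"
  by (simp add: ex_k_def single_def)

lemma single_subset: "single k \<subseteq> ST"
  by (auto simp: single_def C_set_def)

lemma P_tuple_nonneg:
  "(!!q. q \<in> SK K ==> 0 <= x q) ==> s \<in> ST ==> 0 <= P_tuple l s x"
  unfolding P_tuple_def by (intro prod_nonneg) (auto dest: ST_app)

lemma P_tuple_single:
  assumes "s \<in> single k"
  shows "P_tuple l s x = x (enat k) * x \<infinity> ^ (l - 1)"
proof -
  obtain i where i: "i \<in> {1..l}" "s i = enat k" "ALL j:{1..l} - {i}. s j = \<infinity>"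
    using assms by (auto simp: single_def)
  have "P_tuple l s x = x (s i) * (PROD j:{1..l} - {i}. x (s j))"
    unfolding P_tuple_def using i(1) by (intro prod.remove) auto
  also have "(PROD j:{1..l} - {i}. x (s j)) = (PROD j:{1..l} - {i}. x \<infinity>)"
    using i(3) by (intro prod.cong) auto
  finally show ?thesis using i by simp
qed

lemma sum_single: "(SUM s:single k. P_tuple l s x) = real (card (single k)) * (x (enat k) * x \<infinity> ^ (l - 1))"
  by (simp add: P_tuple_single)

lemma prod_remove_two:
  fixes c :: "'i => real"
  assumes "finite A" "i \<in> A" "j \<in> A" "i ~= j"
  shows "(PROD m:A. c m) = c i * (c j * (PROD m:A - {i} - {j}. c m))"
proof -
  have "(PROD m:A. c m) = c i * (PROD m:A - {i}. c m)"
    using assms by (intro prod.remove) auto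
  also have "(PROD m:A - {i}. c m) = c j * (PROD m:A - {i} - {j}. c m)"
    using assms by (intro prod.remove) auto
  finally show ?thesis .
qed

lemma prod_two_special:
  fixes c :: "nat => real"
  assumes "i \<in> {1..l}" "j \<in> {1..l}" "i ~= j" "!!m. m \<in> {1..l} - {i, j} ==> c m = d"
  shows "(PROD m:{1..l}. c m) = c i * c j * d ^ (l - 2)"
proof -
  have "(PROD m:{1..l}. c m) = c i * (c j * (PROD m:{1..l} - {i} - {j}. c m))"
    by (rule prod_remove_two[OF finite_atLeastAtMost assms(1-3)])
  also have "(PROD m:{1..l} - {i} - {j}. c m) = (PROD m:{1..l} - {i} - {j}. d)"
    by (rule prod.cong[OF refl], rule assms(4)) blast
  also have "... = d ^ card ({1..l} - {i} - {j})" by (rule prod_constant)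
  also have "card ({1..l} - {i} - {j}) = l - 2"
    using assms(1-3) by (subst card_Diff_singleton; (subst card_Diff_singleton)?) auto
  finally show ?thesis by simp
qed

lemma sum_two_special:
  assumes "(SUM q:SK K. x q) = 1" "i \<in> {1..l}" "j \<in> {1..l}" "i ~= j" "A \<subseteq> SK K" "B \<subseteq> SK K"
  shows "(SUM s:{s\<in>ST. s i \<in> A & s j \<in> B}. P_tuple l s x) = (SUM q:A. x q) * (SUM q:B. x q)"
proof -
  let ?B = "%m. if m = i then A else if m = j then B else SK K"
  have "{s\<in>ST. s i \<in> A & s j \<in> B} = (\<Pi>\<^sub>E m\<in>{1..l}. ?B m)"
  proof (intro set_eqI iffI)
    fix s assume "s \<in> {s\<in>ST. s i \<in> A & s j \<in> B}"
    then have s: "s \<in> ST" "s i \<in> A" "s j \<in> B" by blast+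
    show "s \<in> (\<Pi>\<^sub>E m\<in>{1..l}. ?B m)"
    proof (rule PiE_I)
      fix m assume "m \<in> {1..l}"
      with ST_app[OF s(1)] s(2,3) show "s m \<in> ?B m" by presburger
    next
      fix m assume "m \<notin> {1..l}"
      with s(1) show "s m = undefined" unfolding size_tuples_def by (rule PiE_arb)
    qed
  next
    fix s assume s: "s \<in> (\<Pi>\<^sub>E m\<in>{1..l}. ?B m)"
    have sm: "s m \<in> ?B m" if "m \<in> {1..l}" for m using s that by (rule PiE_mem)
    have "s m \<in> SK K" if "m \<in> {1..l}" for m
      using sm[OF that] assms(5,6) by (auto split: if_splits)
    moreover have "s m = undefined" if "m \<notin> {1..l}" for m using s that by (rule PiE_arb)
    ultimately have "s \<in> ST" unfolding size_tuples_def by (intro PiE_I)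
    moreover have "s i \<in> A" using sm[OF assms(2)] by simp
    moreover have "s j \<in> B" using sm[OF assms(3)] assms(4) by simp
    ultimately show "s \<in> {s\<in>ST. s i \<in> A & s j \<in> B}" by blast
  qed
  moreover have "finite (?B m)" for m
    using assms(5,6) finite_SK[of K] by (auto intro: finite_subset)
  ultimately have "(SUM s:{s\<in>ST. s i \<in> A & s j \<in> B}. P_tuple l s x) = (PROD m:{1..l}. SUM q:?B m. x q)"
    by (simp only: sum_P_tuple_PiE)
  also have "... = (SUM q:?B i. x q) * (SUM q:?B j. x q) * 1 ^ (l - 2)"
    using assms by (intro prod_two_special) auto
  finally show ?thesis using assms(4) by simp
qed

text \<open>A union bound over the fewer than \<open>l ^ 2\<close> ordered pairs of positions.
  Keeping a general set \<open>A\<close> for one of them yields, with \<open>A = {enat k}\<close>,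
  an error proportional to \<open>x (enat k)\<close> itself.\<close>

lemma sum_P_tuple_multi_containing:
  assumes nn: "!!q. q \<in> SK K ==> 0 <= x q" and sum: "(SUM q:SK K. x q) = 1"
    and A: "A \<subseteq> SK K"
  shows "(SUM s:{s\<in>ST. EX i:{1..l}. EX j:{1..l}. i ~= j & s i \<in> A & s j ~= \<infinity>}. P_tuple l s x)
    <= (real l)^2 * (SUM q:A. x q) * (1 - x \<infinity>)"
proof -
  let ?S = "%p. {s\<in>ST. s (fst p) \<in> A & s (snd p) \<in> SK K - {\<infinity>}}"
  let ?I = "{p \<in> {1..l} \<times> {1..l}. fst p ~= snd p}"
  have fI: "finite ?I" by simp
  have w: "(SUM q:SK K - {\<infinity>}. x q) = 1 - x \<infinity>"
    using sum finite_SK[of K] infinity_in_SK[of K] by (simp add: sum.remove)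
  have w0: "0 <= 1 - x \<infinity>" unfolding w[symmetric] by (intro sum_nonneg) (auto intro: nn)
  have A0: "0 <= (SUM q:A. x q)" using A by (intro sum_nonneg) (auto intro: nn)
  have "(SUM s:{s\<in>ST. EX i:{1..l}. EX j:{1..l}. i ~= j & s i \<in> A & s j ~= \<infinity>}. P_tuple l s x)
     <= (SUM s:(\<Union>p\<in>?I. ?S p). P_tuple l s x)"
  proof (rule sum_mono2)
    show "finite (\<Union>p\<in>?I. ?S p)" using finite_ST by auto
    show "{s\<in>ST. EX i:{1..l}. EX j:{1..l}. i ~= j & s i \<in> A & s j ~= \<infinity>} \<subseteq> (\<Union>p\<in>?I. ?S p)"
      using ST_app by fastforce
  qed (auto intro: P_tuple_nonneg nn)
  also have "... <= (SUM p:?I. SUM s:?S p. P_tuple l s x)"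
    using fI finite_ST nn by (intro sum_UNION_le) (auto intro: P_tuple_nonneg)
  also have "... = (SUM p:?I. (SUM q:A. x q) * (1 - x \<infinity>))"
    using A by (intro sum.cong refl) (subst sum_two_special[OF sum], auto simp: w)
  also have "... = real (card ?I) * ((SUM q:A. x q) * (1 - x \<infinity>))" by simp
  also have "card ?I <= card ({1..l} \<times> {1..l})" by (intro card_mono) auto
  then have "real (card ?I) <= (real l)^2" by (simp add: power2_eq_square flip: of_nat_mult)
  then have "real (card ?I) * ((SUM q:A. x q) * (1 - x \<infinity>)) <= (real l)^2 * ((SUM q:A. x q) * (1 - x \<infinity>))"
    using w0 A0 by (intro mult_right_mono) auto
  finally show ?thesis by (simp add: mult.assoc)
qed

lemma sum_P_tuple_multi:
  assumes nn: "!!q. q \<in> SK K ==> 0 <= x q" and sum: "(SUM q:SK K. x q) = 1"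
  shows "(SUM s:{s\<in>ST. multi s}. P_tuple l s x) <= (real l)^2 * (1 - x \<infinity>)^2"
proof -
  have w: "(SUM q:SK K - {\<infinity>}. x q) = 1 - x \<infinity>"
    using sum finite_SK[of K] infinity_in_SK[of K] by (simp add: sum.remove)
  have "{s\<in>ST. multi s} = {s\<in>ST. EX i:{1..l}. EX j:{1..l}. i ~= j & s i \<in> SK K - {\<infinity>} & s j ~= \<infinity>}"
    using ST_app by (fastforce simp: multi_def)
  then show ?thesis
    using sum_P_tuple_multi_containing[OF assms, of "SK K - {\<infinity>}"] unfolding w
    by (simp add: power2_eq_square mult.assoc)
qed

lemma ST_cases:
  assumes "s \<in> ST"
  obtains (multi) "multi s" | (all) "!!j. j \<in> {1..l} ==> s j = \<infinity>"
  | (one) i k where "i \<in> {1..l}" "1 <= k" "k <= K" "s i = enat k" "!!j. j \<in> {1..l} ==> j ~= i ==> s j = \<infinity>"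
      "~ multi s"
proof (cases "multi s")
  case False
  show ?thesis
  proof (cases "ALL j:{1..l}. s j = \<infinity>")
    case f: False
    then obtain i where i: "i \<in> {1..l}" "s i ~= \<infinity>" by blast
    then obtain k where k: "s i = enat k" by auto
    with ST_app[OF assms i(1)] have "1 <= k" "k <= K" by (auto simp: enat_in_SK)
    moreover have "s j = \<infinity>" if "j \<in> {1..l}" "j ~= i" for j
      using False i that unfolding multi_def by blast
    ultimately show ?thesis using that(3)[OF i(1) _ _ k] False by blast
  qed (use that in blast)
qed (use that in blast)

lemma single_iff:
  assumes "s \<in> ST" "i \<in> {1..l}" "s i = enat k" "!!j. j \<in> {1..l} ==> j ~= i ==> s j = \<infinity>"
  shows "s \<in> single k' \<longleftrightarrow> k' = k & (sel1 s = i | sel2 s = i)"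
proof
  assume "s \<in> single k'"
  then obtain i' where i': "i' \<in> {1..l}" "s i' = enat k'"
    and C: "{s (sel1 s), s (sel2 s)} = {enat k', \<infinity>}"
    by (auto simp: single_def C_set_def')
  have "i' = i" using assms(4)[OF i'(1)] i'(2) by auto
  moreover have "sel1 s = i | sel2 s = i"
  proof (rule ccontr)
    assume "~ ?thesis"
    then have "s (sel1 s) = \<infinity>" "s (sel2 s) = \<infinity>"
      using sel_range[OF assms(1)] assms(4)[of "sel1 s"] assms(4)[of "sel2 s"] by blast+
    then show False using C by (simp add: doubleton_eq_iff)
  qed
  ultimately show "k' = k & (sel1 s = i | sel2 s = i)" using i' assms(3) by auto
next
  assume a: "k' = k & (sel1 s = i | sel2 s = i)"
  then have "{s (sel1 s), s (sel2 s)} = {enat k, \<infinity>}"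
    using sel_range[OF assms(1)] assms(3) assms(4)[of "sel1 s"] assms(4)[of "sel2 s"]
    by (auto simp: doubleton_eq_iff)
  then show "s \<in> single k'"
    using a assms(1) assms(2,3) assms(4) unfolding single_def C_set_def'
    by (intro CollectI conjI bexI[of _ i]) auto
qed

lemma single_not_multi:
  assumes "s \<in> single k"
  shows "~ multi s"
proof
  assume "multi s"
  then obtain a b where ab: "a \<in> {1..l}" "b \<in> {1..l}" "a ~= b" "s a ~= \<infinity>" "s b ~= \<infinity>"
    by (auto simp: multi_def)
  obtain i where i: "i \<in> {1..l}" "ALL j:{1..l} - {i}. s j = \<infinity>" using assms by (auto simp: single_def)
  have "a = i" using ab i by (metis Diff_iff singletonD)
  moreover have "b = i" using ab i by (metis Diff_iff singletonD)
  ultimately show False using ab by simp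
qed

text \<open>Creating a size in \<open>{1..K}\<close> takes two small components, which only a
  \<open>multi\<close> tuple provides; what remains is the loss of the one component that is hit and
  selected.\<close>

lemma gain_not_multi:
  assumes s: "s \<in> ST" "~ multi s" and k: "1 <= k" "k <= K"
  shows "gain (enat k) (s (sel1 s)) (s (sel2 s)) = - real k * of_bool (s \<in> single k)"
  using s(1)
proof (cases rule: ST_cases)
  case multi
  then show ?thesis using s by simp
next
  case all
  then have "s \<notin> single k" by (auto simp: single_def)
  then show ?thesis using all sel_range[OF s(1)] by (simp add: gain_def)
next
  case (one i k')
  have *: "(s \<in> single k) \<longleftrightarrow> k = k' & (sel1 s = i | sel2 s = i)"
    by (rule single_iff[OF s(1) one(1,4,5)])
  have sel: "sel1 s \<in> {1..l}" "sel2 s \<in> {1..l}" "sel1 s ~= sel2 s"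
    using sel_range[OF s(1)] by blast+
  have s1: "s (sel1 s) = (if sel1 s = i then enat k' else \<infinity>)"
    using one(4) one(5)[OF sel(1)] by simp
  have s2: "s (sel2 s) = (if sel2 s = i then enat k' else \<infinity>)"
    using one(4) one(5)[OF sel(2)] by simp
  show ?thesis
    unfolding * gain_def s1 s2 using sel by auto
qed

text \<open>The two errors differ on purpose. The upper one is quadratic in
  \<open>1 - x \<infinity>\<close>; the lower one carries the factor \<open>x (enat k)\<close>,
  because a tuple without \<open>k\<close> can only increase the \<open>k\<close>-th coordinate. The
  lower bound is what later keeps the rescaled \<open>z (enat k)\<close> away from 0.\<close>

lemma ode_rhs_linearization:
  assumes nn: "!!q. q \<in> SK K ==> 0 <= x q" and sum: "(SUM q:SK K. x q) = 1"
    and k: "1 <= k" "k <= K"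
  shows "ode_rhs K l R (enat k) x <= - real (ex_k K l R k) * x (enat k) * x \<infinity> ^ (l - 1)
      + 2 * real K * (real l)^2 * (1 - x \<infinity>)^2"
    and "- real (ex_k K l R k) * x (enat k) * x \<infinity> ^ (l - 1)
      - 2 * real K * (real l)^2 * x (enat k) * (1 - x \<infinity>) <= ode_rhs K l R (enat k) x"
proof -
  let ?g = "%s. gain (enat k) (s (sel1 s)) (s (sel2 s))"
  let ?M = "{s\<in>ST. multi s}" and ?N = "{s\<in>ST. ~ multi s}"
  let ?D = "{s\<in>ST. EX i:{1..l}. EX j:{1..l}. i ~= j & s i \<in> {enat k} & s j ~= \<infinity>}"
  have kS: "enat k \<in> SK K" using k by (simp add: enat_in_SK)
  have gb: "\<bar>?g s\<bar> <= 2 * real K" if "s \<in> ST" for s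
    using ST_sel[OF that] kS by (intro gain_bound)
  have "(SUM s:?N. ?g s * P_tuple l s x) = (SUM s:?N. if s \<in> single k then - real k * P_tuple l s x else 0)"
    using gain_not_multi k by (intro sum.cong) auto
  also have "... = (SUM s:?N \<inter> single k. - real k * P_tuple l s x)"
    using finite_ST by (simp add: sum.If_cases Int_def)
  also have "?N \<inter> single k = single k"
    using single_not_multi single_subset by auto
  also have "(SUM s:single k. - real k * P_tuple l s x) = - real k * (SUM s:single k. P_tuple l s x)"
    by (rule sum_distrib_left[symmetric])
  also have "... = - real (ex_k K l R k) * x (enat k) * x \<infinity> ^ (l - 1)"
    by (simp add: sum_single ex_k_single)
  finally have N: "(SUM s:?N. ?g s * P_tuple l s x) = - real (ex_k K l R k) * x (enat k) * x \<infinity> ^ (l - 1)" .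
  have "ST = ?M \<union> ?N" by auto
  then have "ode_rhs K l R (enat k) x = (SUM s:?M \<union> ?N. ?g s * P_tuple l s x)"
    by (simp add: ode_rhs_tuple[OF kS])
  also have "... = (SUM s:?M. ?g s * P_tuple l s x) + (SUM s:?N. ?g s * P_tuple l s x)"
    using finite_ST by (intro sum.union_disjoint) auto
  finally have eq: "ode_rhs K l R (enat k) x = (SUM s:?M. ?g s * P_tuple l s x)
      - real (ex_k K l R k) * x (enat k) * x \<infinity> ^ (l - 1)" using N by simp
  have "(SUM s:?M. ?g s * P_tuple l s x) <= (SUM s:?M. 2 * real K * P_tuple l s x)"
    using gb by (intro sum_mono mult_right_mono P_tuple_nonneg nn) (auto simp: abs_le_iff)
  also have "... <= 2 * real K * ((real l)^2 * (1 - x \<infinity>)^2)"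
    unfolding sum_distrib_left[symmetric]
    using sum_P_tuple_multi[OF nn sum] by (intro mult_left_mono) auto
  finally show "ode_rhs K l R (enat k) x <= - real (ex_k K l R k) * x (enat k) * x \<infinity> ^ (l - 1)
      + 2 * real K * (real l)^2 * (1 - x \<infinity>)^2" using eq by (simp add: mult.assoc)
  have g_neg: "- (2 * real K) * of_bool (s \<in> ?D) <= ?g s" if sM: "s \<in> ?M" for s
  proof (cases "s \<in> ?D")
    case True
    then show ?thesis using gb[of s] sM by (simp add: abs_le_iff)
  next
    case False
    \<comment> \<open>In a \<open>multi\<close> tuple an entry \<open>k\<close> always has a small
      partner at another position, so outside \<open>?D\<close> the size \<open>k\<close> does not
      occur and cannot be lost.\<close>
    have "s (sel1 s) ~= enat k & s (sel2 s) ~= enat k"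
    proof (rule ccontr)
      assume "~ ?thesis"
      then obtain i where i: "i \<in> {1..l}" "s i = enat k" using sel_range[of s] sM by blast
      obtain a b where ab: "a \<in> {1..l}" "b \<in> {1..l}" "a ~= b" "s a ~= \<infinity>" "s b ~= \<infinity>"
        using sM by (auto simp: multi_def)
      then obtain j where j: "j \<in> {1..l}" "i ~= j" "s j ~= \<infinity>" by (cases "a = i") auto
      have "s \<in> ?D" using i j sM by (intro CollectI conjI bexI[of _ i] bexI[of _ j]) auto
      then show False using False by blast
    qed
    then have "0 <= ?g s" by (auto simp: gain_def)
    then show ?thesis using False by simp
  qed
  have Deq: "(SUM s:?D. P_tuple l s x) = (SUM s:?M. of_bool (s \<in> ?D) * P_tuple l s x)"
  proof -
    have "?D = {s\<in>?M. s \<in> ?D}" unfolding multi_def by auto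
    then have "(SUM s:?D. P_tuple l s x) = (SUM s:{s\<in>?M. s \<in> ?D}. P_tuple l s x)" by (rule arg_cong)
    also have "... = (SUM s:?M. if s \<in> ?D then P_tuple l s x else 0)"
      using finite_ST by (intro sum.inter_filter) auto
    also have "... = (SUM s:?M. of_bool (s \<in> ?D) * P_tuple l s x)"
      by (intro sum.cong refl) simp
    finally show ?thesis .
  qed
  have "(SUM s:?D. P_tuple l s x) <= (real l)^2 * x (enat k) * (1 - x \<infinity>)"
    using sum_P_tuple_multi_containing[OF nn sum, of "{enat k}"] kS by simp
  then have "2 * real K * ((real l)^2 * x (enat k) * (1 - x \<infinity>))
      >= 2 * real K * (SUM s:?M. of_bool (s \<in> ?D) * P_tuple l s x)"
    unfolding Deq[symmetric] by (intro mult_left_mono) auto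
  moreover have "(SUM s:?M. ?g s * P_tuple l s x) >= (SUM s:?M. - (2 * real K) * of_bool (s \<in> ?D) * P_tuple l s x)"
    using g_neg by (intro sum_mono mult_right_mono P_tuple_nonneg nn) auto
  moreover have "(SUM s:?M. - (2 * real K) * of_bool (s \<in> ?D) * P_tuple l s x)
      = - (2 * real K) * (SUM s:?M. of_bool (s \<in> ?D) * P_tuple l s x)"
    unfolding sum_distrib_left by (simp only: mult.assoc)
  ultimately show "- real (ex_k K l R k) * x (enat k) * x \<infinity> ^ (l - 1)
      - 2 * real K * (real l)^2 * x (enat k) * (1 - x \<infinity>) <= ode_rhs K l R (enat k) x"
    unfolding eq by linarith
qed

text \<open>Only the \<open>single\<close> tuples are kept of each pair of sizes \<open>k\<close>
  and \<open>\<infinity>\<close>; each size contributes at least the minimal rate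
  \<open>ex\<close>.\<close>

lemma f_omega_lower:
  assumes nn: "!!q. q \<in> SK K ==> 0 <= x q"
  shows "real ex * (\<Sum>k=1..K. x (enat k)) * x \<infinity> ^ (l - 1) <= ode_rhs K l R \<infinity> x"
proof -
  have xi: "0 <= x \<infinity>" by (rule nn[OF infinity_in_SK])
  have P0: "0 <= P_pair K l R \<mu> \<nu> x" for \<mu> \<nu>
    unfolding P_pair_def by (intro sum_nonneg P_tuple_nonneg nn) (auto simp: C_set_def)
  have "real ex * (\<Sum>k=1..K. x (enat k)) * x \<infinity> ^ (l - 1) = (\<Sum>k=1..K. real ex * (x (enat k) * x \<infinity> ^ (l - 1)))"
    by (simp add: sum_distrib_left sum_distrib_right mult.assoc)
  also have "... <= (\<Sum>k=1..K. real k * P_pair K l R (enat k) \<infinity> x)"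
  proof (intro sum_mono)
    fix k assume k: "k \<in> {1..K}"
    have "ex <= ex_k K l R k" using k by (auto simp: ex_rate_def)
    then have "real ex * (x (enat k) * x \<infinity> ^ (l - 1)) <= real (ex_k K l R k) * (x (enat k) * x \<infinity> ^ (l - 1))"
      using nn k xi by (intro mult_right_mono mult_nonneg_nonneg) (auto simp: enat_in_SK)
    also have "... = real k * (SUM s:single k. P_tuple l s x)"
      by (simp add: sum_single ex_k_single)
    also have "... <= real k * P_pair K l R (enat k) \<infinity> x"
      unfolding P_pair_def using finite_ST
      by (intro mult_left_mono sum_mono2 P_tuple_nonneg nn)
        (auto simp: single_def C_set_def intro: finite_subset)
    finally show "real ex * (x (enat k) * x \<infinity> ^ (l - 1)) <= real k * P_pair K l R (enat k) \<infinity> x" .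
  qed
  also have "... <= f_omega K l R x"
    unfolding f_omega_def using P0 by (auto intro!: sum_nonneg add_increasing)
  finally show ?thesis by (simp add: ode_rhs_def)
qed

end

section \<open>One round of the process\<close>

declare One_nat_def [simp del]

text \<open>By convexity the sum of squares with fixed total is largest when all entries but one sit
  at the lower bound \<open>b\<close>. For the excesses \<open>d i\<close> over \<open>b\<close>
  this is the inequality between the sum of squares and the square of the sum.\<close>

lemma sum_squares_le_extreme:
  fixes a :: "'i => real"
  assumes "finite I" "I ~= {}" "!!i. i \<in> I ==> b <= a i" "0 <= b"
  shows "(SUM i:I. (a i)^2) <= ((SUM i:I. a i) - (real (card I) - 1) * b)^2 + (real (card I) - 1) * b\<^sup>2"
proof -
  define d where "d i = a i - b" for i
  have d0: "0 <= d i" if "i \<in> I" for i using assms(3)[OF that] by (simp add: d_def)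
  define D where "D = (SUM i:I. d i)"
  have sum_a: "(SUM i:I. a i) = real (card I) * b + D"
    by (simp add: D_def d_def sum_subtractf)
  have "(SUM i:I. (d i)^2) <= (SUM i:I. d i * D)"
    unfolding power2_eq_square D_def using assms(1) d0
    by (intro sum_mono mult_left_mono member_le_sum) auto
  also have "... = D\<^sup>2" by (simp add: D_def sum_distrib_right power2_eq_square)
  finally have d2: "(SUM i:I. (d i)^2) <= D\<^sup>2" .
  have "(SUM i:I. (a i)^2) = (SUM i:I. b\<^sup>2 + 2 * b * d i + (d i)^2)"
    by (intro sum.cong) (auto simp: d_def power2_eq_square algebra_simps)
  also have "... = real (card I) * b\<^sup>2 + 2 * b * D + (SUM i:I. (d i)^2)"
    by (simp add: sum.distrib D_def sum_distrib_left)
  finally show ?thesis using d2 unfolding sum_a by (simp add: power2_eq_square algebra_simps)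
qed

lemma vertex_count_comp_sum:
  "finite V ==> real (card {u \<in> V. P (card (component_of V E u))})
    = comp_sum V E (%j. real j * of_bool (P j))"
  using sum_vertices_components[of V "%j. of_bool (P j)" E] by (simp add: Int_def)

context size_rule
begin

definition Tup :: "nat => (nat => nat) set" where
  "Tup n = {1..l} \<rightarrow>\<^sub>E {1..n}"

text \<open>A finite sum, so that estimates of one round need no measurability;
  \<open>integral_X\<close> identifies it with the integral over one round.\<close>

definition Av :: "nat => ((nat => nat) => real) => real" where
  "Av n g = (SUM x:Tup n. g x) / real n ^ l"

lemma finite_Tup: "finite (Tup n)"
  unfolding Tup_def by (intro finite_PiE) auto

lemma card_Tup: "card (Tup n) = n ^ l"
  by (simp add: Tup_def card_PiE)

lemma Tup_app: "x \<in> Tup n ==> j \<in> {1..l} ==> x j \<in> {1..n}"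
  by (auto simp: Tup_def)

lemma Av_mono: "(!!x. x \<in> Tup n ==> f x <= g x) ==> Av n f <= Av n g"
  unfolding Av_def by (intro divide_right_mono sum_mono) auto

lemma Av_cong: "(!!x. x \<in> Tup n ==> f x = g x) ==> Av n f = Av n g"
  unfolding Av_def by (simp cong: sum.cong)

lemma Av_const: "n >= 1 ==> Av n (%_. c) = c"
  by (simp add: Av_def card_Tup)

lemma Av_add: "Av n (%x. f x + g x) = Av n f + Av n g"
  by (simp add: Av_def sum.distrib add_divide_distrib)

lemma Av_diff: "Av n (%x. f x - g x) = Av n f - Av n g"
  by (simp add: Av_def sum_subtractf diff_divide_distrib)

lemma Av_cmult: "Av n (%x. c * f x) = c * Av n f"
  by (simp add: Av_def sum_distrib_left[symmetric])

lemma Av_sum: "Av n (%x. SUM i:I. f i x) = (SUM i:I. Av n (f i))"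
  unfolding Av_def by (subst sum.swap) (simp add: sum_divide_distrib)

lemma Av_abs_le: "(!!x. x \<in> Tup n ==> \<bar>f x\<bar> <= g x) ==> \<bar>Av n f\<bar> <= Av n g"
proof -
  assume a: "!!x. x \<in> Tup n ==> \<bar>f x\<bar> <= g x"
  have "Av n f <= Av n g" using a by (intro Av_mono) (auto simp: abs_le_iff)
  moreover have "Av n (%x. (-1) * f x) <= Av n g" using a by (intro Av_mono) (auto simp: abs_le_iff)
  ultimately show ?thesis unfolding Av_cmult by simp
qed

text \<open>Expanding \<open>\<phi> (x i) (x j)\<close> over the values \<open>u\<close>,
  \<open>w\<close> with point indicators turns the integrand into a sum of products over positions,
  which \<open>prod_sum_PiE\<close> evaluates.\<close>

lemma Av_two:
  assumes "i \<in> {1..l}" "j \<in> {1..l}" "i ~= j" "W \<subseteq> {1..n}"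
  shows "Av n (%x. of_bool (ALL m:{1..l} - {i, j}. x m \<in> W) * \<phi> (x i) (x j)) =
    (SUM u:{1..n}. SUM w:{1..n}. \<phi> u w) / (real n)^2 * (real (card W) / real n) ^ (l - 2)"
proof -
  let ?c = "%u w m y. if m = i then of_bool (y = u) else if m = j then of_bool (y = w) else (of_bool (y \<in> W) :: real)"
  have pw: "of_bool (ALL m:{1..l} - {i, j}. x m \<in> W) * \<phi> (x i) (x j) =
     (SUM u:{1..n}. SUM w:{1..n}. \<phi> u w * (PROD m:{1..l}. ?c u w m (x m)))" if x: "x \<in> Tup n" for x
  proof -
    have split: "(PROD m:{1..l}. ?c u w m (x m)) =
        of_bool (x i = u) * (of_bool (x j = w) * of_bool (ALL m:{1..l} - {i, j}. x m \<in> W))" for u w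
    proof -
      have "(PROD m:{1..l}. ?c u w m (x m)) = ?c u w i (x i) * (?c u w j (x j) * (PROD m:{1..l} - {i} - {j}. ?c u w m (x m)))"
        by (rule prod_remove_two[OF finite_atLeastAtMost assms(1-3)])
      also have "(PROD m:{1..l} - {i} - {j}. ?c u w m (x m)) = (PROD m:{1..l} - {i} - {j}. of_bool (x m \<in> W))"
        by (intro prod.cong) auto
      also have "... = of_bool (ALL m:{1..l} - {i} - {j}. x m \<in> W)"
        by (induction rule: finite_induct[OF finite_subset[of "{1..l} - {i} - {j}" "{1..l}"]]) auto
      also have "{1..l} - {i} - {j} = {1..l} - {i, j}" by auto
      finally show ?thesis using assms by simp
    qed
    have "(SUM u:{1..n}. SUM w:{1..n}. \<phi> u w * (PROD m:{1..l}. ?c u w m (x m))) =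
      (SUM u:{1..n}. SUM w:{1..n}. if w = x j then (if u = x i then
          \<phi> (x i) (x j) * of_bool (ALL m:{1..l} - {i, j}. x m \<in> W) else 0) else 0)"
      unfolding split by (intro sum.cong) auto
    also have "... = \<phi> (x i) (x j) * of_bool (ALL m:{1..l} - {i, j}. x m \<in> W)"
      using Tup_app[OF x assms(1)] Tup_app[OF x assms(2)] by (simp add: sum.delta)
    finally show ?thesis by simp
  qed
  have val: "(SUM x:Tup n. PROD m:{1..l}. ?c u w m (x m)) = real (card W) ^ (l - 2)"
    if "u \<in> {1..n}" "w \<in> {1..n}" for u w
  proof -
    have "(SUM x:Tup n. PROD m:{1..l}. ?c u w m (x m)) = (PROD m:{1..l}. SUM y:{1..n}. ?c u w m y)"
      unfolding Tup_def by (rule prod_sum_PiE[symmetric]) auto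
    also have "... = (SUM y:{1..n}. ?c u w i y) * (SUM y:{1..n}. ?c u w j y) * real (card W) ^ (l - 2)"
      using assms by (intro prod_two_special) (auto simp: Int_absorb1 Int_commute inf.absorb2 intro!: arg_cong[where f = card])
    also have "(SUM y:{1..n}. ?c u w i y) = 1" using that by (simp add: of_bool_def)
    also have "(SUM y:{1..n}. ?c u w j y) = 1" using that assms by (simp add: of_bool_def)
    finally show ?thesis by simp
  qed
  have "(SUM x:Tup n. of_bool (ALL m:{1..l} - {i, j}. x m \<in> W) * \<phi> (x i) (x j)) =
     (SUM x:Tup n. SUM u:{1..n}. SUM w:{1..n}. \<phi> u w * (PROD m:{1..l}. ?c u w m (x m)))"
    by (intro sum.cong refl pw)
  also have "... = (SUM u:{1..n}. SUM x:Tup n. SUM w:{1..n}. \<phi> u w * (PROD m:{1..l}. ?c u w m (x m)))"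
    by (rule sum.swap)
  also have "... = (SUM u:{1..n}. SUM w:{1..n}. SUM x:Tup n. \<phi> u w * (PROD m:{1..l}. ?c u w m (x m)))"
    by (intro sum.cong refl sum.swap)
  also have "... = (SUM u:{1..n}. SUM w:{1..n}. \<phi> u w * real (card W) ^ (l - 2))"
    unfolding sum_distrib_left[symmetric] by (intro sum.cong refl arg_cong2[where f = "(*)"] val)
  also have "... = (SUM u:{1..n}. SUM w:{1..n}. \<phi> u w) * real (card W) ^ (l - 2)"
    by (simp add: sum_distrib_right)
  finally have "Av n (%x. of_bool (ALL m:{1..l} - {i, j}. x m \<in> W) * \<phi> (x i) (x j))
     = (SUM u:{1..n}. SUM w:{1..n}. \<phi> u w) * real (card W) ^ (l - 2) / real n ^ l" by (simp add: Av_def)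
  moreover have "real n ^ l = (real n)^2 * real n ^ (l - 2)" using l2 by (metis le_add_diff_inverse power_add)
  ultimately show ?thesis by (simp add: power_divide)
qed

definition sizes :: "nat => nat set set => (nat => nat) => nat => enat" where
  "sizes n E x = (\<lambda>j\<in>{1..l}. trunc_size K {1..n} E (x j))"

definition round :: "nat => nat set set => (nat => nat) => nat set set" where
  "round n E x = add_edge (x (sel1 (sizes n E x))) (x (sel2 (sizes n E x))) E"

lemma process_edges_Suc: "process_edges K l R n v (Suc N) = round n (process_edges K l R n v N) (v N)"
  by (simp add: round_def sizes_def sel1_def sel2_def Let_def)

definition frac :: "nat => nat set set => enat => real" where
  "frac n E q = real (card {u \<in> {1..n}. trunc_size K {1..n} E u = q}) / real n"

abbreviation block :: "nat => nat set set => nat => nat set" where "block n E u \<equiv> component_of {1..n} E u"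

lemma comp_card: "u \<in> {1..n} ==> 1 <= card (block n E u)"
  by (rule graph_component_card_pos[of "{1..n}" _ E]) (auto simp: graph_components_def)

lemma trunc_size_SK: "(u::nat) \<in> {1..n} ==> trunc_size K {1..n} E u \<in> SK K"
  using comp_card[of u n E] by (auto simp: trunc_size_def enat_in_SK infinity_in_SK)

lemma sizes_ST: "x \<in> Tup n ==> sizes n E x \<in> ST"
  using trunc_size_SK Tup_app by (fastforce simp: sizes_def size_tuples_def)

lemma sizes_app: "j \<in> {1..l} ==> sizes n E x j = trunc_size K {1..n} E (x j)"
  by (simp add: sizes_def)

lemma frac_nonneg: "0 <= frac n E q"
  by (simp add: frac_def)

lemma frac_sum: "n >= 1 ==> (SUM q:SK K. frac n E q) = 1"
proof -
  assume n: "n >= 1"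
  have "real n = (SUM u:{1..n}. 1)" by simp
  also have "... = (SUM q:SK K. SUM u:{u\<in>{1..n}. trunc_size K {1..n} E u = q}. 1)"
    using trunc_size_SK by (intro sum.group[symmetric] finite_SK finite_atLeastAtMost image_subsetI)
  finally show ?thesis using n by (simp add: frac_def sum_divide_distrib[symmetric])
qed

lemma frac_le_1: "n >= 1 ==> q \<in> SK K ==> frac n E q <= 1"
  using frac_sum[of n E] member_le_sum[of q "SK K" "frac n E"] finite_SK frac_nonneg by auto

text \<open>The \<open>l\<close> vertices are independent and uniform, so the number of vertex
  tuples with size tuple \<open>s\<close> is a product of class sizes.\<close>

lemma Av_sizes:
  "Av n (%x. h (sizes n E x)) = (SUM s:ST. h s * P_tuple l s (frac n E))"
proof -
  have "(SUM x:Tup n. h (sizes n E x)) = (SUM s:ST. SUM x:{x\<in>Tup n. sizes n E x = s}. h (sizes n E x))"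
    using finite_ST finite_Tup sizes_ST by (intro sum.group[symmetric]) auto
  also have "... = (SUM s:ST. h s * real (card {x\<in>Tup n. sizes n E x = s}))"
    by (intro sum.cong) auto
  also have "... = (SUM s:ST. h s * (PROD j:{1..l}. real (card {u\<in>{1..n}. trunc_size K {1..n} E u = s j})))"
  proof (intro sum.cong refl arg_cong2[where f = "(*)"])
    fix s assume s: "s \<in> ST"
    have "{x\<in>Tup n. sizes n E x = s} = (\<Pi>\<^sub>E j\<in>{1..l}. {u\<in>{1..n}. trunc_size K {1..n} E u = s j})" (is "?A = ?B")
    proof
      show "?A \<subseteq> ?B"
      proof
        fix x assume x: "x \<in> ?A"
        have "trunc_size K {1..n} E (x j) = s j" if "j \<in> {1..l}" for j
          using x sizes_app[OF that, of n E x] by auto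
        then show "x \<in> ?B" using x by (auto simp: Tup_def PiE_iff)
      qed
      show "?B \<subseteq> ?A"
      proof
        fix x assume x: "x \<in> ?B"
        have "sizes n E x = s"
          using x s unfolding sizes_def size_tuples_def
          by (intro ext) (auto simp: PiE_iff extensional_def)
        then show "x \<in> ?A" using x by (auto simp: Tup_def PiE_iff)
      qed
    qed
    then show "real (card {x\<in>Tup n. sizes n E x = s}) = (PROD j:{1..l}. real (card {u\<in>{1..n}. trunc_size K {1..n} E u = s j}))"
      by (simp add: card_PiE)
  qed
  finally show ?thesis
    by (simp add: Av_def sum_divide_distrib P_tuple_def frac_def prod_dividef)
qed

lemma Av_sizes_of_bool:
  "Av n (%x. of_bool (sizes n E x \<in> A)) = (SUM s:ST \<inter> A. P_tuple l s (frac n E))"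
proof -
  have "Av n (%x. of_bool (sizes n E x \<in> A)) = (SUM s:ST. of_bool (s \<in> A) * P_tuple l s (frac n E))"
    by (rule Av_sizes)
  also have "... = (SUM s:ST. if s \<in> A then P_tuple l s (frac n E) else 0)"
    by (intro sum.cong) auto
  also have "... = (SUM s:ST \<inter> A. P_tuple l s (frac n E))"
    by (rule sum.inter_restrict[symmetric, OF finite_ST])
  finally show ?thesis .
qed

lemma Av_multi: "n >= 1 ==> Av n (%x. of_bool (multi (sizes n E x))) <= (real l)^2 * (1 - frac n E \<infinity>)^2"
  using Av_sizes_of_bool[of n E "Collect multi"] sum_P_tuple_multi[of "frac n E"] frac_nonneg frac_sum
  by (simp add: Int_def)

lemma frac_small: "1 <= k ==> k <= K ==> frac n E (enat k) = real k * real (comp_count {1..n} E {k}) / real n"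
proof -
  assume k: "1 <= k" "k <= K"
  have "{u \<in> {1..n}. trunc_size K {1..n} E u = enat k} = {u \<in> {1..n}. card (block n E u) = k}"
    using k by (auto simp: trunc_size_def)
  then have "real (card {u \<in> {1..n}. trunc_size K {1..n} E u = enat k}) = comp_sum {1..n} E (%j. real j * of_bool (j = k))"
    by (simp only: vertex_count_comp_sum[OF finite_atLeastAtMost, where P = "%j. j = k"])
  also have "... = real k * comp_sum {1..n} E (%j. if j \<in> {k} then 1 else 0)"
    unfolding comp_sum_def sum_distrib_left by (intro sum.cong) auto
  finally show ?thesis by (simp add: frac_def comp_count_comp_sum)
qed

lemma frac_large: "real n * frac n E \<infinity> = comp_sum {1..n} E (%j. real j * of_bool (K < j))" if "n >= 1"
proof -
  have "{u \<in> {1..n}. trunc_size K {1..n} E u = \<infinity>} = {u \<in> {1..n}. K < card (block n E u)}"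
    by (auto simp: trunc_size_def)
  then show ?thesis using that unfolding frac_def
    by (simp only: vertex_count_comp_sum[OF finite_atLeastAtMost, where P = "%j. K < j"]) simp
qed

text \<open>The factor \<open>k\<close> of \<open>ex_k\<close> accounts for the \<open>k\<close>
  vertices of each component, so \<open>ex_k / n\<close> is a rate per component.\<close>

lemma Av_single:
  assumes "1 <= k" "k <= K" "n >= 1"
  shows "Av n (%x. of_bool (sizes n E x \<in> single k)) =
     real (ex_k K l R k) * real (comp_count {1..n} E {k}) / real n * frac n E \<infinity> ^ (l - 1)"
  using assms single_subset[of k]
  by (simp add: Av_sizes_of_bool inf.absorb2 sum_single ex_k_single frac_small)

lemma round_comp_sum:
  assumes "x \<in> Tup n"
  shows "comp_sum {1..n} (round n E x) g = comp_sum {1..n} E g +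
    (let a = x (sel1 (sizes n E x)); b = x (sel2 (sizes n E x)) in
     if block n E a = block n E b then 0
     else g (card (block n E a) + card (block n E b)) - g (card (block n E a)) - g (card (block n E b)))"
  unfolding round_def Let_def
  using Tup_app[OF assms] sel_range[OF sizes_ST[OF assms]] by (intro comp_sum_add_edge) auto

definition differ :: "nat => nat set set => (nat => nat) => bool" where
  "differ n E x \<longleftrightarrow> block n E (x (sel1 (sizes n E x))) ~= block n E (x (sel2 (sizes n E x)))"

text \<open>The number of mergers still missing: it drops by exactly one in every round that joins
  two components and vanishes exactly for connected graphs.\<close>

definition Q :: "nat => nat set set => real" where
  "Q n E = real (comp_count {1..n} E UNIV) - 1"

lemma Q_nonneg: "n >= 1 ==> 0 <= Q n E"
proof -
  assume "n >= 1"
  then have "graph_components {1..n} E ~= {}" by (auto simp: graph_components_def)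
  then have "card (graph_components {1..n} E) >= 1"
    using finite_graph_components[of "{1..n}" E] by (simp add: One_nat_def Suc_le_eq card_gt_0_iff)
  then show ?thesis by (simp add: Q_def comp_count_def)
qed

lemma Q_le: "Q n E <= real n"
proof -
  have "card (graph_components {1..n} E) <= n"
    unfolding graph_components_def using card_image_le[of "{1..n}"] by simp
  then show ?thesis by (simp add: Q_def comp_count_def)
qed

lemma Q_round: "x \<in> Tup n ==> Q n (round n E x) = Q n E - of_bool (differ n E x)"
  using round_comp_sum[of x n E "%_. 1"]
  by (auto simp: Q_def comp_count_comp_sum differ_def Let_def)

text \<open>The event that all chosen vertices lie in large components and that the selected edge joins
  two different ones; it is expressed through the fixed pair of positions that the rule selects on
  the constant tuple.\<close>

definition merge_large :: "nat => nat set set => (nat => nat) => bool" where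
  "merge_large n E x \<longleftrightarrow> (ALL j:{1..l}. K < card (block n E (x j))) & differ n E x"

lemma Av_merge_large:
  assumes n: "n >= 1" and L: "comp_count {1..n} E {K<..} >= 1"
  shows "Av n (%x. of_bool (merge_large n E x)) >=
    (real (comp_count {1..n} E {K<..}) - 1) * real (K + 1) / real n *
    (2 * frac n E \<infinity> - real (comp_count {1..n} E {K<..}) * real (K + 1) / real n) * frac n E \<infinity> ^ (l - 2)"
proof -
  define s0 where "s0 = (\<lambda>j\<in>{1..l}. \<infinity> :: enat)"
  define i where "i = sel1 s0"
  define j where "j = sel2 s0"
  have s0: "s0 \<in> ST" by (auto simp: s0_def size_tuples_def infinity_in_SK)
  have ij: "i \<in> {1..l}" "j \<in> {1..l}" "i ~= j" using sel_range[OF s0] by (auto simp: i_def j_def)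
  define W where "W = {u \<in> {1..n}. K < card (block n E u)}"
  define \<phi> where "\<phi> u w = (of_bool (u \<in> W & w \<in> W & block n E u ~= block n E w) :: real)" for u w
  define G where "G = {C \<in> graph_components {1..n} E. K < card C}"
  define A where "A = real (card W)"
  define m where "m = real (comp_count {1..n} E {K<..})"
  define b where "b = real (K + 1)"
  have m: "m = real (card G)" by (simp add: m_def comp_count_def G_def)
  have finG: "finite G" by (simp add: G_def finite_graph_components)
  have Gne: "G ~= {}" using L unfolding comp_count_def G_def[symmetric] greaterThan_iff by (intro notI) simp
  have AW: "A = real n * frac n E \<infinity>"
    unfolding A_def W_def frac_large[OF n]
    by (rule vertex_count_comp_sum) simp
  have AG: "A = (SUM C:G. real (card C))"
  proof -
    have "A = comp_sum {1..n} E (%j. real j * of_bool (K < j))"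
      unfolding A_def W_def by (rule vertex_count_comp_sum) simp
    also have "... = (SUM C:graph_components {1..n} E. if K < card C then real (card C) else 0)"
      unfolding comp_sum_def by (intro sum.cong) auto
    finally show ?thesis unfolding G_def by (simp add: sum.inter_filter finite_graph_components)
  qed
  have bool_eq: "of_bool (ALL m:{1..l} - {i, j}. x m \<in> W) * \<phi> (x i) (x j) <= of_bool (merge_large n E x)"
    if x: "x \<in> Tup n" for x
  proof (cases "(ALL m:{1..l} - {i, j}. x m \<in> W) & x i \<in> W & x j \<in> W & block n E (x i) ~= block n E (x j)")
    case True
    then have all: "ALL m:{1..l}. x m \<in> W" by auto
    then have "trunc_size K {1..n} E (x m) = \<infinity>" if "m \<in> {1..l}" for m
      using that by (auto simp: W_def trunc_size_def not_le)
    then have "sizes n E x = s0" unfolding sizes_def s0_def by (intro restrict_ext) blast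
    then have "merge_large n E x" using all True by (simp add: merge_large_def differ_def W_def i_def j_def)
    then show ?thesis by (simp add: \<phi>_def)
  next
    case False
    then show ?thesis by (auto simp: \<phi>_def)
  qed
  have inner: "(SUM w:{1..n}. \<phi> u w) = of_bool (K < card (block n E u)) * (A - real (card (block n E u)))" if u: "u \<in> {1..n}" for u
  proof (cases "u \<in> W")
    case True
    have cu: "block n E u \<subseteq> W" "finite (block n E u)"
    proof -
      show "block n E u \<subseteq> W"
      proof
        fix w assume w: "w \<in> block n E u"
        then show "w \<in> W" using True component_of_eq[OF w] component_of_subset[of "{1..n}" E u]
          by (auto simp: W_def)
      qed
      then show "finite (block n E u)" by (rule finite_subset) (simp add: W_def)
    qed
    have "{w \<in> {1..n}. w \<in> W & block n E u ~= block n E w} = W - block n E u" (is "?A = ?B")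
    proof -
      have "w \<in> block n E u \<longleftrightarrow> block n E u = block n E w" if "w \<in> {1..n}" for w
        using component_of_eq[of w "{1..n}" E u] component_of_self[OF that, of E] by metis
      then show ?thesis by (auto simp: W_def)
    qed
    then have "(SUM w:{1..n}. \<phi> u w) = real (card (W - block n E u))"
      using True by (simp add: \<phi>_def Int_def conj_commute)
    also have "... = A - real (card (block n E u))"
      using cu card_mono[of W "block n E u"] by (simp add: card_Diff_subset A_def of_nat_diff W_def)
    finally show ?thesis using True by (simp add: W_def)
  next
    case False
    then show ?thesis using u by (simp add: \<phi>_def W_def)
  qed
  have "(SUM u:{1..n}. SUM w:{1..n}. \<phi> u w) =
     (SUM u:{1..n}. of_bool (K < card (block n E u)) * (A - real (card (block n E u))))"
    by (intro sum.cong refl inner)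
  also have "... = comp_sum {1..n} E (%j. real j * (of_bool (K < j) * (A - real j)))"
    by (rule sum_vertices_components) simp
  also have "... = (SUM C:G. real (card C) * (A - real (card C)))"
  proof -
    have "comp_sum {1..n} E (%j. real j * (of_bool (K < j) * (A - real j)))
       = (SUM C:graph_components {1..n} E. if K < card C then real (card C) * (A - real (card C)) else 0)"
      unfolding comp_sum_def by (intro sum.cong) auto
    then show ?thesis unfolding G_def by (simp add: sum.inter_filter finite_graph_components)
  qed
  also have "... = A\<^sup>2 - (SUM C:G. (real (card C))^2)"
    by (simp add: right_diff_distrib sum_subtractf sum_distrib_right[symmetric] AG[symmetric] power2_eq_square)
  also have "... >= A\<^sup>2 - ((A - (m - 1) * b)^2 + (m - 1) * b\<^sup>2)"
    using sum_squares_le_extreme[OF finG Gne, of b "%C. real (card C)"]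
    by (auto simp: AG m b_def G_def)
  also have "A\<^sup>2 - ((A - (m - 1) * b)^2 + (m - 1) * b\<^sup>2) = (m - 1) * b * (2 * A - m * b)"
    by (simp add: power2_eq_square algebra_simps)
  finally have S: "(m - 1) * b * (2 * A - m * b) <= (SUM u:{1..n}. SUM w:{1..n}. \<phi> u w)" by simp
  have "(m - 1) * b * (2 * A - m * b) / (real n)^2 * (real (card W) / real n) ^ (l - 2)
     <= (SUM u:{1..n}. SUM w:{1..n}. \<phi> u w) / (real n)^2 * (real (card W) / real n) ^ (l - 2)"
    using S by (intro mult_right_mono divide_right_mono) auto
  also have "... = Av n (%x. of_bool (ALL m:{1..l} - {i, j}. x m \<in> W) * \<phi> (x i) (x j))"
    using ij by (intro Av_two[symmetric]) (auto simp: W_def)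
  also have "... <= Av n (%x. of_bool (merge_large n E x))"
    by (intro Av_mono bool_eq)
  finally have f1: "(m - 1) * b * (2 * A - m * b) / (real n)^2 * (real (card W) / real n) ^ (l - 2)
    <= Av n (%x. of_bool (merge_large n E x))" .
  have f2: "real (card W) / real n = frac n E \<infinity>" using AW n by (simp add: A_def)
  have f3: "(m - 1) * b * (2 * A - m * b) / (real n)^2 = (m - 1) * b / real n * (2 * frac n E \<infinity> - m * b / real n)"
    using n by (simp add: AW power2_eq_square field_simps)
  show ?thesis using f1[unfolded f2 f3] unfolding m_def b_def .
qed

end

section \<open>Drift of the component counts\<close>

lemma comp_count_sum:
  assumes "finite V" "finite S"
  shows "comp_count V E S = (SUM k:S. comp_count V E {k})"
  using assms(2)
proof (induction S rule: finite_induct)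
  case empty
  then show ?case by (simp add: comp_count_def)
next
  case (insert k S)
  then show ?case using comp_count_Un[of V "{k}" S E] assms(1) by simp
qed

text \<open>Taylor expansion with explicit remainder. The remainder of order \<open>Suc m\<close> is
  \<open>u\<close> times that of order \<open>m\<close> plus \<open>a\<close> times the first
  difference, so both bounds follow by induction.\<close>

lemma power_add_second_order:
  fixes u a :: real
  assumes "0 <= u" "0 <= a" "u + a <= 1"
  shows "0 <= (u + a) ^ m - u ^ m - real m * a * u ^ (m - 1)"
    and "(u + a) ^ m - u ^ m - real m * a * u ^ (m - 1) <= (real m * a)^2"
    and "0 <= (u + a) ^ m - u ^ m" and "(u + a) ^ m - u ^ m <= real m * a"
proof -
  have 0: "0 <= (u + a) ^ m - u ^ m" for m using assms by (simp add: power_mono)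
  then show "0 <= (u + a) ^ m - u ^ m" .
  have 1: "(u + a) ^ m - u ^ m <= real m * a" for m
  proof (induction m)
    case (Suc m)
    have "(u + a) ^ Suc m - u ^ Suc m = u * ((u + a) ^ m - u ^ m) + a * (u + a) ^ m"
      by (simp add: algebra_simps)
    also have "... <= 1 * (real m * a) + a * 1"
      using assms 0[of m] Suc by (intro add_mono mult_mono) (auto simp: power_le_one)
    finally show ?case by (simp add: algebra_simps)
  qed simp
  then show "(u + a) ^ m - u ^ m <= real m * a" .
  have 2: "0 <= (u + a) ^ m - u ^ m - real m * a * u ^ (m - 1) &
    (u + a) ^ m - u ^ m - real m * a * u ^ (m - 1) <= (real m * a)^2" for m
  proof (induction m)
    case (Suc m)
    let ?r = "(u + a) ^ m - u ^ m - real m * a * u ^ (m - 1)"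
    have eq: "(u + a) ^ Suc m - u ^ Suc m - real (Suc m) * a * u ^ (Suc m - 1)
        = u * ?r + a * ((u + a) ^ m - u ^ m)"
      by (cases m) (simp_all add: algebra_simps)
    have "u * ?r + a * ((u + a) ^ m - u ^ m) <= 1 * (real m * a)^2 + a * (real m * a)"
      using assms Suc 1[of m] by (intro add_mono mult_mono) (auto intro: power_mono)
    also have "... <= (real (Suc m) * a)^2"
      using assms by (simp add: power2_eq_square algebra_simps)
    finally have le: "u * ?r + a * ((u + a) ^ m - u ^ m) <= (real (Suc m) * a)^2" .
    have "0 <= u * ?r + a * ((u + a) ^ m - u ^ m)"
      using Suc[THEN conjunct1] assms 0[of m] by (intro add_nonneg_nonneg mult_nonneg_nonneg)
    then show ?case unfolding eq using le by blast
  qed simp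
  from 2 show "0 <= (u + a) ^ m - u ^ m - real m * a * u ^ (m - 1)" by blast
  from 2 show "(u + a) ^ m - u ^ m - real m * a * u ^ (m - 1) <= (real m * a)^2" by blast
qed

lemma power_power_second_order:
  fixes u a v b :: real
  assumes "0 <= u" "0 <= a" "u + a <= 1" "0 <= v" "0 <= b" "v + b <= 1"
  shows "\<bar>(u + a) ^ m * (v + b) ^ k - u ^ m * v ^ k - real m * a * u ^ (m - 1) * v ^ k
      - real k * b * u ^ m * v ^ (k - 1)\<bar> <= (real m * a + real k * b)^2"
proof -
  define X where "X = (u + a) ^ m" define x where "x = u ^ m" define x1 where "x1 = real m * a * u ^ (m - 1)"
  define Y where "Y = (v + b) ^ k" define y where "y = v ^ k" define y1 where "y1 = real k * b * v ^ (k - 1)"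
  note p = power_add_second_order[OF assms(1-3), of m, folded X_def x_def x1_def]
  note q = power_add_second_order[OF assms(4-6), of k, folded Y_def y_def y1_def]
  have X: "0 <= X" "X <= 1" and y: "0 <= y" "y <= 1" and y1: "0 <= y1" "y1 <= real k * b"
    using assms by (auto simp: X_def y_def y1_def power_le_one mult_left_le)
  have eq: "X * Y - x * y - x1 * y - x * y1 = X * (Y - y - y1) + (X - x) * y1 + (X - x - x1) * y"
    by (simp add: algebra_simps)
  have "0 <= X * (Y - y - y1) + (X - x) * y1 + (X - x - x1) * y"
    using p q X y y1 by (intro add_nonneg_nonneg mult_nonneg_nonneg) auto
  moreover have "X * (Y - y - y1) + (X - x) * y1 + (X - x - x1) * y
      <= 1 * (real k * b)^2 + (real m * a) * (real k * b) + (real m * a)^2 * 1"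
    using p q X y y1 assms by (intro add_mono mult_mono) auto
  moreover have "... <= (real m * a + real k * b)^2"
  proof -
    have "0 <= (real m * a) * (real k * b)" using assms by (intro mult_nonneg_nonneg) auto
    then show ?thesis unfolding power2_sum by linarith
  qed
  ultimately have le: "\<bar>X * Y - x * y - x1 * y - x * y1\<bar> <= (real m * a + real k * b)^2"
    unfolding eq by linarith
  have e1: "x1 * y = real m * a * u ^ (m - 1) * v ^ k" by (simp add: x1_def y_def)
  have e2: "x * y1 = real k * b * u ^ m * v ^ (k - 1)" by (simp add: x_def y1_def)
  show ?thesis using le unfolding e1 e2 unfolding X_def Y_def x_def y_def .
qed

text \<open>Used for \<open>multi\<close> rounds, in which the exponents move by at most 2: the
  change stays proportional to \<open>1 - u\<close> and \<open>1 - v\<close>.\<close>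

lemma power_power_diff_le:
  fixes u v :: real
  assumes "0 <= u" "u <= 1" "0 <= v" "v <= 1"
  shows "\<bar>u ^ m' * v ^ k' - u ^ m * v ^ k\<bar> <= \<bar>real m' - real m\<bar> * (1 - u) + \<bar>real k' - real k\<bar> * (1 - v)"
proof -
  have *: "\<bar>u ^ m' - u ^ m\<bar> <= \<bar>real m' - real m\<bar> * (1 - u)" if u: "0 <= u" "u <= 1" for u :: real and m m'
  proof -
    have le: "\<bar>u ^ j - u ^ i\<bar> <= (real j - real i) * (1 - u)" if "i <= j" for i j
    proof -
      have b: "1 - u ^ (j - i) <= real (j - i) * (1 - u)"
        using Bernoulli_inequality[of "u - 1" "j - i"] u by (simp add: algebra_simps)
      have "u ^ i - u ^ j = u ^ i * (1 - u ^ (j - i))"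
        using that by (simp add: right_diff_distrib flip: power_add)
      also have "... <= 1 * (real (j - i) * (1 - u))"
        using u b by (intro mult_mono) (auto simp: power_le_one)
      finally show ?thesis using that u power_decreasing[of i j u] by (simp add: of_nat_diff)
    qed
    show ?thesis using le[of m m'] le[of m' m] by (cases "m <= m'") auto
  qed
  have "u ^ m' * v ^ k' - u ^ m * v ^ k = (u ^ m' - u ^ m) * v ^ k' + u ^ m * (v ^ k' - v ^ k)"
    by (simp add: algebra_simps)
  then have "\<bar>u ^ m' * v ^ k' - u ^ m * v ^ k\<bar> <= \<bar>u ^ m' - u ^ m\<bar> * \<bar>v ^ k'\<bar> + \<bar>u ^ m\<bar> * \<bar>v ^ k' - v ^ k\<bar>"
    by (metis abs_mult abs_triangle_ineq)
  also have "... <= \<bar>u ^ m' - u ^ m\<bar> * 1 + 1 * \<bar>v ^ k' - v ^ k\<bar>"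
    using assms by (intro add_mono mult_mono) (auto simp: power_le_one)
  also have "... <= \<bar>real m' - real m\<bar> * (1 - u) + \<bar>real k' - real k\<bar> * (1 - v)"
    using *[OF assms(1,2), of m' m] *[OF assms(3,4), of k' k] by simp
  finally show ?thesis .
qed

context size_rule
begin

abbreviation cnt :: "nat => nat set set => nat set => nat" where
  "cnt n E S \<equiv> comp_count {1..n} E S"

abbreviation fr :: "nat => nat set set => real" where
  "fr n E \<equiv> frac n E \<infinity>"

lemma fr_bounds: "n >= 1 ==> 0 <= fr n E & fr n E <= 1"
  using frac_nonneg frac_le_1[OF _ infinity_in_SK] by blast

lemma cnt_small_sum: "S \<subseteq> {1..K} ==> real (cnt n E S) = (SUM k:S. real (cnt n E {k}))"
  by (subst comp_count_sum) (auto intro: finite_subset)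

lemma small_mass: "n >= 1 ==> real n * (1 - fr n E) = (SUM k:{1..K}. real k * real (cnt n E {k}))"
proof -
  assume n: "n >= 1"
  have "1 - fr n E = (\<Sum>k=1..K. frac n E (enat k))"
    using frac_sum[OF n, of E] by (simp add: SK_split)
  also have "... = (\<Sum>k=1..K. real k * real (cnt n E {k}) / real n)"
    by (intro sum.cong refl frac_small) auto
  finally show ?thesis using n by (simp add: sum_divide_distrib[symmetric])
qed

lemma cnt_le_mass: "n >= 1 ==> real (cnt n E {1..K}) <= real n * (1 - fr n E)"
  unfolding cnt_small_sum[OF order_refl] small_mass
  by (intro sum_mono) (auto simp: mult_le_cancel_right1)

lemma mass_le_cnt: "n >= 1 ==> real n * (1 - fr n E) <= real K * real (cnt n E {1..K})"
  unfolding cnt_small_sum[OF order_refl] small_mass sum_distrib_left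
  by (intro sum_mono) (auto intro: mult_right_mono)

lemma cnt_UNIV: "cnt n E UNIV = cnt n E {1..K} + cnt n E {K<..}"
proof -
  have "cnt n E UNIV = cnt n E ({1..K} \<union> {K<..})"
    using comp_count_0_UNIV[of "{1..n}" E UNIV] comp_count_0_UNIV[of "{1..n}" E "{1..K} \<union> {K<..}"] K1
    by (simp add: Int_Un_distrib2 ivl_disj_un Int_absorb2 Int_commute inf.absorb1 subset_iff)
  then show ?thesis by (subst (asm) comp_count_Un) auto
qed

lemma Q_cnt: "Q n E = real (cnt n E {1..K}) + real (cnt n E {K<..}) - 1"
  by (simp add: Q_def cnt_UNIV)

lemma large_mass: "n >= 1 ==> real (cnt n E {K<..}) * real (K + 1) <= real n * fr n E"
  unfolding frac_large comp_count_comp_sum[OF finite_atLeastAtMost] comp_sum_def sum_distrib_right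
  by (intro sum_mono) auto

lemma large_exists: "n >= 1 ==> 0 < fr n E ==> 1 <= cnt n E {K<..}"
proof (rule ccontr)
  assume n: "n >= 1" "0 < fr n E" "~ 1 <= cnt n E {K<..}"
  then have "cnt n E {K<..} = 0" by linarith
  then have "{C \<in> graph_components {1..n} E. card C \<in> {K<..}} = {}"
    unfolding comp_count_def using finite_graph_components[of "{1..n}" E] by simp
  then have "real n * fr n E = 0"
    unfolding frac_large[OF n(1)] comp_sum_def by (intro sum.neutral) auto
  then show False using n by simp
qed

text \<open>A large component absorbs the \<open>- 1\<close> in \<open>Q\<close>, so the small ones
  number at most \<open>Q\<close>. Without this knowledge \<open>mass_le_Q'\<close> loses 1.\<close>

lemma mass_le_Q: "n >= 1 ==> 0 < fr n E ==> real n * (1 - fr n E) <= real K * Q n E"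
  using mass_le_cnt[of n E] large_exists[of n E] mult_left_mono[of "real (cnt n E {1..K})" "Q n E" "real K"]
  by (simp add: Q_cnt)

lemma mass_le_Q': "n >= 1 ==> real n * (1 - fr n E) <= real K * (Q n E + 1)"
  using mass_le_cnt[of n E] mult_left_mono[of "real (cnt n E {1..K})" "Q n E + 1" "real K"]
  by (simp add: Q_cnt)

lemma cnt_round:
  assumes "x \<in> Tup n"
  shows "real (cnt n (round n E x) S) = real (cnt n E S) +
    (let a = card (block n E (x (sel1 (sizes n E x)))); b = card (block n E (x (sel2 (sizes n E x)))) in
     if differ n E x then of_bool (a + b \<in> S) - of_bool (a \<in> S) - of_bool (b \<in> S) else 0)"
  unfolding comp_count_comp_sum[OF finite_atLeastAtMost] round_comp_sum[OF assms] differ_def Let_def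
  by simp

lemma sizes_sel:
  assumes "x \<in> Tup n"
  shows "sizes n E x (sel1 (sizes n E x)) = trunc_size K {1..n} E (x (sel1 (sizes n E x)))"
    "sizes n E x (sel2 (sizes n E x)) = trunc_size K {1..n} E (x (sel2 (sizes n E x)))"
  using sel_range[OF sizes_ST[OF assms]] by (auto intro: sizes_app)

lemma trunc_size_enat: "trunc_size K V E u = enat k \<longleftrightarrow> card (component_of V E u) = k & k <= K"
  by (auto simp: trunc_size_def)

lemma trunc_size_infinity: "trunc_size K V E u = \<infinity> \<longleftrightarrow> K < card (component_of V E u)"
  by (auto simp: trunc_size_def)

lemma single_blocks:
  assumes x: "x \<in> Tup n" and s: "sizes n E x \<in> single k"
  defines "a \<equiv> card (block n E (x (sel1 (sizes n E x))))"
    and "b \<equiv> card (block n E (x (sel2 (sizes n E x))))"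
  shows "differ n E x" "k <= K" "a = k & K < b | b = k & K < a"
proof -
  have "{sizes n E x (sel1 (sizes n E x)), sizes n E x (sel2 (sizes n E x))} = {enat k, \<infinity>}"
    using s by (auto simp: single_def C_set_def')
  then have "trunc_size K {1..n} E (x (sel1 (sizes n E x))) = enat k & trunc_size K {1..n} E (x (sel2 (sizes n E x))) = \<infinity>
     | trunc_size K {1..n} E (x (sel2 (sizes n E x))) = enat k & trunc_size K {1..n} E (x (sel1 (sizes n E x))) = \<infinity>"
    unfolding sizes_sel[OF x] by (auto simp: doubleton_eq_iff)
  then show *: "k <= K" "a = k & K < b | b = k & K < a"
    unfolding trunc_size_enat trunc_size_infinity a_def b_def by auto
  then show "differ n E x" unfolding differ_def a_def b_def by auto
qed

lemma single_unique: "s \<in> single k ==> s \<in> single k' ==> k = k'"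
  by (auto simp: single_def C_set_def' doubleton_eq_iff)

text \<open>The case \<open>large\<close> is wider than \<open>merge_large\<close>: it includes
  rounds in which one small component is hit but not selected. Counts of small sizes do not change
  there.\<close>

lemma round_cases:
  assumes x: "x \<in> Tup n"
  obtains (multi) "multi (sizes n E x)" "~ merge_large n E x" "!!k. sizes n E x \<notin> single k"
  | (single) k where "1 <= k" "k <= K" "sizes n E x \<in> single k" "~ multi (sizes n E x)" "~ merge_large n E x"
  | (large) "~ multi (sizes n E x)" "!!k. sizes n E x \<notin> single k"
      "K < card (block n E (x (sel1 (sizes n E x))))" "K < card (block n E (x (sel2 (sizes n E x))))"
proof -
  let ?s = "sizes n E x"
  have ml: "?s j = \<infinity>" if "merge_large n E x" "j \<in> {1..l}" for j
    using that by (simp add: merge_large_def sizes_app trunc_size_infinity)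
  show ?thesis
  proof (cases "multi ?s")
    case True
    moreover have "~ merge_large n E x" using ml True by (auto simp: multi_def)
    ultimately show ?thesis using multi single_not_multi by blast
  next
    case nm: False
    show ?thesis
    proof (cases "EX k. ?s \<in> single k")
      case True
      then obtain k where k: "?s \<in> single k" by blast
      then obtain i where i: "i \<in> {1..l}" "?s i = enat k" by (auto simp: single_def)
      have "1 <= k" "k <= K" using ST_app[OF sizes_ST[OF x, of E] i(1)] i(2) by (auto simp: enat_in_SK)
      moreover have "~ merge_large n E x" using ml i by force
      ultimately show ?thesis using single k nm by blast
    next
      case False
      have "?s (sel1 ?s) = \<infinity> & ?s (sel2 ?s) = \<infinity>"
        using sizes_ST[OF x, of E]
      proof (cases rule: ST_cases)
        case multi
        then show ?thesis using nm by simp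
      next
        case all
        then show ?thesis using sel_range[OF sizes_ST[OF x, of E]] by blast
      next
        case (one i k)
        have "~ (sel1 ?s = i | sel2 ?s = i)"
          using single_iff[OF sizes_ST[OF x, of E] one(1,4,5), of k] False by blast
        then show ?thesis using one(5) sel_range[OF sizes_ST[OF x, of E]] by blast
      qed
      then have "K < card (block n E (x (sel1 ?s)))" "K < card (block n E (x (sel2 ?s)))"
        unfolding sizes_sel[OF x] trunc_size_infinity by blast+
      then show ?thesis using large nm False by blast
    qed
  qed
qed

lemma cnt_round_bounds:
  assumes "x \<in> Tup n"
  shows "real (cnt n (round n E x) S) <= real (cnt n E S) + 1"
    "\<bar>real (cnt n (round n E x) S) - real (cnt n E S)\<bar> <= 2"
  unfolding cnt_round[OF assms] Let_def by auto

lemma sum_single_indicator: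
  assumes "s \<in> single k" "finite S"
  shows "(SUM j:S. of_bool (s \<in> single j) :: real) = of_bool (k \<in> S)"
proof -
  have "(SUM j:S. of_bool (s \<in> single j) :: real) = (SUM j:S. if j = k then 1 else 0)"
    using assms single_unique by (intro sum.cong) auto
  then show ?thesis using assms by (simp add: sum.delta)
qed

lemma cnt_round_small:
  assumes x: "x \<in> Tup n" and S: "S \<subseteq> {1..K}" and nm: "~ multi (sizes n E x)"
  shows "real (cnt n (round n E x) S) = real (cnt n E S) - (SUM k:S. of_bool (sizes n E x \<in> single k))"
proof -
  have fS: "finite S" using S finite_subset by blast
  show ?thesis
    using x
  proof (cases rule: round_cases[of x n E])
    case (single k)
    show ?thesis
      using single_blocks[OF x single(3)] S
      unfolding cnt_round[OF x] sum_single_indicator[OF single(3) fS] Let_def by auto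
  next
    case large
    then show ?thesis using S unfolding cnt_round[OF x] Let_def by auto
  qed (use nm in auto)
qed

text \<open>Since \<open>S\<close> contains all large sizes, an absorption removes a component
  exactly when the small size is in \<open>S\<close>. The count can rise only if two sizes outside
  \<open>S\<close> merge into \<open>S\<close>, which takes a \<open>multi\<close> round and is
  impossible for \<open>S = UNIV\<close>.\<close>

lemma cnt_round_with_large:
  assumes x: "x \<in> Tup n" and S: "{K<..} \<subseteq> S"
  shows "real (cnt n (round n E x) S) <= real (cnt n E S)
     - (SUM k:S \<inter> {1..K}. of_bool (sizes n E x \<in> single k)) - of_bool (merge_large n E x)
     + of_bool (multi (sizes n E x) & S ~= UNIV)"
  using x
proof (cases rule: round_cases[of x n E])
  case multi
  have "real (cnt n (round n E x) S) <= real (cnt n E S) + of_bool (S ~= UNIV)"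
    unfolding cnt_round[OF x] Let_def by auto
  then show ?thesis using multi by simp
next
  case (single k)
  have fS: "finite (S \<inter> {1..K})" by simp
  show ?thesis
    using single_blocks[OF x single(3)] S single
    unfolding cnt_round[OF x] sum_single_indicator[OF single(3) fS] Let_def by auto
next
  case large
  have "~ merge_large n E x | differ n E x" by (simp add: merge_large_def)
  then show ?thesis using S large unfolding cnt_round[OF x] Let_def by auto
qed

text \<open>The basic contraction, with the giant discounted by \<open>- 1\<close>. The rate
  \<open>q\<close> has to stay below \<open>ex_k\<close> for the small sizes in \<open>S\<close> and
  below \<open>2 * K + 2\<close>, the rate of merging large components;
  \<open>real l * \<zeta>\<close> is the relative loss because not all vertices lie in one giant. It
  is applied with \<open>S = UNIV\<close> to \<open>Q\<close> and with the fast and large sizes to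
  \<open>V\<close>.\<close>

lemma Av_cnt_with_large:
  assumes n: "n >= 1" and S: "{K<..} \<subseteq> S" and L: "cnt n E {K<..} >= 1"
    and q: "!!k. k \<in> S \<inter> {1..K} ==> q <= real (ex_k K l R k)" "q <= 2 * real K + 2" "0 <= q"
    and \<zeta>: "real (K + 1) * (Q n E + 1) <= \<zeta> * real n" "real l * \<zeta> <= 1"
  shows "Av n (%x. real (cnt n (round n E x) S) - 1) <=
      (real (cnt n E S) - 1) * (1 - q * (1 - real l * \<zeta>) / real n)
      + of_bool (S ~= UNIV) * (real l)^2 * (1 - fr n E)^2"
proof -
  have n0: "real n > 0" using n by simp
  define L where "L = real (cnt n E {K<..})"
  define f where "f = fr n E"
  have f1: "0 <= f" "f <= 1" using fr_bounds[OF n] by (auto simp: f_def)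
  have \<zeta>0: "0 <= \<zeta>"
    using \<zeta>(1) Q_nonneg[OF n, of E] n0 by (smt (verit) mult_nonneg_nonneg mult_neg_pos of_nat_0_le_iff)
  have "real n * (1 - f) <= real K * (Q n E + 1)" using mass_le_Q'[OF n] by (simp add: f_def)
  also have "... <= real (K + 1) * (Q n E + 1)" using Q_nonneg[OF n, of E] by (intro mult_right_mono) auto
  also have "... <= \<zeta> * real n" by (rule \<zeta>)
  finally have f\<zeta>: "1 - \<zeta> <= f" using n0 by (simp add: mult.commute mult_le_cancel_left)
  have L\<zeta>: "L * real (K + 1) / real n <= \<zeta>"
  proof -
    have "L * real (K + 1) <= (Q n E + 1) * real (K + 1)" by (intro mult_right_mono) (auto simp: L_def Q_cnt)
    then show ?thesis using \<zeta>(1) n0 by (simp add: field_simps)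
  qed
  have \<zeta>1: "\<zeta> <= 1"   proof -
    have "1 * \<zeta> <= real l * \<zeta>" using \<zeta>0 l1 by (intro mult_right_mono) auto
    then show ?thesis using \<zeta>(2) by simp
  qed
  have pow: "1 - real m * \<zeta> <= f ^ m" for m
  proof -
    have "1 - real m * \<zeta> <= (1 - \<zeta>) ^ m" using Bernoulli_inequality[of "- \<zeta>" m] \<zeta>1 by simp
    also have "... <= f ^ m" using f\<zeta> \<zeta>1 by (intro power_mono) auto
    finally show ?thesis .
  qed
  have fl1: "1 - real l * \<zeta> <= f ^ (l - 1)"
    using pow[of "l - 1"] \<zeta>0 l1 by (simp add: of_nat_diff algebra_simps)
  have single_sum: "Av n (%x. SUM k:S \<inter> {1..K}. of_bool (sizes n E x \<in> single k)) >=
      q * (1 - real l * \<zeta>) / real n * real (cnt n E (S \<inter> {1..K}))"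
  proof -
    have "q * (1 - real l * \<zeta>) / real n * real (cnt n E (S \<inter> {1..K}))
      = (SUM k:S \<inter> {1..K}. q * real (cnt n E {k}) / real n * (1 - real l * \<zeta>))"
      by (subst cnt_small_sum) (auto simp: sum_distrib_left mult_ac)
    also have "... <= (SUM k:S \<inter> {1..K}. real (ex_k K l R k) * real (cnt n E {k}) / real n * f ^ (l - 1))"
      using q \<zeta>(2) fl1 by (intro sum_mono mult_mono divide_right_mono) auto
    also have "... = (SUM k:S \<inter> {1..K}. Av n (%x. of_bool (sizes n E x \<in> single k)))"
      using n by (intro sum.cong refl) (simp add: Av_single f_def)
    finally show ?thesis unfolding Av_sum .
  qed
  have merge: "Av n (%x. of_bool (merge_large n E x)) >= q * (1 - real l * \<zeta>) / real n * (L - 1)"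
  proof -
    have L1: "0 <= L - 1" using assms(3) by (simp add: L_def)
    have "q * (1 - real l * \<zeta>) / real n * (L - 1)
       <= (L - 1) * real (K + 1) / real n * (2 * (1 - real l * \<zeta>))"
    proof -
      have "q * ((1 - real l * \<zeta>) / real n * (L - 1)) <= (2 * real K + 2) * ((1 - real l * \<zeta>) / real n * (L - 1))"
        using q \<zeta> L1 by (intro mult_right_mono mult_nonneg_nonneg divide_nonneg_nonneg) auto
      then show ?thesis by (simp add: algebra_simps add_divide_distrib diff_divide_distrib)
    qed
    also have "... <= (L - 1) * real (K + 1) / real n * ((2 * f - L * real (K + 1) / real n) * f ^ (l - 2))"
    proof (rule mult_left_mono)
      \<comment> \<open>The factor \<open>1 - 2 * \<zeta>\<close> serves the two selected positions,
        where \<open>2 * f - L * real (K + 1) / real n >= 2 * (1 - 2 * \<zeta>)\<close>; the other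
        factor serves the remaining \<open>l - 2\<close> positions by Bernoulli.\<close>
      have "2 * (1 - real l * \<zeta>) <= 2 * (1 - 2 * \<zeta>) * (1 - real (l - 2) * \<zeta>)"
      proof -
        have "2 * (1 - 2 * \<zeta>) * (1 - real (l - 2) * \<zeta>) = 2 * (1 - real l * \<zeta>) + 4 * real (l - 2) * (\<zeta> * \<zeta>)"
          using l2 by (simp add: of_nat_diff algebra_simps)
        then show ?thesis using \<zeta>0 by simp
      qed
      show "2 * (1 - real l * \<zeta>) <= (2 * f - L * real (K + 1) / real n) * f ^ (l - 2)"
      proof (cases "2 * \<zeta> <= 1")
        case True
        have "2 * (1 - real l * \<zeta>) <= 2 * (1 - 2 * \<zeta>) * (1 - real (l - 2) * \<zeta>)" by fact
        also have "... <= 2 * (1 - 2 * \<zeta>) * f ^ (l - 2)"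
          using True pow[of "l - 2"] by (intro mult_left_mono) auto
        also have "... <= (2 * f - L * real (K + 1) / real n) * f ^ (l - 2)"
          using f\<zeta> L\<zeta> \<zeta>0 f1 by (intro mult_right_mono) auto
        finally show ?thesis .
      next
        case False
        have "2 * \<zeta> <= real l * \<zeta>" using \<zeta>0 l2 by (intro mult_right_mono) auto
        then have "real l * \<zeta> > 1" using False by linarith
        then show ?thesis using \<zeta>(2) by simp
      qed
    qed (use L1 in auto)
    also have "... <= Av n (%x. of_bool (merge_large n E x))"
      using Av_merge_large[OF n assms(3)] by (simp add: L_def f_def mult.assoc)
    finally show ?thesis .
  qed
  have S_split: "real (cnt n E S) - 1 = real (cnt n E (S \<inter> {1..K})) + (L - 1)"
  proof -
    have "cnt n E S = cnt n E (S \<inter> {1..})" by (simp add: comp_count_0_UNIV)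
    also have "S \<inter> {1..} = (S \<inter> {1..K}) \<union> {K<..}" using S K1 by auto
    also have "cnt n E ... = cnt n E (S \<inter> {1..K}) + cnt n E {K<..}" by (intro comp_count_Un) auto
    finally show ?thesis by (simp add: L_def)
  qed
  have "Av n (%x. real (cnt n (round n E x) S) - 1) <= Av n (%x. (real (cnt n E S) - 1)
     - (SUM k:S \<inter> {1..K}. of_bool (sizes n E x \<in> single k)) - of_bool (merge_large n E x)
     + of_bool (S ~= UNIV) * of_bool (multi (sizes n E x)))"
  proof (rule Av_mono)
    fix x assume x: "x \<in> Tup n"
    show "real (cnt n (round n E x) S) - 1 <= (real (cnt n E S) - 1)
     - (SUM k:S \<inter> {1..K}. of_bool (sizes n E x \<in> single k)) - of_bool (merge_large n E x)
     + of_bool (S ~= UNIV) * of_bool (multi (sizes n E x))"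
      using cnt_round_with_large[OF x S, of E] by (cases "S = UNIV") auto
  qed
  also have "... = (real (cnt n E S) - 1) - Av n (%x. SUM k:S \<inter> {1..K}. of_bool (sizes n E x \<in> single k))
     - Av n (%x. of_bool (merge_large n E x)) + of_bool (S ~= UNIV) * Av n (%x. of_bool (multi (sizes n E x)))"
    by (simp only: Av_add Av_diff Av_cmult Av_const[OF n])
  also have "... <= (real (cnt n E S) - 1) - q * (1 - real l * \<zeta>) / real n * real (cnt n E (S \<inter> {1..K}))
     - q * (1 - real l * \<zeta>) / real n * (L - 1) + of_bool (S ~= UNIV) * ((real l)^2 * (1 - fr n E)^2)"
    using single_sum merge Av_multi[OF n, of E] by (intro add_mono diff_mono mult_left_mono) auto
  also have "... = (real (cnt n E S) - 1) * (1 - q * (1 - real l * \<zeta>) / real n)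
      + of_bool (S ~= UNIV) * (real l)^2 * (1 - fr n E)^2"
  proof -
    define r where "r = q * (1 - real l * \<zeta>) / real n"
    show ?thesis unfolding S_split r_def[symmetric] by (simp add: algebra_simps)
  qed
  finally show ?thesis .
qed

lemma Av_two_same_block:
  assumes n: "n >= 1" and "i \<in> {1..l}" "j \<in> {1..l}" "i ~= j"
  shows "Av n (%x. of_bool (block n E (x i) = block n E (x j) & card (block n E (x i)) <= K)) <= real K / real n"
proof -
  let ?\<phi> = "%u w. of_bool (block n E u = block n E w & card (block n E u) <= K) :: real"
  have "Av n (%x. ?\<phi> (x i) (x j)) = Av n (%x. of_bool (ALL m:{1..l} - {i, j}. x m \<in> {1..n}) * ?\<phi> (x i) (x j))"
  proof (rule Av_cong)
    fix x assume x: "x \<in> Tup n"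
    have "ALL m:{1..l} - {i, j}. x m \<in> {1..n}" using Tup_app[OF x] by blast
    then show "?\<phi> (x i) (x j) = of_bool (ALL m:{1..l} - {i, j}. x m \<in> {1..n}) * ?\<phi> (x i) (x j)" by simp
  qed
  also have "... = (SUM u:{1..n}. SUM w:{1..n}. ?\<phi> u w) / (real n)^2 * (real (card {1..n}) / real n) ^ (l - 2)"
    using assms by (intro Av_two) auto
  also have "... <= (SUM u:{1..n}. real K) / (real n)^2 * 1"
  proof (intro mult_mono divide_right_mono sum_mono)
    fix u assume u: "u \<in> {1..n}"
    have "(SUM w:{1..n}. ?\<phi> u w) = real (card {w \<in> {1..n}. block n E u = block n E w & card (block n E u) <= K})"
      by (simp add: Int_def)
    also have "... <= real K"
    proof (cases "card (block n E u) <= K")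
      case True
      have fin: "finite (block n E u)" using component_of_subset[of "{1..n}" E u] by (auto intro: finite_subset)
      have "{w \<in> {1..n}. block n E u = block n E w & card (block n E u) <= K} \<subseteq> block n E u"
        using component_of_self[of _ "{1..n}" E] by auto
      then have "card {w \<in> {1..n}. block n E u = block n E w & card (block n E u) <= K} <= card (block n E u)"
        using fin by (intro card_mono)
      then show ?thesis using True by linarith
    qed simp
    finally show "(SUM w:{1..n}. ?\<phi> u w) <= real K" .
  qed (use n in auto)
  also have "... = real K / real n" using n by (simp add: power2_eq_square)
  finally show ?thesis .
qed

lemma selected_pair:
  "s \<in> ST ==> EX i:{1..l div 2}. sel1 s = 2 * i - 1 & sel2 s = 2 * i"
  using R_range[of s] by (intro bexI[of _ "R s"]) (auto simp: sel1_def sel2_def)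

text \<open>Which pair is selected depends on the whole tuple, so all \<open>l div 2\<close> fixed
  pairs are summed; for each, the second vertex has at most \<open>K\<close> choices.\<close>

lemma Av_same_block:
  assumes n: "n >= 1"
  shows "Av n (%x. of_bool (~ differ n E x & card (block n E (x (sel1 (sizes n E x)))) <= K)) <= real (l * K) / real n"
proof -
  let ?\<phi> = "%x i. of_bool (block n E (x (2 * i - 1)) = block n E (x (2 * i)) & card (block n E (x (2 * i - 1))) <= K) :: real"
  have "Av n (%x. of_bool (~ differ n E x & card (block n E (x (sel1 (sizes n E x)))) <= K))
      <= Av n (%x. SUM i:{1..l div 2}. ?\<phi> x i)"
  proof (rule Av_mono)
    fix x assume x: "x \<in> Tup n"
    obtain i where i: "i \<in> {1..l div 2}" "sel1 (sizes n E x) = 2 * i - 1" "sel2 (sizes n E x) = 2 * i"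
      using selected_pair[OF sizes_ST[OF x, of E]] by blast
    have "of_bool (~ differ n E x & card (block n E (x (sel1 (sizes n E x)))) <= K) = ?\<phi> x i"
      unfolding differ_def i(2,3) by simp
    also have "... <= (SUM i:{1..l div 2}. ?\<phi> x i)"
      using i(1) by (intro member_le_sum) auto
    finally show "of_bool (~ differ n E x & card (block n E (x (sel1 (sizes n E x)))) <= K) <= (SUM i:{1..l div 2}. ?\<phi> x i)" .
  qed
  also have "... = (SUM i:{1..l div 2}. Av n (%x. ?\<phi> x i))" by (rule Av_sum)
  also have "... <= (SUM i:{1..l div 2}. real K / real n)"
    using n by (intro sum_mono Av_two_same_block) auto
  also have "... = real (l div 2) * (real K / real n)" by simp
  also have "... <= real l * (real K / real n)" by (intro mult_right_mono) auto
  finally show ?thesis by simp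
qed

lemma Av_all_small:
  assumes n: "n >= 1"
  shows "Av n (%x. of_bool (ALL j:{1..l}. sizes n E x j ~= \<infinity>)) = (1 - fr n E) ^ l"
proof -
  have "Av n (%x. of_bool (ALL j:{1..l}. sizes n E x j ~= \<infinity>)) =
     Av n (%x. of_bool (sizes n E x \<in> {s. ALL j:{1..l}. s j ~= \<infinity>}))" by simp
  also have "... = (SUM s:ST \<inter> {s. ALL j:{1..l}. s j ~= \<infinity>}. P_tuple l s (frac n E))" by (rule Av_sizes_of_bool)
  also have "ST \<inter> {s. ALL j:{1..l}. s j ~= \<infinity>} = {1..l} \<rightarrow>\<^sub>E (SK K - {\<infinity>})"
    unfolding size_tuples_def by (rule set_eqI) (simp only: Int_iff PiE_iff mem_Collect_eq Diff_iff singleton_iff, blast)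
  also have "(SUM s:{1..l} \<rightarrow>\<^sub>E (SK K - {\<infinity>}). P_tuple l s (frac n E)) = (PROD j:{1..l}. SUM q:SK K - {\<infinity>}. frac n E q)"
    by (rule sum_P_tuple_PiE) (simp add: finite_SK)
  also have "(SUM q:SK K - {\<infinity>}. frac n E q) = 1 - fr n E"
    using frac_sum[OF n, of E] by (simp add: sum.remove[OF finite_SK infinity_in_SK])
  finally show ?thesis by simp
qed

end

section \<open>Contraction rates and the generating function step for a non-degenerate rule\<close>

locale nondegenerate_rule = size_rule +
  assumes nondegenerate: "~ degenerate K l R" and ex_less: "ex < 2 * K + 2"
begin

lemma ex_pos: "1 <= ex"
  using nondegenerate by (simp add: degenerate_def)

lemma ex_le: "k \<in> {1..K} ==> ex <= ex_k K l R k"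
  by (auto simp: ex_rate_def)

lemma slow_subset: "slow K l R \<subseteq> {1..K}"
  by (auto simp: slow_def)

lemma slow_ex: "k \<in> slow K l R ==> ex_k K l R k = ex"
  by (simp add: slow_def)

lemma slow_nonempty: "slow K l R ~= {}"
proof -
  have "ex \<in> ex_k K l R ` {1..K}" unfolding ex_rate_def using K1 by (intro Min_in) auto
  then show ?thesis by (auto simp: slow_def)
qed

lemma fast_ex: "k \<in> fast K l R ==> ex + 1 <= ex_k K l R k"
  using ex_le[of k] by (auto simp: fast_def slow_def)

text \<open>Half of \<open>(1/2) ^ l\<close>, which bounds from below the chance that all chosen
  vertices are in small components while these contain more than half of the vertices. The other
  half pays for selected pairs inside one small component, of probability at most
  \<open>l * K / n\<close>.\<close>

definition base_rate :: real where "base_rate = 1 / 2 ^ (l + 1)"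

lemma base_rate: "0 < base_rate" "base_rate <= 1"
  by (auto simp: base_rate_def)

text \<open>No assumption on the graph is made. If less than half of the vertices are in large
  components, an effective edge has constant probability, and \<open>Q <= n\<close>. Otherwise every
  missing merger has its own rate of at least \<open>base_rate / n\<close>, by
  \<open>Av_single\<close> and \<open>Av_merge_large\<close>.\<close>

lemma Q_decay_universal:
  assumes n: "real n >= 2 ^ (l + 1) * real (l * K)" "n >= 1"
  shows "Av n (%x. Q n (round n E x)) <= Q n E * (1 - base_rate / real n)"
proof -
  have n0: "real n > 0" using n by simp
  have Qn: "0 <= Q n E" "Q n E <= real n" using Q_nonneg[OF n(2)] Q_le by auto
  have AvQ: "Av n (%x. Q n (round n E x)) = Q n E - Av n (%x. of_bool (differ n E x))"
  proof -
    have "Av n (%x. Q n (round n E x)) = Av n (%x. Q n E - of_bool (differ n E x))"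
      by (intro Av_cong Q_round)
    then show ?thesis by (simp only: Av_diff Av_const[OF n(2)])
  qed
  have "base_rate * Q n E / real n <= Av n (%x. of_bool (differ n E x))"
  proof (cases "fr n E < 1 / 2")
    case True
    have "base_rate * Q n E / real n <= base_rate"
      using Qn n0 base_rate by (simp add: pos_divide_le_eq mult_left_le)
    also have "... <= (1/2) ^ l - real (l * K) / real n"
    proof -
      have "real (l * K) / real n <= base_rate"
        using n n0 by (simp add: base_rate_def field_simps)
      moreover have "(1/2::real) ^ l = 2 * base_rate" by (simp add: base_rate_def power_divide power_add)
      ultimately show ?thesis by simp
    qed
    also have "... <= (1 - fr n E) ^ l - Av n (%x. of_bool (~ differ n E x & card (block n E (x (sel1 (sizes n E x)))) <= K))"
      using True Av_same_block[OF n(2), of E] by (intro diff_mono power_mono) auto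
    also have "... = Av n (%x. of_bool (ALL j:{1..l}. sizes n E x j ~= \<infinity>)
        - of_bool (~ differ n E x & card (block n E (x (sel1 (sizes n E x)))) <= K))"
      by (simp only: Av_diff Av_all_small[OF n(2)])
    also have "... <= Av n (%x. of_bool (differ n E x))"
    proof (rule Av_mono)
      fix x assume x: "x \<in> Tup n"
      have "card (block n E (x (sel1 (sizes n E x)))) <= K" if "ALL j:{1..l}. sizes n E x j ~= \<infinity>"
        using that sel_range[OF sizes_ST[OF x, of E]] sizes_sel(1)[OF x, of E]
        by (metis linorder_not_less trunc_size_infinity)
      then show "of_bool (ALL j:{1..l}. sizes n E x j ~= \<infinity>)
        - of_bool (~ differ n E x & card (block n E (x (sel1 (sizes n E x)))) <= K) <= (of_bool (differ n E x) :: real)"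
        by auto
    qed
    finally show ?thesis .
  next
    case False
    have L: "cnt n E {K<..} >= 1" using False by (intro large_exists n) auto
    define L' where "L' = real (cnt n E {K<..})"
    define f where "f = fr n E"
    have f: "1 / 2 <= f" "f <= 1" using False fr_bounds[OF n(2), of E] by (auto simp: f_def)
    have half: "base_rate <= (1/2) ^ (l - 1)"
    proof -
      have "base_rate = (1/2) ^ (l + 1)" by (simp add: base_rate_def power_divide)
      also have "... <= (1/2) ^ (l - 1)" by (intro power_decreasing) auto
      finally show ?thesis .
    qed
    have fl: "base_rate <= f ^ (l - 1)"
      using half power_mono[of "1/2" f "l - 1"] f by auto
    have "base_rate * Q n E / real n = (SUM k:{1..K}. base_rate * real (cnt n E {k}) / real n) + base_rate * (L' - 1) / real n"
      unfolding Q_cnt cnt_small_sum[OF order_refl] L'_def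
      by (simp add: sum_divide_distrib[symmetric] sum_distrib_left[symmetric] add_divide_distrib[symmetric] algebra_simps)
    also have "... <= (SUM k:{1..K}. Av n (%x. of_bool (sizes n E x \<in> single k))) + Av n (%x. of_bool (merge_large n E x))"
    proof (intro add_mono sum_mono)
      fix k assume k: "k \<in> {1..K}"
      have "1 <= real (ex_k K l R k)" using ex_le[OF k] ex_pos by simp
      then have "real (cnt n E {k}) * base_rate <= (real (ex_k K l R k) * real (cnt n E {k})) * f ^ (l - 1)"
        using fl base_rate by (intro mult_mono) (auto simp: mult_le_cancel_right1)
      then have "real (cnt n E {k}) * base_rate / real n <= (real (ex_k K l R k) * real (cnt n E {k})) * f ^ (l - 1) / real n"
        by (intro divide_right_mono) auto
      then show "base_rate * real (cnt n E {k}) / real n <= Av n (%x. of_bool (sizes n E x \<in> single k))"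
        using k n by (simp add: Av_single f_def mult_ac)
    next
      have L1: "0 <= L' - 1" using L by (simp add: L'_def)
      have Lf: "L' * real (K + 1) / real n <= f"
        using large_mass[OF n(2), of E] n0 by (simp add: L'_def f_def pos_divide_le_eq mult.commute)
      have "base_rate * (L' - 1) / real n = (L' - 1) * 1 / real n * base_rate" by simp
      also have "... <= (L' - 1) * real (K + 1) / real n * (f * f ^ (l - 2))"
      proof (intro mult_mono divide_right_mono mult_left_mono)
        show "base_rate <= f * f ^ (l - 2)"
          using fl l2 by (metis One_nat_def Suc_diff_le diff_Suc_Suc numeral_2_eq_2 power_Suc)
      qed (use L1 f base_rate in auto)
      also have "... <= (L' - 1) * real (K + 1) / real n * ((2 * f - L' * real (K + 1) / real n) * f ^ (l - 2))"
        using L1 Lf f by (intro mult_left_mono mult_right_mono) auto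
      also have "... <= Av n (%x. of_bool (merge_large n E x))"
        using Av_merge_large[OF n(2) L] by (simp add: L'_def f_def mult.assoc)
      finally show "base_rate * (L' - 1) / real n <= Av n (%x. of_bool (merge_large n E x))" .
    qed
    also have "... = Av n (%x. (SUM k:{1..K}. of_bool (sizes n E x \<in> single k)) + of_bool (merge_large n E x))"
      by (simp only: Av_add Av_sum)
    also have "... <= Av n (%x. of_bool (differ n E x))"
    proof (rule Av_mono)
      fix x assume x: "x \<in> Tup n"
      show "(SUM k:{1..K}. of_bool (sizes n E x \<in> single k)) + of_bool (merge_large n E x) <= (of_bool (differ n E x) :: real)"
        using cnt_round_with_large[OF x subset_UNIV, of E] Q_round[OF x, of E] by (simp add: Q_def)
    qed
    finally show ?thesis .
  qed
  then show ?thesis unfolding AvQ by (simp add: algebra_simps)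
qed

text \<open>Because \<open>Q\<close> drops by at most 1, the product \<open>Q * (Q - 1)\<close>
  drops by exactly \<open>2 * (Q - 1)\<close> in an effective round and contracts at twice the rate
  of \<open>Q\<close>. A plain square would leave a remainder linear in \<open>Q\<close>.\<close>

lemma Q_decay:
  assumes n: "n >= 1" and L: "cnt n E {K<..} >= 1"
    and \<zeta>: "real (K + 1) * (Q n E + 1) <= \<zeta> * real n" "real l * \<zeta> <= 1"
  shows "Av n (%x. Q n (round n E x)) <= Q n E * (1 - real ex * (1 - real l * \<zeta>) / real n)"
    and "Av n (%x. Q n (round n E x) * (Q n (round n E x) - 1))
        <= Q n E * (Q n E - 1) * (1 - 2 * (real ex * (1 - real l * \<zeta>) / real n))"
proof -
  let ?r = "real ex * (1 - real l * \<zeta>) / real n"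
  have ex2: "real ex <= 2 * real K + 2" using ex_less by linarith
  have "Av n (%x. real (cnt n (round n E x) UNIV) - 1) <=
      (real (cnt n E UNIV) - 1) * (1 - real ex * (1 - real l * \<zeta>) / real n)
      + of_bool (UNIV ~= (UNIV :: nat set)) * (real l)^2 * (1 - fr n E)^2"
    using ex_le ex2 by (intro Av_cnt_with_large[OF n _ L _ _ _ \<zeta>]) auto
  then show 1: "Av n (%x. Q n (round n E x)) <= Q n E * (1 - ?r)" by (simp add: Q_def)
  define p where "p = Av n (%x. of_bool (differ n E x))"
  have AvQ: "Av n (%x. Q n (round n E x)) = Q n E - p"
  proof -
    have "Av n (%x. Q n (round n E x)) = Av n (%x. Q n E - of_bool (differ n E x))"
      by (intro Av_cong Q_round)
    then show ?thesis by (simp only: Av_diff Av_const[OF n] p_def)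
  qed
  have "Av n (%x. Q n (round n E x) * (Q n (round n E x) - 1)) =
      Av n (%x. Q n E * (Q n E - 1) - 2 * (Q n E - 1) * of_bool (differ n E x))"
  proof (rule Av_cong)
    fix x assume "x \<in> Tup n"
    then show "Q n (round n E x) * (Q n (round n E x) - 1)
      = Q n E * (Q n E - 1) - 2 * (Q n E - 1) * of_bool (differ n E x)"
      by (cases "differ n E x") (simp_all add: Q_round algebra_simps)
  qed
  also have "... = Q n E * (Q n E - 1) - 2 * (Q n E - 1) * p"
    by (simp only: Av_diff Av_const[OF n] Av_cmult p_def)
  also have "... <= Q n E * (Q n E - 1) - 2 * (Q n E - 1) * (Q n E * ?r)"
  proof (cases "Q n E >= 1")
    case True
    have "Q n E * ?r <= p" using 1 unfolding AvQ by (simp add: algebra_simps)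
    then show ?thesis using True by (intro diff_mono mult_left_mono) auto
  next
    case False
    \<comment> \<open>\<open>Q\<close> is integer valued, so a value below 1 is 0; the graph is then
      connected and no round can be effective.\<close>
    then have Q0: "Q n E = 0" using Q_nonneg[OF n, of E] by (simp add: Q_def)
    have "differ n E x = False" if "x \<in> Tup n" for x
      using Q_round[OF that, of E] Q_nonneg[OF n, of "round n E x"] Q0 by auto
    then have "p = Av n (%x. 0)" unfolding p_def by (intro Av_cong) simp
    then show ?thesis using Q0 by (simp add: Av_const[OF n])
  qed
  finally show "Av n (%x. Q n (round n E x) * (Q n (round n E x) - 1)) <= Q n E * (Q n E - 1) * (1 - 2 * ?r)"
    by (simp add: algebra_simps)
qed

text \<open>The components that have to disappear besides those of slow size. Every large component besides
  the giant has at least \<open>K + 1\<close> vertices and is absorbed at rate about \<open>2 * (K + 1)\<close> or more, so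
  \<open>ex < 2 * K + 2\<close> makes \<open>V\<close> decay faster than the slow counts.\<close>

definition V :: "nat => nat set set => real" where
  "V n E = real (cnt n E (fast K l R \<union> {K<..})) - 1"

lemma V_decay:
  assumes n: "n >= 1" and L: "cnt n E {K<..} >= 1"
    and \<zeta>: "real (K + 1) * (Q n E + 1) <= \<zeta> * real n" "real l * \<zeta> <= 1"
  shows "Av n (%x. V n (round n E x)) <= V n E * (1 - (real ex + 1) * (1 - real l * \<zeta>) / real n)
     + (real l)^2 * (1 - fr n E)^2"
proof -
  have "real (ex + 1) <= 2 * real K + 2" using ex_less by linarith
  then have ex2: "real ex + 1 <= 2 * real K + 2" by simp
  have fast: "real ex + 1 <= real (ex_k K l R k)" if "k \<in> (fast K l R \<union> {K<..}) \<inter> {1..K}" for k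
    using that fast_ex[of k] by (auto simp flip: of_nat_Suc)
  have "Av n (%x. V n (round n E x)) <= V n E * (1 - (real ex + 1) * (1 - real l * \<zeta>) / real n)
     + of_bool (fast K l R \<union> {K<..} ~= UNIV) * (real l)^2 * (1 - fr n E)^2"
    unfolding V_def using fast ex2 by (intro Av_cnt_with_large[OF n _ L _ _ _ \<zeta>]) auto
  also have "... <= V n E * (1 - (real ex + 1) * (1 - real l * \<zeta>) / real n) + (real l)^2 * (1 - fr n E)^2"
    by simp
  finally show ?thesis .
qed

text \<open>The summands come from \<open>multi\<close> rounds, from replacing
  \<open>fr n E ^ (l - 1)\<close> by 1, and from the second-order remainder of the powers.\<close>

definition gen_const :: real where
  "gen_const = 4 * (real l)^2 + 2 * real ex * real l + 4 * (real ex)^2"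

text \<open>To first order each component of slow size vanishes with probability \<open>h\<close> in
  the round, and a component kept with probability \<open>1 - h\<close> contributes
  \<open>(1 - h) * u + h = u + h * (1 - u)\<close>. The factor \<open>p\<close> records that the
  error vanishes with \<open>1 - u\<close> and \<open>1 - v\<close>, which is essential when errors
  of many rounds are added.\<close>

theorem generating_step:
  assumes n: "n >= ex" "n >= 1" and ST: "S \<subseteq> slow K l R" "T \<subseteq> slow K l R" "S \<inter> T = {}"
    and uv: "0 <= u" "u <= 1" "0 <= v" "v <= 1" and p: "1 - u <= p" "1 - v <= p" "p <= 1"
  defines "h \<equiv> real ex / real n"
  shows "\<bar>Av n (%x. u ^ cnt n (round n E x) S * v ^ cnt n (round n E x) T)
     - (u + h * (1 - u)) ^ cnt n E S * (v + h * (1 - v)) ^ cnt n E T\<bar> <= gen_const * p * (1 - fr n E)^2"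
proof -
  define A where "A = cnt n E S"
  define B where "B = cnt n E T"
  define f where "f = fr n E"
  define w where "w = 1 - f"
  have n0: "real n > 0" using n by simp
  have h: "0 <= h" "h <= 1" using n n0 by (auto simp: h_def)
  have f: "0 <= f" "f <= 1" using fr_bounds[OF n(2), of E] by (auto simp: f_def)
  have w: "0 <= w" "w <= 1" using f by (auto simp: w_def)
  have p0: "0 <= p" using p uv by linarith
  have SK: "S \<subseteq> {1..K}" "T \<subseteq> {1..K}" using ST slow_subset by blast+
  have fin: "finite S" "finite T" using SK finite_subset by blast+
  have An: "real A <= real n * w" "real B <= real n * w"
  proof -
    have "cnt n E U <= cnt n E {1..K}" if "U \<subseteq> {1..K}" for U using that by (intro comp_count_mono) auto
    then show "real A <= real n * w" "real B <= real n * w"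
      using cnt_le_mass[OF n(2), of E] SK by (auto simp: A_def B_def w_def f_def intro: order_trans[rotated])
  qed
  have hA: "h * real A <= real ex * w" "h * real B <= real ex * w"
  proof -
    have *: "h * c <= real ex * w" if "c <= real n * w" for c
    proof -
      have "h * c <= h * (real n * w)" using h that by (intro mult_left_mono) auto
      then show ?thesis using n0 by (simp add: h_def)
    qed
    show "h * real A <= real ex * w" "h * real B <= real ex * w" using * An by blast+
  qed
  \<comment> \<open>The increases of \<open>u ^ A * v ^ B\<close> when one component of a size in
    \<open>S\<close>, respectively \<open>T\<close>, disappears.\<close>
  define a where "a = u ^ (A - 1) * (1 - u) * v ^ B"
  define b where "b = u ^ A * (v ^ (B - 1) * (1 - v))"
  have ab: "0 <= a" "a <= p" "0 <= b" "b <= p"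
  proof -
    have "u ^ (A - 1) * (1 - u) * v ^ B <= 1 * p * 1"
      using uv p p0 by (intro mult_mono) (auto simp: power_le_one)
    then show "a <= p" by (simp add: a_def)
    have "u ^ A * (v ^ (B - 1) * (1 - v)) <= 1 * (1 * p)"
      using uv p p0 by (intro mult_mono) (auto simp: power_le_one)
    then show "b <= p" by (simp add: b_def)
  qed (use uv in \<open>auto simp: a_def b_def\<close>)
  let ?s = "%x. sizes n E x"
  let ?iS = "%x. SUM k:S. of_bool (?s x \<in> single k) :: real"
  let ?iT = "%x. SUM k:T. of_bool (?s x \<in> single k) :: real"
  let ?uv = "%x. u ^ cnt n (round n E x) S * v ^ cnt n (round n E x) T"
  have pw: "\<bar>?uv x - (u ^ A * v ^ B + a * ?iS x + b * ?iT x)\<bar> <= 4 * p * of_bool (multi (?s x))"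
    if x: "x \<in> Tup n" for x
    using x
  proof (cases rule: round_cases[of x n E])
    case multi
    then have "?iS x = 0" "?iT x = 0" by auto
    moreover have "\<bar>?uv x - u ^ A * v ^ B\<bar> <= 2 * p + 2 * p"
      using power_power_diff_le[OF uv, of "cnt n (round n E x) S" "cnt n (round n E x) T" A B]
        cnt_round_bounds(2)[OF x, of E S] cnt_round_bounds(2)[OF x, of E T] p p0 uv
        mult_mono[of "\<bar>real (cnt n (round n E x) S) - real A\<bar>" 2 "1 - u" p]
        mult_mono[of "\<bar>real (cnt n (round n E x) T) - real B\<bar>" 2 "1 - v" p]
      by (simp add: A_def B_def)
    ultimately show ?thesis using multi by simp
  next
    case (single k)
    have A': "real (cnt n (round n E x) S) = real A - of_bool (k \<in> S)"
      using cnt_round_small[OF x SK(1) single(4)] sum_single_indicator[OF single(3) fin(1)] by (simp add: A_def)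
    have B': "real (cnt n (round n E x) T) = real B - of_bool (k \<in> T)"
      using cnt_round_small[OF x SK(2) single(4)] sum_single_indicator[OF single(3) fin(2)] by (simp add: B_def)
    consider "k \<in> S" "k \<notin> T" | "k \<notin> S" "k \<in> T" | "k \<notin> S" "k \<notin> T" using ST(3) by blast
    then have "?uv x = u ^ A * v ^ B + a * ?iS x + b * ?iT x"
    proof cases
      case 1
      then have "A = Suc (cnt n (round n E x) S)" "cnt n (round n E x) T = B" using A' B' by auto
      then show ?thesis
        unfolding sum_single_indicator[OF single(3) fin(1)] sum_single_indicator[OF single(3) fin(2)]
        using 1 by (simp add: a_def algebra_simps)
    next
      case 2
      then have "B = Suc (cnt n (round n E x) T)" "cnt n (round n E x) S = A" using A' B' by auto
      then show ?thesis
        unfolding sum_single_indicator[OF single(3) fin(1)] sum_single_indicator[OF single(3) fin(2)]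
        using 2 by (simp add: b_def algebra_simps)
    next
      case 3
      then have "cnt n (round n E x) S = A" "cnt n (round n E x) T = B" using A' B' by auto
      then show ?thesis
        unfolding sum_single_indicator[OF single(3) fin(1)] sum_single_indicator[OF single(3) fin(2)]
        using 3 by simp
    qed
    then show ?thesis using p0 by simp
  next
    case large
    then have "?iS x = 0" "?iT x = 0" by auto
    moreover have "cnt n (round n E x) S = A" "cnt n (round n E x) T = B"
      using cnt_round_small[OF x SK(1) large(1)] cnt_round_small[OF x SK(2) large(1)] large(2)
      by (auto simp: A_def B_def)
    ultimately show ?thesis using large p0 by simp
  qed
  have Av_i: "Av n (%x. SUM k:U. of_bool (?s x \<in> single k)) = h * real (cnt n E U) * f ^ (l - 1)"
    if U: "U \<subseteq> slow K l R" for U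
  proof -
    have UK: "U \<subseteq> {1..K}" using U slow_subset by blast
    have "Av n (%x. SUM k:U. of_bool (?s x \<in> single k)) = (SUM k:U. h * real (cnt n E {k}) * f ^ (l - 1))"
      unfolding Av_sum
    proof (intro sum.cong refl)
      fix k assume k: "k \<in> U"
      then have "1 <= k" "k <= K" "ex_k K l R k = ex" using U UK slow_ex[of k] by auto
      then show "Av n (%x. of_bool (?s x \<in> single k)) = h * real (cnt n E {k}) * f ^ (l - 1)"
        using Av_single[OF _ _ n(2), of k E] by (simp add: h_def f_def)
    qed
    also have "... = h * (SUM k:U. real (cnt n E {k})) * f ^ (l - 1)"
      by (simp add: sum_distrib_left sum_distrib_right)
    finally show ?thesis using cnt_small_sum[OF UK, of n E] by simp
  qed
  have E0: "Av n ?uv - (u ^ A * v ^ B + a * (h * real A * f ^ (l - 1)) + b * (h * real B * f ^ (l - 1)))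
     = Av n (%x. ?uv x - (u ^ A * v ^ B + a * ?iS x + b * ?iT x))"
    by (simp only: Av_diff Av_add Av_cmult Av_const[OF n(2)] Av_i[OF ST(1)] Av_i[OF ST(2)] A_def B_def)
  have "\<bar>Av n (%x. ?uv x - (u ^ A * v ^ B + a * ?iS x + b * ?iT x))\<bar> <= Av n (%x. 4 * p * of_bool (multi (?s x)))"
    by (rule Av_abs_le) (rule pw)
  also have "... <= 4 * p * ((real l)^2 * w\<^sup>2)"
    unfolding Av_cmult using Av_multi[OF n(2), of E] p0
    by (intro mult_left_mono) (auto simp: w_def f_def)
  finally have E1: "\<bar>Av n ?uv - (u ^ A * v ^ B + a * (h * real A * f ^ (l - 1)) + b * (h * real B * f ^ (l - 1)))\<bar>
      <= 4 * p * ((real l)^2 * w\<^sup>2)"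
    unfolding E0 .
  have fl: "0 <= 1 - f ^ (l - 1)" "1 - f ^ (l - 1) <= real l * w"
  proof -
    show "0 <= 1 - f ^ (l - 1)" using f by (simp add: power_le_one)
    have "1 + real (l - 1) * (- w) <= (1 + (- w)) ^ (l - 1)" using w by (intro Bernoulli_inequality) auto
    moreover have "1 + - w = f" by (simp add: w_def)
    ultimately have "1 - f ^ (l - 1) <= real (l - 1) * w" by simp
    also have "... <= real l * w" using w by (intro mult_right_mono) auto
    finally show "1 - f ^ (l - 1) <= real l * w" .
  qed
  have E2: "\<bar>c * (h * real M * f ^ (l - 1)) - h * real M * c\<bar> <= p * (real ex * w) * (real l * w)"
    if c: "0 <= c" "c <= p" and M: "h * real M <= real ex * w" for c M
  proof -
    have "\<bar>c * (h * real M * f ^ (l - 1)) - h * real M * c\<bar> = c * (h * real M) * (1 - f ^ (l - 1))"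
    proof -
      have "c * (h * real M * f ^ (l - 1)) - h * real M * c = - (c * (h * real M) * (1 - f ^ (l - 1)))"
        by (simp add: algebra_simps)
      then show ?thesis using c h fl by simp
    qed
    also have "... <= p * (real ex * w) * (real l * w)"
      by (rule mult_mono[OF mult_mono[OF c(2) M] fl(2)]) (use c h w p0 fl in auto)
    finally show ?thesis .
  qed
  have E3: "\<bar>(u + h * (1 - u)) ^ A * (v + h * (1 - v)) ^ B - u ^ A * v ^ B - h * real A * a - h * real B * b\<bar>
      <= (2 * (real ex * w * p))^2"
  proof -
    have le1: "y + h * (1 - y) <= 1" if "y <= 1" for y
    proof -
      have "0 <= (1 - y) * (1 - h)" using h that by (intro mult_nonneg_nonneg) auto
      then show ?thesis by (simp add: algebra_simps)
    qed
    have "\<bar>(u + h * (1 - u)) ^ A * (v + h * (1 - v)) ^ B - u ^ A * v ^ B - real A * (h * (1 - u)) * u ^ (A - 1) * v ^ B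
      - real B * (h * (1 - v)) * u ^ A * v ^ (B - 1)\<bar> <= (real A * (h * (1 - u)) + real B * (h * (1 - v)))^2"
      using uv h le1 by (intro power_power_second_order) auto
    also have "... <= (2 * (real ex * w * p))^2"
    proof (rule power_mono)
      have "h * real A * (1 - u) + h * real B * (1 - v) <= real ex * w * p + real ex * w * p"
        by (rule add_mono[OF mult_mono[OF hA(1) p(1)] mult_mono[OF hA(2) p(2)]]) (use uv w in auto)
      then show "real A * (h * (1 - u)) + real B * (h * (1 - v)) <= 2 * (real ex * w * p)" by (simp add: mult_ac)
    qed (use uv h in auto)
    also have "real A * (h * (1 - u)) * u ^ (A - 1) * v ^ B = h * real A * a" by (simp add: a_def mult_ac)
    also have "real B * (h * (1 - v)) * u ^ A * v ^ (B - 1) = h * real B * b" by (simp add: b_def mult_ac)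
    finally show ?thesis .
  qed
  have "(2 * (real ex * w * p))^2 = 4 * (real ex)^2 * (p * p) * w\<^sup>2"
    by (simp add: power2_eq_square)
  also have "... <= 4 * (real ex)^2 * (p * 1) * w\<^sup>2"
    using p p0 by (intro mult_left_mono mult_right_mono) auto
  finally have E4: "(2 * (real ex * w * p))^2 <= 4 * (real ex)^2 * p * w\<^sup>2" by simp
  have "\<bar>Av n ?uv - (u + h * (1 - u)) ^ A * (v + h * (1 - v)) ^ B\<bar>
     <= 4 * p * ((real l)^2 * w\<^sup>2) + 2 * (p * (real ex * w) * (real l * w)) + 4 * (real ex)^2 * p * w\<^sup>2"
    using E1 E2[OF ab(1,2) hA(1)] E2[OF ab(3,4) hA(2)] E3 E4 by linarith
  also have "... = gen_const * p * w\<^sup>2" by (simp add: gen_const_def power2_eq_square algebra_simps)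
  finally show ?thesis by (simp add: A_def B_def w_def f_def)
qed

end

section \<open>Expectations over the choices of the first rounds\<close>

context size_rule
begin

definition X :: "nat => (nat => nat) measure" where
  "X n = (\<Pi>\<^sub>M j\<in>{1..l}. uniform_count_measure {1..n})"

lemma choice_space_X: "choice_space l n = (\<Pi>\<^sub>M N\<in>UNIV. X n)"
  by (simp add: choice_space_def X_def)

lemma prob_uniform: "(n::nat) >= 1 ==> prob_space (uniform_count_measure {1..n})"
  by (rule prob_space_uniform_count_measure) auto

lemma space_X: "space (X n) = Tup n"
  by (simp add: X_def space_PiM Tup_def space_uniform_count_measure)

lemma singleton_X: "x \<in> Tup n ==> {x} = (\<Pi>\<^sub>E j\<in>{1..l}. {x j})"
  by (rule PiE_singleton[symmetric]) (auto simp: Tup_def PiE_iff)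

lemma sets_X: "sets (X n) = Pow (Tup n)"
proof
  show "sets (X n) \<subseteq> Pow (Tup n)" using sets.space_closed[of "X n"] by (simp add: space_X)
  show "Pow (Tup n) \<subseteq> sets (X n)"
  proof
    fix A assume "A \<in> Pow (Tup n)"
    then have A: "A \<subseteq> Tup n" by simp
    have "{x} \<in> sets (X n)" if "x \<in> A" for x
    proof -
      have x: "x \<in> Tup n" using that A by blast
      show ?thesis unfolding singleton_X[OF x] X_def
        using Tup_app[OF x] by (intro sets_PiM_I_finite) (auto simp: sets_uniform_count_measure)
    qed
    moreover have "finite A" using A finite_Tup finite_subset by blast
    ultimately have "(\<Union>x\<in>A. {x}) \<in> sets (X n)" by (intro sets.finite_UN) auto
    then show "A \<in> sets (X n)" by simp
  qed
qed

lemma X_eq: "n >= 1 ==> X n = uniform_count_measure (Tup n)"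
proof (rule measure_eqI_finite[OF sets_X _ finite_Tup])
  assume n: "n >= 1"
  show "sets (uniform_count_measure (Tup n)) = Pow (Tup n)" by (rule sets_uniform_count_measure)
  fix x assume x: "x \<in> Tup n"
  interpret product_sigma_finite "%j::nat. uniform_count_measure {1..n}"
    by unfold_locales (metis n prob_uniform prob_space_imp_sigma_finite sigma_finite_measure.sigma_finite_countable)
  have "emeasure (X n) {x} = (PROD j:{1..l}. emeasure (uniform_count_measure {1..n}) {x j})"
    unfolding singleton_X[OF x] X_def
    using Tup_app[OF x] by (intro emeasure_PiM) (auto simp: sets_uniform_count_measure)
  also have "... = (PROD j:{1..l}. ennreal (1 / real n))"
    using Tup_app[OF x] by (intro prod.cong refl) (simp add: emeasure_uniform_count_measure)
  also have "... = ennreal ((1 / real n) ^ l)" by (simp add: ennreal_power)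
  also have "... = emeasure (uniform_count_measure (Tup n)) {x}"
    using x finite_Tup by (simp add: emeasure_uniform_count_measure card_Tup power_divide)
  finally show "emeasure (X n) {x} = emeasure (uniform_count_measure (Tup n)) {x}" .
qed

lemma Tup_nonempty: "n >= 1 ==> Tup n ~= {}"
  by (auto simp: Tup_def PiE_eq_empty_iff)

lemma prob_X: "n >= 1 ==> prob_space (X n)"
  unfolding X_eq by (rule prob_space_uniform_count_measure) (auto simp: finite_Tup Tup_nonempty)

lemma integral_X: "n >= 1 ==> integral\<^sup>L (X n) g = Av n g"
  by (simp add: X_eq integral_uniform_count_measure finite_Tup card_Tup Av_def)

lemma sequence_space_X: "n >= 1 ==> sequence_space (X n)"
  using prob_X[of n] unfolding sequence_space_def
  by (intro product_prob_spaceI)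

section \<open>Expectations of functions of finitely many rounds\<close>

definition Mean :: "nat => ((nat => nat => nat) => real) => real" where
  "Mean n f = integral\<^sup>L (choice_space l n) f"

abbreviation Om :: "nat => (nat => nat => nat) set" where
  "Om n \<equiv> space (choice_space l n)"

lemma Om_iff: "v \<in> Om n \<longleftrightarrow> (ALL N. v N \<in> Tup n)"
  by (simp add: choice_space_X space_PiM space_X PiE_iff)

lemma prob_choice: "n >= 1 ==> prob_space (choice_space l n)"
proof -
  assume n: "n >= 1"
  interpret sequence_space "X n" using sequence_space_X[OF n] .
  show ?thesis unfolding choice_space_X by (rule prob_space_PiM) (rule prob_X[OF n])
qed

text \<open>Stated as dependence on the first \<open>N\<close> coordinates rather than through a
  filtration: since a round has finitely many outcomes, measurability and integrability then come
  for free.\<close>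

definition adapted :: "nat => ((nat => nat => nat) => 'b) => bool" where
  "adapted N f \<longleftrightarrow> (ALL v v'. (ALL i<N. v i = v' i) --> f v = f v')"

lemma adapted_mono: "adapted N f ==> N <= M ==> adapted M f"
  unfolding adapted_def by (meson order_less_le_trans)

lemma adapted_const: "adapted N (%_. c)"
  by (simp add: adapted_def)

lemma adapted_comp1: "adapted N f ==> adapted N (%v. h (f v))"
  unfolding adapted_def by metis

lemma adapted_comp2: "adapted N f ==> adapted N g ==> adapted N (%v. h (f v) (g v))"
  unfolding adapted_def by metis

lemma adapted_coord: "i < N ==> adapted N (%v. v i)"
  by (simp add: adapted_def)

lemma finite_histories: "finite ({..<N::nat} \<rightarrow>\<^sub>E Tup n)"
  by (intro finite_PiE) (auto simp: finite_Tup)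

lemma adapted_restrict: "adapted N f ==> f v = f (restrict v {..<N})"
  unfolding adapted_def by (metis lessThan_iff restrict_apply')

lemma adapted_image:
  assumes "adapted N f"
  shows "f ` Om n \<subseteq> f ` ({..<N} \<rightarrow>\<^sub>E Tup n)"
proof
  fix y assume "y \<in> f ` Om n"
  then obtain v where v: "v \<in> Om n" "y = f v" by blast
  then have "restrict v {..<N} \<in> {..<N} \<rightarrow>\<^sub>E Tup n" by (auto simp: Om_iff)
  then show "y \<in> f ` ({..<N} \<rightarrow>\<^sub>E Tup n)" using adapted_restrict[OF assms, of v] v by auto
qed

text \<open>A preimage is a finite union of cylinders, one for each history of \<open>N\<close>
  rounds.\<close>

lemma adapted_measurable:
  assumes "adapted N f"
  shows "f \<in> measurable (choice_space l n) (count_space UNIV)"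
proof (rule measurableI)
  fix A :: "'a set"
  let ?H = "{x \<in> {..<N} \<rightarrow>\<^sub>E Tup n. f x \<in> A}"
  let ?C = "%x. {v \<in> Om n. ALL i:{..<N}. v i \<in> {x i}}"
  have "f -` A \<inter> Om n = (\<Union>x\<in>?H. ?C x)"
  proof
    show "f -` A \<inter> Om n \<subseteq> (\<Union>x\<in>?H. ?C x)"
    proof
      fix v assume v: "v \<in> f -` A \<inter> Om n"
      then have "restrict v {..<N} \<in> ?H" using adapted_restrict[OF assms, of v] by (auto simp: Om_iff)
      moreover have "v \<in> ?C (restrict v {..<N})" using v by auto
      ultimately show "v \<in> (\<Union>x\<in>?H. ?C x)" by blast
    qed
    show "(\<Union>x\<in>?H. ?C x) \<subseteq> f -` A \<inter> Om n"
    proof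
      fix v assume "v \<in> (\<Union>x\<in>?H. ?C x)"
      then obtain x where x: "x \<in> ?H" "v \<in> ?C x" by blast
      then have "f v = f x" using assms unfolding adapted_def by (metis (mono_tags, lifting) lessThan_iff mem_Collect_eq singletonD)
      then show "v \<in> f -` A \<inter> Om n" using x by auto
    qed
  qed
  also have "... \<in> sets (choice_space l n)"
  proof (intro sets.finite_UN)
    show "finite ?H" using finite_histories[of N n] by simp
    fix x assume x: "x \<in> ?H"
    show "?C x \<in> sets (choice_space l n)"
    proof (rule sets.sets_Collect_finite_All)
      fix i assume i: "i \<in> {..<N}"
      have "(%v. v i) \<in> measurable (choice_space l n) (X n)"
        unfolding choice_space_X by (rule measurable_component_singleton) simp
      then have "(%v. v i) -` {x i} \<inter> Om n \<in> sets (choice_space l n)"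
        by (rule measurable_sets) (use x i in \<open>auto simp: sets_X\<close>)
      moreover have "(%v. v i) -` {x i} \<inter> Om n = {v \<in> Om n. v i \<in> {x i}}" by auto
      ultimately show "{v \<in> Om n. v i \<in> {x i}} \<in> sets (choice_space l n)" by simp
    qed simp
  qed
  finally show "f -` A \<inter> Om n \<in> sets (choice_space l n)" .
qed simp

lemma adapted_borel: "adapted N (f :: _ => real) ==> f \<in> borel_measurable (choice_space l n)"
proof -
  assume "adapted N f"
  then have "f \<in> measurable (choice_space l n) (count_space UNIV)" by (rule adapted_measurable)
  moreover have "(%x::real. x) \<in> measurable (count_space UNIV) borel" by simp
  ultimately have "(%v. (%x. x) (f v)) \<in> borel_measurable (choice_space l n)"
    by (rule measurable_compose)
  then show ?thesis by simp
qed

lemma adapted_integrable: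
  assumes n: "n >= 1" and f: "adapted N (f :: _ => real)"
  shows "integrable (choice_space l n) f"
proof -
  interpret prob_space "choice_space l n" by (rule prob_choice[OF n])
  have fin: "finite (f ` Om n)"
    using adapted_image[OF f] finite_histories finite_subset by blast
  define B where "B = Max (insert 0 ((%y. \<bar>y\<bar>) ` f ` Om n))"
  have "\<bar>f v\<bar> <= B" if "v \<in> Om n" for v
    unfolding B_def using fin that by (intro Max_ge) auto
  then show ?thesis
    by (intro integrable_const_bound[of _ B] adapted_borel[OF f]) auto
qed

lemma Mean_const: "n >= 1 ==> Mean n (%_. c) = c"
proof -
  assume n: "n >= 1"
  interpret prob_space "choice_space l n" by (rule prob_choice[OF n])
  show ?thesis by (simp add: Mean_def prob_space)
qed

lemma Mean_add:
  assumes "n >= 1" "adapted N f" "adapted M g"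
  shows "Mean n (%v. f v + g v) = Mean n f + Mean n g"
  unfolding Mean_def using adapted_integrable[OF assms(1,2)] adapted_integrable[OF assms(1,3)]
  by (rule Bochner_Integration.integral_add)

lemma Mean_diff:
  assumes "n >= 1" "adapted N f" "adapted M g"
  shows "Mean n (%v. f v - g v) = Mean n f - Mean n g"
  unfolding Mean_def using adapted_integrable[OF assms(1,2)] adapted_integrable[OF assms(1,3)]
  by (rule Bochner_Integration.integral_diff)

lemma Mean_cmult: "Mean n (%v. c * f v) = c * Mean n f"
  unfolding Mean_def by simp

lemma Mean_sum:
  assumes "n >= 1" "!!i. i \<in> I ==> adapted N (f i)"
  shows "Mean n (%v. SUM i:I. f i v) = (SUM i:I. Mean n (f i))"
  unfolding Mean_def using adapted_integrable[OF assms(1)] assms(2)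
  by (intro Bochner_Integration.integral_sum) blast

lemma Mean_mono:
  assumes "n >= 1" "adapted N f" "adapted M g" "!!v. v \<in> Om n ==> f v <= g v"
  shows "Mean n f <= Mean n g"
  unfolding Mean_def using adapted_integrable[OF assms(1,2)] adapted_integrable[OF assms(1,3)] assms(4)
  by (intro integral_mono)

lemma Mean_cong: "(!!v. v \<in> Om n ==> f v = g v) ==> Mean n f = Mean n g"
  unfolding Mean_def by (intro Bochner_Integration.integral_cong) auto

lemma Mean_nonneg: "(!!v. v \<in> Om n ==> 0 <= f v) ==> 0 <= Mean n f"
  unfolding Mean_def by (rule integral_nonneg_AE) (auto intro: AE_I2)

lemma Mean_abs_le:
  assumes "n >= 1" "adapted N f" "adapted M g" "!!v. v \<in> Om n ==> \<bar>f v\<bar> <= g v"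
  shows "\<bar>Mean n f\<bar> <= Mean n g"
proof -
  have "Mean n f <= Mean n g" using assms by (intro Mean_mono) (auto simp: abs_le_iff)
  moreover have "Mean n (%v. (-1) * f v) <= Mean n g"
    using assms adapted_comp1[OF assms(2), of "%y. (-1) * y"] by (intro Mean_mono) (auto simp: abs_le_iff)
  ultimately show ?thesis unfolding Mean_cmult by simp
qed

lemma prob_adapted:
  assumes n: "n >= 1" and P: "adapted N P"
  shows "\<P>(v in choice_space l n. P v) = Mean n (%v. of_bool (P v))"
proof -
  have "{v \<in> Om n. P v} \<in> sets (choice_space l n)"
    using measurable_sets[OF adapted_measurable[OF P, of n], of "{True}"]
    by (simp add: vimage_def Int_def conj_commute)
  then have "\<P>(v in choice_space l n. P v) = integral\<^sup>L (choice_space l n) (indicator {v \<in> Om n. P v})"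
    by (simp add: Int_absorb1 subset_iff)
  also have "... = Mean n (%v. of_bool (P v))"
    unfolding Mean_def by (intro Bochner_Integration.integral_cong) (auto simp: indicator_def)
  finally show ?thesis .
qed

text \<open>The sequence space is split at time \<open>N\<close> by \<open>comb_seq\<close> into
  independent copies for the past and the future, and round \<open>N\<close> becomes coordinate 0 of
  the second copy. As \<open>\<phi>\<close> sees only the past in its first argument, Fubini
  averages the round alone.\<close>

theorem Mean_next_round:
  assumes n: "n >= 1" and ad: "!!x. adapted N (%v. \<phi> v x)"
  shows "Mean n (%v. \<phi> v (v N)) = Mean n (%v. Av n (\<phi> v))"
proof -
  interpret sequence_space "X n" by (rule sequence_space_X[OF n])
  interpret SP: prob_space S using prob_choice[OF n] by (simp add: choice_space_X)
  interpret PP: pair_sigma_finite S S ..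
  have ad': "adapted (Suc N) (%v. \<phi> v (v N))"
    using ad unfolding adapted_def by (metis less_Suc_eq)
  have intb: "integrable S (%v. \<phi> v (v N))"
    using adapted_integrable[OF n ad'] by (simp add: choice_space_X)
  have cs: "(%(\<omega>, \<omega>'). comb_seq N \<omega> \<omega>') \<in> measurable (S \<Otimes>\<^sub>M S) S" by (rule measurable_comb_seq)
  have eq: "\<phi> (comb_seq N \<omega> \<omega>') (comb_seq N \<omega> \<omega>' N) = \<phi> \<omega> (\<omega>' 0)" for \<omega> \<omega>'
  proof -
    have "comb_seq N \<omega> \<omega>' N = \<omega>' 0" using comb_seq_add[of N \<omega> \<omega>' 0] by simp
    moreover have "\<phi> (comb_seq N \<omega> \<omega>') x = \<phi> \<omega> x" for x
      using ad[of x] comb_seq_less[of _ N \<omega> \<omega>'] unfolding adapted_def by blast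
    ultimately show ?thesis by simp
  qed
  have bm: "(%v. \<phi> v (v N)) \<in> borel_measurable S" using intb by simp
  have int2: "integrable (S \<Otimes>\<^sub>M S) (%p. \<phi> (fst p) (snd p 0))"
  proof -
    have "integrable (distr (S \<Otimes>\<^sub>M S) S (%(\<omega>, \<omega>'). comb_seq N \<omega> \<omega>')) (%v. \<phi> v (v N))"
      using intb by (simp only: PiM_comb_seq)
    then have "integrable (S \<Otimes>\<^sub>M S) (%p. (%v. \<phi> v (v N)) ((%(\<omega>, \<omega>'). comb_seq N \<omega> \<omega>') p))"
      by (rule integrable_distr[OF cs])
    then show ?thesis by (simp add: case_prod_beta eq)
  qed
  have "Mean n (%v. \<phi> v (v N)) = integral\<^sup>L (distr (S \<Otimes>\<^sub>M S) S (%(\<omega>, \<omega>'). comb_seq N \<omega> \<omega>')) (%v. \<phi> v (v N))"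
    unfolding Mean_def choice_space_X PiM_comb_seq ..
  also have "... = integral\<^sup>L (S \<Otimes>\<^sub>M S) (%p. (%v. \<phi> v (v N)) ((%(\<omega>, \<omega>'). comb_seq N \<omega> \<omega>') p))"
    by (rule integral_distr[OF cs bm])
  also have "... = integral\<^sup>L (S \<Otimes>\<^sub>M S) (%p. \<phi> (fst p) (snd p 0))"
    by (simp add: case_prod_beta eq)
  also have "... = (\<integral>\<omega>. (\<integral>\<omega>'. \<phi> \<omega> (\<omega>' 0) \<partial>S) \<partial>S)"
    using PP.integral_fst'[OF int2] by simp
  also have "... = (\<integral>\<omega>. Av n (\<phi> \<omega>) \<partial>S)"
  proof (intro Bochner_Integration.integral_cong refl)
    fix \<omega>
    have m: "(%\<omega>'. \<omega>' 0) \<in> measurable S (X n)" by (rule measurable_component_singleton) simp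
    have bX: "\<phi> \<omega> \<in> borel_measurable (X n)"
      using X_eq[OF n] by (simp add: measurable_def sets_uniform_count_measure space_uniform_count_measure)
    have "(\<integral>\<omega>'. \<phi> \<omega> (\<omega>' 0) \<partial>S) = integral\<^sup>L (distr S (X n) (%\<omega>'. \<omega>' 0)) (\<phi> \<omega>)"
      by (rule integral_distr[OF m bX, symmetric])
    also have "distr S (X n) (%\<omega>'. \<omega>' 0) = X n" by (rule PiM_component) simp
    finally show "(\<integral>\<omega>'. \<phi> \<omega> (\<omega>' 0) \<partial>S) = Av n (\<phi> \<omega>)" by (simp add: integral_X[OF n])
  qed
  finally show ?thesis by (simp add: Mean_def choice_space_X)
qed

abbreviation G :: "nat => (nat => nat => nat) => nat => nat set set" where
  "G n v N \<equiv> process_edges K l R n v N"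

lemma adapted_G: "adapted N (%v. G n v N)"
proof (induction N)
  case (Suc N)
  have "G n v (Suc N) = G n v' (Suc N)" if v: "ALL i<Suc N. v i = v' i" for v v'
  proof -
    have "G n v N = G n v' N" using Suc v unfolding adapted_def by simp
    then show ?thesis using v unfolding process_edges_Suc by simp
  qed
  then show ?case unfolding adapted_def by blast
qed (simp add: adapted_def)

lemma adapted_G': "N <= M ==> adapted M (%v. f (G n v N))"
  by (intro adapted_comp1[where h = f]) (rule adapted_mono[OF adapted_G])

lemma Mean_G_Suc:
  assumes n: "n >= 1" and Z: "adapted N Z"
  shows "Mean n (%v. Z v * \<Phi> (G n v (Suc N))) = Mean n (%v. Z v * Av n (%x. \<Phi> (round n (G n v N) x)))"
proof -
  have "Mean n (%v. Z v * \<Phi> (G n v (Suc N))) = Mean n (%v. (%v x. Z v * \<Phi> (round n (G n v N) x)) v (v N))"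
    by (simp only: process_edges_Suc)
  also have "... = Mean n (%v. Av n (%x. Z v * \<Phi> (round n (G n v N) x)))"
    by (rule Mean_next_round[OF n]) (rule adapted_comp2[where h = "(*)", OF Z adapted_G'[OF order_refl]])
  finally show ?thesis by (simp only: Av_cmult)
qed

lemma Mean_G_Suc_le:
  assumes n: "n >= 1" and Z: "adapted N Z" and \<Psi>: "adapted N \<Psi>"
    and le: "!!v. v \<in> Om n ==> Z v * Av n (%x. \<Phi> (round n (G n v N) x)) <= \<Psi> v"
  shows "Mean n (%v. Z v * \<Phi> (G n v (Suc N))) <= Mean n \<Psi>"
  unfolding Mean_G_Suc[OF n Z]
  by (rule Mean_mono[OF n _ \<Psi> le]) (rule adapted_comp2[where h = "(*)", OF Z adapted_G'[OF order_refl]])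

lemma recursion_bound:
  fixes a :: "nat => real"
  assumes "!!N. N0 <= N ==> a (Suc N) <= r * a N" "0 <= r" "N0 <= N"
  shows "a N <= r ^ (N - N0) * a N0"
  using assms(3)
proof (induction N rule: dec_induct)
  case (step N)
  have "a (Suc N) <= r * a N" using step by (intro assms(1)) auto
  also have "... <= r * (r ^ (N - N0) * a N0)" using step assms(2) by (intro mult_left_mono) auto
  finally show ?case using step by (simp add: Suc_diff_le)
qed simp

lemma recursion_bound_inhomogeneous:
  fixes a b :: "nat => real"
  assumes "!!N. N0 <= N ==> a (Suc N) <= r * a N + b N" "0 <= r" "N0 <= N"
  shows "a N <= r ^ (N - N0) * a N0 + (SUM M:{N0..<N}. r ^ (N - M - 1) * b M)"
  using assms(3)
proof (induction N rule: dec_induct)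
  case (step N)
  have "a (Suc N) <= r * a N + b N" using step by (intro assms(1)) auto
  also have "... <= r * (r ^ (N - N0) * a N0 + (SUM M:{N0..<N}. r ^ (N - M - 1) * b M)) + b N"
    using step assms(2) by (intro add_right_mono mult_left_mono) auto
  also have "... = r ^ (Suc N - N0) * a N0 + ((SUM M:{N0..<N}. r ^ (Suc N - M - 1) * b M) + b N)"
  proof -
    have "r * (SUM M:{N0..<N}. r ^ (N - M - 1) * b M) = (SUM M:{N0..<N}. r ^ (Suc N - M - 1) * b M)"
      unfolding sum_distrib_left
    proof (intro sum.cong refl)
      fix M assume "M \<in> {N0..<N}"
      then have "Suc N - M - 1 = Suc (N - M - 1)" by auto
      then show "r * (r ^ (N - M - 1) * b M) = r ^ (Suc N - M - 1) * b M" by simp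
    qed
    then show ?thesis using step by (simp add: Suc_diff_le algebra_simps)
  qed
  also have "(SUM M:{N0..<N}. r ^ (Suc N - M - 1) * b M) + b N = (SUM M:{N0..<Suc N}. r ^ (Suc N - M - 1) * b M)"
    using step by (simp add: sum.atLeastLessThan_Suc)
  finally show ?case .
qed simp

end

context nondegenerate_rule
begin

lemma Mean_Q_universal:
  assumes n: "real n >= 2 ^ (l + 1) * real (l * K)" "n >= 1"
  shows "Mean n (%v. Q n (G n v N)) <= real n * (1 - base_rate / real n) ^ N"
proof -
  let ?r = "1 - base_rate / real n"
  have r: "0 <= ?r" using base_rate n(2) by (simp add: field_simps)
  have rec: "Mean n (%v. Q n (G n v (Suc N))) <= ?r * Mean n (%v. Q n (G n v N))" for N
  proof -
    have "Mean n (%v. 1 * Q n (G n v (Suc N))) <= Mean n (%v. ?r * Q n (G n v N))"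
    proof (rule Mean_G_Suc_le[OF n(2) adapted_const adapted_G'[OF order_refl]])
      fix v
      show "1 * Av n (%x. Q n (round n (G n v N) x)) <= ?r * Q n (G n v N)"
        using Q_decay_universal[OF n, of "G n v N"] by (simp only: mult.commute mult_1)
    qed
    then show ?thesis by (simp only: Mean_cmult mult_1)
  qed
  have "Mean n (%v. Q n (G n v N)) <= ?r ^ (N - 0) * Mean n (%v. Q n (G n v 0))"
    by (rule recursion_bound[where a = "%N. Mean n (%v. Q n (G n v N))" and ?N0.0 = 0, OF rec r]) simp
  also have "... <= ?r ^ N * Mean n (%_. real n)"
  proof (unfold diff_zero, rule mult_left_mono)
    show "Mean n (%v. Q n (G n v 0)) <= Mean n (%_. real n)"
      by (rule Mean_mono[OF n(2) adapted_G'[OF order_refl] adapted_const]) (rule Q_le)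
  qed (use r in simp)
  finally show ?thesis by (simp add: Mean_const[OF n(2)] mult.commute)
qed

end

section \<open>The process once few components are left\<close>

context nondegenerate_rule
begin

lemma Q_path_mono:
  assumes v: "v \<in> Om n" and N: "N <= M"
  shows "Q n (G n v M) <= Q n (G n v N)"
  using N
proof (induction M rule: dec_induct)
  case (step M)
  have "v M \<in> Tup n" using v by (simp add: Om_iff)
  then have "Q n (G n v (Suc M)) <= Q n (G n v M)"
    unfolding process_edges_Suc by (simp add: Q_round)
  then show ?case using step by linarith
qed simp

text \<open>With the factor \<open>K + 1\<close> one inequality controls both quantities needed for
  the drift: the vertices outside large components, at most \<open>K * (Q + 1)\<close>, and
  \<open>K + 1\<close> times the number of large components. It persists because \<open>Q\<close>
  never increases.\<close>

definition good :: "nat => nat => real => (nat => nat => nat) => bool" where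
  "good n N0 \<zeta> v \<longleftrightarrow> real (K + 1) * (Q n (G n v N0) + 1) <= \<zeta> * real n"

lemma adapted_good: "N0 <= N ==> adapted N (good n N0 \<zeta>)"
  unfolding good_def[abs_def] by (rule adapted_G'[where f = "%E. real (K + 1) * (Q n E + 1) <= \<zeta> * real n"])

text \<open>\<open>good\<close> is decided at time \<open>N0\<close> and persists, so its indicator can be carried as a factor through
  all later rounds.\<close>

definition Zg :: "nat => nat => real => (nat => nat => nat) => real" where
  "Zg n N0 \<zeta> v = of_bool (good n N0 \<zeta> v)"

lemma adapted_Zg: "N0 <= N ==> adapted N (Zg n N0 \<zeta>)"
  unfolding Zg_def[abs_def] by (intro adapted_comp1[where h = of_bool] adapted_good)

lemma Zg_bounds: "0 <= Zg n N0 \<zeta> v" "Zg n N0 \<zeta> v <= 1"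
  by (auto simp: Zg_def)

lemma good_later:
  assumes n: "n >= 1" and v: "v \<in> Om n" and g: "good n N0 \<zeta> v" and N: "N0 <= N" and \<zeta>: "real l * \<zeta> <= 1"
  shows "real (K + 1) * (Q n (G n v N) + 1) <= \<zeta> * real n" "0 < fr n (G n v N)" "cnt n (G n v N) {K<..} >= 1"
proof -
  have "real (K + 1) * (Q n (G n v N) + 1) <= real (K + 1) * (Q n (G n v N0) + 1)"
    using Q_path_mono[OF v N] by (intro mult_left_mono) auto
  then show 1: "real (K + 1) * (Q n (G n v N) + 1) <= \<zeta> * real n" using g unfolding good_def by linarith
  have Q0: "0 <= Q n (G n v N)" by (rule Q_nonneg[OF n])
  have "0 <= real (K + 1) * (Q n (G n v N) + 1)" using Q0 by (intro mult_nonneg_nonneg) auto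
  then have "0 <= \<zeta> * real n" using 1 by (rule order_trans)
  then have \<zeta>0: "0 <= \<zeta>" using n by (simp add: zero_le_mult_iff)
  have "1 * \<zeta> <= real l * \<zeta>" using \<zeta>0 l1 by (intro mult_right_mono) auto
  then have \<zeta>1: "\<zeta> <= 1" using \<zeta> by simp
  have "real n * (1 - fr n (G n v N)) <= real K * (Q n (G n v N) + 1)" by (rule mass_le_Q'[OF n])
  also have "... < real (K + 1) * (Q n (G n v N) + 1)" using Q0 by (intro mult_strict_right_mono) auto
  also have "... <= \<zeta> * real n" by (rule 1)
  also have "... <= 1 * real n" using \<zeta>1 by (intro mult_right_mono) auto
  finally show "0 < fr n (G n v N)" using n by simp
  then show "cnt n (G n v N) {K<..} >= 1" by (rule large_exists[OF n])
qed

lemma Mean_Zg_rec: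
  assumes n: "n >= 1" and N: "N0 <= N" and \<zeta>: "real l * \<zeta> <= 1"
    and le: "!!E. cnt n E {K<..} >= 1 ==> 0 < fr n E ==> real (K + 1) * (Q n E + 1) <= \<zeta> * real n ==>
       Av n (%x. \<Phi> (round n E x)) <= r * \<Phi> E + \<Psi> E"
  shows "Mean n (%v. Zg n N0 \<zeta> v * \<Phi> (G n v (Suc N))) <=
    r * Mean n (%v. Zg n N0 \<zeta> v * \<Phi> (G n v N)) + Mean n (%v. Zg n N0 \<zeta> v * \<Psi> (G n v N))"
proof -
  have ad: "adapted N (%v. Zg n N0 \<zeta> v * F (G n v N))" for F :: "nat set set => real"
    by (rule adapted_comp2[where h = "(*)", OF adapted_Zg[OF N] adapted_G'[OF order_refl]])
  have ad2: "adapted N (%v. r * (Zg n N0 \<zeta> v * \<Phi> (G n v N)))"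
    by (rule adapted_comp1[where h = "%y. r * y", OF ad])
  have "Mean n (%v. Zg n N0 \<zeta> v * \<Phi> (G n v (Suc N))) <=
     Mean n (%v. r * (Zg n N0 \<zeta> v * \<Phi> (G n v N)) + Zg n N0 \<zeta> v * \<Psi> (G n v N))"
  proof (rule Mean_G_Suc_le[OF n adapted_Zg[OF N] adapted_comp2[where h = "(+)", OF ad2 ad]])
    fix v assume v: "v \<in> Om n"
    show "Zg n N0 \<zeta> v * Av n (%x. \<Phi> (round n (G n v N) x))
      <= r * (Zg n N0 \<zeta> v * \<Phi> (G n v N)) + Zg n N0 \<zeta> v * \<Psi> (G n v N)"
    proof (cases "good n N0 \<zeta> v")
      case True
      show ?thesis using le[OF good_later(3,2,1)[OF n v True N \<zeta>]] True by (simp add: Zg_def)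
    qed (simp add: Zg_def)
  qed
  also have "... = r * Mean n (%v. Zg n N0 \<zeta> v * \<Phi> (G n v N)) + Mean n (%v. Zg n N0 \<zeta> v * \<Psi> (G n v N))"
    by (simp only: Mean_add[OF n ad2 ad] Mean_cmult)
  finally show ?thesis .
qed

lemma power_le_exp: "0 <= 1 - x ==> (1 - x) ^ j <= exp (- x * real j)" for x :: real
proof -
  assume "0 <= 1 - x"
  then have "(1 - x) ^ j <= exp (- x) ^ j"
    using exp_ge_add_one_self[of "- x"] by (intro power_mono) auto
  also have "... = exp (- x * real j)" by (simp add: exp_of_nat_mult[symmetric] mult.commute)
  finally show ?thesis .
qed

definition dec :: "real => nat => nat => real" where
  "dec c n j = exp (- c * real j / real n)"

lemma dec_pos: "0 < dec c n j" by (simp add: dec_def)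

lemma dec_add: "dec c n (i + j) = dec c n i * dec c n j"
  by (simp add: dec_def exp_add[symmetric] add_divide_distrib[symmetric] algebra_simps)

lemma dec_mono: "c' <= c ==> dec c n j <= dec c' n j"
  by (simp add: dec_def divide_right_mono mult_right_mono)

lemma dec_le_1: "0 <= c ==> dec c n j <= 1"
  by (simp add: dec_def)

lemma dec_antimono: "0 <= c ==> i <= j ==> dec c n j <= dec c n i"
  by (simp add: dec_def divide_right_mono mult_left_mono)

lemma exp_bounds: "exp (1/2::real) <= 2" "exp (1::real) <= 3"
proof -
  show "exp (1::real) <= 3" by (rule exp_le)
  have "exp (1/2::real) * exp (1/2) = exp 1" by (simp add: exp_add[symmetric])
  then have "(exp (1/2::real))^2 <= 2\<^sup>2" using \<open>exp (1::real) <= 3\<close> by (simp add: power2_eq_square)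
  then show "exp (1/2::real) <= 2" by (rule power2_le_imp_le) simp
qed

text \<open>The relative loss \<open>real l * \<zeta>\<close> in the rate accumulates over
  \<open>j\<close> rounds to the exponent \<open>b\<close>, so only a constant factor separates the
  contraction from the ideal decay \<open>dec\<close>.\<close>

lemma contraction_le_dec:
  assumes n: "n >= 1" and c: "0 <= c" "c <= real n" and \<zeta>: "0 <= \<zeta>" "real l * \<zeta> <= 1"
    and small: "c * (real l * \<zeta>) * real j / real n <= b"
  shows "0 <= 1 - c * (1 - real l * \<zeta>) / real n" "(1 - c * (1 - real l * \<zeta>) / real n) ^ j <= exp b * dec c n j"
proof -
  have "c * (1 - real l * \<zeta>) <= real n * 1" using c \<zeta> by (intro mult_mono) auto
  then show 0: "0 <= 1 - c * (1 - real l * \<zeta>) / real n" using n by simp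
  have "(1 - c * (1 - real l * \<zeta>) / real n) ^ j <= exp (- (c * (1 - real l * \<zeta>) / real n) * real j)"
    by (rule power_le_exp[OF 0])
  also have "- (c * (1 - real l * \<zeta>) / real n) * real j = c * (real l * \<zeta>) * real j / real n + (- c * real j / real n)"
    by (simp add: divide_inverse algebra_simps)
  also have "exp ... <= exp (b + (- c * real j / real n))" using small by simp
  finally show "(1 - c * (1 - real l * \<zeta>) / real n) ^ j <= exp b * dec c n j" unfolding dec_def exp_add .
qed

abbreviation ex' :: real where "ex' \<equiv> real ex"

lemma ex'1: "1 <= ex'" using ex_pos by simp

text \<open>The common yardstick of late errors: both the probability of a \<open>multi\<close>
  round and the error of \<open>generating_step\<close> are at most a constant times this
  mean.\<close>

definition Wm :: "nat => nat => real => nat => real" where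
  "Wm n N0 \<zeta> N = Mean n (%v. Zg n N0 \<zeta> v * (1 - fr n (G n v N))^2)"

lemma Wm_nonneg: "0 <= Wm n N0 \<zeta> N"
  unfolding Wm_def by (intro Mean_nonneg mult_nonneg_nonneg Zg_bounds) auto

text \<open>The last clause bounds the accumulated loss from \<open>\<zeta>\<close> over the whole
  window, so that \<open>contraction_le_dec\<close> costs at most \<open>exp (1/2)\<close>, or
  \<open>exp 1\<close> at the doubled rate \<open>2 * ex'\<close>.\<close>

definition late :: "nat => nat => real => nat => bool" where
  "late n N0 \<zeta> H \<longleftrightarrow> n >= 1 & 2 * ex' <= real n & 0 <= \<zeta> & real l * \<zeta> <= 1 & N0 <= H &
     (ex' + 1) * (real l * \<zeta>) * real (H - N0) / real n <= 1 / 2"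

lemma late_n: "late n N0 \<zeta> H ==> n >= 1" "late n N0 \<zeta> H ==> real l * \<zeta> <= 1"
    "late n N0 \<zeta> H ==> 0 <= \<zeta>" "late n N0 \<zeta> H ==> 2 * ex' <= real n"
  by (auto simp: late_def)

lemma late_small:
  assumes "late n N0 \<zeta> H" "N0 <= N" "N <= H" "0 <= c" "c <= ex' + 1"
  shows "c * (real l * \<zeta>) * real (N - N0) / real n <= 1 / 2"
proof -
  have "c * (real l * \<zeta>) * real (N - N0) / real n <= (ex' + 1) * (real l * \<zeta>) * real (H - N0) / real n"
    using assms by (intro divide_right_mono mult_mono mult_nonneg_nonneg) (auto simp: late_def)
  then show ?thesis using assms(1) unfolding late_def by linarith
qed

lemma Mean_Q_late:
  assumes "late n N0 \<zeta> H" "N0 <= N" "N <= H"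
  shows "Mean n (%v. Zg n N0 \<zeta> v * Q n (G n v N)) <= 2 * real n * dec ex' n (N - N0)"
proof -
  note L = late_n[OF assms(1)]
  let ?r = "1 - ex' * (1 - real l * \<zeta>) / real n"
  let ?a = "%N. Mean n (%v. Zg n N0 \<zeta> v * Q n (G n v N))"
  have ad: "adapted N0 (%v. Zg n N0 \<zeta> v * Q n (G n v N0))"
    by (rule adapted_comp2[where h = "(*)", OF adapted_Zg[OF order_refl] adapted_G'[OF order_refl]])
  have c: "0 <= ex'" "ex' <= real n" "ex' <= ex' + 1" using ex'1 L(4) by auto
  note cd = contraction_le_dec[OF L(1) c(1,2) L(3,2) late_small[OF assms c(1,3)]]
  have a0: "?a N0 <= real n"
  proof -
    have "?a N0 <= Mean n (%_. real n)"
    proof (rule Mean_mono[OF L(1) ad adapted_const])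
      fix v
      have "Zg n N0 \<zeta> v * Q n (G n v N0) <= 1 * real n"
        using Zg_bounds Q_le Q_nonneg[OF L(1)] by (intro mult_mono) auto
      then show "Zg n N0 \<zeta> v * Q n (G n v N0) <= real n" by simp
    qed
    then show ?thesis by (simp add: Mean_const[OF L(1)])
  qed
  have rec: "?a (Suc M) <= ?r * ?a M" if "N0 <= M" for M
  proof -
    have "?a (Suc M) <= ?r * ?a M + Mean n (%v. Zg n N0 \<zeta> v * (%_. 0) (G n v M))"
      using Q_decay(1)[OF L(1)] L(2) by (intro Mean_Zg_rec[OF L(1) that L(2)]) (simp add: mult.commute)
    then show ?thesis by (simp add: Mean_def)
  qed
  have "?a N <= ?r ^ (N - N0) * ?a N0"
    using rec cd(1) assms(2) by (rule recursion_bound[where a = ?a])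
  also have "... <= (exp (1/2) * dec ex' n (N - N0)) * real n"
    using cd a0 dec_pos[of ex' n "N - N0"]
    by (intro mult_mono Mean_nonneg mult_nonneg_nonneg Zg_bounds Q_nonneg[OF L(1)]) (auto simp: less_imp_le)
  also have "... <= (2 * dec ex' n (N - N0)) * real n"
    using exp_bounds dec_pos[of ex' n "N - N0"] by (intro mult_right_mono) auto
  finally show ?thesis by (simp add: mult_ac)
qed

lemma Mean_QQ_late:
  assumes "late n N0 \<zeta> H" "N0 <= N" "N <= H"
  shows "Mean n (%v. Zg n N0 \<zeta> v * (Q n (G n v N) * (Q n (G n v N) - 1))) <= 3 * (real n)^2 * (dec ex' n (N - N0))^2"
proof -
  note L = late_n[OF assms(1)]
  let ?r = "1 - 2 * (ex' * (1 - real l * \<zeta>) / real n)"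
  let ?F = "%E. Q n E * (Q n E - 1)"
  let ?a = "%N. Mean n (%v. Zg n N0 \<zeta> v * ?F (G n v N))"
  have ad: "adapted N0 (%v. Zg n N0 \<zeta> v * ?F (G n v N0))"
    by (rule adapted_comp2[where h = "(*)", OF adapted_Zg[OF order_refl] adapted_G'[where f = ?F, OF order_refl]])
  have F0: "0 <= ?F E" for E
  proof (cases "Q n E >= 1")
    case False
    then have "Q n E = 0" using Q_nonneg[OF L(1), of E] by (simp add: Q_def)
    then show ?thesis by simp
  qed auto
  have c: "0 <= ex'" "ex' <= ex' + 1" "0 <= 2 * ex'" using ex'1 by auto
  have sm: "(2 * ex') * (real l * \<zeta>) * real (N - N0) / real n <= 1"
  proof -
    have "(2 * ex') * (real l * \<zeta>) * real (N - N0) / real n = 2 * (ex' * (real l * \<zeta>) * real (N - N0) / real n)"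
      by simp
    then show ?thesis using late_small[OF assms c(1,2)] by linarith
  qed
  note cd0 = contraction_le_dec[OF L(1) c(3) L(4) L(3,2) sm]
  have cd: "0 <= ?r" "?r ^ (N - N0) <= exp 1 * dec (2 * ex') n (N - N0)"
    using cd0 by (simp_all add: mult.assoc)
  have a0: "?a N0 <= (real n)^2"
  proof -
    have "?a N0 <= Mean n (%_. (real n)^2)"
    proof (rule Mean_mono[OF L(1) ad adapted_const])
      fix v
      have "?F (G n v N0) <= Q n (G n v N0) * real n"
        using Q_le[of n "G n v N0"] Q_nonneg[OF L(1), of "G n v N0"] by (intro mult_left_mono) auto
      also have "... <= real n * real n"
        using Q_le[of n "G n v N0"] by (intro mult_right_mono) auto
      finally have "?F (G n v N0) <= real n * real n" .
      then have "Zg n N0 \<zeta> v * ?F (G n v N0) <= 1 * (real n * real n)"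
        by (rule mult_mono[OF Zg_bounds(2)]) (rule F0 | simp)+
      then show "Zg n N0 \<zeta> v * ?F (G n v N0) <= (real n)^2" by (simp add: power2_eq_square)
    qed
    then show ?thesis by (simp add: Mean_const[OF L(1)])
  qed
  have rec: "?a (Suc M) <= ?r * ?a M" if "N0 <= M" for M
  proof -
    have "?a (Suc M) <= ?r * ?a M + Mean n (%v. Zg n N0 \<zeta> v * (%_. 0) (G n v M))"
    proof (rule Mean_Zg_rec[where \<Phi> = ?F, OF L(1) that L(2)])
      fix E assume a: "cnt n E {K<..} >= 1" "0 < fr n E" "real (K + 1) * (Q n E + 1) <= \<zeta> * real n"
      show "Av n (%x. ?F (round n E x)) <= ?r * ?F E + 0"
        using Q_decay(2)[OF L(1) a(1,3) L(2)] by (simp add: mult.commute)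
    qed
    then show ?thesis by (simp add: Mean_def)
  qed
  have "?a N <= ?r ^ (N - N0) * ?a N0"
    using rec cd(1) assms(2) by (rule recursion_bound[where a = ?a])
  also have "... <= (exp 1 * dec (2 * ex') n (N - N0)) * (real n)^2"
    using cd a0 dec_pos[of "2 * ex'" n "N - N0"]
    by (intro mult_mono Mean_nonneg mult_nonneg_nonneg[OF Zg_bounds(1) F0]) (auto simp: less_imp_le)
  also have "... <= (3 * dec (2 * ex') n (N - N0)) * (real n)^2"
    using exp_bounds dec_pos[of "2 * ex'" n "N - N0"] by (intro mult_right_mono) auto
  also have "dec (2 * ex') n (N - N0) = (dec ex' n (N - N0))^2"
    by (simp add: dec_def power2_eq_square exp_add[symmetric] field_simps)
  finally show ?thesis by (simp add: mult_ac)
qed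

text \<open>On \<open>good\<close> paths \<open>1 - fr\<close> is at most \<open>K * Q / n\<close>,
  and \<open>Q ^ 2 = Q * (Q - 1) + Q\<close>; the first part decays at twice the rate, the second
  carries the extra factor \<open>1 / n\<close>.\<close>

lemma Wm_bound:
  assumes "late n N0 \<zeta> H" "N0 <= N" "N <= H"
  shows "Wm n N0 \<zeta> N <= (real K)^2 * (3 * (dec ex' n (N - N0))^2 + 2 / real n * dec ex' n (N - N0))"
proof -
  note L = late_n[OF assms(1)]
  have n0: "0 < real n" using L(1) by simp
  let ?Q = "%v. Q n (G n v N)"
  have ad1: "adapted N (%v. Zg n N0 \<zeta> v * (?Q v * (?Q v - 1)))"
    by (rule adapted_comp2[where h = "(*)", OF adapted_Zg[OF assms(2)] adapted_G'[where f = "%E. Q n E * (Q n E - 1)", OF order_refl]])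
  have ad2: "adapted N (%v. Zg n N0 \<zeta> v * ?Q v)"
    by (rule adapted_comp2[where h = "(*)", OF adapted_Zg[OF assms(2)] adapted_G'[OF order_refl]])
  have ad3: "adapted N (%v. Zg n N0 \<zeta> v * (1 - fr n (G n v N))^2)"
    by (rule adapted_comp2[where h = "(*)", OF adapted_Zg[OF assms(2)] adapted_G'[where f = "%E. (1 - fr n E)^2", OF order_refl]])
  let ?c = "(real K)^2 / (real n)^2"
  have "Wm n N0 \<zeta> N <= Mean n (%v. ?c * (Zg n N0 \<zeta> v * (?Q v * (?Q v - 1)) + Zg n N0 \<zeta> v * ?Q v))"
    unfolding Wm_def
  proof (rule Mean_mono[OF L(1) ad3 adapted_comp1[where h = "%y. ?c * y", OF adapted_comp2[where h = "(+)", OF ad1 ad2]]])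
    fix v assume v: "v \<in> Om n"
    show "Zg n N0 \<zeta> v * (1 - fr n (G n v N))^2 <= ?c * (Zg n N0 \<zeta> v * (?Q v * (?Q v - 1)) + Zg n N0 \<zeta> v * ?Q v)"
    proof (cases "good n N0 \<zeta> v")
      case True
      have "real n * (1 - fr n (G n v N)) <= real K * ?Q v"
        using good_later(2)[OF L(1) v True assms(2) L(2)] by (rule mass_le_Q[OF L(1)])
      then have "1 - fr n (G n v N) <= real K * ?Q v / real n" using n0 by (simp add: field_simps)
      then have "(1 - fr n (G n v N))^2 <= (real K * ?Q v / real n)^2"
        using fr_bounds[OF L(1)] by (intro power_mono) auto
      also have "... = ?c * (?Q v * (?Q v - 1) + ?Q v)" by (simp add: power2_eq_square algebra_simps)
      finally show ?thesis using True by (simp add: Zg_def)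
    qed (simp add: Zg_def)
  qed
  also have "... = ?c * (Mean n (%v. Zg n N0 \<zeta> v * (?Q v * (?Q v - 1))) + Mean n (%v. Zg n N0 \<zeta> v * ?Q v))"
    by (simp only: Mean_cmult Mean_add[OF L(1) ad1 ad2])
  also have "... <= ?c * (3 * (real n)^2 * (dec ex' n (N - N0))^2 + 2 * real n * dec ex' n (N - N0))"
    using Mean_QQ_late[OF assms] Mean_Q_late[OF assms] by (intro mult_left_mono add_mono) auto
  also have "... = (real K)^2 * (3 * (dec ex' n (N - N0))^2 + 2 / real n * dec ex' n (N - N0))"
    using n0 by (simp add: field_simps power2_eq_square)
  finally show ?thesis .
qed

lemma V_nonneg: "cnt n E {K<..} >= 1 ==> 0 <= V n E"
proof -
  have "cnt n E {K<..} <= cnt n E (fast K l R \<union> {K<..})" by (intro comp_count_mono) auto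
  then show "cnt n E {K<..} >= 1 ==> ?thesis" by (simp add: V_def)
qed

lemma V_le_Q: "V n E <= Q n E"
  unfolding V_def Q_def using comp_count_mono[of "{1..n}" "fast K l R \<union> {K<..}" UNIV E] by simp

lemma Zg_V_nonneg:
  assumes "n >= 1" "v \<in> Om n" "N0 <= N" "real l * \<zeta> <= 1"
  shows "0 <= Zg n N0 \<zeta> v * V n (G n v N)"
  using V_nonneg[OF good_later(3)[OF assms(1,2) _ assms(3,4)]] by (cases "good n N0 \<zeta> v") (auto simp: Zg_def)

text \<open>Variation of constants, with \<open>Wm\<close> as source. As \<open>ex' >= 1\<close>,
  the quadratic part of the source decays at rate \<open>2 * ex' >= ex' + 1\<close>, no slower than
  the homogeneous solution; only the part with \<open>1 / n\<close> has the slower rate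
  \<open>ex'\<close>.\<close>

lemma Mean_V_late:
  assumes "late n N0 \<zeta> H" "N0 <= N" "N <= H"
  defines "C \<equiv> (real l)^2 * (real K)^2"
  shows "Mean n (%v. Zg n N0 \<zeta> v * V n (G n v N)) <=
    2 * real n * dec (ex' + 1) n (N - N0) + real (N - N0) * (18 * C * dec (ex' + 1) n (N - N0) + 12 * C / real n * dec ex' n (N - N0))"
proof -
  note L = late_n[OF assms(1)]
  have n0: "0 < real n" using L(1) by simp
  let ?r = "1 - (ex' + 1) * (1 - real l * \<zeta>) / real n"
  let ?a = "%N. Mean n (%v. Zg n N0 \<zeta> v * V n (G n v N))"
  have ad: "adapted N0 (%v. Zg n N0 \<zeta> v * V n (G n v N0))"
    by (rule adapted_comp2[where h = "(*)", OF adapted_Zg[OF order_refl] adapted_G'[OF order_refl]])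
  have c: "0 <= ex' + 1" "ex' + 1 <= real n" using ex'1 L(4) by auto
  have cd: "0 <= ?r" "?r ^ j <= 2 * dec (ex' + 1) n j" if "j <= N - N0" for j
  proof -
    have "N0 + j <= H" "N0 <= N0 + j" using that assms by auto
    then have "(ex' + 1) * (real l * \<zeta>) * real j / real n <= 1 / 2"
      using late_small[OF assms(1), of "N0 + j" "ex' + 1"] c by simp
    note cd = contraction_le_dec[OF L(1) c L(3,2) this]
    show "0 <= ?r" by (rule cd(1))
    have "?r ^ j <= exp (1/2) * dec (ex' + 1) n j" by (rule cd(2))
    also have "... <= 2 * dec (ex' + 1) n j"
      using exp_bounds dec_pos[of "ex' + 1" n j] by (intro mult_right_mono) auto
    finally show "?r ^ j <= 2 * dec (ex' + 1) n j" .
  qed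
  have a0: "?a N0 <= real n"
  proof -
    have "?a N0 <= Mean n (%_. real n)"
    proof (rule Mean_mono[OF L(1) ad adapted_const])
      fix v
      have "Zg n N0 \<zeta> v * V n (G n v N0) <= Zg n N0 \<zeta> v * real n"
        by (rule mult_left_mono[OF order_trans[OF V_le_Q Q_le] Zg_bounds(1)])
      also have "... <= 1 * real n" using Zg_bounds by (intro mult_right_mono) auto
      finally show "Zg n N0 \<zeta> v * V n (G n v N0) <= real n" by simp
    qed
    then show ?thesis by (simp add: Mean_const[OF L(1)])
  qed
  have rec: "?a (Suc M) <= ?r * ?a M + (real l)^2 * Wm n N0 \<zeta> M" if "N0 <= M" for M
  proof -
    have "?a (Suc M) <= ?r * ?a M + Mean n (%v. Zg n N0 \<zeta> v * (%E. (real l)^2 * (1 - fr n E)^2) (G n v M))"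
    proof (rule Mean_Zg_rec[OF L(1) that L(2)])
      fix E assume a: "cnt n E {K<..} >= 1" "0 < fr n E" "real (K + 1) * (Q n E + 1) <= \<zeta> * real n"
      show "Av n (%x. V n (round n E x)) <= ?r * V n E + (real l)^2 * (1 - fr n E)^2"
        using V_decay[OF L(1) a(1,3) L(2)] by (simp add: mult.commute)
    qed
    also have "Mean n (%v. Zg n N0 \<zeta> v * (%E. (real l)^2 * (1 - fr n E)^2) (G n v M)) = (real l)^2 * Wm n N0 \<zeta> M"
      unfolding Wm_def Mean_cmult[symmetric] by (simp add: mult_ac)
    finally show ?thesis .
  qed
  have exp3: "exp ((ex' + 1) / real n) <= 3"
  proof -
    have "exp ((ex' + 1) / real n) <= exp 1" using c n0 by simp
    then show ?thesis using exp_bounds by linarith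
  qed
  have summand: "?r ^ (N - M - 1) * ((real l)^2 * Wm n N0 \<zeta> M)
     <= 18 * C * dec (ex' + 1) n (N - N0) + 12 * C / real n * dec ex' n (N - N0)" if M: "M \<in> {N0..<N}" for M
  proof -
    let ?d = "dec (ex' + 1) n (N - M - 1)"
    \<comment> \<open>The two intervals add up to one round less than \<open>N - N0\<close>; the
      missing round costs at most the factor 3.\<close>
    have shift: "dec c' n (N - M - 1) * dec c' n (M - N0) <= 3 * dec c' n (N - N0)" if c': "0 <= c'" "c' <= ex' + 1" for c'
    proof -
      have "N - N0 = (N - M - 1) + (M - N0) + 1" using M by auto
      then have "dec c' n (N - N0) = dec c' n (N - M - 1) * dec c' n (M - N0) * dec c' n 1"
        by (simp only: dec_add)
      moreover have "1 <= 3 * dec c' n 1"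
      proof -
        have "exp (c' / real n) <= exp ((ex' + 1) / real n)" using c' n0 by (simp add: divide_right_mono)
        then have "exp (c' / real n) <= 3" using exp3 by linarith
        then have "exp (c' / real n) * dec c' n 1 <= 3 * dec c' n 1" using dec_pos by (intro mult_right_mono) (auto simp: less_imp_le)
        then show ?thesis by (simp add: dec_def exp_add[symmetric])
      qed
      ultimately show ?thesis
        using mult_left_mono[of 1 "3 * dec c' n 1" "dec c' n (N - M - 1) * dec c' n (M - N0)"] dec_pos[of c' n]
        by (simp add: less_imp_le mult_ac)
    qed
    have sq: "(dec ex' n (M - N0))^2 <= dec (ex' + 1) n (M - N0)"
    proof -
      have "(dec ex' n (M - N0))^2 = dec (2 * ex') n (M - N0)"
        by (simp add: dec_def power2_eq_square exp_add[symmetric] field_simps)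
      also have "... <= dec (ex' + 1) n (M - N0)" using ex'1 by (intro dec_mono) auto
      finally show ?thesis .
    qed
    have "?r ^ (N - M - 1) * ((real l)^2 * Wm n N0 \<zeta> M)
      <= (2 * ?d) * ((real l)^2 * ((real K)^2 * (3 * (dec ex' n (M - N0))^2 + 2 / real n * dec ex' n (M - N0))))"
      using M assms(3) Wm_nonneg
      by (intro mult_mono cd(2) mult_left_mono Wm_bound[OF assms(1)] mult_nonneg_nonneg) (auto simp: less_imp_le dec_pos)
    also have "... = 6 * C * (?d * (dec ex' n (M - N0))^2) + 4 * C / real n * (?d * dec ex' n (M - N0))"
      by (simp add: C_def algebra_simps)
    also have "... <= 6 * C * (3 * dec (ex' + 1) n (N - N0)) + 4 * C / real n * (3 * dec ex' n (N - N0))"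
    proof (intro add_mono mult_left_mono)
      have "?d * (dec ex' n (M - N0))^2 <= ?d * dec (ex' + 1) n (M - N0)"
        using sq dec_pos by (intro mult_left_mono) (auto simp: less_imp_le)
      also have "... <= 3 * dec (ex' + 1) n (N - N0)" using c by (intro shift) auto
      finally show "?d * (dec ex' n (M - N0))^2 <= 3 * dec (ex' + 1) n (N - N0)" .
      have "?d * dec ex' n (M - N0) <= dec ex' n (N - M - 1) * dec ex' n (M - N0)"
        using dec_pos by (intro mult_right_mono dec_mono) (auto simp: less_imp_le)
      also have "... <= 3 * dec ex' n (N - N0)" using ex'1 by (intro shift) auto
      finally show "?d * dec ex' n (M - N0) <= 3 * dec ex' n (N - N0)" .
    qed (auto simp: C_def)
    finally show ?thesis by simp
  qed
  have "?a N <= ?r ^ (N - N0) * ?a N0 + (SUM M:{N0..<N}. ?r ^ (N - M - 1) * ((real l)^2 * Wm n N0 \<zeta> M))"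
    using rec cd(1)[of 0] assms(2) by (intro recursion_bound_inhomogeneous[where a = ?a]) auto
  also have "... <= (2 * dec (ex' + 1) n (N - N0)) * real n
     + (SUM M:{N0..<N}. 18 * C * dec (ex' + 1) n (N - N0) + 12 * C / real n * dec ex' n (N - N0))"
    using cd[of "N - N0"] a0 dec_pos[of "ex' + 1" n "N - N0"]
    by (intro add_mono mult_mono sum_mono summand Mean_nonneg Zg_V_nonneg[OF L(1)] L(2) order_refl) (auto simp: less_imp_le)
  finally show ?thesis by (simp add: mult_ac)
qed

text \<open>A component of slow size vanishes with probability about \<open>ex / n\<close> in each late round. Pulling the
  variable of a generating function back by one round therefore multiplies \<open>1 - u\<close> by \<open>1 - ex / n\<close>.\<close>

definition unroll :: "nat => nat => real => real" where
  "unroll n j u = 1 - (1 - ex' / real n) ^ j * (1 - u)"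

lemma unroll_0: "unroll n 0 u = u" by (simp add: unroll_def)

lemma unroll_Suc: "unroll n (Suc j) u = unroll n j u + ex' / real n * (1 - unroll n j u)"
  unfolding unroll_def power_Suc by (simp add: divide_inverse algebra_simps)

lemma unroll_bounds:
  assumes "ex' <= real n" "0 <= u" "u <= 1"
  shows "0 <= unroll n j u" "unroll n j u <= 1" "1 - unroll n j u <= dec ex' n j"
proof -
  have r: "0 <= 1 - ex' / real n" "1 - ex' / real n <= 1" using assms ex'1 by (auto simp: divide_le_eq_1)
  have p: "0 <= (1 - ex' / real n) ^ j" "(1 - ex' / real n) ^ j <= 1" using r by (auto simp: power_le_one)
  have "(1 - ex' / real n) ^ j * (1 - u) <= 1 * 1" using p assms by (intro mult_mono) auto
  then show "0 <= unroll n j u" by (simp add: unroll_def)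
  show "unroll n j u <= 1" using p assms by (simp add: unroll_def)
  have "(1 - ex' / real n) ^ j * (1 - u) <= exp (- (ex' / real n) * real j) * 1"
    using power_le_exp[OF r(1), of j] assms by (intro mult_mono) auto
  then show "1 - unroll n j u <= dec ex' n j" by (simp add: unroll_def dec_def)
qed

definition gf :: "nat => nat set => nat set => real => real => nat set set => real" where
  "gf n S T u w E = u ^ cnt n E S * w ^ cnt n E T"

lemma gf_bounds: "0 <= u ==> u <= 1 ==> 0 <= w ==> w <= 1 ==> 0 <= gf n S T u w E & gf n S T u w E <= 1"
  by (simp add: gf_def mult_le_one power_le_one)

text \<open>Pulling the variables back one round at a time telescopes the difference. The step at
  round \<open>M\<close> has an error of order \<open>dec ex' n (N - Suc M)\<close> times
  \<open>Wm\<close> at \<open>M\<close>; decay before and after \<open>M\<close> combine to the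
  decay over the whole window, so all rounds obey the same bound. The weight \<open>Z\<close> may be
  any event known at time \<open>N1\<close> inside \<open>good\<close>.\<close>

theorem generating_phase:
  assumes late: "late n N0 \<zeta> H" and N: "N0 <= N1" "N1 <= N" "N <= H"
    and ST: "S \<subseteq> slow K l R" "T \<subseteq> slow K l R" "S \<inter> T = {}"
    and uw: "0 <= u" "u <= 1" "0 <= w" "w <= 1"
    and Z: "adapted N1 Z" "!!v. v \<in> Om n ==> 0 <= Z v" "!!v. v \<in> Om n ==> Z v <= Zg n N0 \<zeta> v"
  shows "\<bar>Mean n (%v. Z v * gf n S T u w (G n v N))
     - Mean n (%v. Z v * gf n S T (unroll n (N - N1) u) (unroll n (N - N1) w) (G n v N1))\<bar>
     <= gen_const * (real K)^2 * real (N - N1) *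
        (9 * dec ex' n (N - N0) * dec ex' n (N1 - N0) + 6 / real n * dec ex' n (N - N0))"
proof -
  note L = late_n[OF late]
  have n0: "0 < real n" using L(1) by simp
  have exn: "ex' <= real n" "ex <= n" using ex'1 L(4) by auto
  \<comment> \<open>The interpolation: the graph at time \<open>M\<close> with the variables
    unrolled over the remaining \<open>N - M\<close> rounds. \<open>?a N\<close> and
    \<open>?a N1\<close> are the two means to be compared.\<close>
  let ?g = "%M. gf n S T (unroll n (N - M) u) (unroll n (N - M) w)"
  let ?a = "%M. Mean n (%v. Z v * ?g M (G n v M))"
  let ?B = "(real K)^2 * (9 * dec ex' n (N - N0) * dec ex' n (N1 - N0) + 6 / real n * dec ex' n (N - N0))"
  have gc0: "0 <= gen_const" using ex'1 by (simp add: gen_const_def)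
  have step: "\<bar>?a (Suc M) - ?a M\<bar> <= gen_const * ?B" if M: "M \<in> {N1..<N}" for M
  proof -
    define j where "j = N - Suc M"
    have jM: "N - M = Suc j" using M by (auto simp: j_def)
    define u1 where "u1 = unroll n j u"
    define w1 where "w1 = unroll n j w"
    have b: "0 <= u1" "u1 <= 1" "1 - u1 <= dec ex' n j" "0 <= w1" "w1 <= 1" "1 - w1 <= dec ex' n j"
      using unroll_bounds[OF exn(1)] uw by (auto simp: u1_def w1_def)
    have d1: "dec ex' n j <= 1" by (simp add: dec_le_1)
    have M': "N0 <= M" "M <= H" "N1 <= M" using M N by auto
    have adZ: "adapted M Z" by (rule adapted_mono[OF Z(1) M'(3)])
    have ad: "adapted M (%v. Z v * F (G n v M))" for F :: "nat set set => real"
      by (rule adapted_comp2[where h = "(*)", OF adZ adapted_G'[OF order_refl]])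
    have adW: "adapted M (%v. gen_const * dec ex' n j * (Zg n N0 \<zeta> v * (1 - fr n (G n v M))^2))"
      by (rule adapted_comp1[where h = "%y. gen_const * dec ex' n j * y",
            OF adapted_comp2[where h = "(*)", OF adapted_Zg[OF M'(1)] adapted_G'[where f = "%E. (1 - fr n E)^2", OF order_refl]]])
    have aS: "?a (Suc M) = Mean n (%v. Z v * Av n (%x. gf n S T u1 w1 (round n (G n v M) x)))"
      unfolding j_def[symmetric] u1_def[symmetric] w1_def[symmetric] by (rule Mean_G_Suc[OF L(1) adZ])
    have aM: "?a M = Mean n (%v. Z v * gf n S T (u1 + ex' / real n * (1 - u1)) (w1 + ex' / real n * (1 - w1)) (G n v M))"
      unfolding jM unroll_Suc u1_def w1_def ..
    have "?a (Suc M) - ?a M = Mean n (%v. Z v * Av n (%x. gf n S T u1 w1 (round n (G n v M) x))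
        - Z v * gf n S T (u1 + ex' / real n * (1 - u1)) (w1 + ex' / real n * (1 - w1)) (G n v M))"
      unfolding aS aM by (rule Mean_diff[OF L(1) ad ad, symmetric])
    moreover have "\<bar>Mean n (%v. Z v * Av n (%x. gf n S T u1 w1 (round n (G n v M) x))
        - Z v * gf n S T (u1 + ex' / real n * (1 - u1)) (w1 + ex' / real n * (1 - w1)) (G n v M))\<bar>
      <= Mean n (%v. gen_const * dec ex' n j * (Zg n N0 \<zeta> v * (1 - fr n (G n v M))^2))"
    proof (rule Mean_abs_le[OF L(1) adapted_comp2[where h = "(-)", OF ad ad] adW])
      fix v assume v: "v \<in> Om n"
      have "\<bar>Av n (%x. gf n S T u1 w1 (round n (G n v M) x))
        - gf n S T (u1 + ex' / real n * (1 - u1)) (w1 + ex' / real n * (1 - w1)) (G n v M)\<bar>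
        <= gen_const * dec ex' n j * (1 - fr n (G n v M))^2"
        unfolding gf_def by (rule generating_step[OF exn(2) L(1) ST b(1,2,4,5,3,6) d1])
      then have "Z v * \<bar>Av n (%x. gf n S T u1 w1 (round n (G n v M) x))
        - gf n S T (u1 + ex' / real n * (1 - u1)) (w1 + ex' / real n * (1 - w1)) (G n v M)\<bar>
        <= Zg n N0 \<zeta> v * (gen_const * dec ex' n j * (1 - fr n (G n v M))^2)"
        using Z(2,3)[OF v] gc0 dec_pos[of ex' n j] by (intro mult_mono) (auto simp: less_imp_le)
      moreover have "\<bar>Z v * Av n (%x. gf n S T u1 w1 (round n (G n v M) x))
        - Z v * gf n S T (u1 + ex' / real n * (1 - u1)) (w1 + ex' / real n * (1 - w1)) (G n v M)\<bar>
        = Z v * \<bar>Av n (%x. gf n S T u1 w1 (round n (G n v M) x))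
        - gf n S T (u1 + ex' / real n * (1 - u1)) (w1 + ex' / real n * (1 - w1)) (G n v M)\<bar>"
        using Z(2)[OF v] by (simp add: right_diff_distrib[symmetric] abs_mult)
      ultimately show "\<bar>Z v * Av n (%x. gf n S T u1 w1 (round n (G n v M) x))
        - Z v * gf n S T (u1 + ex' / real n * (1 - u1)) (w1 + ex' / real n * (1 - w1)) (G n v M)\<bar>
        <= gen_const * dec ex' n j * (Zg n N0 \<zeta> v * (1 - fr n (G n v M))^2)" by (simp add: mult_ac)
    qed
    moreover have "Mean n (%v. gen_const * dec ex' n j * (Zg n N0 \<zeta> v * (1 - fr n (G n v M))^2))
       = gen_const * (dec ex' n j * Wm n N0 \<zeta> M)" by (simp only: Mean_cmult Wm_def mult.assoc)
    moreover have "dec ex' n j * Wm n N0 \<zeta> M <= ?B"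
    proof -
      let ?dM = "dec ex' n (M - N0)"
      have "exp (ex' / real n) <= exp 1" using exn n0 by simp
      then have e3: "exp (ex' / real n) <= 3" using exp_bounds by linarith
      have shift: "dec ex' n j * ?dM <= 3 * dec ex' n (N - N0)"
      proof -
        have "N - N0 = j + (M - N0) + 1" using M N by (auto simp: j_def)
        then have "dec ex' n (N - N0) = dec ex' n j * ?dM * dec ex' n 1" by (simp only: dec_add)
        moreover have "1 <= 3 * dec ex' n 1"
        proof -
          have "exp (ex' / real n) * dec ex' n 1 <= 3 * dec ex' n 1" using e3 dec_pos by (intro mult_right_mono) (auto simp: less_imp_le)
          then show ?thesis by (simp add: dec_def exp_add[symmetric])
        qed
        ultimately show ?thesis
          using mult_left_mono[of 1 "3 * dec ex' n 1" "dec ex' n j * ?dM"] dec_pos[of ex' n]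
          by (simp add: less_imp_le mult_ac)
      qed
      have "dec ex' n j * Wm n N0 \<zeta> M <= dec ex' n j * ((real K)^2 * (3 * ?dM\<^sup>2 + 2 / real n * ?dM))"
        using Wm_bound[OF late M'(1,2)] dec_pos by (intro mult_left_mono) (auto simp: less_imp_le)
      also have "... = (real K)^2 * (3 * ?dM * (dec ex' n j * ?dM) + 2 / real n * (dec ex' n j * ?dM))"
        by (simp add: power2_eq_square algebra_simps)
      also have "... <= (real K)^2 * (3 * dec ex' n (N1 - N0) * (3 * dec ex' n (N - N0)) + 2 / real n * (3 * dec ex' n (N - N0)))"
      proof (rule mult_left_mono[OF add_mono])
        have "?dM <= dec ex' n (N1 - N0)" using M' by (intro dec_antimono) auto
        then have "3 * ?dM <= 3 * dec ex' n (N1 - N0)" by simp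
        then show "3 * ?dM * (dec ex' n j * ?dM) <= 3 * dec ex' n (N1 - N0) * (3 * dec ex' n (N - N0))"
          by (rule mult_mono[OF _ shift]) (auto simp: less_imp_le dec_pos)
        show "2 / real n * (dec ex' n j * ?dM) <= 2 / real n * (3 * dec ex' n (N - N0))"
          by (rule mult_left_mono[OF shift]) simp
      qed simp
      finally show ?thesis by (simp add: mult_ac)
    qed
    ultimately show ?thesis using mult_left_mono[of "dec ex' n j * Wm n N0 \<zeta> M" ?B gen_const] gc0 by linarith
  qed
  have "?a N - ?a N1 = (SUM M:{N1..<N}. ?a (Suc M) - ?a M)"
    by (rule sum_Suc_diff'[OF N(2), where f = ?a, symmetric])
  then have "\<bar>?a N - ?a N1\<bar> <= (SUM M:{N1..<N}. \<bar>?a (Suc M) - ?a M\<bar>)" by (simp only: sum_abs)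
  also have "... <= (SUM M:{N1..<N}. gen_const * ?B)" by (intro sum_mono step)
  also have "... = real (N - N1) * (gen_const * ?B)" by simp
  finally show ?thesis by (simp add: unroll_0 mult_ac)
qed

end

section \<open>Comparison with the differential equations\<close>

lemma abs_prod_diff_le:
  fixes a b :: "'i => real"
  assumes "finite A" "1 <= B" "!!i. i \<in> A ==> \<bar>a i\<bar> <= B" "!!i. i \<in> A ==> \<bar>b i\<bar> <= B"
  shows "\<bar>PROD i:A. a i\<bar> <= B ^ card A"
    and "\<bar>(PROD i:A. a i) - (PROD i:A. b i)\<bar> <= B ^ card A * (SUM i:A. \<bar>a i - b i\<bar>)"
proof -
  have P: "\<bar>PROD i:A. c i\<bar> <= B ^ card A" if "finite A" "!!i. i \<in> A ==> \<bar>c i\<bar> <= B" for A and c :: "'i => real"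
  proof -
    have "\<bar>PROD i:A. c i\<bar> = (PROD i:A. \<bar>c i\<bar>)" by (rule abs_prod)
    also have "... <= (PROD i:A. B)" using that by (intro prod_mono) auto
    finally show ?thesis by simp
  qed
  show "\<bar>PROD i:A. a i\<bar> <= B ^ card A" using assms by (intro P)
  show "\<bar>(PROD i:A. a i) - (PROD i:A. b i)\<bar> <= B ^ card A * (SUM i:A. \<bar>a i - b i\<bar>)"
    using assms(1,3,4)
  proof (induction A rule: finite_induct)
    case (insert i A)
    let ?P = "PROD i:A. a i" and ?Q = "PROD i:A. b i" and ?S = "SUM i:A. \<bar>a i - b i\<bar>"
    have PB: "\<bar>?P\<bar> <= B ^ card A" using insert by (intro P) auto
    have IH: "\<bar>?P - ?Q\<bar> <= B ^ card A * ?S" using insert by auto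
    have B0: "0 <= B ^ card A" "B ^ card A <= B ^ Suc (card A)" using assms(2) by (auto intro: power_increasing)
    have PB': "\<bar>?P\<bar> <= B ^ Suc (card A)" using PB B0(2) by (rule order_trans)
    have "a i * ?P - b i * ?Q = (a i - b i) * ?P + b i * (?P - ?Q)" by (simp add: algebra_simps)
    then have "\<bar>a i * ?P - b i * ?Q\<bar> <= \<bar>a i - b i\<bar> * \<bar>?P\<bar> + \<bar>b i\<bar> * \<bar>?P - ?Q\<bar>"
      by (metis abs_mult abs_triangle_ineq)
    also have "... <= \<bar>a i - b i\<bar> * B ^ Suc (card A) + B * (B ^ card A * ?S)"
    proof (intro add_mono)
      show "\<bar>a i - b i\<bar> * \<bar>?P\<bar> <= \<bar>a i - b i\<bar> * B ^ Suc (card A)" using PB' by (rule mult_left_mono) simp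
      show "\<bar>b i\<bar> * \<bar>?P - ?Q\<bar> <= B * (B ^ card A * ?S)"
        using IH insert assms(2) by (intro mult_mono) auto
    qed
    finally show ?case using insert by (simp add: algebra_simps)
  qed simp
qed

context nondegenerate_rule
begin

definition Lip :: "real => real" where
  "Lip B = 2 * real K * real (card ST) * B ^ l * real l"

definition Fbd :: "real => real" where
  "Fbd B = 2 * real K * real (card ST) * B ^ l"

lemma gain_ST: "s \<in> ST ==> q \<in> SK K ==> \<bar>gain q (s (sel1 s)) (s (sel2 s))\<bar> <= 2 * real K"
  using ST_sel by (intro gain_bound)

lemma ode_rhs_bound:
  assumes B: "1 <= B" and x: "!!q. q \<in> SK K ==> \<bar>x q\<bar> <= B" and q: "q \<in> SK K"
  shows "\<bar>ode_rhs K l R q x\<bar> <= Fbd B"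
proof -
  have "\<bar>ode_rhs K l R q x\<bar> <= (SUM s:ST. \<bar>gain q (s (sel1 s)) (s (sel2 s)) * P_tuple l s x\<bar>)"
    unfolding ode_rhs_tuple[OF q] by (rule sum_abs)
  also have "... <= (SUM s:ST. 2 * real K * B ^ l)"
  proof (rule sum_mono)
    fix s assume s: "s \<in> ST"
    have "\<bar>P_tuple l s x\<bar> <= B ^ card {1..l}"
      unfolding P_tuple_def using ST_app[OF s] x B by (intro abs_prod_diff_le(1)[of _ B _ "%j. x (s j)"]) auto
    then show "\<bar>gain q (s (sel1 s)) (s (sel2 s)) * P_tuple l s x\<bar> <= 2 * real K * B ^ l"
      unfolding abs_mult using gain_ST[OF s q] by (intro mult_mono) auto
  qed
  finally show ?thesis by (simp add: Fbd_def mult_ac)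
qed

lemma ode_rhs_lipschitz:
  assumes B: "1 <= B" and x: "!!q. q \<in> SK K ==> \<bar>x q\<bar> <= B" and y: "!!q. q \<in> SK K ==> \<bar>y q\<bar> <= B"
    and q: "q \<in> SK K"
  shows "\<bar>ode_rhs K l R q x - ode_rhs K l R q y\<bar> <= Lip B * (SUM q:SK K. \<bar>x q - y q\<bar>)"
proof -
  let ?D = "SUM q:SK K. \<bar>x q - y q\<bar>"
  have "\<bar>ode_rhs K l R q x - ode_rhs K l R q y\<bar>
      = \<bar>SUM s:ST. gain q (s (sel1 s)) (s (sel2 s)) * (P_tuple l s x - P_tuple l s y)\<bar>"
    unfolding ode_rhs_tuple[OF q] by (simp add: sum_subtractf[symmetric] right_diff_distrib)
  also have "... <= (SUM s:ST. \<bar>gain q (s (sel1 s)) (s (sel2 s)) * (P_tuple l s x - P_tuple l s y)\<bar>)"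
    by (rule sum_abs)
  also have "... <= (SUM s:ST. 2 * real K * (B ^ l * (real l * ?D)))"
  proof (rule sum_mono)
    fix s assume s: "s \<in> ST"
    have "\<bar>P_tuple l s x - P_tuple l s y\<bar> <= B ^ card {1..l} * (SUM j:{1..l}. \<bar>x (s j) - y (s j)\<bar>)"
      unfolding P_tuple_def using ST_app[OF s] x y B
      by (intro abs_prod_diff_le(2)[of _ B "%j. x (s j)" "%j. y (s j)"]) auto
    also have "... <= B ^ card {1..l} * (SUM j:{1..l}. ?D)"
      using B ST_app[OF s] finite_SK
      by (intro mult_left_mono sum_mono member_le_sum[of _ _ "%q. \<bar>x q - y q\<bar>"]) auto
    finally have "\<bar>P_tuple l s x - P_tuple l s y\<bar> <= B ^ l * (real l * ?D)" by simp
    then show "\<bar>gain q (s (sel1 s)) (s (sel2 s)) * (P_tuple l s x - P_tuple l s y)\<bar> <= 2 * real K * (B ^ l * (real l * ?D))"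
      unfolding abs_mult using gain_ST[OF s q] by (intro mult_mono) auto
  qed
  finally show ?thesis by (simp add: Lip_def mult_ac)
qed

lemma frac_comp_sum:
  assumes n: "n >= 1" and q: "q \<in> SK K"
  shows "real n * frac n E q = comp_sum {1..n} E (%j. case q of enat k => real j * of_bool (j = k) | \<infinity> => real j * of_bool (K < j))"
proof (cases q)
  case (enat k)
  then have k: "1 <= k" "k <= K" using q by (auto simp: enat_in_SK)
  have "comp_sum {1..n} E (%j. real j * of_bool (j = k)) = real k * comp_sum {1..n} E (%j. if j \<in> {k} then 1 else 0)"
    unfolding comp_sum_def sum_distrib_left by (intro sum.cong) auto
  then show ?thesis using n enat frac_small[OF k, of n E] by (simp add: comp_count_comp_sum)
next
  case infinity
  then show ?thesis using frac_large[OF n, of E] by simp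
qed

text \<open>The size tuple determines the change of the fractions unless the selected vertices share
  a small component. If they share a large one, the graph does not change and the gain is 0 as
  well.\<close>

lemma frac_round:
  fixes E :: "nat set set"
  assumes n: "n >= 1" and q: "q \<in> SK K" and x: "x \<in> Tup n"
  defines "s \<equiv> sizes n E x"
  shows "\<bar>real n * (frac n (round n E x) q - frac n E q) - gain q (s (sel1 s)) (s (sel2 s))\<bar>
      <= 2 * real K * of_bool (~ differ n E x & card (block n E (x (sel1 (sizes n E x)))) <= K)"
    and "\<bar>frac n (round n E x) q - frac n E q\<bar> <= 2 * real K / real n"
proof -
  define a where "a = card (block n E (x (sel1 s)))"
  define b where "b = card (block n E (x (sel2 s)))"
  define g where "g = gain q (s (sel1 s)) (s (sel2 s))"
  have sST: "s \<in> ST" unfolding s_def by (rule sizes_ST[OF x])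
  have ab1: "1 <= a" "1 <= b"
    using comp_card[of _ n E] Tup_app[OF x] sel_range[OF sST] by (auto simp: a_def b_def)
  have sa: "s (sel1 s) = (if a <= K then enat a else \<infinity>)" "s (sel2 s) = (if b <= K then enat b else \<infinity>)"
    using sizes_sel[OF x, of E] by (simp_all add: s_def a_def b_def trunc_size_def)
  define gg where "gg = (%j. case q of enat k => real j * of_bool (j = k) | \<infinity> => real j * of_bool (K < j))"
  have diff: "real n * (frac n (round n E x) q - frac n E q) = (if differ n E x then gg (a + b) - gg a - gg b else 0)"
    unfolding right_diff_distrib frac_comp_sum[OF n q, folded gg_def] round_comp_sum[OF x]
    by (simp add: differ_def Let_def a_def b_def s_def)
  have gab: "gg (a + b) - gg a - gg b = g"
  proof (cases q)
    case (enat k)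
    then have k: "1 <= k" "k <= K" using q by (auto simp: enat_in_SK)
    have "(s (sel1 s) + s (sel2 s) = enat k) \<longleftrightarrow> a + b = k" using k sa by auto
    moreover have "(s (sel1 s) = enat k) \<longleftrightarrow> a = k" "(s (sel2 s) = enat k) \<longleftrightarrow> b = k" using k sa by auto
    ultimately show ?thesis using enat k ab1 by (simp add: g_def gg_def gain_def right_diff_distrib)
  next
    case infinity
    have "(enat K < s (sel1 s) + s (sel2 s)) \<longleftrightarrow> K < a + b" using sa by auto
    then show ?thesis using infinity sa by (auto simp: g_def gg_def gain_def)
  qed
  have same: "g = 0 | a <= K" if "~ differ n E x"
  proof (cases "a <= K")
    case False
    have "a = b" using that by (simp add: differ_def a_def b_def s_def)
    then have "s (sel1 s) = \<infinity>" "s (sel2 s) = \<infinity>" using sa False by auto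
    then show ?thesis by (auto simp: g_def gain_def split: enat.splits)
  qed simp
  have gb: "\<bar>g\<bar> <= 2 * real K" unfolding g_def by (rule gain_ST[OF sST q])
  show "\<bar>real n * (frac n (round n E x) q - frac n E q) - gain q (s (sel1 s)) (s (sel2 s))\<bar>
      <= 2 * real K * of_bool (~ differ n E x & card (block n E (x (sel1 (sizes n E x)))) <= K)"
  proof (cases "differ n E x")
    case True
    then show ?thesis unfolding diff g_def[symmetric] gab by simp
  next
    case False
    then show ?thesis unfolding diff g_def[symmetric] using same gb by (auto simp: a_def s_def)
  qed
  have "\<bar>real n * (frac n (round n E x) q - frac n E q)\<bar> <= 2 * real K"
    unfolding diff gab using gb by simp
  then show "\<bar>frac n (round n E x) q - frac n E q\<bar> <= 2 * real K / real n"
  proof -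
    assume "\<bar>real n * (frac n (round n E x) q - frac n E q)\<bar> <= 2 * real K"
    then have "\<bar>frac n (round n E x) q - frac n E q\<bar> * real n <= 2 * real K"
      by (simp only: abs_mult abs_of_nat mult.commute)
    then show ?thesis using n by (subst pos_le_divide_eq) auto
  qed
qed

lemma Av_frac_round:
  assumes n: "n >= 1" and q: "q \<in> SK K"
  shows "\<bar>Av n (%x. frac n (round n E x) q - frac n E q) - ode_rhs K l R q (frac n E) / real n\<bar>
    <= 2 * real K * real (l * K) / (real n)^2"
proof -
  have n0: "0 < real n" using n by simp
  let ?g = "%s. gain q (s (sel1 s)) (s (sel2 s))"
  have "Av n (%x. ?g (sizes n E x)) = ode_rhs K l R q (frac n E)"
    unfolding ode_rhs_tuple[OF q] by (rule Av_sizes)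
  then have eq: "real n * Av n (%x. frac n (round n E x) q - frac n E q) - ode_rhs K l R q (frac n E)
     = Av n (%x. real n * (frac n (round n E x) q - frac n E q) - ?g (sizes n E x))"
    by (simp only: Av_diff Av_cmult)
  have "\<bar>Av n (%x. real n * (frac n (round n E x) q - frac n E q) - ?g (sizes n E x))\<bar>
    <= Av n (%x. 2 * real K * of_bool (~ differ n E x & card (block n E (x (sel1 (sizes n E x)))) <= K))"
    by (rule Av_abs_le) (rule frac_round(1)[OF n q])
  also have "... <= 2 * real K * (real (l * K) / real n)"
    unfolding Av_cmult using Av_same_block[OF n] by (intro mult_left_mono) auto
  finally have "\<bar>real n * Av n (%x. frac n (round n E x) q - frac n E q) - ode_rhs K l R q (frac n E)\<bar>
    <= 2 * real K * (real (l * K) / real n)" unfolding eq .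
  then have "\<bar>real n * Av n (%x. frac n (round n E x) q - frac n E q) - ode_rhs K l R q (frac n E)\<bar> / real n
    <= 2 * real K * (real (l * K) / real n) / real n" by (rule divide_right_mono) simp
  moreover have "\<bar>real n * Av n (%x. frac n (round n E x) q - frac n E q) - ode_rhs K l R q (frac n E)\<bar> / real n
    = \<bar>Av n (%x. frac n (round n E x) q - frac n E q) - ode_rhs K l R q (frac n E) / real n\<bar>"
  proof -
    have "\<bar>real n * Av n (%x. frac n (round n E x) q - frac n E q) - ode_rhs K l R q (frac n E)\<bar> / real n
      = \<bar>(real n * Av n (%x. frac n (round n E x) q - frac n E q) - ode_rhs K l R q (frac n E)) / real n\<bar>" by simp
    also have "(real n * Av n (%x. frac n (round n E x) q - frac n E q) - ode_rhs K l R q (frac n E)) / real n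
      = Av n (%x. frac n (round n E x) q - frac n E q) - ode_rhs K l R q (frac n E) / real n"
      using n0 by (simp add: diff_divide_distrib)
    finally show ?thesis .
  qed
  ultimately show ?thesis by (simp add: power2_eq_square)
qed

lemma frac_start:
  assumes n: "n >= 1" and q: "q \<in> SK K"
  shows "frac n {} q = (if q = enat 1 then 1 else 0)"
proof -
  have "block n {} u = {u}" if "u \<in> {1..n}" for u
    using that by (auto simp: component_of_def)
  then have "trunc_size K {1..n} {} u = enat 1" if "u \<in> {1..n}" for u
    using that K1 by (simp add: trunc_size_def)
  then have "{u \<in> {1..n}. trunc_size K {1..n} {} u = q} = (if q = enat 1 then {1..n} else {})" by auto
  then show ?thesis using n by (simp add: frac_def)
qed

lemma card_SK: "card (SK K) = K + 1"
proof -
  have "SK K = insert \<infinity> (enat ` {1..K})" by (auto simp: SK_def)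
  then show ?thesis by (simp add: card_image inj_on_def image_iff One_nat_def)
qed

lemma sum_abs_squared_le:
  fixes a :: "enat => real"
  shows "(SUM q:SK K. \<bar>a q\<bar>)^2 <= real (K + 1) * (SUM q:SK K. (a q)^2)"
  using sum_squared_le_sum_of_squares[of "%q. \<bar>a q\<bar>" "SK K"] by (simp add: card_SK mult.commute)

end

section \<open>Gronwall comparison of the fractions with the solution\<close>

locale rule_ode = nondegenerate_rule +
  fixes z :: "real => enat => real"
  assumes sol: "ode_solution K l R z"
begin

lemma z_0: "q \<in> SK K ==> z 0 q = (if q = enat 1 then 1 else 0)"
  using sol by (simp add: ode_solution_def)

lemma z_deriv: "q \<in> SK K ==> t >= 0 ==>
    ((%u. z u q) has_real_derivative ode_rhs K l R q (z t)) (at t within {0..})"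
  using sol by (simp add: ode_solution_def)

lemma z_deriv_sub: "q \<in> SK K ==> t >= 0 ==> A \<subseteq> {0..} ==>
    ((%u. z u q) has_real_derivative ode_rhs K l R q (z t)) (at t within A)"
  by (rule DERIV_subset[OF z_deriv])

lemma z_continuous: "q \<in> SK K ==> continuous_on {0..} (%t. z t q)"
  unfolding continuous_on_eq_continuous_within
  by (auto intro: DERIV_continuous[OF z_deriv])

lemma z_mvt:
  assumes "q \<in> SK K" "0 <= a" "a < b"
  shows "EX \<xi>:{a<..<b}. z b q - z a q = ode_rhs K l R q (z \<xi>) * (b - a)"
proof -
  have "EX \<xi>:{a<..<b}. z b q - z a q = (*) (ode_rhs K l R q (z \<xi>)) (b - a)"
  proof (rule mvt_simple[OF assms(3)])
    fix t assume "a <= t" "t <= b"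
    then show "((%u. z u q) has_derivative (*) (ode_rhs K l R q (z t))) (at t within {a..b})"
      using z_deriv_sub[OF assms(1), of t "{a..b}"] assms(2) by (auto simp: has_field_derivative_def)
  qed
  then show ?thesis by simp
qed

lemma z_lipschitz:
  assumes B: "1 <= B" "!!t q. 0 <= t ==> t <= T ==> q \<in> SK K ==> \<bar>z t q\<bar> <= B"
    and q: "q \<in> SK K" and ab: "0 <= a" "a <= b" "b <= T"
  shows "\<bar>z b q - z a q\<bar> <= Fbd B * (b - a)"
proof (cases "a = b")
  case False
  then have "a < b" using ab by simp
  then obtain \<xi> where \<xi>: "\<xi> \<in> {a<..<b}" "z b q - z a q = ode_rhs K l R q (z \<xi>) * (b - a)"
    using z_mvt[OF q ab(1)] by blast
  have "\<bar>ode_rhs K l R q (z \<xi>)\<bar> <= Fbd B"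
    using \<xi>(1) ab B by (intro ode_rhs_bound[OF B(1)] q) auto
  then show ?thesis using ab unfolding \<xi>(2) abs_mult by (intro mult_mono) auto
qed simp

lemma z_increment:
  assumes B: "1 <= B" "!!t q. 0 <= t ==> t <= T ==> q \<in> SK K ==> \<bar>z t q\<bar> <= B"
    and q: "q \<in> SK K" and a: "0 <= a" and h: "0 < h" and b: "a + h <= T"
  shows "\<bar>z (a + h) q - z a q - h * ode_rhs K l R q (z a)\<bar> <= Lip B * real (K + 1) * Fbd B * h\<^sup>2"
proof -
  obtain \<xi> where \<xi>: "\<xi> \<in> {a<..<a+h}" "z (a + h) q - z a q = ode_rhs K l R q (z \<xi>) * (a + h - a)"
    using z_mvt[OF q a, of "a + h"] h by auto
  have F0: "0 <= Fbd B" "0 <= Lip B" using B(1) by (auto simp: Fbd_def Lip_def)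
  have "\<bar>ode_rhs K l R q (z \<xi>) - ode_rhs K l R q (z a)\<bar> <= Lip B * (SUM q:SK K. \<bar>z \<xi> q - z a q\<bar>)"
    using \<xi>(1) a b h by (intro ode_rhs_lipschitz[OF B(1) B(2) B(2) q]) auto
  also have "... <= Lip B * (SUM q:SK K. Fbd B * h)"
  proof (intro mult_left_mono sum_mono F0)
    fix q assume q: "q \<in> SK K"
    have "\<bar>z \<xi> q - z a q\<bar> <= Fbd B * (\<xi> - a)" using \<xi>(1) a b by (intro z_lipschitz[OF B q]) auto
    also have "... <= Fbd B * h" using \<xi>(1) F0 by (intro mult_left_mono) auto
    finally show "\<bar>z \<xi> q - z a q\<bar> <= Fbd B * h" .
  qed
  finally have le: "\<bar>ode_rhs K l R q (z \<xi>) - ode_rhs K l R q (z a)\<bar> <= Lip B * real (K + 1) * Fbd B * h"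
    by (simp add: card_SK mult_ac)
  have "z (a + h) q - z a q - h * ode_rhs K l R q (z a) = h * (ode_rhs K l R q (z \<xi>) - ode_rhs K l R q (z a))"
    unfolding \<xi>(2) by (simp add: algebra_simps)
  then have "\<bar>z (a + h) q - z a q - h * ode_rhs K l R q (z a)\<bar> = h * \<bar>ode_rhs K l R q (z \<xi>) - ode_rhs K l R q (z a)\<bar>"
    using h by (simp add: abs_mult)
  also have "... <= h * (Lip B * real (K + 1) * Fbd B * h)" using le h by (intro mult_left_mono) auto
  finally show ?thesis by (simp add: power2_eq_square mult_ac)
qed

definition sqdist :: "nat => nat => nat set set => real" where
  "sqdist n N E = (SUM q:SK K. (frac n E q - z (real N / real n) q)^2)"

text \<open>Constants of the Gronwall step for solutions bounded by \<open>B\<close>: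
  \<open>gw1\<close> is the growth rate; \<open>gw0\<close> collects the drift errors of order
  \<open>1 / n ^ 2\<close>, from edges inside a small component and from the curvature of the
  solution; \<open>gw2\<close> adds the square of the one-round change.\<close>

definition gw1 :: "real => real" where "gw1 B = 2 * Lip B * real (K + 1)"

definition gw0 :: "real => real" where
  "gw0 B = 2 * real K * real (l * K) + Lip B * real (K + 1) * Fbd B"

definition gw2 :: "real => real" where
  "gw2 B = 2 * gw0 B * (real (K + 1) * (1 + B)) + real (K + 1) * (2 * real K + Fbd B)^2"

lemma gw_nonneg: "1 <= B ==> 0 <= gw0 B & 0 <= gw1 B & 0 <= gw2 B"
  by (auto simp: gw0_def gw1_def gw2_def Lip_def Fbd_def)

text \<open>Expanding the square, the cross term needs only the mean of the change, where the
  Lipschitz bound applies, and the remaining square is of order \<open>1 / n ^ 2\<close> pointwise.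
  \<open>sum_abs_squared_le\<close> converts the \<open>L1\<close> norm of the Lipschitz estimate
  back into the squared distance.\<close>

lemma sqdist_step:
  assumes B: "1 <= B" "!!t q. 0 <= t ==> t <= T ==> q \<in> SK K ==> \<bar>z t q\<bar> <= B"
    and n: "n >= 1" and N: "real (Suc N) / real n <= T"
  shows "Av n (%x. sqdist n (Suc N) (round n E x)) <= (1 + gw1 B / real n) * sqdist n N E + gw2 B / (real n)^2"
proof -
  have n0: "0 < real n" using n by simp
  define t0 where "t0 = real N / real n"
  define h where "h = 1 / real n"
  have h: "0 < h" using n0 by (simp add: h_def)
  have t1: "real (Suc N) / real n = t0 + h" by (simp add: t0_def h_def add_divide_distrib)
  have t0: "0 <= t0" "t0 <= T" "t0 + h <= T" using N n0 h unfolding t1 by (auto simp: t0_def)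
  define a where "a q = frac n E q - z t0 q" for q
  define D where "D q = z (t0 + h) q - z t0 q" for q
  define S1 where "S1 = (SUM q:SK K. \<bar>a q\<bar>)"
  define S2 where "S2 = (SUM q:SK K. (a q)^2)"
  let ?\<delta> = "%q x. frac n (round n E x) q - frac n E q"
  have F0: "0 <= Fbd B" "0 <= Lip B" "0 <= gw0 B" using B(1) gw_nonneg by (auto simp: Fbd_def Lip_def)
  have fB: "\<bar>frac n E q\<bar> <= B" if "q \<in> SK K" for q
    using frac_le_1[OF n that, of E] frac_nonneg[of n E q] B(1) by auto
  have S1: "0 <= S1" "S1 <= real (K + 1) * (1 + B)" "S1\<^sup>2 <= real (K + 1) * S2"
  proof -
    show "0 <= S1" by (simp add: S1_def sum_nonneg)
    have "S1 <= (SUM q:SK K. 1 + B)" unfolding S1_def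
    proof (rule sum_mono)
      fix q assume q: "q \<in> SK K"
      show "\<bar>a q\<bar> <= 1 + B"
        using frac_le_1[OF n q, of E] frac_nonneg[of n E q] B(2)[OF t0(1,2) q] unfolding a_def by linarith
    qed
    then show "S1 <= real (K + 1) * (1 + B)" by (simp add: card_SK)
    show "S1\<^sup>2 <= real (K + 1) * S2" unfolding S1_def S2_def by (rule sum_abs_squared_le)
  qed
  have drift: "\<bar>Av n (?\<delta> q) - D q\<bar> <= Lip B * S1 * h + gw0 B * h\<^sup>2" if q: "q \<in> SK K" for q
  proof -
    have 1: "\<bar>Av n (?\<delta> q) - h * ode_rhs K l R q (frac n E)\<bar> <= 2 * real K * real (l * K) * h\<^sup>2"
      using Av_frac_round[OF n q, of E] by (simp add: h_def power2_eq_square mult_ac)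
    have 2: "\<bar>D q - h * ode_rhs K l R q (z t0)\<bar> <= Lip B * real (K + 1) * Fbd B * h\<^sup>2"
      unfolding D_def by (rule z_increment[OF B q t0(1) h t0(3)])
    have "\<bar>ode_rhs K l R q (frac n E) - ode_rhs K l R q (z t0)\<bar> <= Lip B * S1"
      unfolding S1_def a_def using t0 by (intro ode_rhs_lipschitz[OF B(1) fB B(2) q]) auto
    then have "h * \<bar>ode_rhs K l R q (frac n E) - ode_rhs K l R q (z t0)\<bar> <= h * (Lip B * S1)"
      using h by (intro mult_left_mono) auto
    then have 3: "\<bar>h * ode_rhs K l R q (frac n E) - h * ode_rhs K l R q (z t0)\<bar> <= Lip B * S1 * h"
      using h by (simp add: right_diff_distrib[symmetric] abs_mult mult_ac)
    have "gw0 B * h\<^sup>2 = 2 * real K * real (l * K) * h\<^sup>2 + Lip B * real (K + 1) * Fbd B * h\<^sup>2"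
      by (simp add: gw0_def algebra_simps)
    then show ?thesis using 1 2 3 by linarith
  qed
  have summand: "Av n (%x. (frac n (round n E x) q - z (t0 + h) q)^2)
     <= (a q)^2 + 2 * \<bar>a q\<bar> * (Lip B * S1 * h + gw0 B * h\<^sup>2) + (2 * real K + Fbd B)^2 * h\<^sup>2" if q: "q \<in> SK K" for q
  proof -
    have "Av n (%x. (frac n (round n E x) q - z (t0 + h) q)^2)
      <= Av n (%x. ((a q)^2 - 2 * a q * D q + (2 * real K + Fbd B)^2 * h\<^sup>2) + 2 * a q * ?\<delta> q x)"
    proof (rule Av_mono)
      fix x assume x: "x \<in> Tup n"
      have "\<bar>?\<delta> q x\<bar> <= 2 * real K * h" using frac_round(2)[OF n q x, of E] by (simp add: h_def)
      moreover have "\<bar>D q\<bar> <= Fbd B * h"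
        unfolding D_def using z_lipschitz[OF B q t0(1) _ t0(3)] h by simp
      ultimately have "\<bar>?\<delta> q x - D q\<bar> <= (2 * real K + Fbd B) * h" by (simp add: algebra_simps)
      then have "\<bar>?\<delta> q x - D q\<bar>\<^sup>2 <= ((2 * real K + Fbd B) * h)^2" by (intro power_mono) auto
      then have sq: "(?\<delta> q x - D q)^2 <= (2 * real K + Fbd B)^2 * h\<^sup>2" by (simp add: power_mult_distrib)
      have "frac n (round n E x) q - z (t0 + h) q = a q + (?\<delta> q x - D q)" by (simp add: a_def D_def)
      then have "(frac n (round n E x) q - z (t0 + h) q)^2 = (a q)^2 + 2 * a q * (?\<delta> q x - D q) + (?\<delta> q x - D q)^2"
        by (simp only: power2_sum)
      then show "(frac n (round n E x) q - z (t0 + h) q)^2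
        <= ((a q)^2 - 2 * a q * D q + (2 * real K + Fbd B)^2 * h\<^sup>2) + 2 * a q * ?\<delta> q x"
        using sq by (simp add: algebra_simps)
    qed
    also have "... = (a q)^2 - 2 * a q * D q + (2 * real K + Fbd B)^2 * h\<^sup>2 + 2 * a q * Av n (?\<delta> q)"
      by (simp only: Av_add Av_const[OF n] Av_cmult)
    also have "... = (a q)^2 + 2 * (a q * (Av n (?\<delta> q) - D q)) + (2 * real K + Fbd B)^2 * h\<^sup>2"
      by (simp add: algebra_simps)
    also have "a q * (Av n (?\<delta> q) - D q) <= \<bar>a q\<bar> * \<bar>Av n (?\<delta> q) - D q\<bar>"
      by (metis abs_ge_self abs_mult)
    also have "... <= \<bar>a q\<bar> * (Lip B * S1 * h + gw0 B * h\<^sup>2)"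
      using drift[OF q] by (intro mult_left_mono) auto
    finally show ?thesis by (simp add: mult.assoc)
  qed
  have "Av n (%x. sqdist n (Suc N) (round n E x)) = (SUM q:SK K. Av n (%x. (frac n (round n E x) q - z (t0 + h) q)^2))"
    unfolding sqdist_def t1 by (rule Av_sum)
  also have "... <= (SUM q:SK K. (a q)^2 + 2 * \<bar>a q\<bar> * (Lip B * S1 * h + gw0 B * h\<^sup>2) + (2 * real K + Fbd B)^2 * h\<^sup>2)"
    by (intro sum_mono summand)
  also have "... = S2 + 2 * S1 * (Lip B * S1 * h + gw0 B * h\<^sup>2) + real (K + 1) * ((2 * real K + Fbd B)^2 * h\<^sup>2)"
    by (simp add: sum.distrib S1_def S2_def card_SK sum_distrib_left sum_distrib_right mult_ac)
  also have "... = S2 + 2 * Lip B * h * S1\<^sup>2 + 2 * gw0 B * h\<^sup>2 * S1 + real (K + 1) * ((2 * real K + Fbd B)^2 * h\<^sup>2)"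
    by (simp add: power2_eq_square algebra_simps)
  also have "... <= S2 + 2 * Lip B * h * (real (K + 1) * S2) + 2 * gw0 B * h\<^sup>2 * (real (K + 1) * (1 + B))
      + real (K + 1) * ((2 * real K + Fbd B)^2 * h\<^sup>2)"
    using S1 F0 h by (intro add_mono mult_left_mono order_refl) auto
  also have "... = (1 + gw1 B / real n) * S2 + gw2 B / (real n)^2"
    by (simp add: gw1_def gw2_def h_def power2_eq_square add_divide_distrib algebra_simps)
  finally show ?thesis by (simp add: S2_def sqdist_def a_def t0_def)
qed

lemma adapted_sqdist: "adapted N (%v. sqdist n M (G n v N))"
  by (rule adapted_G'[OF order_refl])

theorem sqdist_bound:
  assumes B: "1 <= B" "!!t q. 0 <= t ==> t <= T ==> q \<in> SK K ==> \<bar>z t q\<bar> <= B"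
    and n: "n >= 1" and N: "real N / real n <= T"
  shows "Mean n (%v. sqdist n N (G n v N)) <= (real N / real n) * exp (gw1 B * (real N / real n)) * gw2 B / real n"
proof -
  have n0: "0 < real n" using n by simp
  let ?a = "%N. Mean n (%v. sqdist n N (G n v N))"
  let ?r = "1 + gw1 B / real n" and ?b = "gw2 B / (real n)^2"
  have g: "0 <= gw1 B" "0 <= gw2 B" using gw_nonneg[OF B(1)] by auto
  have r1: "1 <= ?r" using g by simp
  have bound: "real M / real n <= T ==> ?a M <= real M * (?r ^ M * ?b)" for M
  proof (induction M)
    case 0
    have "sqdist n 0 {} = 0"
      unfolding sqdist_def by (intro sum.neutral) (simp add: frac_start[OF n] z_0)
    then show ?case by (simp add: Mean_const[OF n])
  next
    case (Suc M)
    have M: "real M / real n <= T"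
    proof -
      have "real M / real n <= real (Suc M) / real n" by (intro divide_right_mono) auto
      then show ?thesis using Suc.prems by linarith
    qed
    have "Mean n (%v. 1 * sqdist n (Suc M) (G n v (Suc M))) <= Mean n (%v. ?r * sqdist n M (G n v M) + ?b)"
    proof (rule Mean_G_Suc_le[OF n adapted_const])
      show "adapted M (%v. ?r * sqdist n M (G n v M) + ?b)"
        by (rule adapted_G'[where f = "%E. ?r * sqdist n M E + ?b", OF order_refl])
      fix v
      show "1 * Av n (%x. sqdist n (Suc M) (round n (G n v M) x)) <= ?r * sqdist n M (G n v M) + ?b"
        using sqdist_step[OF B n Suc.prems] by simp
    qed
    also have "... = ?r * ?a M + ?b"
      by (simp only: Mean_add[OF n adapted_G'[where f = "%E. ?r * sqdist n M E", OF order_refl] adapted_const[of 0]]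
          Mean_cmult Mean_const[OF n])
    also have "... <= ?r * (real M * (?r ^ M * ?b)) + ?r ^ Suc M * ?b"
    proof (intro add_mono mult_left_mono Suc.IH M)
      have "1 * ?b <= ?r ^ Suc M * ?b" using r1 g by (intro mult_right_mono one_le_power) auto
      then show "?b <= ?r ^ Suc M * ?b" by simp
    qed (use r1 in auto)
    also have "... = real (Suc M) * (?r ^ Suc M * ?b)"
    proof -
      have "r * (m * (X * b)) + r * X * b = (1 + m) * (r * X * b)" for r m X b :: real
        by (simp add: algebra_simps)
      then show ?thesis by (simp only: of_nat_Suc power_Suc)
    qed
    finally show ?case by simp
  qed
  have "?r ^ N <= exp (gw1 B / real n) ^ N"
    using r1 exp_ge_add_one_self[of "gw1 B / real n"] by (intro power_mono) auto
  also have "... = exp (gw1 B * (real N / real n))" by (simp add: exp_of_nat_mult[symmetric] mult_ac)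
  finally have rN: "?r ^ N <= exp (gw1 B * (real N / real n))" .
  have "?a N <= real N * (?r ^ N * ?b)" by (rule bound[OF N])
  also have "... <= real N * (exp (gw1 B * (real N / real n)) * ?b)"
    using rN g by (intro mult_left_mono mult_right_mono) auto
  also have "... = (real N / real n) * exp (gw1 B * (real N / real n)) * gw2 B / real n"
    using n0 by (simp add: power2_eq_square)
  finally show ?thesis .
qed

lemma Mean_square_le:
  assumes n: "n >= 1" and f: "adapted N f"
  shows "(Mean n f)^2 <= Mean n (%v. (f v)^2)"
proof -
  interpret prob_space "choice_space l n" by (rule prob_choice[OF n])
  have i1: "integrable (choice_space l n) f" by (rule adapted_integrable[OF n f])
  have i2: "integrable (choice_space l n) (%v. (f v)^2)"
    by (rule adapted_integrable[OF n adapted_comp1[where h = "%y. y\<^sup>2", OF f]])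
  show ?thesis using variance_eq[OF i1 i2] variance_positive[of f] by (simp add: Mean_def)
qed

lemma Mean_frac_diff:
  assumes n: "n >= 1" and q: "q \<in> SK K"
  shows "(Mean n (%v. frac n (G n v N) q) - z (real N / real n) q)^2 <= Mean n (%v. sqdist n N (G n v N))"
proof -
  let ?f = "%E. frac n E q - z (real N / real n) q"
  have "(Mean n (%v. ?f (G n v N)))^2 <= Mean n (%v. (?f (G n v N))^2)"
    by (rule Mean_square_le[OF n adapted_G'[where f = ?f, OF order_refl]])
  also have "... <= Mean n (%v. sqdist n N (G n v N))"
  proof (rule Mean_mono[OF n adapted_G'[where f = "%E. (?f E)^2", OF order_refl] adapted_sqdist])
    fix v
    show "(?f (G n v N))^2 <= sqdist n N (G n v N)"
      unfolding sqdist_def using q finite_SK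
      by (intro member_le_sum[of q _ "%q. (frac n (G n v N) q - z (real N / real n) q)^2"]) auto
  qed
  also have "Mean n (%v. ?f (G n v N)) = Mean n (%v. frac n (G n v N) q) - z (real N / real n) q"
    by (simp only: Mean_diff[OF n adapted_G'[where f = "%E. frac n E q", OF order_refl] adapted_const[of 0]] Mean_const[OF n])
  finally show ?thesis .
qed

text \<open>An a priori bound from continuity alone. That the solution stays in
  \<open>[0, 1]\<close> is not yet known; it follows from \<open>Mean_frac_tendsto\<close>, whose
  proof needs some bound first.\<close>

lemma z_bounded_on_compact: "EX B>=1. ALL t q. 0 <= t --> t <= T --> q \<in> SK K --> \<bar>z t q\<bar> <= B"
proof -
  have "EX b>=0. ALL t:{0..T}. \<bar>z t q\<bar> <= b" if q: "q \<in> SK K" for q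
  proof -
    have "continuous_on {0..T} (%t. z t q)"
      using z_continuous[OF q] by (rule continuous_on_subset) auto
    then have "bounded ((%t. z t q) ` {0..T})"
      by (intro compact_imp_bounded compact_continuous_image) auto
    then obtain b where "ALL t:{0..T}. \<bar>z t q\<bar> <= b" by (auto simp: bounded_iff)
    then show ?thesis by (intro exI[of _ "max 0 b"]) auto
  qed
  then obtain b where b: "!!q. q \<in> SK K ==> 0 <= b q" "!!q t. q \<in> SK K ==> t \<in> {0..T} ==> \<bar>z t q\<bar> <= b q"
    by metis
  show ?thesis
  proof (intro exI[of _ "1 + (SUM q:SK K. b q)"] conjI allI impI)
    show "1 <= 1 + (SUM q:SK K. b q)" using b(1) by (simp add: sum_nonneg)
    fix t q assume "0 <= t" "t <= T" and q: "q \<in> SK K"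
    then have "\<bar>z t q\<bar> <= b q" using b(2) by auto
    also have "... <= (SUM q:SK K. b q)" using b(1) q finite_SK by (intro member_le_sum) auto
    finally show "\<bar>z t q\<bar> <= 1 + (SUM q:SK K. b q)" by simp
  qed
qed

lemma floor_ratio_tendsto:
  assumes "0 <= t"
  shows "(%n. real (nat \<lfloor>t * real n\<rfloor>) / real n) \<longlonglongrightarrow> t"
proof (rule tendsto_sandwich[of "%n. t - 1 / real n" _ _ "%n. t"])
  show "\<forall>\<^sub>F n in sequentially. t - 1 / real n <= real (nat \<lfloor>t * real n\<rfloor>) / real n"
    using eventually_gt_at_top[of 0]
  proof eventually_elim
    case (elim n)
    have "t * real n - 1 <= real (nat \<lfloor>t * real n\<rfloor>)" using assms by linarith
    then have "(t * real n - 1) / real n <= real (nat \<lfloor>t * real n\<rfloor>) / real n" by (intro divide_right_mono) auto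
    then show ?case using elim by (simp add: diff_divide_distrib)
  qed
  show "\<forall>\<^sub>F n in sequentially. real (nat \<lfloor>t * real n\<rfloor>) / real n <= t"
    using eventually_gt_at_top[of 0]
  proof eventually_elim
    case (elim n)
    have "real (nat \<lfloor>t * real n\<rfloor>) <= t * real n" using assms by (simp add: of_nat_nat)
    then show ?case using elim by (simp add: field_simps)
  qed
  show "(%n. t - 1 / real n) \<longlonglongrightarrow> t"
    using tendsto_diff[OF tendsto_const lim_const_over_n, of t "1 :: real"] by simp
qed simp

text \<open>Its purpose is to transfer properties from the process to the solution: bounds,
  normalisation and decay hold for the means at every \<open>n\<close> and pass to the
  limit.\<close>

theorem Mean_frac_tendsto:
  assumes t: "0 <= t" and q: "q \<in> SK K"
  shows "(%n. Mean n (%v. frac n (G n v (nat \<lfloor>t * real n\<rfloor>)) q)) \<longlonglongrightarrow> z t q"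
proof -
  obtain B where B: "1 <= B" "!!s q. 0 <= s ==> s <= t ==> q \<in> SK K ==> \<bar>z s q\<bar> <= B"
    using z_bounded_on_compact[of t] by blast
  let ?N = "%n. nat \<lfloor>t * real n\<rfloor>"
  let ?m = "%n. Mean n (%v. frac n (G n v (?N n)) q)"
  let ?c = "t * exp (gw1 B * t) * gw2 B"
  have g: "0 <= gw1 B" "0 <= gw2 B" using gw_nonneg[OF B(1)] by auto
  have r: "real (?N n) / real n <= t" if "n >= 1" for n
  proof -
    have "real (?N n) <= t * real n" using t by (simp add: of_nat_nat)
    then show ?thesis using that by (simp add: field_simps)
  qed
  have up: "\<forall>\<^sub>F n in sequentially. (?m n - z (real (?N n) / real n) q)^2 <= ?c / real n"
    using eventually_ge_at_top[of 1]
  proof eventually_elim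
    case (elim n)
    have "(?m n - z (real (?N n) / real n) q)^2 <= Mean n (%v. sqdist n (?N n) (G n v (?N n)))"
      by (rule Mean_frac_diff[OF elim q])
    also have "... <= (real (?N n) / real n) * exp (gw1 B * (real (?N n) / real n)) * gw2 B / real n"
      by (rule sqdist_bound[OF B elim r[OF elim]])
    also have "... <= ?c / real n"
    proof (intro divide_right_mono mult_right_mono)
      have "exp (gw1 B * (real (?N n) / real n)) <= exp (gw1 B * t)"
        using mult_left_mono[OF r[OF elim] g(1)] by (simp only: exp_le_cancel_iff)
      then show "real (?N n) / real n * exp (gw1 B * (real (?N n) / real n)) <= t * exp (gw1 B * t)"
        using r[OF elim] t by (intro mult_mono) auto
    qed (use g in auto)
    finally show ?case .
  qed
  have lim0: "(%n. ?c / real n) \<longlonglongrightarrow> 0" by (rule lim_const_over_n)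
  have "(%n. (?m n - z (real (?N n) / real n) q)^2) \<longlonglongrightarrow> 0"
    by (rule tendsto_sandwich[OF always_eventually up tendsto_const lim0]) (rule allI, rule zero_le_power2)
  then have "(%n. sqrt ((?m n - z (real (?N n) / real n) q)^2)) \<longlonglongrightarrow> sqrt 0" by (rule tendsto_real_sqrt)
  then have 1: "(%n. ?m n - z (real (?N n) / real n) q) \<longlonglongrightarrow> 0"
    by (simp only: real_sqrt_abs real_sqrt_zero tendsto_rabs_zero_iff)
  have 2: "(%n. z (real (?N n) / real n) q) \<longlonglongrightarrow> z t q"
    using z_continuous[OF q] floor_ratio_tendsto[OF t] t
    by (intro continuous_on_tendsto_compose[OF z_continuous[OF q] floor_ratio_tendsto[OF t]]) auto
  show ?thesis using tendsto_add[OF 1 2] by simp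
qed

section \<open>Properties of the solution inherited from the process\<close>

lemma Mean_frac_bounds: "n >= 1 ==> q \<in> SK K ==> 0 <= Mean n (%v. frac n (G n v N) q) & Mean n (%v. frac n (G n v N) q) <= 1"
proof -
  assume n: "n >= 1" and q: "q \<in> SK K"
  have "Mean n (%v. frac n (G n v N) q) <= Mean n (%_. 1)"
    by (rule Mean_mono[OF n adapted_G'[where f = "%E. frac n E q", OF order_refl] adapted_const[of 0]]) (rule frac_le_1[OF n q])
  then show ?thesis by (simp add: Mean_const[OF n] Mean_nonneg frac_nonneg)
qed

lemma z_bounds: "0 <= t ==> q \<in> SK K ==> 0 <= z t q" "0 <= t ==> q \<in> SK K ==> z t q <= 1"
proof -
  assume t: "0 <= t" and q: "q \<in> SK K"
  show "0 <= z t q"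
    by (rule tendsto_lowerbound[OF Mean_frac_tendsto[OF t q]])
      (use Mean_frac_bounds[OF _ q] in \<open>auto intro: eventually_sequentiallyI[of 1]\<close>)
  show "z t q <= 1"
    by (rule tendsto_upperbound[OF Mean_frac_tendsto[OF t q]])
      (use Mean_frac_bounds[OF _ q] in \<open>auto intro: eventually_sequentiallyI[of 1]\<close>)
qed

lemma z_sum: "0 <= t ==> (SUM q:SK K. z t q) = 1"
proof -
  assume t: "0 <= t"
  let ?N = "%n. nat \<lfloor>t * real n\<rfloor>"
  have "(%n. SUM q:SK K. Mean n (%v. frac n (G n v (?N n)) q)) \<longlonglongrightarrow> (SUM q:SK K. z t q)"
    by (intro tendsto_sum Mean_frac_tendsto t)
  moreover have "\<forall>\<^sub>F n in sequentially. (SUM q:SK K. Mean n (%v. frac n (G n v (?N n)) q)) = 1"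
    using eventually_ge_at_top[of 1]
  proof eventually_elim
    case (elim n)
    have "(SUM q:SK K. Mean n (%v. frac n (G n v (?N n)) q)) = Mean n (%v. SUM q:SK K. frac n (G n v (?N n)) q)"
      by (rule Mean_sum[symmetric, OF elim]) (rule adapted_G'[OF order_refl])
    then show ?case by (simp only: frac_sum[OF elim] Mean_const[OF elim])
  qed
  then have "(%n. SUM q:SK K. Mean n (%v. frac n (G n v (?N n)) q)) \<longlonglongrightarrow> 1"
    by (rule tendsto_eventually)
  ultimately show ?thesis by (rule LIMSEQ_unique)
qed

definition w :: "real => real" where "w t = 1 - z t \<infinity>"

text \<open>The crude universal decay of \<open>Q\<close> becomes, with time scaled by
  \<open>n\<close>, an exponential decay of the small mass. The rate is not sharp, but any
  exponential rate suffices to start \<open>w_decay_exact\<close>.\<close>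

lemma w_decay: "0 <= t ==> w t <= real K * exp (- base_rate * t)"
proof -
  assume t: "0 <= t"
  let ?N = "%n. nat \<lfloor>t * real n\<rfloor>"
  have lim: "(%n. 1 - Mean n (%v. fr n (G n v (?N n)))) \<longlonglongrightarrow> w t"
    unfolding w_def by (intro tendsto_diff tendsto_const Mean_frac_tendsto t infinity_in_SK)
  have lim2: "(%n. real K * (exp (- base_rate * (real (?N n) / real n)) + 1 / real n)) \<longlonglongrightarrow> real K * (exp (- base_rate * t) + 0)"
    by (intro tendsto_intros floor_ratio_tendsto t)
  have "\<forall>\<^sub>F n in sequentially. 1 - Mean n (%v. fr n (G n v (?N n))) <= real K * (exp (- base_rate * (real (?N n) / real n)) + 1 / real n)"
  proof -
    have "\<forall>\<^sub>F n in sequentially. real n >= 2 ^ (l + 1) * real (l * K)"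
      using filterlim_real_sequentially by (simp add: filterlim_at_top)
    then show ?thesis using eventually_ge_at_top[of 1]
    proof eventually_elim
      case (elim n)
      have n0: "0 < real n" using elim(2) by simp
      have ad: "adapted (?N n) (%v. f (G n v (?N n)))" for f :: "nat set set => real" by (rule adapted_G'[OF order_refl])
      have "real n * (1 - Mean n (%v. fr n (G n v (?N n)))) = Mean n (%v. real n * (1 - fr n (G n v (?N n))))"
        by (simp only: Mean_cmult Mean_diff[OF elim(2) adapted_const[of 0 "1::real"] ad[of "fr n"]] Mean_const[OF elim(2)])
      also have "... <= Mean n (%v. real K * (Q n (G n v (?N n)) + 1))"
        by (rule Mean_mono[OF elim(2) ad[of "%E. real n * (1 - fr n E)"] ad[of "%E. real K * (Q n E + 1)"]]) (rule mass_le_Q'[OF elim(2)])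
      also have "... = real K * (Mean n (%v. Q n (G n v (?N n))) + 1)"
        by (simp only: Mean_cmult Mean_add[OF elim(2) ad[of "Q n"] adapted_const[of 0 "1::real"]] Mean_const[OF elim(2)])
      also have "... <= real K * (real n * (1 - base_rate / real n) ^ ?N n + 1)"
        using Mean_Q_universal[OF elim] by (intro mult_left_mono) auto
      also have "... <= real K * (real n * exp (- (base_rate / real n) * real (?N n)) + 1)"
      proof -
        have "0 <= 1 - base_rate / real n" using base_rate n0 elim(2) by (simp add: field_simps)
        then show ?thesis using power_le_exp[of "base_rate / real n" "?N n"] by (intro mult_left_mono add_mono) auto
      qed
      finally have "real n * (1 - Mean n (%v. fr n (G n v (?N n)))) <= real n * (real K * (exp (- base_rate * (real (?N n) / real n)) + 1 / real n))"
        using n0 by (simp add: algebra_simps)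
      then show ?case using n0 by simp
    qed
  qed
  then have "w t <= real K * (exp (- base_rate * t) + 0)"
    by (intro tendsto_le[OF _ lim2 lim]) auto
  then show ?thesis by simp
qed

text \<open>With \<open>B = 1\<close> from \<open>z_bounds\<close> the Gronwall constants no longer
  depend on the time horizon, so \<open>N / n\<close> may grow like a small multiple of
  \<open>ln n\<close>.\<close>

theorem sqdist_bound_uniform:
  "n >= 1 ==> Mean n (%v. sqdist n N (G n v N)) <= (real N / real n) * exp (gw1 1 * (real N / real n)) * gw2 1 / real n"
  using z_bounds by (intro sqdist_bound[of 1 "real N / real n"]) auto

end

section \<open>Long-time behaviour of the differential equations\<close>

lemma nonneg_derivative_mono:
  fixes f f' :: "real => real"
  assumes d: "!!t. t >= 0 ==> (f has_real_derivative f' t) (at t within {0..})"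
    and nn: "!!t. t > 0 ==> 0 <= f' t" and ab: "0 <= a" "a <= b"
  shows "f a <= f b"
proof (cases "a = b")
  case False
  then have "a < b" using ab by simp
  have "EX \<xi>:{a<..<b}. f b - f a = (*) (f' \<xi>) (b - a)"
  proof (rule mvt_simple[OF \<open>a < b\<close>])
    fix t assume "a <= t" "t <= b"
    then show "(f has_derivative (*) (f' t)) (at t within {a..b})"
      using DERIV_subset[OF d[of t], of "{a..b}"] ab by (auto simp: has_field_derivative_def)
  qed
  then obtain \<xi> where \<xi>: "\<xi> \<in> {a<..<b}" "f b - f a = f' \<xi> * (b - a)" by auto
  then have "0 <= f' \<xi> * (b - a)" using nn[of \<xi>] ab by (intro mult_nonneg_nonneg) auto
  then show ?thesis using \<xi>(2) by simp
qed simp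

lemma pos_derivative_strict_mono:
  fixes f f' :: "real => real"
  assumes d: "!!t. t >= 0 ==> (f has_real_derivative f' t) (at t within {0..})"
    and nn: "!!t. t > 0 ==> 0 < f' t" and ab: "0 <= a" "a < b"
  shows "f a < f b"
proof -
  have "EX \<xi>:{a<..<b}. f b - f a = (*) (f' \<xi>) (b - a)"
  proof (rule mvt_simple[OF ab(2)])
    fix t assume "a <= t" "t <= b"
    then show "(f has_derivative (*) (f' t)) (at t within {a..b})"
      using DERIV_subset[OF d[of t], of "{a..b}"] ab by (auto simp: has_field_derivative_def)
  qed
  then obtain \<xi> where \<xi>: "\<xi> \<in> {a<..<b}" "f b - f a = f' \<xi> * (b - a)" by auto
  then have "0 < f' \<xi> * (b - a)" using nn[of \<xi>] ab by (intro mult_pos_pos) auto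
  then show ?thesis using \<xi>(2) by simp
qed

lemma antimono_bounded_tendsto:
  fixes f :: "real => real"
  assumes anti: "!!a b. 0 <= a ==> a <= b ==> f b <= f a" and bd: "!!t. 0 <= t ==> c <= f t"
  shows "EX L. (f \<longlongrightarrow> L) at_top"
proof -
  define L where "L = Inf (f ` {0..})"
  have bdd: "bdd_below (f ` {0..})" using bd by (auto intro!: bdd_belowI)
  have "(f \<longlongrightarrow> L) at_top"
  proof (rule order_tendstoI)
    fix a assume a: "a < L"
    have 1: "a < f t" if "0 <= t" for t
      using cInf_lower[of "f t" "f ` {0..}"] bdd that a by (auto simp: L_def)
    show "\<forall>\<^sub>F t in at_top. a < f t" using eventually_ge_at_top[of 0] by (rule eventually_mono) (rule 1)
  next
    fix a assume "L < a"
    then obtain y where "y \<in> f ` {0..}" "y < a"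
      unfolding L_def using cInf_lessD[of "f ` {0..}" a] by auto
    then obtain t0 where t0: "t0 >= 0" "f t0 < a" by auto
    show "\<forall>\<^sub>F t in at_top. f t < a"
      using eventually_ge_at_top[of t0] by eventually_elim (use anti[of t0] t0 in force)
  qed
  then show ?thesis by blast
qed

context rule_ode
begin

lemma z_deriv_exp:
  assumes "q \<in> SK K" "t >= 0"
  shows "((%u. z u q * exp (c * u)) has_real_derivative (ode_rhs K l R q (z t) + c * z t q) * exp (c * t)) (at t within {0..})"
  by (auto intro!: derivative_eq_intros z_deriv[OF assms] simp: algebra_simps)

lemma w_bounds: "0 <= t ==> 0 <= w t" "0 <= t ==> w t <= 1"
  using z_bounds[OF _ infinity_in_SK] by (auto simp: w_def)

lemma w_sum: "0 <= t ==> w t = (\<Sum>k=1..K. z t (enat k))"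
  using z_sum[of t] by (simp add: SK_split w_def)

lemma z_le_w: "0 <= t ==> k \<in> {1..K} ==> z t (enat k) <= w t"
  unfolding w_sum by (intro member_le_sum) (auto intro!: z_bounds simp: enat_in_SK)

lemma one_minus_pow: "0 <= t ==> 1 - z t \<infinity> ^ (l - 1) <= real l * w t"
proof -
  assume t: "0 <= t"
  have "1 + real (l - 1) * (- w t) <= (1 + (- w t)) ^ (l - 1)"
    using w_bounds[OF t] by (intro Bernoulli_inequality) auto
  moreover have "1 + (- w t) = z t \<infinity>" by (simp add: w_def)
  ultimately have "1 - z t \<infinity> ^ (l - 1) <= real (l - 1) * w t" by simp
  also have "... <= real l * w t" using w_bounds[OF t] by (intro mult_right_mono) auto
  finally show ?thesis .
qed

lemma z_infinity_pow_le_1: "0 <= t ==> 0 <= z t \<infinity> ^ (l - 1) & z t \<infinity> ^ (l - 1) <= 1"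
  using z_bounds[OF _ infinity_in_SK, of t] by (simp add: power_le_one)

definition Cw :: real where "Cw = exp (ex' * real l * real K / base_rate)"

text \<open>The equation gives decay of \<open>w\<close> at rate at least
  \<open>ex' * (1 - real l * w)\<close>. By \<open>w_decay\<close> the correction is integrable, and
  \<open>b\<close> is chosen so that the derivative of \<open>b * exp (- base_rate * u)\<close>
  compensates it; the product with the integrating factor is then nonincreasing.\<close>

lemma w_decay_exact: "0 <= t ==> w t <= Cw * exp (- ex' * t)"
proof -
  assume t: "0 <= t"
  define b where "b = ex' * real l * real K / base_rate"
  have b0: "0 <= b" using base_rate by (simp add: b_def)
  let ?\<psi> = "%u. - (w u * exp (ex' * u + b * exp (- base_rate * u)))"
  let ?d = "%u. - (- ode_rhs K l R \<infinity> (z u) + w u * (ex' + b * (- base_rate * exp (- base_rate * u))))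
      * exp (ex' * u + b * exp (- base_rate * u))"
  have "?\<psi> 0 <= ?\<psi> t"
  proof (rule nonneg_derivative_mono[where f' = ?d, OF _ _ order_refl t])
    fix u :: real assume u: "u >= 0"
    have dw: "(w has_real_derivative - ode_rhs K l R \<infinity> (z u)) (at u within {0..})"
      unfolding w_def[abs_def] by (auto intro!: derivative_eq_intros z_deriv[OF infinity_in_SK u])
    show "(?\<psi> has_real_derivative ?d u) (at u within {0..})"
      by (auto intro!: derivative_eq_intros dw simp: algebra_simps)
  next
    fix u :: real assume "u > 0"
    then have u: "u >= 0" by simp
    note wb = w_bounds[OF u]
    have "ex' * (w u * (1 - real l * w u)) <= ex' * (w u * z u \<infinity> ^ (l - 1))"
      using one_minus_pow[OF u] wb by (intro mult_left_mono) auto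
    also have "... <= ode_rhs K l R \<infinity> (z u)"
      using f_omega_lower[of "z u"] z_bounds(1)[OF u] by (simp add: w_sum[OF u] mult.assoc)
    finally have 1: "ex' * w u - ex' * real l * (w u * w u) <= ode_rhs K l R \<infinity> (z u)"
      by (simp add: algebra_simps)
    have "ex' * real l * (w u * w u) <= ex' * real l * (w u * (real K * exp (- base_rate * u)))"
      using w_decay[OF u] wb by (intro mult_left_mono) auto
    also have "... = w u * (b * (base_rate * exp (- base_rate * u)))"
      using base_rate by (simp add: b_def)
    finally have "ex' * real l * (w u * w u) <= w u * (b * (base_rate * exp (- base_rate * u)))" .
    with 1 have "0 <= - (- ode_rhs K l R \<infinity> (z u) + w u * (ex' + b * (- base_rate * exp (- base_rate * u))))"
      by (simp add: algebra_simps)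
    then show "0 <= ?d u" by (rule mult_nonneg_nonneg) simp
  qed
  then have "w t * exp (ex' * t + b * exp (- base_rate * t)) <= w 0 * exp b" by simp
  also have "... <= 1 * exp b" using w_bounds[of 0] by (intro mult_right_mono) auto
  finally have 2: "w t * exp (ex' * t + b * exp (- base_rate * t)) <= exp b" by simp
  have "w t * exp (ex' * t) <= w t * exp (ex' * t + b * exp (- base_rate * t))"
    using w_bounds[OF t] b0 by (intro mult_left_mono) auto
  with 2 have "w t * exp (ex' * t) <= exp b" by linarith
  then have "w t * exp (ex' * t) * exp (- ex' * t) <= exp b * exp (- ex' * t)"
    by (intro mult_right_mono) auto
  then show ?thesis by (simp add: Cw_def b_def mult.assoc exp_add[symmetric])
qed

lemma gain_nonneg_if_absent:
  "\<alpha> ~= enat k ==> \<beta> ~= enat k ==> 0 <= gain (enat k) \<alpha> \<beta>"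
  by (simp add: gain_def)

text \<open>Sizes 1 and \<open>k - 1\<close> alternate, so whichever pair
  \<open>2 * i - 1, 2 * i\<close> the rule selects, a component of size \<open>k\<close> is formed.
  Hence every rule creates every size.\<close>

definition merge_tuple :: "nat => nat => enat" where
  "merge_tuple k = (\<lambda>j\<in>{1..l}. if odd j then enat 1 else enat (k - 1))"

lemma merge_tuple:
  assumes "2 <= k" "k <= K"
  shows "merge_tuple k \<in> ST" "gain (enat k) (merge_tuple k (sel1 (merge_tuple k))) (merge_tuple k (sel2 (merge_tuple k))) = real k"
    "P_tuple l (merge_tuple k) x = x (enat 1) ^ card {j \<in> {1..l}. odd j} * x (enat (k - 1)) ^ card {j \<in> {1..l}. even j}"
proof -
  let ?s = "merge_tuple k"
  show s: "?s \<in> ST"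
    using assms K1 by (auto simp: merge_tuple_def size_tuples_def enat_in_SK)
  have R: "1 <= R ?s" using R_range[OF s] by simp
  have r: "sel1 ?s \<in> {1..l}" "sel2 ?s \<in> {1..l}" using sel_range[OF s] by auto
  have "odd (sel1 ?s)" "even (sel2 ?s)" using R by (auto simp: sel1_def sel2_def)
  then have "?s (sel1 ?s) = enat 1" "?s (sel2 ?s) = enat (k - 1)" using r by (auto simp: merge_tuple_def)
  then show "gain (enat k) (?s (sel1 ?s)) (?s (sel2 ?s)) = real k"
    using assms by (simp add: gain_def)
  have "P_tuple l ?s x = (PROD j:{1..l}. if odd j then x (enat 1) else x (enat (k - 1)))"
    unfolding P_tuple_def by (intro prod.cong) (auto simp: merge_tuple_def)
  also have "... = (PROD j:{1..l} \<inter> {j. odd j}. x (enat 1)) * (PROD j:{1..l} \<inter> - {j. odd j}. x (enat (k - 1)))"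
    by (rule prod.If_cases) simp
  also have "{1..l} \<inter> {j. odd j} = {j \<in> {1..l}. odd j}" by auto
  also have "{1..l} \<inter> - {j. odd j} = {j \<in> {1..l}. even j}" by auto
  finally show "P_tuple l ?s x = x (enat 1) ^ card {j \<in> {1..l}. odd j} * x (enat (k - 1)) ^ card {j \<in> {1..l}. even j}"
    by simp
qed

lemma merge_tuple_absent: "2 <= k ==> j \<in> {1..l} ==> merge_tuple k j ~= enat k"
  by (auto simp: merge_tuple_def)

definition Mz :: real where "Mz = 2 * real K * real (card ST)"

lemma rhs_lower:
  assumes t: "0 <= t" and k: "1 <= k" "k <= K"
  shows "- Mz * z t (enat k) + (if 2 <= k then real k * P_tuple l (merge_tuple k) (z t) else 0) <= ode_rhs K l R (enat k) (z t)"
proof -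
  let ?b = "if 2 <= k then real k * P_tuple l (merge_tuple k) (z t) else 0"
  let ?g = "%s. gain (enat k) (s (sel1 s)) (s (sel2 s))"
  have kS: "enat k \<in> SK K" using k by (simp add: enat_in_SK)
  have zk: "0 <= z t (enat k)" by (rule z_bounds(1)[OF t kS])
  have P0: "0 <= P_tuple l s (z t)" if "s \<in> ST" for s using z_bounds(1)[OF t] that by (intro P_tuple_nonneg)
  have pw: "- 2 * real K * z t (enat k) + (if s = merge_tuple k then ?b else 0) <= ?g s * P_tuple l s (z t)" if s: "s \<in> ST" for s
  proof (cases "EX j:{1..l}. s j = enat k")
    case True
    then obtain j where j: "j \<in> {1..l}" "s j = enat k" by blast
    have "P_tuple l s (z t) = z t (s j) * (PROD i:{1..l} - {j}. z t (s i))"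
      unfolding P_tuple_def using j(1) by (intro prod.remove) auto
    also have "... <= z t (s j) * 1"
      using ST_app[OF s] z_bounds[OF t] j zk by (intro mult_left_mono prod_le_1) auto
    finally have P1: "P_tuple l s (z t) <= z t (enat k)" using j by simp
    have "- (?g s * P_tuple l s (z t)) <= \<bar>?g s\<bar> * P_tuple l s (z t)"
      using P0[OF s] abs_ge_minus_self[of "?g s"] mult_right_mono[of "- ?g s" "\<bar>?g s\<bar>" "P_tuple l s (z t)"] by simp
    also have "... <= (2 * real K) * z t (enat k)"
      using gain_ST[OF s kS] P1 P0[OF s] by (intro mult_mono) auto
    finally have "- 2 * real K * z t (enat k) <= ?g s * P_tuple l s (z t)" by simp
    moreover have "(if s = merge_tuple k then ?b else 0) = 0"
      using merge_tuple_absent[of k j] j by auto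
    ultimately show ?thesis by simp
  next
    case False
    then have "s (sel1 s) ~= enat k" "s (sel2 s) ~= enat k" using sel_range[OF s] by blast+
    then have g0: "0 <= ?g s" by (rule gain_nonneg_if_absent)
    have z0: "- 2 * real K * z t (enat k) <= 0" using zk by simp
    show ?thesis
    proof (cases "s = merge_tuple k & 2 <= k")
      case True
      then have s': "s = merge_tuple k" and k2: "2 <= k" by auto
      have "?g s * P_tuple l s (z t) = ?b" unfolding s' using merge_tuple(2)[OF k2 k(2)] k2 by simp
      moreover have "(if s = merge_tuple k then ?b else 0) = ?b" using s' by simp
      ultimately show ?thesis using z0 by linarith
    next
      case False
      then have "(if s = merge_tuple k then ?b else 0) = 0" by auto
      moreover have "0 <= ?g s * P_tuple l s (z t)" using g0 P0[OF s] by (rule mult_nonneg_nonneg)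
      ultimately show ?thesis using z0 by linarith
    qed
  qed
  have "- Mz * z t (enat k) + ?b = (SUM s:ST. - 2 * real K * z t (enat k)) + ?b" by (simp add: Mz_def)
  also have "?b <= (SUM s:ST. if s = merge_tuple k then ?b else 0)"
    using merge_tuple(1)[of k] k finite_ST by (simp add: sum.delta)
  also have "(SUM s:ST. - 2 * real K * z t (enat k)) + ... = (SUM s:ST. - 2 * real K * z t (enat k) + (if s = merge_tuple k then ?b else 0))"
    by (rule sum.distrib[symmetric])
  also have "... <= ode_rhs K l R (enat k) (z t)"
    unfolding ode_rhs_tuple[OF kS] by (intro sum_mono pw)
  finally show ?thesis by simp
qed

text \<open>Induction on the size: with the integrating factor \<open>exp (Mz * t)\<close> the
  losses are neutralised, and for \<open>k >= 2\<close> the term from \<open>merge_tuple\<close>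
  gives a strictly positive source.\<close>

lemma z_positive: "1 <= k ==> k <= K ==> 0 < t ==> 0 < z t (enat k)"
proof (induction k arbitrary: t rule: less_induct)
  case (less k)
  have kS: "enat k \<in> SK K" using less.prems by (simp add: enat_in_SK)
  have oneS: "enat 1 \<in> SK K" using K1 by (simp add: enat_in_SK)
  let ?f = "%u. z u (enat k) * exp (Mz * u)"
  let ?f' = "%u. (ode_rhs K l R (enat k) (z u) + Mz * z u (enat k)) * exp (Mz * u)"
  have d: "(?f has_real_derivative ?f' u) (at u within {0..})" if "u >= 0" for u
    by (rule z_deriv_exp[OF kS that])
  show ?case
  proof (cases "k = 1")
    case True
    have "?f 0 <= ?f t"
    proof (rule nonneg_derivative_mono[OF d])
      fix u :: real assume "u > 0"
      then show "0 <= ?f' u"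
        using rhs_lower[of u k] less.prems True by (intro mult_nonneg_nonneg) auto
    qed (use less.prems in auto)
    then have "0 < z t (enat k) * exp (Mz * t)" using z_0[OF kS] True by simp
    then show ?thesis by (simp add: zero_less_mult_iff)
  next
    case False
    then have k2: "2 <= k" using less.prems by simp
    have "?f 0 < ?f t"
    proof (rule pos_derivative_strict_mono[OF d])
      fix u :: real assume u: "u > 0"
      have "0 < z u (enat 1)" "0 < z u (enat (k - 1))"
        using less.IH[of 1 u] less.IH[of "k - 1" u] k2 less.prems u by auto
      then have "0 < real k * P_tuple l (merge_tuple k) (z u)"
        using merge_tuple(3)[OF k2 less.prems(2), of "z u"] k2 by simp
      then have "0 < ode_rhs K l R (enat k) (z u) + Mz * z u (enat k)"
        using rhs_lower[of u k] less.prems u k2 by auto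
      then show "0 < ?f' u" by simp
    qed (use less.prems in auto)
    then have "0 < z t (enat k) * exp (Mz * t)" using z_0[OF kS] False by simp
    then show ?thesis by (simp add: zero_less_mult_iff)
  qed
qed

text \<open>Let \<open>?U\<close> be the rescaled coordinate. Its derivative is at most
  \<open>C4 * exp (- ex' * t)\<close>, so adding the tail \<open>e\<close> makes it decreasing and
  it converges. The derivative is also at least \<open>- C5 * exp (- ex' * t) * ?U\<close>, so
  \<open>?U * exp (- q)\<close> is increasing; being positive at time 1, it keeps the limit
  positive.\<close>

theorem slow_limit:
  assumes k: "k \<in> slow K l R"
  shows "EX L>0. ((%t. z t (enat k) * exp (ex' * t)) \<longlongrightarrow> L) at_top"
proof -
  have k1: "1 <= k" "k <= K" "k \<in> {1..K}" using slow_subset k by auto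
  have kS: "enat k \<in> SK K" using k1 by (simp add: enat_in_SK)
  have exk: "ex_k K l R k = ex" by (rule slow_ex[OF k])
  let ?U = "%t. z t (enat k) * exp (ex' * t)"
  let ?U' = "%t. (ode_rhs K l R (enat k) (z t) + ex' * z t (enat k)) * exp (ex' * t)"
  have dU: "(?U has_real_derivative ?U' t) (at t within {0..})" if "t >= 0" for t
    by (rule z_deriv_exp[OF kS that])
  define C3 where "C3 = ex' * real l + 2 * real K * (real l)^2"
  define C4 where "C4 = C3 * Cw\<^sup>2"
  define C5 where "C5 = 2 * real K * (real l)^2 * Cw"
  have ex0: "0 < ex'" using ex'1 by simp
  have C0: "0 <= C3" "0 <= C4" "0 <= C5" by (auto simp: C3_def C4_def C5_def Cw_def)
  have Cw2: "(w t)^2 * exp (ex' * t) <= Cw\<^sup>2 * exp (- ex' * t)" if t: "0 <= t" for t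
  proof -
    have "(w t)^2 <= (Cw * exp (- ex' * t))^2" using w_decay_exact[OF t] w_bounds[OF t] by (intro power_mono)
    then have "(w t)^2 * exp (ex' * t) <= (Cw * exp (- ex' * t))^2 * exp (ex' * t)" by (intro mult_right_mono) auto
    also have "... = Cw\<^sup>2 * (exp (- ex' * t) * (exp (- ex' * t) * exp (ex' * t)))" by (simp add: power2_eq_square)
    also have "exp (- ex' * t) * exp (ex' * t) = 1" by (simp add: exp_add[symmetric])
    finally show ?thesis by simp
  qed
  have up: "?U' t <= C4 * exp (- ex' * t)" if t: "0 <= t" for t
  proof -
    have zw: "z t (enat k) <= w t" by (rule z_le_w[OF t k1(3)])
    have z0: "0 <= z t (enat k)" by (rule z_bounds(1)[OF t kS])
    have "ode_rhs K l R (enat k) (z t) + ex' * z t (enat k)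
      <= ex' * (z t (enat k) * (1 - z t \<infinity> ^ (l - 1))) + 2 * real K * (real l)^2 * (1 - z t \<infinity>)^2"
      using ode_rhs_linearization(1)[OF z_bounds(1)[OF t] z_sum[OF t] k1(1,2)] unfolding exk
      by (simp add: algebra_simps)
    also have "... <= ex' * (w t * (real l * w t)) + 2 * real K * (real l)^2 * (w t)^2"
      using zw z0 one_minus_pow[OF t] z_infinity_pow_le_1[OF t] w_bounds[OF t] ex0
      by (intro add_mono mult_left_mono mult_mono) (auto simp: w_def)
    also have "... = C3 * (w t)^2" by (simp add: C3_def power2_eq_square algebra_simps)
    finally have "?U' t <= C3 * (w t)^2 * exp (ex' * t)" by (intro mult_right_mono) auto
    also have "... <= C3 * (Cw\<^sup>2 * exp (- ex' * t))"
      using mult_left_mono[OF Cw2[OF t] C0(1)] by (simp add: mult.assoc)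
    finally show ?thesis by (simp add: C4_def mult.assoc)
  qed
  have low: "- C5 * exp (- ex' * t) * ?U t <= ?U' t" if t: "0 <= t" for t
  proof -
    have z0: "0 <= z t (enat k)" by (rule z_bounds(1)[OF t kS])
    have "ex' * z t (enat k) * z t \<infinity> ^ (l - 1) <= ex' * z t (enat k) * 1"
      using z_infinity_pow_le_1[OF t] z0 ex0 by (intro mult_left_mono) auto
    then have "- 2 * real K * (real l)^2 * z t (enat k) * w t <= ode_rhs K l R (enat k) (z t) + ex' * z t (enat k)"
      using ode_rhs_linearization(2)[OF z_bounds(1)[OF t] z_sum[OF t] k1(1,2)] unfolding exk w_def by linarith
    moreover have "- 2 * real K * (real l)^2 * z t (enat k) * w t >= - C5 * exp (- ex' * t) * z t (enat k)"
    proof -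
      have "2 * real K * (real l)^2 * z t (enat k) * w t <= 2 * real K * (real l)^2 * z t (enat k) * (Cw * exp (- ex' * t))"
        using w_decay_exact[OF t] z0 by (intro mult_left_mono) auto
      then show ?thesis by (simp add: C5_def mult_ac)
    qed
    ultimately have "- C5 * exp (- ex' * t) * z t (enat k) <= ode_rhs K l R (enat k) (z t) + ex' * z t (enat k)" by linarith
    then have "- C5 * exp (- ex' * t) * z t (enat k) * exp (ex' * t) <= ?U' t" by (rule mult_right_mono) simp
    then show ?thesis by (simp add: mult.assoc)
  qed
  define e where "e t = C4 / ex' * exp (- ex' * t)" for t
  have de: "(e has_real_derivative - C4 * exp (- ex' * t)) (at t within {0..})" for t
    unfolding e_def[abs_def] using ex0 by (auto intro!: derivative_eq_intros)
  have "EX L. ((%t. ?U t + e t) \<longlongrightarrow> L) at_top"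
  proof (rule antimono_bounded_tendsto[of _ 0])
    fix a b :: real assume ab: "0 <= a" "a <= b"
    have "- (?U a + e a) <= - (?U b + e b)"
    proof (rule nonneg_derivative_mono[where f' = "%t. - (?U' t + - C4 * exp (- ex' * t))", OF _ _ ab])
      fix t :: real assume "t >= 0"
      then show "((%t. - (?U t + e t)) has_real_derivative - (?U' t + - C4 * exp (- ex' * t))) (at t within {0..})"
        by (intro DERIV_minus DERIV_add dU de)
    next
      fix t :: real assume "t > 0"
      then show "0 <= - (?U' t + - C4 * exp (- ex' * t))" using up[of t] by simp
    qed
    then show "?U b + e b <= ?U a + e a" by simp
  next
    fix t :: real assume "0 <= t"
    then show "0 <= ?U t + e t" using z_bounds(1)[OF _ kS, of t] C0 ex0 by (simp add: e_def)
  qed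
  then obtain L where L: "((%t. ?U t + e t) \<longlongrightarrow> L) at_top" by blast
  have e0: "(e \<longlongrightarrow> 0) at_top"
  proof -
    have "((%t. C4 / ex' * exp (- ex' * t)) \<longlongrightarrow> C4 / ex' * 0) at_top"
    proof (intro tendsto_mult tendsto_const)
      have "filterlim (%t. - ex' * t) at_bot at_top"
        using ex0 by (intro filterlim_tendsto_neg_mult_at_bot[OF tendsto_const _ filterlim_ident]) simp
      then show "((%t. exp (- ex' * t)) \<longlongrightarrow> 0) at_top" by (rule filterlim_compose[OF exp_at_bot])
    qed
    then show ?thesis by (simp add: e_def[abs_def])
  qed
  have UL: "(?U \<longlongrightarrow> L) at_top" using tendsto_diff[OF L e0] by simp
  define q where "q t = C5 / ex' * exp (- ex' * t)" for t
  have dq: "(q has_real_derivative - C5 * exp (- ex' * t)) (at t within {0..})" for t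
    unfolding q_def[abs_def] using ex0 by (auto intro!: derivative_eq_intros)
  have dg: "((%t. ?U t * exp (- q t)) has_real_derivative (?U' t + C5 * exp (- ex' * t) * ?U t) * exp (- q t)) (at t within {0..})" if "t >= 0" for t
  proof -
    have "((%t. ?U t * exp (- q t)) has_real_derivative ?U' t * exp (- q t) + exp (- q t) * - (- C5 * exp (- ex' * t)) * ?U t) (at t within {0..})"
      by (rule DERIV_mult[OF dU[OF that] DERIV_chain2[OF DERIV_exp DERIV_minus[OF dq]]])
    then show ?thesis by (simp add: algebra_simps)
  qed
  have g: "?U 1 * exp (- q 1) <= ?U t" if t: "1 <= t" for t
  proof -
    have "?U 1 * exp (- q 1) <= ?U t * exp (- q t)"
    proof (rule nonneg_derivative_mono[OF dg _ _ t])
      fix u :: real assume "u > 0"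
      then show "0 <= (?U' u + C5 * exp (- ex' * u) * ?U u) * exp (- q u)"
        using low[of u] by (intro mult_nonneg_nonneg) auto
    qed auto
    also have "... <= ?U t * 1"
      using z_bounds(1)[OF _ kS, of t] t C0 ex0 by (intro mult_left_mono) (auto simp: q_def)
    finally show ?thesis by simp
  qed
  have "?U 1 * exp (- q 1) <= L"
  proof (rule tendsto_lowerbound[OF UL])
    show "\<forall>\<^sub>F t in at_top. ?U 1 * exp (- q 1) <= ?U t"
      using eventually_ge_at_top[of 1] by (rule eventually_mono) (rule g)
  qed simp
  moreover have "0 < ?U 1 * exp (- q 1)" using z_positive[OF k1(1,2), of 1] by simp
  ultimately have "0 < L" by linarith
  then show ?thesis using UL by blast
qed

abbreviation d where "d \<equiv> d_const K l R z"

theorem slow_constants: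
  assumes k: "k \<in> slow K l R"
  shows "EX L. (shifted_log K l R z k \<longlongrightarrow> L) at_top" "0 < d k"
    "((%t. z t (enat k) * exp (ex' * t) / real k) \<longlongrightarrow> d k) at_top"
proof -
  obtain L where L: "0 < L" "((%t. z t (enat k) * exp (ex' * t)) \<longlongrightarrow> L) at_top"
    using slow_limit[OF k] by blast
  have k1: "1 <= k" "k <= K" using slow_subset k by auto
  have "((%t. ln (z t (enat k) * exp (ex' * t))) \<longlongrightarrow> ln L) at_top"
    using L by (intro tendsto_ln) auto
  moreover have "\<forall>\<^sub>F t in at_top. ln (z t (enat k) * exp (ex' * t)) = shifted_log K l R z k t"
    using eventually_gt_at_top[of 0]
  proof eventually_elim
    case (elim t)
    show ?case using z_positive[OF k1 elim] by (simp add: shifted_log_def ln_mult)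
  qed
  ultimately have lim: "(shifted_log K l R z k \<longlongrightarrow> ln L) at_top" by (rule Lim_transform_eventually)
  then show "EX L. (shifted_log K l R z k \<longlongrightarrow> L) at_top" by blast
  have "c_const K l R z k = ln L" unfolding c_const_def using lim by (intro tendsto_Lim) auto
  then have d: "d k = L / real k" using L(1) by (simp add: d_const_def)
  then show "0 < d k" using L(1) k1 by simp
  show "((%t. z t (enat k) * exp (ex' * t) / real k) \<longlongrightarrow> d k) at_top"
    unfolding d using k1 by (intro tendsto_divide L(2) tendsto_const) auto
qed

end

section \<open>Polynomially small sequences\<close>

text \<open>A negative power of \<open>n\<close> survives multiplication by \<open>ln n\<close>.
  This yields the rate \<open>o(1 / ln n)\<close> and absorbs sums over \<open>O(n * ln n)\<close>
  rounds divided by \<open>n\<close>.\<close>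

definition tiny :: "(nat => real) => bool" where
  "tiny f \<longleftrightarrow> (EX \<epsilon>>0. \<forall>\<^sub>F n in sequentially. f n <= real n powr (- \<epsilon>))"

lemma tiny_mono: "\<forall>\<^sub>F n in sequentially. f n <= g n ==> tiny g ==> tiny f"
proof -
  assume le: "\<forall>\<^sub>F n in sequentially. f n <= g n" and "tiny g"
  then obtain e where e: "e > 0" "\<forall>\<^sub>F n in sequentially. g n <= real n powr (- e)" by (auto simp: tiny_def)
  from le e(2) have "\<forall>\<^sub>F n in sequentially. f n <= real n powr (- e)" by eventually_elim (rule order_trans)
  then show ?thesis using e(1) unfolding tiny_def by blast
qed

lemma tiny_ln_powr:
  assumes x: "x < 0"
  shows "tiny (%n. C * (ln (real n) * real n powr x))"
proof -
  have "(%n. C * (ln (real n) / real n powr (- x / 2))) \<longlonglongrightarrow> C * 0"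
    using x by (intro tendsto_mult tendsto_const lim_ln_over_power) auto
  then have "\<forall>\<^sub>F n in sequentially. C * (ln (real n) / real n powr (- x / 2)) < 1"
    by (intro order_tendstoD) auto
  then have "\<forall>\<^sub>F n in sequentially. C * (ln (real n) * real n powr x) <= real n powr (- (- x / 2))"
    using eventually_gt_at_top[of 0]
  proof eventually_elim
    case (elim n)
    have p: "real n powr x = real n powr (x / 2) / real n powr (- x / 2)"
      using elim(2) by (simp flip: powr_diff)
    have "C * (ln (real n) * real n powr x) = C * (ln (real n) / real n powr (- x / 2)) * real n powr (x / 2)"
      unfolding p by simp
    also have "... <= 1 * real n powr (x / 2)" using elim(1) by (intro mult_right_mono) auto
    finally show ?case by simp
  qed
  then show ?thesis unfolding tiny_def using x by (intro exI[of _ "- x / 2"]) auto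
qed

lemma ev_ln_ge: "\<forall>\<^sub>F n in sequentially. c <= ln (real n)"
  using filterlim_compose[OF ln_at_top filterlim_real_sequentially] by (simp add: filterlim_at_top)

lemma tiny_powr:
  assumes x: "x < 0"
  shows "tiny (%n. C * real n powr x)"
proof (rule tiny_mono[OF _ tiny_ln_powr[OF x, of "\<bar>C\<bar>"]])
  show "\<forall>\<^sub>F n in sequentially. C * real n powr x <= \<bar>C\<bar> * (ln (real n) * real n powr x)"
    using ev_ln_ge[of 1]
  proof eventually_elim
    case (elim n)
    have "C * real n powr x <= \<bar>C\<bar> * (1 * real n powr x)" by (simp add: mult_right_mono)
    also have "... <= \<bar>C\<bar> * (ln (real n) * real n powr x)" using elim by (intro mult_left_mono mult_right_mono) auto
    finally show ?case .
  qed
qed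

lemma powr_plus_minus_one: "0 < x ==> x powr (a + - 1) = x powr a / (x::real)"
  by (metis add_uminus_conv_diff less_imp_le powr_diff powr_one)

lemma rate_algebra:
  fixes m :: real
  assumes "0 < m"
  shows "g * k * (C * (m * L)) * (27 * (a / m) + 6 * (b / m)) = g * k * C * (27 * (L * a) + 6 * (L * b))"
    "C * (m * L) * ((2 + 18 * p) * (a / m) + 12 * p / m * b) = C * (2 + 18 * p) * (L * a) + C * 12 * p * (L * b)"
    "C * (m * L) * (q * (k * (3 * (a / m) + 2 / m * b))) = q * k * C * (3 * (L * a) + 2 * (L * b))"
  using assms by (simp_all add: field_simps)

lemma tiny_add:
  assumes "tiny f" "tiny g"
  shows "tiny (%n. f n + g n)"
proof -
  obtain a where a: "a > 0" "\<forall>\<^sub>F n in sequentially. f n <= real n powr (- a)" using assms(1) by (auto simp: tiny_def)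
  obtain b where b: "b > 0" "\<forall>\<^sub>F n in sequentially. g n <= real n powr (- b)" using assms(2) by (auto simp: tiny_def)
  have "tiny (%n. 2 * real n powr (- min a b))" using a b by (intro tiny_powr) auto
  moreover have "\<forall>\<^sub>F n in sequentially. f n + g n <= 2 * real n powr (- min a b)"
    using a(2) b(2) eventually_ge_at_top[of 1]
  proof eventually_elim
    case (elim n)
    have "real n powr (- a) <= real n powr (- min a b)" "real n powr (- b) <= real n powr (- min a b)"
      using elim(3) by (auto intro: powr_mono)
    then show ?case using elim by linarith
  qed
  ultimately show ?thesis by (rule tiny_mono[rotated])
qed

lemma tiny_cmult:
  assumes "tiny f" "0 <= C"
  shows "tiny (%n. C * f n)"
proof -
  obtain a where a: "a > 0" "\<forall>\<^sub>F n in sequentially. f n <= real n powr (- a)" using assms(1) by (auto simp: tiny_def)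
  have le: "\<forall>\<^sub>F n in sequentially. C * f n <= C * real n powr (- a)"
    using a(2) by (rule eventually_mono) (rule mult_left_mono[OF _ assms(2)])
  have "- a < 0" using a(1) by simp
  from tiny_mono[OF le tiny_powr[OF this]] show ?thesis .
qed

lemma tiny_ln_tendsto:
  assumes "tiny f" "\<forall>\<^sub>F n in sequentially. 0 <= f n"
  shows "(%n. ln (real n) * f n) \<longlonglongrightarrow> 0"
proof -
  obtain a where a: "a > 0" "\<forall>\<^sub>F n in sequentially. f n <= real n powr (- a)" using assms(1) by (auto simp: tiny_def)
  have l: "(%n. ln (real n) / real n powr a) \<longlonglongrightarrow> 0" using a(1) by (rule lim_ln_over_power)
  show ?thesis
  proof (rule tendsto_sandwich[OF _ _ tendsto_const l])
    show "\<forall>\<^sub>F n in sequentially. 0 <= ln (real n) * f n"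
      using assms(2) ev_ln_ge[of 0] by eventually_elim (rule mult_nonneg_nonneg)
    show "\<forall>\<^sub>F n in sequentially. ln (real n) * f n <= ln (real n) / real n powr a"
      using a(2) ev_ln_ge[of 0]
    proof eventually_elim
      case (elim n)
      have "ln (real n) * f n <= ln (real n) * real n powr (- a)" using elim by (intro mult_left_mono)
      then show ?case by (simp add: powr_minus divide_inverse)
    qed
  qed
qed

lemma tiny_tendsto:
  assumes "tiny f" "\<forall>\<^sub>F n in sequentially. 0 <= f n"
  shows "f \<longlonglongrightarrow> 0"
proof (rule tendsto_sandwich[OF assms(2) _ tendsto_const tiny_ln_tendsto[OF assms]])
  show "\<forall>\<^sub>F n in sequentially. f n <= ln (real n) * f n"
    using assms(2) ev_ln_ge[of 1]
  proof eventually_elim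
    case (elim n)
    then have "1 * f n <= ln (real n) * f n" by (intro mult_right_mono)
    then show ?case by simp
  qed
qed

section \<open>Choice of the time scales\<close>

context rule_ode
begin

text \<open>The first bound keeps the Gronwall growth up to \<open>n1\<close> below a power
  \<open>1 / 8\<close> of \<open>n\<close>. The second gives \<open>sl <= 1 / (16 * ex')\<close>,
  where \<open>n powr (- sl)\<close> is roughly the decay of slow counts up to \<open>n1\<close>;
  \<open>Mean_V_rng\<close> needs \<open>sl\<close> this small compared with
  \<open>1 / ex'\<close>.\<close>

definition dl :: real where "dl = min (1 / (8 * (gw1 1 + 1))) (1 / (16 * ex'\<^sup>2))"

definition sl :: real where "sl = ex' * dl"

lemma dl: "0 < dl" "gw1 1 * dl <= 1 / 8" "dl <= 1 / 16"
  and sl: "0 < sl" "sl <= 1 / (16 * ex')" "sl <= 1 / 16"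
proof -
  have g: "0 <= gw1 1" using gw_nonneg[of 1] by simp
  have e: "1 <= ex'\<^sup>2" using ex'1 by simp
  show dl0: "0 < dl" using g ex_pos by (simp add: dl_def)
  have "gw1 1 * dl <= (gw1 1 + 1) * dl" using dl0 by (intro mult_right_mono) auto
  also have "... <= (gw1 1 + 1) * (1 / (8 * (gw1 1 + 1)))" using g by (intro mult_left_mono) (auto simp: dl_def)
  also have "... = 1 / 8" using g by (simp add: field_simps)
  finally show "gw1 1 * dl <= 1 / 8" .
  have "dl <= 1 / (16 * ex'\<^sup>2)" by (simp add: dl_def)
  also have d2: "... <= 1 / 16" using e by (intro frac_le) auto
  finally show "dl <= 1 / 16" .
  show "0 < sl" using dl0 ex'1 by (simp add: sl_def)
  have "sl <= ex' * (1 / (16 * ex'\<^sup>2))" unfolding sl_def using ex'1 by (intro mult_left_mono) (auto simp: dl_def)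
  also have "... = 1 / (16 * ex')" using ex'1 by (simp add: power2_eq_square)
  finally show s: "sl <= 1 / (16 * ex')" .
  have "1 / (16 * ex') <= 1 / 16" using ex'1 by (intro frac_le) auto
  with s show "sl <= 1 / 16" by linarith
qed

text \<open>By time \<open>n0\<close> at most a fraction \<open>zt\<close> of the vertices is outside large components. By time \<open>n1\<close> the
  differential equations still describe the process: \<open>dl\<close> is so small that the Gronwall factor
  \<open>exp (gw1 1 * n1 / n)\<close> is at most \<open>n powr (1 / 8)\<close>. After time \<open>hz\<close> the graph is connected with
  probability \<open>1 - O(1 / n\<^sup>2)\<close>.\<close>

definition n0 :: "nat => nat" where "n0 n = nat \<lfloor>dl / 4 * (real n * ln (real n))\<rfloor>"
definition n1 :: "nat => nat" where "n1 n = nat \<lfloor>dl * (real n * ln (real n))\<rfloor>"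
definition hz :: "nat => nat" where "hz n = nat \<lceil>3 / base_rate * (real n * ln (real n))\<rceil>"
definition zt :: "nat => real" where "zt n = real n powr (- (base_rate * dl / 16))"

lemma zt_inverse: "zt n = 1 / real n powr (base_rate * dl / 16)"
  unfolding zt_def powr_minus inverse_eq_divide ..

abbreviation nl :: "nat => real" where "nl n \<equiv> real n * ln (real n)"

lemma scale_bounds:
  assumes n: "n >= 3"
  shows "1 <= ln (real n)" "3 <= nl n"
    "real (n0 n) <= dl / 4 * nl n" "dl / 4 * nl n - 1 <= real (n0 n)"
    "real (n1 n) <= dl * nl n" "dl * nl n - 1 <= real (n1 n)"
    "3 / base_rate * nl n <= real (hz n)" "real (hz n) <= 3 / base_rate * nl n + 1"
    "n0 n <= n1 n" "n1 n <= hz n"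
proof -
  have "exp 1 <= real n" using exp_le n by linarith
  then show l1: "1 <= ln (real n)" using n by (simp add: ln_ge_iff)
  have "real n * 1 <= nl n" using l1 by (intro mult_left_mono) auto
  then show nl3: "3 <= nl n" using n by linarith
  have nn: "0 <= dl / 4 * nl n" "0 <= dl * nl n" "0 <= 3 / base_rate * nl n"
    using nl3 dl(1) base_rate by (auto intro!: mult_nonneg_nonneg)
  show "real (n0 n) <= dl / 4 * nl n" "dl / 4 * nl n - 1 <= real (n0 n)"
    unfolding n0_def using nn(1) by linarith+
  show "real (n1 n) <= dl * nl n" "dl * nl n - 1 <= real (n1 n)"
    unfolding n1_def using nn(2) by linarith+
  show "3 / base_rate * nl n <= real (hz n)" "real (hz n) <= 3 / base_rate * nl n + 1"
    unfolding hz_def using nn(3) by linarith+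
  have "dl / 4 * nl n <= dl * nl n" using nl3 dl(1) by (intro mult_right_mono) auto
  then show "n0 n <= n1 n" unfolding n0_def n1_def by (intro nat_mono floor_mono)
  have "dl <= 3 / base_rate"
  proof -
    have "1 <= 1 / base_rate" using base_rate by simp
    then have "3 <= 3 / base_rate" by simp
    then show ?thesis using dl(3) by linarith
  qed
  then have "dl * nl n <= 3 / base_rate * nl n" using nl3 by (intro mult_right_mono) auto
  then have "real (n1 n) <= real (hz n)"
    using \<open>real (n1 n) <= dl * nl n\<close> \<open>3 / base_rate * nl n <= real (hz n)\<close> by linarith
  then show "n1 n <= hz n" by simp
qed

definition ok :: "nat => bool" where
  "ok n \<longleftrightarrow> n >= 3 & K < n & late n (n0 n) (zt n) (hz n) & real n >= 2 ^ (l + 1) * real (l * K)"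

lemma ev_real_ge: "\<forall>\<^sub>F n in sequentially. c <= real n"
  using filterlim_real_sequentially by (simp add: filterlim_at_top)

text \<open>\<open>zt n\<close> is a negative power of \<open>n\<close>, while the window up to
  \<open>hz n\<close> has only \<open>O(n * ln n)\<close> rounds, so the accumulated loss in
  \<open>late\<close> tends to 0.\<close>

lemma ev_ok: "\<forall>\<^sub>F n in sequentially. ok n"
proof -
  have z: "(%n. (ex' + 1) * real l * (3 / base_rate + 1) * (ln (real n) / real n powr (base_rate * dl / 16))) \<longlonglongrightarrow>
     (ex' + 1) * real l * (3 / base_rate + 1) * 0"
    using base_rate dl by (intro tendsto_mult tendsto_const lim_ln_over_power) auto
  then have "\<forall>\<^sub>F n in sequentially. (ex' + 1) * real l * (3 / base_rate + 1) * (ln (real n) / real n powr (base_rate * dl / 16)) < 1 / 2"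
    by (intro order_tendstoD) auto
  then show ?thesis
    using eventually_ge_at_top[of 3] eventually_gt_at_top[of K] ev_real_ge[of "2 * ex'"] ev_real_ge[of "2 ^ (l + 1) * real (l * K)"]
  proof eventually_elim
    case (elim n)
    note sb = scale_bounds[OF elim(2)]
    have n0: "0 < real n" using elim(2) by simp
    have zt0: "0 <= zt n" by (simp add: zt_def)
    have ztinv: "zt n = 1 / real n powr (base_rate * dl / 16)" by (rule zt_inverse)
    have A: "(ex' + 1) * real l * (3 / base_rate + 1) * (ln (real n) * zt n) < 1 / 2"
      using elim(1) by (simp add: ztinv)
    have c1: "1 <= 3 / base_rate + 1" using base_rate by simp
    have "real l * zt n <= (ex' + 1) * real l * (3 / base_rate + 1) * (ln (real n) * zt n)"
    proof -
      have "1 * (real l * zt n) * 1 * 1 <= (ex' + 1) * (real l * zt n) * (3 / base_rate + 1) * ln (real n)"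
        using ex'1 zt0 sb(1) c1 by (intro mult_mono mult_nonneg_nonneg) auto
      then show ?thesis by (simp add: mult_ac)
    qed
    then have l1: "real l * zt n <= 1" using A by linarith
    have "(ex' + 1) * (real l * zt n) * real (hz n - n0 n) / real n
       <= (ex' + 1) * (real l * zt n) * ((3 / base_rate + 1) * nl n) / real n"
    proof (intro divide_right_mono mult_left_mono mult_nonneg_nonneg)
      have "real (hz n - n0 n) <= real (hz n)" by simp
      also have "... <= 3 / base_rate * nl n + nl n" using sb by linarith
      finally show "real (hz n - n0 n) <= (3 / base_rate + 1) * nl n" by (simp add: algebra_simps)
    qed (use ex'1 zt0 in auto)
    also have "... = (ex' + 1) * real l * (3 / base_rate + 1) * (ln (real n) * zt n)"
      using n0 by simp
    finally have "(ex' + 1) * (real l * zt n) * real (hz n - n0 n) / real n <= 1 / 2" using A by linarith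
    then show ?case using elim sb l1 zt0 unfolding ok_def late_def by auto
  qed
qed

lemma okD:
  assumes "ok n"
  shows "n >= 1" "n >= 3" "late n (n0 n) (zt n) (hz n)" "real l * zt n <= 1" "ex' <= real n" "K < n"
    "real n >= 2 ^ (l + 1) * real (l * K)"
  using assms ex'1 late_n[of n "n0 n" "zt n" "hz n"] by (auto simp: ok_def)

lemma exp_ln_powr: "n >= 1 ==> exp (c * ln (real n)) = real n powr c"
  by (simp add: powr_def)

text \<open>Counting the decay only from \<open>n0\<close> on instead of from the start costs
  \<open>n powr (sl / 4)\<close>, since \<open>n0\<close> is a quarter of \<open>n1\<close> up to
  rounding.\<close>

lemma dec_shift:
  assumes n: "n >= 3" and N: "n0 n <= N"
  shows "dec ex' n (N - n0 n) <= dec ex' n N * real n powr (sl / 4)"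
proof -
  note sb = scale_bounds[OF n]
  have n0: "0 < real n" using n by simp
  have "dec ex' n (N - n0 n) = dec ex' n N * exp (ex' * real (n0 n) / real n)"
    using N n0 by (simp add: dec_def exp_add[symmetric] of_nat_diff field_simps)
  also have "ex' * real (n0 n) / real n <= sl / 4 * ln (real n)"
  proof -
    have "ex' * real (n0 n) <= ex' * (dl / 4 * nl n)" using sb ex'1 by (intro mult_left_mono) auto
    then have "ex' * real (n0 n) / real n <= ex' * (dl / 4 * nl n) / real n" by (intro divide_right_mono) auto
    then show ?thesis using n0 by (simp add: sl_def)
  qed
  then have "exp (ex' * real (n0 n) / real n) <= real n powr (sl / 4)"
    using n exp_ln_powr[of n "sl / 4"] by (metis exp_le_cancel_iff le_trans one_le_numeral)
  then have "dec ex' n N * exp (ex' * real (n0 n) / real n) <= dec ex' n N * real n powr (sl / 4)"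
    using dec_pos by (intro mult_left_mono) (auto simp: less_imp_le)
  finally show ?thesis .
qed

lemma exp_div_le_3: "0 <= c ==> c <= real n ==> n >= 1 ==> exp (c / real n) <= 3"
proof -
  assume "0 <= c" "c <= real n" "n >= 1"
  then have "exp (c / real n) <= exp 1" by (simp add: divide_le_eq_1)
  then show ?thesis using exp_bounds by linarith
qed

text \<open>The three quarters of \<open>n1\<close> after \<open>n0\<close> provide the polynomial
  gain \<open>n powr (- 3 * sl / 4)\<close> that makes the errors of the generating functions
  vanish.\<close>

lemma dec_gap:
  assumes "ok n"
  shows "dec ex' n (n1 n - n0 n) <= 3 * real n powr (- 3 * sl / 4)"
proof -
  note o = okD[OF assms]
  note sb = scale_bounds[OF o(2)]
  have n0: "0 < real n" using o(1) by simp
  have "real (n1 n - n0 n) = real (n1 n) - real (n0 n)" using sb(9) by (rule of_nat_diff)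
  then have "3 * dl / 4 * nl n - 1 <= real (n1 n - n0 n)" using sb(3,6) by linarith
  then have "ex' * (3 * dl / 4 * nl n - 1) <= ex' * real (n1 n - n0 n)"
    using ex'1 by (intro mult_left_mono) auto
  then have "ex' * (3 * dl / 4 * nl n - 1) / real n <= ex' * real (n1 n - n0 n) / real n"
    by (rule divide_right_mono) simp
  moreover have "ex' * (3 * dl / 4 * nl n - 1) / real n = 3 * sl / 4 * ln (real n) - ex' / real n"
    using n0 by (simp add: sl_def field_simps)
  ultimately have "- (ex' * real (n1 n - n0 n) / real n) <= ex' / real n + - 3 * sl / 4 * ln (real n)" by simp
  then have "dec ex' n (n1 n - n0 n) <= exp (ex' / real n + - 3 * sl / 4 * ln (real n))"
    by (simp add: dec_def)
  also have "... = exp (ex' / real n) * real n powr (- 3 * sl / 4)"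
    using exp_ln_powr[OF o(1), of "- 3 * sl / 4"] by (simp only: exp_add)
  also have "... <= 3 * real n powr (- 3 * sl / 4)"
    using exp_div_le_3[OF _ o(5,1)] ex'1 by (intro mult_right_mono) auto
  finally show ?thesis .
qed

text \<open>The times at which so few small components are left that rounds hitting two of them at once no
  longer matter.\<close>

definition rng :: "nat => nat => bool" where
  "rng n N \<longleftrightarrow> n1 n <= N & N <= hz n & real n * dec ex' n N <= real n powr (sl / 6)"

text \<open>The exponent is \<open>sl / 6\<close> from \<open>rng\<close> plus \<open>sl / 4\<close>
  from \<open>dec_shift\<close>, less 1.\<close>

lemma rng_dec:
  assumes "ok n" "rng n N"
  shows "dec ex' n (N - n0 n) <= real n powr (5 * sl / 12 - 1)"
proof -
  note o = okD[OF assms(1)]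
  have n0: "0 < real n" using o(1) by simp
  have N: "n0 n <= N" using assms(2) scale_bounds(9)[OF o(2)] by (auto simp: rng_def)
  have d: "dec ex' n N <= real n powr (sl / 6) * real n powr (- 1)"
    using assms(2) n0 by (simp add: rng_def powr_minus field_simps)
  have "dec ex' n (N - n0 n) <= dec ex' n N * real n powr (sl / 4)" by (rule dec_shift[OF o(2) N])
  also have "... <= real n powr (sl / 6) * real n powr (- 1) * real n powr (sl / 4)"
    using d by (intro mult_right_mono) auto
  also have "... = real n powr (5 * sl / 12 - 1)"
    unfolding powr_add[symmetric] by (rule arg_cong[where f = "%x. real n powr x"]) simp
  finally show ?thesis .
qed

lemma hz_le: "n >= 3 ==> real (hz n) <= (3 / base_rate + 1) * nl n"
  using scale_bounds[of n] by (simp add: algebra_simps)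

definition CH :: real where "CH = 3 / base_rate + 1"

lemma CH: "0 < CH" using base_rate by (simp add: CH_def add_pos_pos)

text \<open>The bound of \<open>generating_phase\<close> over at most \<open>CH * n * ln n\<close>
  rounds; the exponent \<open>- sl / 3\<close> is \<open>5 * sl / 12 - 3 * sl / 4\<close> from
  \<open>rng_dec\<close> and \<open>dec_gap\<close>.\<close>

definition gerr :: "nat => real" where
  "gerr n = gen_const * (real K)^2 * CH * (27 * (ln (real n) * real n powr (- sl / 3)) + 6 * (ln (real n) * real n powr (5 * sl / 12 - 1)))"

lemma tiny_gerr: "tiny gerr"
proof -
  have "tiny (%n. gen_const * (real K)^2 * CH * 27 * (ln (real n) * real n powr (- sl / 3))
     + gen_const * (real K)^2 * CH * 6 * (ln (real n) * real n powr (5 * sl / 12 - 1)))"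
    using sl by (intro tiny_add tiny_ln_powr) auto
  then show ?thesis by (simp add: gerr_def[abs_def] algebra_simps)
qed

lemma gen_const_nonneg: "0 <= gen_const"
  using ex'1 by (simp add: gen_const_def)

lemma generating_rng:
  assumes ok: "ok n" and N: "n1 n <= N1" "N1 <= N" "rng n N"
    and ST: "S \<subseteq> slow K l R" "T \<subseteq> slow K l R" "S \<inter> T = {}"
    and uw: "0 <= u" "u <= 1" "0 <= x" "x <= 1"
    and Z: "adapted N1 Z" "!!v. v \<in> Om n ==> 0 <= Z v" "!!v. v \<in> Om n ==> Z v <= Zg n (n0 n) (zt n) v"
  shows "\<bar>Mean n (%v. Z v * gf n S T u x (G n v N))
     - Mean n (%v. Z v * gf n S T (unroll n (N - N1) u) (unroll n (N - N1) x) (G n v N1))\<bar> <= gerr n"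
proof -
  note o = okD[OF ok]
  note sb = scale_bounds[OF o(2)]
  have n0: "0 < real n" using o(1) by simp
  let ?d = "dec ex' n (N - n0 n)" and ?d1 = "dec ex' n (N1 - n0 n)"
  have d: "?d <= real n powr (5 * sl / 12 - 1)" by (rule rng_dec[OF ok N(3)])
  have d1: "?d1 <= 3 * real n powr (- 3 * sl / 4)"
    by (rule order_trans[OF dec_antimono[OF _ diff_le_mono[OF N(1)]] dec_gap[OF ok]]) simp
  have NH: "real (N - N1) <= CH * nl n"
  proof -
    have "N <= hz n" using N(3) by (simp add: rng_def)
    then have "N - N1 <= hz n" by simp
    then have "real (N - N1) <= real (hz n)" by (rule of_nat_mono)
    then show ?thesis using hz_le[OF o(2)] by (simp add: CH_def)
  qed
  have B: "9 * ?d * ?d1 + 6 / real n * ?d <= 27 * (real n powr (- sl / 3) / real n) + 6 * (real n powr (5 * sl / 12 - 1) / real n)"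
  proof -
    have "9 * ?d * ?d1 <= 9 * real n powr (5 * sl / 12 - 1) * (3 * real n powr (- 3 * sl / 4))"
      using d d1 dec_pos by (intro mult_mono) (auto simp: less_imp_le)
    also have "... = 27 * real n powr (- sl / 3 + - 1)" 
    proof -
      have "real n powr (5 * sl / 12 - 1) * real n powr (- 3 * sl / 4) = real n powr (- sl / 3 + - 1)"
        unfolding powr_add[symmetric] by (rule arg_cong[where f = "%x. real n powr x"]) simp
      then show ?thesis by simp
    qed
    also have "real n powr (- sl / 3 + - 1) = real n powr (- sl / 3) / real n"
      using n0 by (rule powr_plus_minus_one)
    finally have 1: "9 * ?d * ?d1 <= 27 * (real n powr (- sl / 3) / real n)" .
    have "6 / real n * ?d <= 6 / real n * real n powr (5 * sl / 12 - 1)" using d by (intro mult_left_mono) auto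
    then show ?thesis using 1 by simp
  qed
  have "\<bar>Mean n (%v. Z v * gf n S T u x (G n v N))
     - Mean n (%v. Z v * gf n S T (unroll n (N - N1) u) (unroll n (N - N1) x) (G n v N1))\<bar>
     <= gen_const * (real K)^2 * real (N - N1) * (9 * ?d * ?d1 + 6 / real n * ?d)"
    using N sb by (intro generating_phase[OF o(3) _ N(2) _ ST uw Z]) (auto simp: rng_def)
  also have "... <= gen_const * (real K)^2 * (CH * nl n) *
      (27 * (real n powr (- sl / 3) / real n) + 6 * (real n powr (5 * sl / 12 - 1) / real n))"
    using NH B gen_const_nonneg CH sb(2) dec_pos
    by (intro mult_mono mult_left_mono) (auto simp: less_imp_le intro!: add_nonneg_nonneg mult_nonneg_nonneg)
  also have "... = gerr n" unfolding gerr_def by (rule rate_algebra(1)[OF n0])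
  finally show ?thesis .
qed

definition verr :: "nat => real" where
  "verr n = CH * (2 + 18 * ((real l)^2 * (real K)^2)) * (ln (real n) * real n powr (- (1 / (2 * ex'))))
     + CH * 12 * ((real l)^2 * (real K)^2) * (ln (real n) * real n powr (5 * sl / 12 - 1))"

lemma tiny_verr: "tiny verr"
  unfolding verr_def[abs_def] using sl ex'1 by (intro tiny_add tiny_ln_powr) auto

text \<open>The faster rate is exploited as a power: \<open>dec (ex' + 1)\<close> equals
  \<open>dec ex'\<close> to the power \<open>1 + 1 / ex'\<close>. Since \<open>dec ex'\<close> is
  \<open>1 / n\<close> up to a factor \<open>n powr (5 * sl / 12)\<close>, the gain
  \<open>1 / ex'\<close> outweighs that factor and leaves \<open>n powr (- (1 / (2 * ex')))\<close>
  below \<open>1 / n\<close>.\<close>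

lemma Mean_V_rng:
  assumes ok: "ok n" and N: "rng n N"
  shows "Mean n (%v. Zg n (n0 n) (zt n) v * V n (G n v N)) <= verr n"
proof -
  note o = okD[OF ok]
  note sb = scale_bounds[OF o(2)]
  have n0: "0 < real n" "1 <= real n" using o(1) by auto
  let ?j = "N - n0 n"
  let ?d = "dec ex' n ?j" and ?D = "dec (ex' + 1) n ?j"
  let ?C = "(real l)^2 * (real K)^2"
  have d: "?d <= real n powr (5 * sl / 12 - 1)" by (rule rng_dec[OF ok N])
  have "?D = exp ((1 + 1 / ex') * (- ex' * real ?j / real n))"
  proof -
    have e: "(1 + 1 / ex') * ex' = ex' + 1" using ex'1 by (simp add: distrib_right)
    have "(1 + 1 / ex') * (- ex' * real ?j / real n) = - ((1 + 1 / ex') * ex') * real ?j / real n" by simp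
    then show ?thesis unfolding dec_def e by simp
  qed
  also have "... = ?d powr (1 + 1 / ex')" by (simp add: dec_def powr_def)
  also have "... <= (real n powr (5 * sl / 12 - 1)) powr (1 + 1 / ex')"
    using d dec_pos ex'1 by (intro powr_mono2) (auto simp: less_imp_le)
  also have "... = real n powr ((5 * sl / 12 - 1) * (1 + 1 / ex'))" by (rule powr_powr)
  also have "... <= real n powr (- (1 / (2 * ex')) + - 1)"
  proof (rule powr_mono[OF _ n0(2)])
    have "5 * sl / 12 * (1 + 1 / ex') <= 5 * (1 / (16 * ex')) / 12 * (1 + 1)"
      using sl ex'1 by (intro mult_mono divide_right_mono mult_left_mono add_left_mono) auto
    also have "... <= 1 / (2 * ex')" using ex'1 by (simp add: field_simps)
    finally have "5 * sl / 12 * (1 + 1 / ex') <= 1 / (2 * ex')" .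
    moreover have "(5 * sl / 12 - 1) * (1 + 1 / ex') = 5 * sl / 12 * (1 + 1 / ex') - 1 - 1 / ex'"
      by (simp add: algebra_simps)
    moreover have "1 / ex' = 1 / (2 * ex') + 1 / (2 * ex')" by simp
    ultimately show "(5 * sl / 12 - 1) * (1 + 1 / ex') <= - (1 / (2 * ex')) + - 1" by linarith
  qed
  also have "... = real n powr (- (1 / (2 * ex'))) / real n"
    using n0(1) by (rule powr_plus_minus_one)
  finally have D: "?D <= real n powr (- (1 / (2 * ex'))) / real n" .
  have jH: "real ?j <= CH * nl n"
  proof -
    have "N <= hz n" using N by (simp add: rng_def)
    then have "?j <= hz n" by simp
    then have "real ?j <= real (hz n)" by (rule of_nat_mono)
    then show ?thesis using hz_le[OF o(2)] by (simp add: CH_def)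
  qed
  have nH: "real n <= CH * nl n"
  proof -
    have "real n * 1 <= nl n" using sb(1) by (intro mult_left_mono) auto
    also have "... <= CH * nl n" using base_rate sb(2) by (simp add: CH_def mult_le_cancel_right1)
    finally show ?thesis by simp
  qed
  have "Mean n (%v. Zg n (n0 n) (zt n) v * V n (G n v N)) <=
    2 * real n * ?D + real ?j * (18 * ?C * ?D + 12 * ?C / real n * ?d)"
    using N sb by (intro Mean_V_late[OF o(3)]) (auto simp: rng_def)
  also have "... <= 2 * (CH * nl n) * ?D + (CH * nl n) * (18 * ?C * ?D + 12 * ?C / real n * ?d)"
    using jH nH dec_pos by (intro add_mono mult_right_mono) (auto simp: less_imp_le intro!: add_nonneg_nonneg mult_nonneg_nonneg)
  also have "... = CH * nl n * ((2 + 18 * ?C) * ?D + 12 * ?C / real n * ?d)" by (simp add: algebra_simps)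
  also have "... <= CH * nl n * ((2 + 18 * ?C) * (real n powr (- (1 / (2 * ex'))) / real n)
      + 12 * ?C / real n * real n powr (5 * sl / 12 - 1))"
    using D d CH sb(2) by (intro mult_left_mono add_mono) (auto intro!: mult_nonneg_nonneg)
  also have "... = verr n" unfolding verr_def by (rule rate_algebra(2)[OF n0(1)])
  finally show ?thesis .
qed

definition werr :: "nat => real" where
  "werr n = (real l)^2 * (real K)^2 * CH * (3 * (ln (real n) * real n powr (5 * sl / 6 - 1)) + 2 * (ln (real n) * real n powr (5 * sl / 12 - 1)))"

lemma tiny_werr: "tiny werr"
proof -
  have "tiny (%n. (real l)^2 * (real K)^2 * CH * 3 * (ln (real n) * real n powr (5 * sl / 6 - 1))
     + (real l)^2 * (real K)^2 * CH * 2 * (ln (real n) * real n powr (5 * sl / 12 - 1)))"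
    using sl by (intro tiny_add tiny_ln_powr) auto
  then show ?thesis by (simp add: werr_def[abs_def] algebra_simps)
qed

text \<open>Bounds the expected number of \<open>multi\<close> rounds between \<open>N\<close> and
  \<open>hz n\<close> on \<open>good\<close> paths. The square of
  \<open>n powr (5 * sl / 12 - 1)\<close> leaves a factor \<open>1 / n\<close> to compensate the
  number of rounds.\<close>

lemma sum_Wm_rng:
  assumes ok: "ok n" and N: "rng n N"
  shows "(SUM M:{N..<hz n}. (real l)^2 * Wm n (n0 n) (zt n) M) <= werr n"
proof -
  note o = okD[OF ok]
  note sb = scale_bounds[OF o(2)]
  have n0: "0 < real n" using o(1) by simp
  let ?d = "real n powr (5 * sl / 12 - 1)"
  let ?B = "(real l)^2 * ((real K)^2 * (3 * ?d\<^sup>2 + 2 / real n * ?d))"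
  have "(SUM M:{N..<hz n}. (real l)^2 * Wm n (n0 n) (zt n) M) <= (SUM M:{N..<hz n}. ?B)"
  proof (rule sum_mono)
    fix M assume M: "M \<in> {N..<hz n}"
    have N0: "n0 n <= N" using N sb by (auto simp: rng_def)
    have "dec ex' n (M - n0 n) <= dec ex' n (N - n0 n)" using M by (intro dec_antimono) auto
    also have "... <= ?d" by (rule rng_dec[OF ok N])
    finally have d: "dec ex' n (M - n0 n) <= ?d" .
    have "Wm n (n0 n) (zt n) M <= (real K)^2 * (3 * (dec ex' n (M - n0 n))^2 + 2 / real n * dec ex' n (M - n0 n))"
      using M N0 by (intro Wm_bound[OF o(3)]) auto
    also have "... <= (real K)^2 * (3 * ?d\<^sup>2 + 2 / real n * ?d)"
      using d dec_pos by (intro mult_left_mono add_mono power_mono) (auto simp: less_imp_le)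
    finally show "(real l)^2 * Wm n (n0 n) (zt n) M <= ?B" by (intro mult_left_mono) auto
  qed
  also have "... = real (hz n - N) * ?B" by simp
  also have "... <= CH * nl n * ?B"
  proof (intro mult_right_mono)
    have "real (hz n - N) <= real (hz n)" by simp
    then show "real (hz n - N) <= CH * nl n" using hz_le[OF o(2)] by (simp add: CH_def)
  qed auto
  also have "?d\<^sup>2 = real n powr (5 * sl / 6 - 1 + - 1)"
    unfolding power2_eq_square powr_add[symmetric] by (rule arg_cong[where f = "%x. real n powr x"]) simp
  also have "... = real n powr (5 * sl / 6 - 1) / real n"
    using n0 by (rule powr_plus_minus_one)
  also have "CH * nl n * ((real l)^2 * ((real K)^2 * (3 * (real n powr (5 * sl / 6 - 1) / real n) + 2 / real n * ?d))) = werr n"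
    unfolding werr_def by (rule rate_algebra(3)[OF n0])
  finally show ?thesis .
qed

definition bad :: "nat => real" where
  "bad n = 1 - Mean n (Zg n (n0 n) (zt n))"

lemma bad_nonneg: "n >= 1 ==> 0 <= bad n"
proof -
  assume n: "n >= 1"
  have "Mean n (Zg n (n0 n) (zt n)) <= Mean n (%_. 1)"
    by (rule Mean_mono[OF n adapted_Zg[OF order_refl] adapted_const[of 0]]) (rule Zg_bounds)
  then show ?thesis by (simp add: bad_def Mean_const[OF n])
qed

lemma Mean_not_good: "n >= 1 ==> Mean n (%v. 1 - Zg n (n0 n) (zt n) v) = bad n"
  using Mean_diff[OF _ adapted_const[of 0 "1::real"] adapted_Zg[OF order_refl]] by (simp add: bad_def Mean_const)

text \<open>Markov's inequality. With \<open>?e = base_rate * dl / 16\<close> the universal decay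
  has reached \<open>n powr (- 4 * ?e)\<close> by \<open>n0\<close>, and the threshold
  \<open>zt n\<close> is \<open>n powr (- ?e)\<close>, which leaves
  \<open>n powr (- 3 * ?e)\<close>. The other term comes from the \<open>+ 1\<close> in
  \<open>good\<close>.\<close>

lemma tiny_bad: "tiny bad"
proof -
  let ?e = "base_rate * dl / 16"
  have e0: "0 < ?e" using base_rate dl by simp
  have "tiny (%n. real (K + 1) * 3 * real n powr (- (3 * ?e)) + real (K + 1) * real n powr (?e - 1))"
  proof (intro tiny_add tiny_powr)
    have "base_rate * dl <= 1 * (1 / 16)" using base_rate dl by (intro mult_mono) auto
    then show "?e - 1 < 0" by simp
  qed (use e0 in simp)
  moreover have "\<forall>\<^sub>F n in sequentially. bad n <= real (K + 1) * 3 * real n powr (- (3 * ?e)) + real (K + 1) * real n powr (?e - 1)"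
    using ev_ok
  proof eventually_elim
    case (elim n)
    note o = okD[OF elim]
    note sb = scale_bounds[OF o(2)]
    have n0: "0 < real n" using o(1) by simp
    have z0: "0 < zt n" using n0 by (simp add: zt_def)
    have adQ: "adapted (n0 n) (%v. F (G n v (n0 n)))" for F :: "nat set set => real" by (rule adapted_G'[OF order_refl])
    have "bad n = Mean n (%v. 1 - Zg n (n0 n) (zt n) v)" by (rule Mean_not_good[OF o(1), symmetric])
    also have "... <= Mean n (%v. real (K + 1) / (zt n * real n) * (Q n (G n v (n0 n)) + 1))"
    proof (rule Mean_mono[OF o(1) _ adQ[of "%E. real (K + 1) / (zt n * real n) * (Q n E + 1)"]])
      show "adapted (n0 n) (%v. 1 - Zg n (n0 n) (zt n) v)"
        by (rule adapted_comp1[where h = "%y. 1 - y", OF adapted_Zg[OF order_refl]])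
      fix v
      have nn: "0 <= real (K + 1) / (zt n * real n) * (Q n (G n v (n0 n)) + 1)"
        using Q_nonneg[OF o(1)] z0 by (intro mult_nonneg_nonneg) auto
      show "1 - Zg n (n0 n) (zt n) v <= real (K + 1) / (zt n * real n) * (Q n (G n v (n0 n)) + 1)"
      proof (cases "good n (n0 n) (zt n) v")
        case True
        then show ?thesis using nn by (simp add: Zg_def)
      next
        case False
        then have "zt n * real n < real (K + 1) * (Q n (G n v (n0 n)) + 1)" by (simp add: good_def)
        then have "1 <= real (K + 1) * (Q n (G n v (n0 n)) + 1) / (zt n * real n)"
          using z0 n0 by (subst pos_le_divide_eq) auto
        then show ?thesis using False by (simp add: Zg_def)
      qed
    qed
    also have "... = real (K + 1) / (zt n * real n) * (Mean n (%v. Q n (G n v (n0 n))) + 1)"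
      by (simp only: Mean_cmult Mean_add[OF o(1) adQ[of "Q n"] adapted_const[of 0 "1::real"]] Mean_const[OF o(1)])
    also have "... <= real (K + 1) / (zt n * real n) * (real n * (3 * real n powr (- (4 * ?e))) + 1)"
    proof (intro mult_left_mono add_right_mono)
      have r0: "0 <= 1 - base_rate / real n" using base_rate n0 o(1) by (simp add: field_simps)
      have "Mean n (%v. Q n (G n v (n0 n))) <= real n * (1 - base_rate / real n) ^ n0 n"
        by (rule Mean_Q_universal[OF o(7,1)])
      also have "... <= real n * exp (- (base_rate / real n) * real (n0 n))"
        using power_le_exp[OF r0, of "n0 n"] by (intro mult_left_mono) auto
      also have "... <= real n * (3 * real n powr (- (4 * ?e)))"
      proof (rule mult_left_mono)
        have "base_rate * (dl / 4 * nl n - 1) <= base_rate * real (n0 n)" using sb base_rate by (intro mult_left_mono) auto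
        then have "base_rate * (dl / 4 * nl n - 1) / real n <= base_rate * real (n0 n) / real n"
          by (rule divide_right_mono) simp
        moreover have "base_rate * (dl / 4 * nl n - 1) / real n = 4 * ?e * ln (real n) - base_rate / real n"
          using n0 by (simp add: field_simps)
        ultimately have "- (base_rate / real n) * real (n0 n) <= base_rate / real n + - (4 * ?e) * ln (real n)" by simp
        then have "exp (- (base_rate / real n) * real (n0 n)) <= exp (base_rate / real n + - (4 * ?e) * ln (real n))" by simp
        also have "... = exp (base_rate / real n) * real n powr (- (4 * ?e))"
          using exp_ln_powr[OF o(1), of "- (4 * ?e)"] by (simp only: exp_add)
        also have "... <= 3 * real n powr (- (4 * ?e))"
          using exp_div_le_3[of base_rate n] base_rate o(1) by (intro mult_right_mono) auto
        finally show "exp (- (base_rate / real n) * real (n0 n)) <= 3 * real n powr (- (4 * ?e))" .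
      qed simp
      finally show "Mean n (%v. Q n (G n v (n0 n))) <= real n * (3 * real n powr (- (4 * ?e)))" .
    qed (use z0 in auto)
    also have "... = real (K + 1) * 3 * (real n powr (- (4 * ?e)) / zt n) + real (K + 1) * (1 / (zt n * real n))"
      using n0 z0 by (simp add: field_simps)
    also have "real n powr (- (4 * ?e)) / zt n = real n powr (- (3 * ?e))"
      unfolding zt_def powr_diff[symmetric] by (rule arg_cong[where f = "%x. real n powr x"]) simp
    also have "1 / (zt n * real n) = real n powr (?e - 1)"
    proof -
      have pd: "real n powr (?e - 1) = real n powr ?e / real n powr 1" by (rule powr_diff)
      have zi: "zt n = 1 / real n powr ?e" by (rule zt_inverse)
      show ?thesis unfolding pd zi using n0 by simp
    qed
    finally show ?case .
  qed
  ultimately show ?thesis by (rule tiny_mono[rotated])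
qed

section \<open>Concentration at the starting time\<close>

text \<open>The order of magnitude of the slow counts at time \<open>n1\<close>: the count of the
  sizes in \<open>S\<close> divided by \<open>sc n\<close> is close to \<open>DD S\<close>.\<close>

definition sc :: "nat => real" where "sc n = real n * dec ex' n (n1 n)"

lemma sc_pos: "n >= 1 ==> 0 < sc n"
  by (simp add: sc_def dec_pos)

definition DD :: "nat set => real" where "DD S = (SUM k:S. d k)"

definition conc :: "nat set => real => nat => nat set set => bool" where
  "conc S \<theta> n E \<longleftrightarrow> \<bar>real (cnt n E S) / sc n - DD S\<bar> <= \<theta>"

lemma n1_ratio_at_top: "filterlim (%n. real (n1 n) / real n) at_top sequentially"
proof (rule filterlim_at_top_mono)
  show "filterlim (%n::nat. - 1 + dl * ln (real n)) at_top sequentially"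
    by (intro filterlim_tendsto_add_at_top[OF tendsto_const] filterlim_tendsto_pos_mult_at_top[OF tendsto_const dl(1)]
        filterlim_compose[OF ln_at_top filterlim_real_sequentially])
  show "\<forall>\<^sub>F n in sequentially. - 1 + dl * ln (real n) <= real (n1 n) / real n"
    using eventually_ge_at_top[of 3]
  proof eventually_elim
    case (elim n)
    have n0: "0 < real n" using elim by simp
    have "(dl * nl n - 1) / real n <= real (n1 n) / real n"
      using scale_bounds(6)[OF elim] by (intro divide_right_mono) auto
    moreover have "(dl * nl n - 1) / real n = dl * ln (real n) - 1 / real n" using n0 by (simp add: diff_divide_distrib)
    moreover have "1 / real n <= 1" using elim by simp
    ultimately show ?case by linarith
  qed
qed

text \<open>Chebyshev's inequality. Half of \<open>\<theta>\<close> is left to the convergence of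
  \<open>z\<close>, the other half to the random fluctuation, whose second moment
  \<open>sqdist\<close> is scaled by \<open>e ^ 2\<close>, at most \<open>n powr (2 * sl)\<close>.
  The exponent \<open>2 * sl + 1 / 8 - 1\<close> is negative.\<close>

theorem tiny_conc:
  assumes S: "S \<subseteq> slow K l R" and \<theta>: "0 < \<theta>"
  shows "tiny (%n. Mean n (%v. of_bool (~ conc S \<theta> n (G n v (n1 n)))))"
proof -
  have SK: "S \<subseteq> {1..K}" using S slow_subset by blast
  then have finS: "finite S" using finite_subset by blast
  let ?t = "%n. real (n1 n) / real n"
  have lim: "(%n. SUM k:S. z (?t n) (enat k) * exp (ex' * ?t n) / real k) \<longlonglongrightarrow> (SUM k:S. d k)"
  proof (rule tendsto_sum)
    fix k assume "k \<in> S"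
    then have "k \<in> slow K l R" using S by blast
    from slow_constants(3)[OF this] show "(%n. z (?t n) (enat k) * exp (ex' * ?t n) / real k) \<longlonglongrightarrow> d k"
      by (rule filterlim_compose[OF _ n1_ratio_at_top])
  qed
  then have close: "\<forall>\<^sub>F n in sequentially. \<bar>(SUM k:S. z (?t n) (enat k) * exp (ex' * ?t n) / real k) - DD S\<bar> < \<theta> / 2"
    using tendstoD[OF lim, of "\<theta> / 2"] \<theta> unfolding DD_def dist_real_def by simp
  define C where "C = 4 / \<theta>\<^sup>2 * real (K + 1) * dl * gw2 1"
  have "tiny (%n. C * (ln (real n) * real n powr (2 * sl + 1 / 8 - 1)))"
    using sl by (intro tiny_ln_powr) auto
  moreover have "\<forall>\<^sub>F n in sequentially. Mean n (%v. of_bool (~ conc S \<theta> n (G n v (n1 n))))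
      <= C * (ln (real n) * real n powr (2 * sl + 1 / 8 - 1))"
    using close ev_ok
  proof eventually_elim
    case (elim n)
    note o = okD[OF elim(2)]
    note sb = scale_bounds[OF o(2)]
    have n0: "0 < real n" using o(1) by simp
    define t where "t = ?t n"
    define e where "e = exp (ex' * t)"
    have t: "0 <= t" "t <= dl * ln (real n)"
      using sb(5) n0 by (auto simp: t_def field_simps)
    have e_le: "e <= real n powr sl"
    proof -
      have "ex' * t <= sl * ln (real n)" using t ex'1 mult_left_mono[of t "dl * ln (real n)" ex'] by (simp add: sl_def)
      then have "e <= exp (sl * ln (real n))" by (simp add: e_def)
      then show ?thesis by (simp add: exp_ln_powr[OF o(1)])
    qed
    have e0: "0 < e" by (simp add: e_def)
    have sce: "sc n = real n / e" using n0 by (simp add: sc_def dec_def e_def t_def exp_minus field_simps)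
    have pw: "of_bool (~ conc S \<theta> n E) <= 4 / \<theta>\<^sup>2 * e\<^sup>2 * real (K + 1) * sqdist n (n1 n) E" for E
    proof (cases "conc S \<theta> n E")
      case True
      have "0 <= sqdist n (n1 n) E" by (simp add: sqdist_def sum_nonneg)
      then have "0 <= 4 / \<theta>\<^sup>2 * e\<^sup>2 * real (K + 1) * sqdist n (n1 n) E"
        by (intro mult_nonneg_nonneg divide_nonneg_nonneg) auto
      then show ?thesis using True by simp
    next
      case False
      have c: "real (cnt n E S) / sc n = (SUM k:S. frac n E (enat k) * e / real k)"
      proof -
        have "real (cnt n E S) / sc n = (SUM k:S. real (cnt n E {k}) * e / real n)"
          unfolding cnt_small_sum[OF SK] sce by (simp add: sum_divide_distrib sum_distrib_right)
        also have "... = (SUM k:S. frac n E (enat k) * e / real k)"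
        proof (rule sum.cong[OF refl])
          fix k assume "k \<in> S"
          then have "1 <= k" "k <= K" using SK by auto
          then show "real (cnt n E {k}) * e / real n = frac n E (enat k) * e / real k"
            by (simp add: frac_small)
        qed
        finally show ?thesis .
      qed
      have "\<theta> < \<bar>real (cnt n E S) / sc n - DD S\<bar>" using False by (simp add: conc_def)
      moreover have "\<bar>(SUM k:S. z t (enat k) * e / real k) - DD S\<bar> < \<theta> / 2" using elim(1) by (simp add: t_def e_def)
      ultimately have "\<theta> / 2 <= \<bar>real (cnt n E S) / sc n - (SUM k:S. z t (enat k) * e / real k)\<bar>" by linarith
      also have "real (cnt n E S) / sc n - (SUM k:S. z t (enat k) * e / real k)
          = (SUM k:S. (frac n E (enat k) - z t (enat k)) * e / real k)"
        unfolding c by (simp add: sum_subtractf[symmetric] left_diff_distrib diff_divide_distrib)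
      also have "\<bar>...\<bar> <= (SUM k:S. \<bar>(frac n E (enat k) - z t (enat k)) * e / real k\<bar>)" by (rule sum_abs)
      also have "... <= (SUM k:S. \<bar>frac n E (enat k) - z t (enat k)\<bar> * e)"
      proof (rule sum_mono)
        fix k assume "k \<in> S"
        then have "1 <= real k" using SK by auto
        then have "\<bar>frac n E (enat k) - z t (enat k)\<bar> * e / real k <= \<bar>frac n E (enat k) - z t (enat k)\<bar> * e / 1"
          using e0 by (intro divide_left_mono) auto
        then show "\<bar>(frac n E (enat k) - z t (enat k)) * e / real k\<bar> <= \<bar>frac n E (enat k) - z t (enat k)\<bar> * e"
          using e0 by (simp add: abs_mult)
      qed
      also have "... <= (\<Sum>k=1..K. \<bar>frac n E (enat k) - z t (enat k)\<bar> * e)"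
        using SK e0 by (intro sum_mono2) auto
      also have "... <= (SUM q:SK K. \<bar>frac n E q - z t q\<bar>) * e"
        using e0 by (simp add: SK_split sum_distrib_right distrib_right)
      finally have A: "\<theta> / 2 <= (SUM q:SK K. \<bar>frac n E q - z t q\<bar>) * e" .
      have "(\<theta> / 2)^2 <= ((SUM q:SK K. \<bar>frac n E q - z t q\<bar>) * e)^2"
        using A \<theta> by (intro power_mono) auto
      also have "... <= (real (K + 1) * sqdist n (n1 n) E) * e\<^sup>2"
        unfolding power_mult_distrib sqdist_def t_def
        by (intro mult_right_mono sum_abs_squared_le) auto
      finally have "4 / \<theta>\<^sup>2 * (\<theta> / 2)^2 <= 4 / \<theta>\<^sup>2 * ((real (K + 1) * sqdist n (n1 n) E) * e\<^sup>2)"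
        by (intro mult_left_mono) auto
      moreover have "4 / \<theta>\<^sup>2 * (\<theta> / 2)^2 = 1" using \<theta> by (simp add: power2_eq_square)
      ultimately show ?thesis using False by (simp add: mult_ac)
    qed
    have "Mean n (%v. of_bool (~ conc S \<theta> n (G n v (n1 n)))) <= Mean n (%v. 4 / \<theta>\<^sup>2 * e\<^sup>2 * real (K + 1) * sqdist n (n1 n) (G n v (n1 n)))"
      by (rule Mean_mono[OF o(1) adapted_G'[where f = "%E. of_bool (~ conc S \<theta> n E)", OF order_refl]
            adapted_G'[where f = "%E. 4 / \<theta>\<^sup>2 * e\<^sup>2 * real (K + 1) * sqdist n (n1 n) E", OF order_refl]]) (rule pw)
    also have "... = 4 / \<theta>\<^sup>2 * e\<^sup>2 * real (K + 1) * Mean n (%v. sqdist n (n1 n) (G n v (n1 n)))" by (rule Mean_cmult)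
    also have "... <= 4 / \<theta>\<^sup>2 * (real n powr sl)^2 * real (K + 1) * ((dl * ln (real n)) * real n powr (1 / 8) * gw2 1 / real n)"
    proof (intro mult_mono mult_left_mono mult_right_mono power_mono e_le)
      have g: "0 <= gw1 1" "0 <= gw2 1" using gw_nonneg[of 1] by auto
      have "exp (gw1 1 * t) <= real n powr (1 / 8)"
      proof -
        have "gw1 1 * t <= gw1 1 * (dl * ln (real n))" using g t by (intro mult_left_mono)
        also have "... = gw1 1 * dl * ln (real n)" by simp
        also have "... <= 1 / 8 * ln (real n)" using dl(2) sb(1) by (intro mult_right_mono) auto
        finally have "exp (gw1 1 * t) <= exp (1 / 8 * ln (real n))" by simp
        then show ?thesis by (simp only: exp_ln_powr[OF o(1)])
      qed
      then have "t * exp (gw1 1 * t) * gw2 1 / real n <= (dl * ln (real n)) * real n powr (1 / 8) * gw2 1 / real n"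
        using t g by (intro divide_right_mono mult_right_mono mult_mono) auto
      then show "Mean n (%v. sqdist n (n1 n) (G n v (n1 n))) <= (dl * ln (real n)) * real n powr (1 / 8) * gw2 1 / real n"
        using sqdist_bound_uniform[OF o(1), of "n1 n"] by (simp add: t_def)
      show "0 <= Mean n (%v. sqdist n (n1 n) (G n v (n1 n)))"
        by (intro Mean_nonneg) (simp add: sqdist_def sum_nonneg)
    qed (use e0 in auto)
    also have "... = C * (ln (real n) * ((real n powr sl)^2 * real n powr (1 / 8) / real n))"
      by (simp add: C_def)
    also have "(real n powr sl)^2 * real n powr (1 / 8) / real n = real n powr (2 * sl + 1 / 8 - 1)"
    proof -
      have "real n powr (2 * sl) = real n powr sl * real n powr sl" unfolding mult_2 by (rule powr_add)
      then show ?thesis unfolding power2_eq_square powr_diff powr_add by simp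
    qed
    finally show ?case .
  qed
  ultimately show ?thesis by (rule tiny_mono[rotated])
qed

end

section \<open>Hitting times\<close>

lemma Inf_enat_le_iff: "Inf (enat ` A) <= enat N \<longleftrightarrow> (EX M:A. M <= N)"
proof
  assume "Inf (enat ` A) <= enat N"
  also have "enat N < enat (Suc N)" by simp
  finally show "EX M:A. M <= N" by (auto simp: Inf_less_iff less_Suc_eq_le)
next
  assume "EX M:A. M <= N"
  then show "Inf (enat ` A) <= enat N" by (auto intro: Inf_lower2)
qed

text \<open>Reduces equality of two hitting times, including infinite values, to countably many
  events at finite times; this gives measurability of \<open>T_last = T_con\<close>.\<close>

lemma enat_eq_iff_le: "a = b \<longleftrightarrow> (ALL N. a <= enat N \<longleftrightarrow> b <= enat N)"
proof
  assume h: "ALL N. a <= enat N \<longleftrightarrow> b <= enat N"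
  show "a = b"
  proof (cases a; cases b)
    fix i j assume "a = enat i" "b = enat j"
    then show ?thesis using h[rule_format, of i] h[rule_format, of j] by simp
  qed (use h in \<open>auto dest: spec[where x = "the_enat a"] spec[where x = "the_enat b"]\<close>)
qed simp

context rule_ode
begin

lemma connected_iff: "n >= 1 ==> graph_connected {1..n} E \<longleftrightarrow> Q n E = 0"
  by (subst graph_connected_iff) (auto simp: Q_def)

lemma T_con_le:
  assumes n: "n >= 1" and v: "v \<in> Om n"
  shows "T_con K l R n v <= enat N \<longleftrightarrow> Q n (G n v N) = 0"
proof -
  have "T_con K l R n v <= enat N \<longleftrightarrow> (EX M<=N. Q n (G n v M) = 0)"
    unfolding T_con_def Inf_enat_le_iff using connected_iff[OF n] by blast
  also have "... \<longleftrightarrow> Q n (G n v N) = 0"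
    using Q_path_mono[OF v, of _ N] Q_nonneg[OF n, of "G n v N"] by force
  finally show ?thesis .
qed

lemma Y_eq: "real (Y K l R n k v N) = real k * real (cnt n (G n v N) {k})"
proof -
  have "real (Y K l R n k v N) = comp_sum {1..n} (G n v N) (%j. real j * of_bool (j = k))"
    unfolding Y_def using vertex_count_comp_sum[of "{1..n}" "%j. j = k"] by simp
  also have "... = real k * comp_sum {1..n} (G n v N) (%j. if j \<in> {k} then 1 else 0)"
    unfolding comp_sum_def sum_distrib_left by (rule sum.cong) auto
  also have "... = real k * real (cnt n (G n v N) {k})" by (simp only: comp_count_comp_sum finite_atLeastAtMost)
  finally show ?thesis .
qed

lemma Y_0_iff: "k >= 1 ==> Y K l R n k v N = 0 \<longleftrightarrow> cnt n (G n v N) {k} = 0"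
  using Y_eq[of n k v N] by (metis mult_eq_0_iff not_one_le_zero of_nat_eq_0_iff)

lemma T_last_le: "k >= 1 ==> T_last K l R n k v <= enat N \<longleftrightarrow> (ALL M>=N. cnt n (G n v M) {k} = 0)"
  unfolding T_last_def Inf_enat_le_iff using Y_0_iff by fastforce

lemma card_large_components: "card (large_components K l R n v N) = cnt n (G n v N) {K<..}"
  by (simp add: large_components_def comp_count_def)

lemma adapted_sets:
  assumes "adapted N P"
  shows "{v \<in> Om n. P v} \<in> sets (choice_space l n)"
  using measurable_sets[OF adapted_measurable[OF assms, of n], of "{True}"]
  by (simp add: vimage_def Int_def conj_commute)

lemma T_con_sets: "n >= 1 ==> {v \<in> Om n. T_con K l R n v <= enat N} \<in> sets (choice_space l n)"
proof -
  assume n: "n >= 1"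
  have "{v \<in> Om n. T_con K l R n v <= enat N} = {v \<in> Om n. Q n (G n v N) = 0}" using T_con_le[OF n] by blast
  then show ?thesis using adapted_sets[OF adapted_G'[where f = "%E. Q n E = 0", OF order_refl]] by simp
qed

lemma T_last_sets: "k >= 1 ==> {v \<in> Om n. T_last K l R n k v <= enat N} \<in> sets (choice_space l n)"
  unfolding T_last_le
  by (intro sets.sets_Collect_countable_All sets.sets_Collect_imp sets.sets_Collect_const
      adapted_sets[OF adapted_G'[where f = "%E. cnt n E {k} = 0", OF order_refl]])

lemma T_con_measurable: "n >= 1 ==> T_con K l R n \<in> measurable (choice_space l n) (count_space UNIV)"
proof -
  assume n: "n >= 1"
  have eq: "{v \<in> Om n. T_con K l R n v = a} = {v \<in> Om n. ALL N. (T_con K l R n v <= enat N --> a <= enat N) & (a <= enat N --> T_con K l R n v <= enat N)}" for a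
    using enat_eq_iff_le[of _ a] by auto
  have "{v \<in> Om n. T_con K l R n v = a} \<in> sets (choice_space l n)" for a
    unfolding eq by (intro sets.sets_Collect_countable_All sets.sets_Collect_conj sets.sets_Collect_imp
        sets.sets_Collect_const T_con_sets n)
  moreover have "T_con K l R n -` {a} \<inter> Om n = {v \<in> Om n. T_con K l R n v = a}" for a by auto
  ultimately show ?thesis by (subst measurable_count_space_eq2_countable) auto
qed

lemma last_eq_con_sets:
  "n >= 1 ==> k >= 1 ==> {v \<in> Om n. T_last K l R n k v = T_con K l R n v} \<in> sets (choice_space l n)"
proof -
  assume n: "n >= 1" "k >= 1"
  have eq: "{v \<in> Om n. T_last K l R n k v = T_con K l R n v} = {v \<in> Om n. ALL N.
      (T_last K l R n k v <= enat N --> T_con K l R n v <= enat N) & (T_con K l R n v <= enat N --> T_last K l R n k v <= enat N)}"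
    using enat_eq_iff_le by auto
  show ?thesis
    unfolding eq by (intro sets.sets_Collect_countable_All sets.sets_Collect_conj sets.sets_Collect_imp T_con_sets T_last_sets n)
qed

lemma Mean_le_prob:
  assumes n: "n >= 1" and P: "adapted N P" and S: "{v \<in> Om n. P' v} \<in> sets (choice_space l n)"
    and imp: "!!v. v \<in> Om n ==> P v ==> P' v"
  shows "Mean n (%v. of_bool (P v)) <= \<P>(v in choice_space l n. P' v)"
proof -
  interpret prob_space "choice_space l n" by (rule prob_choice[OF n])
  show ?thesis unfolding prob_adapted[OF n P, symmetric]
    by (rule finite_measure_mono) (use S imp in auto)
qed

section \<open>Typical late behaviour\<close>

lemma Q_split: "Q n E = real (cnt n E (slow K l R)) + V n E"
proof -
  have "{1..K} = slow K l R \<union> fast K l R" using slow_subset by (auto simp: fast_def)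
  then have "cnt n E {1..K} = cnt n E (slow K l R) + cnt n E (fast K l R)"
    by (metis Diff_disjoint comp_count_Un fast_def finite_atLeastAtMost)
  moreover have "cnt n E (fast K l R \<union> {K<..}) = cnt n E (fast K l R) + cnt n E {K<..}"
    by (rule comp_count_Un) (auto simp: fast_def)
  ultimately show ?thesis by (simp add: Q_cnt V_def)
qed

text \<open>After time \<open>N\<close> a clean path loses its components of slow size one at a time and nothing else
  changes, so all hitting times can be read off from the counts.\<close>

definition clean :: "nat => nat => (nat => nat => nat) => bool" where
  "clean n N v \<longleftrightarrow> good n (n0 n) (zt n) v & V n (G n v N) = 0 &
     (ALL M:{N..<hz n}. ~ multi (sizes n (G n v M) (v M))) & Q n (G n v (hz n)) = 0"

lemma adapted_clean:
  assumes "ok n" "rng n N"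
  shows "adapted (hz n) (clean n N)"
  unfolding adapted_def
proof (intro allI impI)
  fix v v' :: "nat => nat => nat"
  assume eq: "ALL i<hz n. v i = v' i"
  have G: "G n v M = G n v' M" if "M <= hz n" for M
    using adapted_mono[OF adapted_G that, of n] eq unfolding adapted_def by blast
  have "n0 n <= hz n" using scale_bounds(9,10)[OF okD(2)[OF assms(1)]] by linarith
  from adapted_good[OF this] have "good n (n0 n) (zt n) v = good n (n0 n) (zt n) v'"
    using eq unfolding adapted_def by blast
  moreover have "(ALL M:{N..<hz n}. ~ multi (sizes n (G n v M) (v M))) = (ALL M:{N..<hz n}. ~ multi (sizes n (G n v' M) (v' M)))"
    by (rule ball_cong) (use G eq in auto)
  moreover have "G n v N = G n v' N" "G n v (hz n) = G n v' (hz n)" using G assms(2) by (auto simp: rng_def)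
  ultimately show "clean n N v = clean n N v'" by (simp add: clean_def)
qed

lemma adapted_sum:
  assumes "!!i. i \<in> I ==> adapted N (f i)"
  shows "adapted N (%v. SUM i:I. f i v)"
  unfolding adapted_def
proof (intro allI impI sum.cong refl)
  fix v v' :: "nat => nat => nat" and i
  assume "ALL i<N. v i = v' i" "i \<in> I"
  then show "f i v = f i v'" using assms[of i] unfolding adapted_def by blast
qed

lemma Mean_multi:
  assumes n: "n >= 1" and M: "N0 <= M"
  shows "Mean n (%v. Zg n N0 \<zeta> v * of_bool (multi (sizes n (G n v M) (v M)))) <= (real l)^2 * Wm n N0 \<zeta> M"
proof -
  let ?\<phi> = "%v x. Zg n N0 \<zeta> v * of_bool (multi (sizes n (G n v M) x))"
  have ad: "adapted M (%v. ?\<phi> v x)" for x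
    by (rule adapted_comp2[where h = "(*)", OF adapted_Zg[OF M]
          adapted_G'[where f = "%E. of_bool (multi (sizes n E x))", OF order_refl]])
  have "Mean n (%v. ?\<phi> v (v M)) = Mean n (%v. Av n (?\<phi> v))"
    by (rule Mean_next_round[OF n ad])
  also have "... <= Mean n (%v. (real l)^2 * (Zg n N0 \<zeta> v * (1 - fr n (G n v M))^2))"
  proof (rule Mean_mono[OF n])
    show "adapted M (%v. Av n (?\<phi> v))"
      unfolding Av_cmult
      by (rule adapted_comp2[where h = "(*)", OF adapted_Zg[OF M]
          adapted_G'[where f = "%E. Av n (%x. of_bool (multi (sizes n E x)))", OF order_refl]])
    show "adapted M (%v. (real l)^2 * (Zg n N0 \<zeta> v * (1 - fr n (G n v M))^2))"
      by (rule adapted_comp2[where h = "%a b. (real l)^2 * (a * b)", OF adapted_Zg[OF M]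
          adapted_G'[where f = "%E. (1 - fr n E)^2", OF order_refl]])
    fix v
    have "Zg n N0 \<zeta> v * Av n (%x. of_bool (multi (sizes n (G n v M) x))) <= Zg n N0 \<zeta> v * ((real l)^2 * (1 - fr n (G n v M))^2)"
      by (intro mult_left_mono Av_multi[OF n] Zg_bounds)
    then show "Av n (?\<phi> v) <= (real l)^2 * (Zg n N0 \<zeta> v * (1 - fr n (G n v M))^2)"
      unfolding Av_cmult by (simp add: mult_ac)
  qed
  also have "... = (real l)^2 * Wm n N0 \<zeta> M" unfolding Wm_def by (rule Mean_cmult)
  finally show ?thesis .
qed

definition tau :: "nat => real" where
  "tau n = bad n + verr n + werr n + 1 * real n powr (- 2)"

lemma tiny_tau: "tiny tau"
  unfolding tau_def[abs_def] by (intro tiny_add tiny_bad tiny_verr tiny_werr tiny_powr) auto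

lemma Mean_Q_hz:
  assumes ok: "ok n"
  shows "Mean n (%v. Q n (G n v (hz n))) <= real n powr (- 2)"
    "real n * (1 - base_rate / real n) ^ hz n <= real n powr (- 2)"
proof -
  note o = okD[OF ok]
  have n0: "0 < real n" using o(1) by simp
  have r0: "0 <= 1 - base_rate / real n" using base_rate n0 o(1) by (simp add: field_simps)
  have "base_rate * (3 / base_rate * nl n) <= base_rate * real (hz n)"
    using scale_bounds(7)[OF o(2)] base_rate by (intro mult_left_mono) auto
  then have "3 * nl n <= base_rate * real (hz n)" using base_rate by simp
  then have "3 * nl n / real n <= base_rate * real (hz n) / real n" by (rule divide_right_mono) simp
  then have e: "- (base_rate / real n) * real (hz n) <= - 3 * ln (real n)" using n0 by simp
  have "real n * (1 - base_rate / real n) ^ hz n <= real n * exp (- (base_rate / real n) * real (hz n))"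
    using power_le_exp[OF r0, of "hz n"] by (intro mult_left_mono) auto
  also have "... <= real n * exp (- 3 * ln (real n))" using e by (intro mult_left_mono) auto
  also have "... = real n powr (1 + - 3)" unfolding powr_add exp_ln_powr[OF o(1)] by simp
  finally show A: "real n * (1 - base_rate / real n) ^ hz n <= real n powr (- 2)" by simp
  show "Mean n (%v. Q n (G n v (hz n))) <= real n powr (- 2)"
    by (rule order_trans[OF Mean_Q_universal[OF o(7,1)] A])
qed

lemma V_dichotomy: "cnt n E {K<..} >= 1 ==> V n E = 0 | 1 <= V n E"
proof -
  assume "cnt n E {K<..} >= 1"
  moreover have "cnt n E {K<..} <= cnt n E (fast K l R \<union> {K<..})" by (intro comp_count_mono) auto
  ultimately show ?thesis by (cases "cnt n E (fast K l R \<union> {K<..}) = 1") (auto simp: V_def)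
qed

lemma Q_dichotomy: "Q n E = 0 | 1 <= Q n E | Q n E < 0"
  by (cases "comp_count {1..n} E UNIV = 1") (auto simp: Q_def)

text \<open>Each way to fail forces one of four nonnegative summands to be at least 1:
  \<open>V\<close> and \<open>Q\<close> are integer valued here, and the others are indicators. So
  the means of the summands add up to a bound.\<close>

lemma not_clean_bound:
  assumes ok: "ok n" and N: "rng n N"
  shows "Mean n (%v. of_bool (~ clean n N v)) <= tau n"
proof -
  note o = okD[OF ok]
  note sb = scale_bounds[OF o(2)]
  have NN: "n0 n <= N" "N <= hz n" using N sb by (auto simp: rng_def)
  let ?Z = "Zg n (n0 n) (zt n)"
  let ?m = "%M v. ?Z v * of_bool (multi (sizes n (G n v M) (v M)))"
  have adm: "adapted (hz n) (?m M)" if "M \<in> {N..<hz n}" for M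
  proof (rule adapted_comp2[where h = "(*)"])
    show "adapted (hz n) ?Z" using NN by (intro adapted_Zg) auto
    show "adapted (hz n) (%v. of_bool (multi (sizes n (G n v M) (v M))) :: real)"
      by (rule adapted_comp2[where h = "%E x. of_bool (multi (sizes n E x))", OF adapted_mono[OF adapted_G] adapted_coord])
         (use that in auto)
  qed
  have aZ: "adapted (hz n) (%v. 1 - ?Z v)"
    using NN by (intro adapted_comp1[where h = "%y. 1 - y", OF adapted_Zg]) auto
  have aV: "adapted (hz n) (%v. ?Z v * V n (G n v N))"
    using NN by (intro adapted_comp2[where h = "(*)", OF adapted_Zg adapted_G'[where f = "V n"]]) auto
  have aS: "adapted (hz n) (%v. SUM M:{N..<hz n}. ?m M v)" by (rule adapted_sum[OF adm])
  have aQ: "adapted (hz n) (%v. Q n (G n v (hz n)))" by (rule adapted_G'[OF order_refl])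
  note a1 = adapted_comp2[where h = "(+)", OF aZ aV]
  note a2 = adapted_comp2[where h = "(+)", OF a1 aS]
  note a3 = adapted_comp2[where h = "(+)", OF a2 aQ]
  have "Mean n (%v. of_bool (~ clean n N v)) <=
      Mean n (%v. 1 - ?Z v + ?Z v * V n (G n v N) + (SUM M:{N..<hz n}. ?m M v) + Q n (G n v (hz n)))"
  proof (rule Mean_mono[OF o(1) adapted_comp1[where h = "%b. of_bool (~ b)", OF adapted_clean[OF ok N]] a3])
    fix v assume v: "v \<in> Om n"
    have t1: "0 <= 1 - ?Z v" using Zg_bounds(2)[of n "n0 n" "zt n" v] by simp
    have t2: "0 <= ?Z v * V n (G n v N)" by (rule Zg_V_nonneg[OF o(1) v NN(1) o(4)])
    have t3: "0 <= (SUM M:{N..<hz n}. ?m M v)" by (intro sum_nonneg mult_nonneg_nonneg Zg_bounds) auto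
    have t4: "0 <= Q n (G n v (hz n))" by (rule Q_nonneg[OF o(1)])
    show "of_bool (~ clean n N v) <= 1 - ?Z v + ?Z v * V n (G n v N) + (SUM M:{N..<hz n}. ?m M v) + Q n (G n v (hz n))"
    proof (cases "clean n N v")
      case True
      then show ?thesis using t1 t2 t3 t4 by simp
    next
      case False
      consider "~ good n (n0 n) (zt n) v" | "good n (n0 n) (zt n) v" "V n (G n v N) ~= 0"
        | M where "good n (n0 n) (zt n) v" "M \<in> {N..<hz n}" "multi (sizes n (G n v M) (v M))"
        | "Q n (G n v (hz n)) ~= 0"
        using False unfolding clean_def by blast
      then have "1 <= 1 - ?Z v + ?Z v * V n (G n v N) + (SUM M:{N..<hz n}. ?m M v) + Q n (G n v (hz n))"
      proof cases
        case 1
        then show ?thesis using t2 t3 t4 by (simp add: Zg_def)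
      next
        case 2
        have "1 <= V n (G n v N)" using 2 V_dichotomy[OF good_later(3)[OF o(1) v 2(1) NN(1) o(4)]] by blast
        then show ?thesis using 2(1) t3 t4 by (simp add: Zg_def)
      next
        case 3
        have "?m M v <= (SUM M:{N..<hz n}. ?m M v)"
          using 3(2) by (intro member_le_sum) (auto intro: mult_nonneg_nonneg Zg_bounds)
        moreover have "?m M v = 1" using 3 by (simp add: Zg_def)
        ultimately show ?thesis using t1 t2 t4 by linarith
      next
        case 4
        then have "1 <= Q n (G n v (hz n))" using t4 Q_dichotomy[of n "G n v (hz n)"] by linarith
        then show ?thesis using t1 t2 t3 by linarith
      qed
      then show ?thesis using False by simp
    qed
  qed
  also have "... = Mean n (%v. 1 - ?Z v) + Mean n (%v. ?Z v * V n (G n v N)) + Mean n (%v. SUM M:{N..<hz n}. ?m M v)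
      + Mean n (%v. Q n (G n v (hz n)))"
    by (simp only: Mean_add[OF o(1) a2 aQ] Mean_add[OF o(1) a1 aS] Mean_add[OF o(1) aZ aV])
  also have "Mean n (%v. 1 - ?Z v) = bad n" by (rule Mean_not_good[OF o(1)])
  also have "Mean n (%v. SUM M:{N..<hz n}. ?m M v) = (SUM M:{N..<hz n}. Mean n (?m M))"
    by (rule Mean_sum[OF o(1) adm])
  also have "... <= (SUM M:{N..<hz n}. (real l)^2 * Wm n (n0 n) (zt n) M)"
    using NN by (intro sum_mono Mean_multi[OF o(1)]) auto
  also have "... <= werr n" by (rule sum_Wm_rng[OF ok N])
  finally show ?thesis using Mean_V_rng[OF ok N] Mean_Q_hz(1)[OF ok] by (simp add: tau_def)
qed

lemma Mean_of_bool_diff_le: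
  assumes n: "n >= 1" and P: "adapted N P" "adapted N' P'" and B: "adapted M B"
    and eq: "!!v. v \<in> Om n ==> ~ B v ==> P v = P' v"
  shows "\<bar>Mean n (%v. of_bool (P v)) - Mean n (%v. of_bool (P' v))\<bar> <= Mean n (%v. of_bool (B v))"
proof -
  let ?D = "%v. of_bool (P v) - of_bool (P' v) :: real"
  have a: "adapted N (%v. of_bool (P v) :: real)" "adapted N' (%v. of_bool (P' v) :: real)" "adapted M (%v. of_bool (B v) :: real)"
    by (fact adapted_comp1[where h = of_bool, OF P(1)] adapted_comp1[where h = of_bool, OF P(2)] adapted_comp1[where h = of_bool, OF B])+
  have "adapted (max N N') ?D"
    by (rule adapted_comp2[where h = "(-)", OF adapted_mono[OF a(1)] adapted_mono[OF a(2)]]) auto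
  then have "\<bar>Mean n ?D\<bar> <= Mean n (%v. of_bool (B v))"
  proof (rule Mean_abs_le[OF n _ a(3)])
    fix v assume "v \<in> Om n"
    then show "\<bar>?D v\<bar> <= of_bool (B v)" using eq[of v] by (cases "B v") auto
  qed
  then show ?thesis by (simp only: Mean_diff[OF n a(1,2)])
qed

context
  fixes n N :: nat and v
  assumes ok: "ok n" and N: "rng n N" and v: "v \<in> Om n" and cl: "clean n N v"
begin

lemma clean_large: "N <= M ==> 1 <= cnt n (G n v M) {K<..}"
proof -
  assume "N <= M"
  then have "n0 n <= M" using N scale_bounds(9)[OF okD(2)[OF ok]] by (auto simp: rng_def)
  then show ?thesis using cl by (intro good_later(3)[OF okD(1)[OF ok] v _ _ okD(4)[OF ok]]) (auto simp: clean_def)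
qed

lemma clean_Q_end: "hz n <= M ==> Q n (G n v M) = 0"
  using Q_path_mono[OF v, of "hz n" M] Q_nonneg[OF okD(1)[OF ok], of "G n v M"] cl by (simp add: clean_def)

lemma round_in_Tup: "v M \<in> Tup n"
  using v by (simp add: Om_iff)

lemma clean_V: "N <= M ==> V n (G n v M) = 0"
proof (cases "M <= hz n")
  case True
  assume "N <= M"
  then show ?thesis using True
  proof (induction rule: dec_induct)
    case base
    then show ?case using cl by (simp add: clean_def)
  next
    case (step M)
    have nm: "~ multi (sizes n (G n v M) (v M))" using step cl by (auto simp: clean_def)
    have "real (cnt n (round n (G n v M) (v M)) (fast K l R \<union> {K<..})) <= real (cnt n (G n v M) (fast K l R \<union> {K<..}))
       - (SUM k:(fast K l R \<union> {K<..}) \<inter> {1..K}. of_bool (sizes n (G n v M) (v M) \<in> single k))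
       - of_bool (merge_large n (G n v M) (v M))
       + of_bool (multi (sizes n (G n v M) (v M)) & fast K l R \<union> {K<..} ~= UNIV)"
      by (rule cnt_round_with_large[OF round_in_Tup]) auto
    moreover have "0 <= (SUM k:(fast K l R \<union> {K<..}) \<inter> {1..K}. of_bool (sizes n (G n v M) (v M) \<in> single k) :: real)"
      by (intro sum_nonneg) auto
    moreover have "of_bool (multi (sizes n (G n v M) (v M)) & fast K l R \<union> {K<..} ~= UNIV) = (0 :: real)" using nm by simp
    moreover have "0 <= (of_bool (merge_large n (G n v M) (v M)) :: real)" by simp
    ultimately have "V n (G n v (Suc M)) <= V n (G n v M)" unfolding V_def process_edges_Suc by linarith
    moreover have "0 <= V n (G n v (Suc M))" using step by (intro V_nonneg clean_large) auto
    ultimately show ?case using step by simp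
  qed
next
  case False
  assume "N <= M"
  then show ?thesis using False clean_Q_end[of M] V_le_Q[of n "G n v M"] V_nonneg[OF clean_large[of M]] by simp
qed

lemma clean_counts:
  assumes M: "N <= M"
  shows "cnt n (G n v M) (fast K l R) = 0" "cnt n (G n v M) {K<..} = 1"
    "Q n (G n v M) = real (cnt n (G n v M) (slow K l R))"
proof -
  have "cnt n (G n v M) (fast K l R \<union> {K<..}) = cnt n (G n v M) (fast K l R) + cnt n (G n v M) {K<..}"
    by (rule comp_count_Un) (auto simp: fast_def)
  then show "cnt n (G n v M) (fast K l R) = 0" "cnt n (G n v M) {K<..} = 1"
    using clean_V[OF M] clean_large[OF M] unfolding V_def by linarith+
  show "Q n (G n v M) = real (cnt n (G n v M) (slow K l R))" using Q_split clean_V[OF M] by simp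
qed

text \<open>A size in \<open>{1..K}\<close> could only reappear by merging two small components, in
  a \<open>multi\<close> round; after \<open>hz n\<close> the graph is connected with a large
  component, so no small size exists.\<close>

lemma clean_zero_stays:
  assumes M: "N <= M" "M <= M'" and S: "S \<subseteq> {1..K}" and z: "cnt n (G n v M) S = 0"
  shows "cnt n (G n v M') S = 0"
proof (cases "M' <= hz n")
  case True
  from M(2) True z show ?thesis
  proof (induction rule: dec_induct)
    case (step M')
    have nm: "~ multi (sizes n (G n v M') (v M'))" using step M cl by (auto simp: clean_def)
    have "0 <= (SUM k:S. of_bool (sizes n (G n v M') (v M') \<in> single k) :: real)" by (intro sum_nonneg) auto
    then have "real (cnt n (G n v (Suc M')) S) <= real (cnt n (G n v M') S)"
      unfolding process_edges_Suc cnt_round_small[OF round_in_Tup S nm] by simp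
    then show ?case using step by simp
  qed simp
next
  case False
  then have "Q n (G n v M') = 0" by (intro clean_Q_end) simp
  then have "cnt n (G n v M') {1..K} = 0" using clean_large[of M'] M by (simp add: Q_cnt)
  then show ?thesis using comp_count_mono[OF _ S, of "{1..n}" "G n v M'"] by simp
qed

lemma clean_T_last: "k \<in> {1..K} ==> N <= M ==> T_last K l R n k v <= enat M \<longleftrightarrow> cnt n (G n v M) {k} = 0"
  using clean_zero_stays[of M _ "{k}"] by (subst T_last_le) auto

lemma clean_T_con: "N <= M ==> T_con K l R n v <= enat M \<longleftrightarrow> cnt n (G n v M) (slow K l R) = 0"
  using clean_counts(3)[of M] by (subst T_con_le[OF okD(1)[OF ok] v]) auto

lemma clean_fast:
  assumes "N <= M" "k \<in> fast K l R"
  shows "cnt n (G n v M) {k} = 0"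
  using clean_counts(1)[OF assms(1)] comp_count_mono[of "{1..n}" "{k}" "fast K l R" "G n v M"] assms(2) by simp

end

section \<open>Reduction to the state at the starting time\<close>

lemma unroll_add: "unroll n j (unroll n i u) = unroll n (i + j) u"
  by (simp add: unroll_def power_add mult_ac)

lemma Mean_Zg_diff:
  assumes n: "n >= 1" and f: "adapted N f" "n0 n <= N" "!!v. 0 <= f v" "!!v. f v <= 1"
  shows "\<bar>Mean n f - Mean n (%v. Zg n (n0 n) (zt n) v * f v)\<bar> <= bad n"
proof -
  let ?Z = "Zg n (n0 n) (zt n)"
  have aZ: "adapted N ?Z" by (rule adapted_Zg[OF f(2)])
  have aZf: "adapted N (%v. ?Z v * f v)" by (rule adapted_comp2[where h = "(*)", OF aZ f(1)])
  have a1: "adapted N (%v. 1 - ?Z v)" by (rule adapted_comp1[where h = "%y. 1 - y", OF aZ])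
  have "\<bar>Mean n (%v. f v - ?Z v * f v)\<bar> <= Mean n (%v. 1 - ?Z v)"
  proof (rule Mean_abs_le[OF n adapted_comp2[where h = "(-)", OF f(1) aZf] a1])
    fix v
    have "\<bar>f v - ?Z v * f v\<bar> = (1 - ?Z v) * f v"
      using mult_left_le_one_le[of "f v" "?Z v"] Zg_bounds[of n "n0 n" "zt n" v] f(3)[of v] by (simp add: left_diff_distrib)
    also have "... <= (1 - ?Z v) * 1" using Zg_bounds[of n "n0 n" "zt n" v] f(4)[of v] by (intro mult_left_mono) auto
    finally show "\<bar>f v - ?Z v * f v\<bar> <= 1 - ?Z v" by simp
  qed
  moreover have "Mean n (%v. 1 - ?Z v) = bad n" by (rule Mean_not_good[OF n])
  ultimately show ?thesis by (simp add: Mean_diff[OF n f(1) aZf])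
qed

lemma power_0_of_bool: "(0::real) ^ m = of_bool (m = 0)"
  by (cases m) auto

lemma comp_count_empty: "comp_count A E {} = 0"
  by (simp add: comp_count_def)

text \<open>Both variables start at 0, where a generating function is the probability that the
  counts vanish; unrolling moves the evaluation back to time \<open>n1\<close>.\<close>

definition start_gf :: "nat => nat set => nat set => nat => nat => real" where
  "start_gf n S T Nb Na = Mean n (%v. gf n S T (unroll n (Nb - n1 n) 0) (unroll n (Na - n1 n) 0) (G n v (n1 n)))"

text \<open>Two applications of \<open>generating_phase\<close>. From \<open>Nb\<close> back to
  \<open>Na\<close> only the variable of \<open>S\<close> is active and the event that
  \<open>T\<close> has vanished rides along in the weight; from \<open>Na\<close> back to
  \<open>n1\<close> both variables are unrolled.\<close>

theorem two_times:
  assumes ok: "ok n" and Na: "rng n Na" and Nb: "rng n Nb" "Na <= Nb"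
    and ST: "S \<subseteq> slow K l R" "T \<subseteq> slow K l R" "S \<inter> T = {}"
  shows "\<bar>Mean n (%v. of_bool (cnt n (G n v Na) T = 0 & cnt n (G n v Nb) S = 0)) - start_gf n S T Nb Na\<bar> <= 2 * bad n + 2 * gerr n"
proof -
  note o = okD[OF ok]
  note sb = scale_bounds[OF o(2)]
  have le: "n1 n <= Na" "n1 n <= Nb" "n0 n <= Na" "n0 n <= Nb" using Na Nb sb by (auto simp: rng_def)
  let ?Z = "Zg n (n0 n) (zt n)"
  let ?u = "unroll n (Nb - Na) 0"
  let ?f = "%v. of_bool (cnt n (G n v Na) T = 0 & cnt n (G n v Nb) S = 0) :: real"
  let ?z = "%v. ?Z v * of_bool (cnt n (G n v Na) T = 0)"
  let ?g = "%v. gf n S T (unroll n (Nb - n1 n) 0) (unroll n (Na - n1 n) 0) (G n v (n1 n))"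
  note ub = unroll_bounds(1,2)[OF o(5), of 0, simplified]
  have 1: "\<bar>Mean n ?f - Mean n (%v. ?Z v * ?f v)\<bar> <= bad n"
  proof (rule Mean_Zg_diff[OF o(1) _ le(4)])
    show "adapted Nb ?f"
      by (rule adapted_comp2[where h = "%a b. of_bool (a = 0 & b = 0)",
            OF adapted_G'[where f = "%E. cnt n E T", OF Nb(2)] adapted_G'[where f = "%E. cnt n E S", OF order_refl]])
  qed auto
  have az: "adapted Na ?z"
    by (rule adapted_comp2[where h = "(*)", OF adapted_Zg[OF le(3)] adapted_G'[where f = "%E. of_bool (cnt n E T = 0)", OF order_refl]])
  \<comment> \<open>At time \<open>Na\<close> the indicator in \<open>?z\<close> turns into the
    factor \<open>0 ^ cnt n E T\<close>, so the pair of variables continues as \<open>?u\<close> and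
    0.\<close>
  have "\<bar>Mean n (%v. ?z v * gf n S {} 0 1 (G n v Nb))
     - Mean n (%v. ?z v * gf n S {} ?u (unroll n (Nb - Na) 1) (G n v Na))\<bar> <= gerr n"
    by (rule generating_rng[OF ok le(1) Nb(2,1) ST(1) _ _ _ _ _ _ az])
       (auto intro: Zg_bounds simp: Zg_def)
  moreover have "?z v * gf n S {} 0 1 (G n v Nb) = ?Z v * ?f v" for v
    by (simp add: gf_def power_0_of_bool)
  moreover have "?z v * gf n S {} ?u (unroll n (Nb - Na) 1) (G n v Na) = ?Z v * gf n S T ?u 0 (G n v Na)" for v
    by (simp add: gf_def power_0_of_bool comp_count_empty)
  ultimately have 2: "\<bar>Mean n (%v. ?Z v * ?f v) - Mean n (%v. ?Z v * gf n S T ?u 0 (G n v Na))\<bar> <= gerr n" by simp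
  have ad: "Nb - Na + (Na - n1 n) = Nb - n1 n" using le Nb by simp
  have "\<bar>Mean n (%v. ?Z v * gf n S T ?u 0 (G n v Na))
     - Mean n (%v. ?Z v * gf n S T (unroll n (Na - n1 n) ?u) (unroll n (Na - n1 n) 0) (G n v (n1 n)))\<bar> <= gerr n"
    using ub sb(9) by (intro generating_rng[OF ok order_refl le(1) Na ST]) (auto intro: Zg_bounds adapted_Zg)
  then have 3: "\<bar>Mean n (%v. ?Z v * gf n S T ?u 0 (G n v Na)) - Mean n (%v. ?Z v * ?g v)\<bar> <= gerr n"
    unfolding unroll_add ad .
  have 4: "\<bar>Mean n ?g - Mean n (%v. ?Z v * ?g v)\<bar> <= bad n"
    using gf_bounds[OF ub ub] by (intro Mean_Zg_diff[OF o(1) adapted_G'[OF order_refl] sb(9)]) auto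
  show ?thesis using 1 2 3 4 unfolding start_gf_def by linarith
qed

lemma T_con_law:
  assumes ok: "ok n" and N: "rng n N"
  shows "\<bar>Mean n (%v. of_bool (Q n (G n v N) = 0)) - start_gf n (slow K l R) {} N N\<bar> <= tau n + (2 * bad n + 2 * gerr n)"
proof -
  note o = okD[OF ok]
  have "\<bar>Mean n (%v. of_bool (Q n (G n v N) = 0)) - Mean n (%v. of_bool (cnt n (G n v N) {} = 0 & cnt n (G n v N) (slow K l R) = 0))\<bar>
      <= Mean n (%v. of_bool (~ clean n N v))"
  proof (rule Mean_of_bool_diff_le[OF o(1)])
    show "adapted N (%v. Q n (G n v N) = 0)" by (rule adapted_G'[where f = "%E. Q n E = 0", OF order_refl])
    show "adapted N (%v. cnt n (G n v N) {} = 0 & cnt n (G n v N) (slow K l R) = 0)"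
      by (rule adapted_G'[where f = "%E. cnt n E {} = 0 & cnt n E (slow K l R) = 0", OF order_refl])
    show "adapted (hz n) (%v. ~ clean n N v)" by (rule adapted_comp1[where h = Not, OF adapted_clean[OF ok N]])
    fix v assume "v \<in> Om n" "~ ~ clean n N v"
    then show "(Q n (G n v N) = 0) = (cnt n (G n v N) {} = 0 & cnt n (G n v N) (slow K l R) = 0)"
      using clean_counts(3)[OF ok N _ _ order_refl, of v] by (simp add: comp_count_empty)
  qed
  then show ?thesis using not_clean_bound[OF ok N] two_times[OF ok N N order_refl, of "slow K l R" "{}"] by simp
qed

end

section \<open>Limit laws\<close>

lemma exp_neg_diff_le:
  fixes a b :: real
  assumes "a <= 0" "b <= 0"
  shows "\<bar>exp a - exp b\<bar> <= \<bar>a - b\<bar>"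
proof -
  have *: "exp y - exp x <= y - x" if "x <= y" "y <= 0" for x y :: real
  proof -
    have "exp y - exp x = exp y * (1 - exp (x - y))" by (simp add: exp_diff right_diff_distrib)
    also have "... <= 1 * (y - x)"
    proof (rule mult_mono)
      show "1 - exp (x - y) <= y - x" using exp_ge_add_one_self[of "x - y"] by linarith
    qed (use that in auto)
    finally show ?thesis by simp
  qed
  show ?thesis
  proof (cases "a <= b")
    case True
    then have "exp a <= exp b" by simp
    then show ?thesis using *[of a b] True assms by linarith
  next
    case False
    then have "exp b <= exp a" by simp
    then show ?thesis using *[of b a] False assms by linarith
  qed
qed

lemma power_one_minus_bounds:
  fixes p :: real
  assumes "0 <= p" "p <= 1 / 2"
  shows "(1 - p) ^ m = exp (real m * ln (1 - p))" "real m * ln (1 - p) <= - (p * real m)"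
    "- (p * real m) - 2 * p * (p * real m) <= real m * ln (1 - p)"
proof -
  show "(1 - p) ^ m = exp (real m * ln (1 - p))" using assms by (simp add: exp_of_nat_mult)
  have "ln (1 - p) <= - p" using ln_add_one_self_le_self2[of "- p"] assms by simp
  then have "real m * ln (1 - p) <= real m * (- p)" by (intro mult_left_mono) auto
  then show "real m * ln (1 - p) <= - (p * real m)" by (simp add: mult.commute)
  have "real m * (- p - 2 * p\<^sup>2) <= real m * ln (1 - p)"
    using ln_one_minus_pos_lower_bound[OF assms] by (intro mult_left_mono) auto
  then show "- (p * real m) - 2 * p * (p * real m) <= real m * ln (1 - p)"
    by (simp add: algebra_simps power2_eq_square)
qed

lemma power_exp_close:
  fixes p :: real
  assumes p: "0 <= p" "p <= 1 / 2" and b: "0 <= b"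
  shows "\<bar>(1 - p) ^ m - exp (- b)\<bar> <= \<bar>p * real m - b\<bar> + 2 * p * (p * real m)"
proof -
  note B = power_one_minus_bounds[OF p, of m]
  have "0 <= p * real m" "0 <= 2 * p * (p * real m)" using p by auto
  then show ?thesis
    unfolding B(1) using exp_neg_diff_le[of "real m * ln (1 - p)" "- b"] B(2,3) b by linarith
qed

text \<open>If \<open>m\<close> is about \<open>D * s\<close> and \<open>p * s\<close> about
  \<open>x\<close>, then \<open>(1 - p) ^ m\<close> is about \<open>exp (- (p * m))\<close>, that is
  \<open>exp (- (D * x))\<close>; the three error terms come from \<open>m\<close>, from
  \<open>p * s\<close> and from the logarithm.\<close>

lemma factor_close:
  fixes p :: real
  assumes p: "0 <= p" "p <= 1 / 2" and s: "0 < s" and D: "0 <= D" "0 <= x" and c: "\<bar>real m / s - D\<bar> <= \<theta>"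
  shows "\<bar>(1 - p) ^ m - exp (- (D * x))\<bar> <= p * s * \<theta> + D * \<bar>p * s - x\<bar> + 2 * p * (p * s * (D + \<theta>))"
proof -
  have m: "p * real m = p * s * (real m / s)" using s by simp
  have ps: "0 <= p * s" using p s by simp
  have "p * s * (real m / s) - D * x = p * s * (real m / s - D) + D * (p * s - x)" by (simp add: algebra_simps)
  then have "\<bar>p * s * (real m / s) - D * x\<bar> <= \<bar>p * s * (real m / s - D)\<bar> + \<bar>D * (p * s - x)\<bar>"
    by (simp only: abs_triangle_ineq)
  also have "... = p * s * \<bar>real m / s - D\<bar> + D * \<bar>p * s - x\<bar>"
    using p s D by (simp add: abs_mult)
  also have "... <= p * s * \<theta> + D * \<bar>p * s - x\<bar>" using c ps by (intro add_right_mono mult_left_mono)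
  finally have 1: "\<bar>p * real m - D * x\<bar> <= p * s * \<theta> + D * \<bar>p * s - x\<bar>" by (simp only: m)
  have "p * real m <= p * s * (D + \<theta>)" unfolding m using c ps by (intro mult_left_mono) auto
  then have "2 * p * (p * real m) <= 2 * p * (p * s * (D + \<theta>))" using p by (intro mult_left_mono) auto
  then show ?thesis using power_exp_close[OF p, of "D * x" m] 1 D by simp
qed

lemma product_diff_le:
  fixes a b a' b' :: real
  assumes "0 <= a" "a <= 1" "0 <= b'" "b' <= 1"
  shows "\<bar>a * b - a' * b'\<bar> <= \<bar>a - a'\<bar> + \<bar>b - b'\<bar>"
proof -
  have "a * b - a' * b' = a * (b - b') + (a - a') * b'" by (simp add: algebra_simps)
  then have "\<bar>a * b - a' * b'\<bar> <= \<bar>a\<bar> * \<bar>b - b'\<bar> + \<bar>a - a'\<bar> * \<bar>b'\<bar>"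
    by (metis abs_mult abs_triangle_ineq)
  also have "... <= 1 * \<bar>b - b'\<bar> + \<bar>a - a'\<bar> * 1" using assms by (intro add_mono mult_right_mono mult_left_mono) auto
  finally show ?thesis by simp
qed

lemma powr_nat_at_top:
  assumes "0 < a"
  shows "filterlim (%n::nat. real n powr a) at_top sequentially"
proof (rule filterlim_at_top_mono)
  show "filterlim (%n::nat. exp (a * ln (real n))) at_top sequentially"
    by (intro filterlim_compose[OF exp_at_top] filterlim_tendsto_pos_mult_at_top[OF tendsto_const assms]
        filterlim_compose[OF ln_at_top filterlim_real_sequentially])
  show "\<forall>\<^sub>F n in sequentially. exp (a * ln (real n)) <= real n powr a"
    using eventually_gt_at_top[of 0] by eventually_elim (simp add: powr_def)
qed

context rule_ode
begin

text \<open>The idealised probability that a slow component present at time \<open>n1\<close>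
  survives until time \<open>N\<close>.\<close>

definition ps :: "nat => nat => real" where "ps n N = (1 - ex' / real n) ^ (N - n1 n)"

lemma unroll_ps: "unroll n (N - n1 n) 0 = 1 - ps n N"
  by (simp add: unroll_def ps_def)

lemma ps_bounds:
  assumes ok: "ok n" and N: "n1 n <= N" "N <= hz n"
  shows "0 <= ps n N" "ps n N * sc n <= real n * dec ex' n N"
    "real n * dec ex' n N * exp (- (2 * ex'\<^sup>2 * CH * (ln (real n) / real n))) <= ps n N * sc n"
proof -
  note o = okD[OF ok]
  have n0: "0 < real n" using o(1) by simp
  define h where "h = ex' / real n"
  have h: "0 <= h" "h <= 1 / 2" using o(3) n0 by (auto simp: h_def late_def field_simps)
  let ?j = "N - n1 n"
  note B = power_one_minus_bounds[OF h, of ?j]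
  have D: "dec ex' n ?j = exp (- (h * real ?j))" by (simp add: dec_def h_def)
  have sd: "sc n * dec ex' n ?j = real n * dec ex' n N"
    using dec_add[of ex' n "n1 n" ?j] N by (simp add: sc_def)
  have pse: "ps n N = exp (real ?j * ln (1 - h))" using B(1) by (simp add: ps_def h_def)
  show "0 <= ps n N" by (simp add: pse)
  have "ps n N <= dec ex' n ?j" using B(2) by (simp add: pse D)
  then have "ps n N * sc n <= dec ex' n ?j * sc n" using sc_pos[OF o(1)] by (intro mult_right_mono) auto
  then show "ps n N * sc n <= real n * dec ex' n N" using sd by (simp add: mult.commute)
  have jH: "real ?j <= CH * nl n"
  proof -
    have "real ?j <= real (hz n)" using N by simp
    then show ?thesis using hz_le[OF o(2)] by (simp add: CH_def)
  qed
  have "2 * h * (h * real ?j) <= 2 * h * (h * (CH * nl n))" using jH h by (intro mult_left_mono) auto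
  also have "... = 2 * ex'\<^sup>2 * CH * (ln (real n) / real n)"
    using n0 by (simp add: h_def power2_eq_square field_simps)
  finally have "- (h * real ?j) - 2 * ex'\<^sup>2 * CH * (ln (real n) / real n) <= real ?j * ln (1 - h)" using B(3) by linarith
  then have "exp (- (h * real ?j) - 2 * ex'\<^sup>2 * CH * (ln (real n) / real n)) <= ps n N" by (simp only: pse exp_le_cancel_iff)
  moreover have "exp (- (h * real ?j) - 2 * ex'\<^sup>2 * CH * (ln (real n) / real n)) = dec ex' n ?j * exp (- (2 * ex'\<^sup>2 * CH * (ln (real n) / real n)))"
    unfolding D exp_add[symmetric] by simp
  ultimately have "sc n * (dec ex' n ?j * exp (- (2 * ex'\<^sup>2 * CH * (ln (real n) / real n)))) <= sc n * ps n N"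
    using sc_pos[OF o(1)] by (intro mult_left_mono) auto
  then show "real n * dec ex' n N * exp (- (2 * ex'\<^sup>2 * CH * (ln (real n) / real n))) <= ps n N * sc n"
    unfolding mult.assoc[symmetric] sd by (simp add: mult.commute)
qed

lemma sc_ge:
  assumes "n >= 3"
  shows "real n powr (1 / 2) <= sc n"
proof -
  note sb = scale_bounds[OF assms]
  have n0: "0 < real n" using assms by simp
  have "ex' * real (n1 n) <= ex' * (dl * nl n)" using sb(5) ex'1 by (intro mult_left_mono) auto
  then have "ex' * real (n1 n) / real n <= ex' * (dl * nl n) / real n" by (rule divide_right_mono) simp
  also have "... = sl * ln (real n)" using n0 by (simp add: sl_def)
  also have "... <= 1 / 2 * ln (real n)" using sl sb(1) by (intro mult_right_mono) auto
  finally have "exp (- (1 / 2) * ln (real n)) <= dec ex' n (n1 n)" by (simp add: dec_def)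
  then have "real n * real n powr (- (1 / 2)) <= sc n"
    unfolding sc_def using assms exp_ln_powr[of n "- (1 / 2)"] by (intro mult_left_mono) auto
  moreover have "real n * real n powr (- (1 / 2)) = real n powr (1 + - (1 / 2))"
    unfolding powr_add using n0 by simp
  ultimately show ?thesis by simp
qed

lemma sc_at_top: "filterlim sc at_top sequentially"
proof (rule filterlim_at_top_mono)
  show "filterlim (%n::nat. real n powr (1 / 2)) at_top sequentially"
    by (rule powr_nat_at_top) simp
  show "\<forall>\<^sub>F n in sequentially. real n powr (1 / 2) <= sc n"
    using eventually_ge_at_top[of 3] by eventually_elim (rule sc_ge)
qed

lemma dec_hz:
  assumes "n >= 3"
  shows "real n * dec ex' n (hz n) <= real n powr (- 2)"
proof -
  note sb = scale_bounds[OF assms]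
  have n0: "0 < real n" using assms by simp
  have "3 <= ex' * (3 / base_rate)"
  proof -
    have "1 * 3 <= ex' * (3 / base_rate)" using ex'1 base_rate by (intro mult_mono) (auto simp: field_simps)
    then show ?thesis by simp
  qed
  then have "3 * nl n <= ex' * (3 / base_rate) * nl n" using sb(2) by (intro mult_right_mono) auto
  also have "... = ex' * (3 / base_rate * nl n)" by simp
  also have "... <= ex' * real (hz n)" using sb(7) ex'1 by (intro mult_left_mono) auto
  finally have "3 * nl n / real n <= ex' * real (hz n) / real n" by (rule divide_right_mono) simp
  then have "dec ex' n (hz n) <= exp (- 3 * ln (real n))" using n0 by (simp add: dec_def)
  then have "real n * dec ex' n (hz n) <= real n * real n powr (- 3)"
    using assms exp_ln_powr[of n "- 3"] by (intro mult_left_mono) auto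
  also have "... = real n powr (1 + - 3)" unfolding powr_add using n0 by simp
  finally show ?thesis by simp
qed

text \<open>The scale \<open>real n * dec ex' n N\<close> tends to infinity at \<open>n1\<close> and
  to 0 at \<open>hz\<close>, so by monotonicity a time where it has a finite positive limit lies
  between them.\<close>

lemma ev_rng:
  assumes lim: "(%n. real n * dec ex' n (N n)) \<longlonglongrightarrow> x" and x: "0 < x"
  shows "\<forall>\<^sub>F n in sequentially. rng n (N n)"
proof -
  have "(%n. real n powr (- 2)) \<longlonglongrightarrow> 0"
    using tiny_tendsto[of "%n. 1 * real n powr (- 2)"] tiny_powr[of "- 2" 1] by simp
  then have z: "\<forall>\<^sub>F n in sequentially. real n powr (- 2) < x / 2" using x by (intro order_tendstoD) auto
  have p: "\<forall>\<^sub>F n in sequentially. x + 1 <= real n powr (sl / 6)"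
    using powr_nat_at_top[of "sl / 6"] sl by (simp add: filterlim_at_top)
  have s: "\<forall>\<^sub>F n in sequentially. x + 1 <= sc n" using sc_at_top by (auto simp: filterlim_at_top)
  have l: "\<forall>\<^sub>F n in sequentially. x / 2 < real n * dec ex' n (N n)" using x by (intro order_tendstoD(1)[OF lim]) auto
  have u: "\<forall>\<^sub>F n in sequentially. real n * dec ex' n (N n) < x + 1" using x by (intro order_tendstoD(2)[OF lim]) auto
  show ?thesis
    using z p s l u eventually_ge_at_top[of 3]
  proof eventually_elim
    case (elim n)
    have "n1 n <= N n"
    proof (rule ccontr)
      assume "~ n1 n <= N n"
      then have "real n * dec ex' n (n1 n) <= real n * dec ex' n (N n)" by (intro mult_left_mono dec_antimono) auto
      then show False using elim unfolding sc_def by linarith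
    qed
    moreover have "N n <= hz n"
    proof (rule ccontr)
      assume "~ N n <= hz n"
      then have "real n * dec ex' n (N n) <= real n * dec ex' n (hz n)" by (intro mult_left_mono dec_antimono) auto
      then show False using elim dec_hz[of n] by linarith
    qed
    ultimately show ?case using elim by (simp add: rng_def)
  qed
qed

lemma ps_sc_limit:
  assumes lim: "(%n. real n * dec ex' n (N n)) \<longlonglongrightarrow> x" and rng: "\<forall>\<^sub>F n in sequentially. rng n (N n)"
  shows "(%n. ps n (N n) * sc n) \<longlonglongrightarrow> x" "(%n. ps n (N n)) \<longlonglongrightarrow> 0"
proof -
  have lnn: "(%n::nat. ln (real n) / real n) \<longlonglongrightarrow> 0" using lim_ln_over_n .
  have low: "(%n. real n * dec ex' n (N n) * exp (- (2 * ex'\<^sup>2 * CH * (ln (real n) / real n)))) \<longlonglongrightarrow> x * exp (- (2 * ex'\<^sup>2 * CH * 0))"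
    by (intro tendsto_intros lim lnn)
  have low': "(%n. real n * dec ex' n (N n) * exp (- (2 * ex'\<^sup>2 * CH * (ln (real n) / real n)))) \<longlonglongrightarrow> x"
    using low by simp
  show A: "(%n. ps n (N n) * sc n) \<longlonglongrightarrow> x"
  proof (rule tendsto_sandwich[OF _ _ low' lim])
    show "\<forall>\<^sub>F n in sequentially. real n * dec ex' n (N n) * exp (- (2 * ex'\<^sup>2 * CH * (ln (real n) / real n))) <= ps n (N n) * sc n"
      using rng ev_ok by eventually_elim (rule ps_bounds(3), auto simp: rng_def)
    show "\<forall>\<^sub>F n in sequentially. ps n (N n) * sc n <= real n * dec ex' n (N n)"
      using rng ev_ok by eventually_elim (rule ps_bounds(2), auto simp: rng_def)
  qed
  have "(%n. ps n (N n) * sc n / sc n) \<longlonglongrightarrow> 0"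
    using A sc_at_top by (intro tendsto_divide_0[OF A] filterlim_at_top_imp_at_infinity)
  then show "(%n. ps n (N n)) \<longlonglongrightarrow> 0"
  proof (rule Lim_transform_eventually)
    show "\<forall>\<^sub>F n in sequentially. ps n (N n) * sc n / sc n = ps n (N n)"
      using eventually_ge_at_top[of 1] by eventually_elim (use sc_pos in force)
  qed
qed

lemma DD_nonneg: "S \<subseteq> slow K l R ==> 0 <= DD S"
  unfolding DD_def by (intro sum_nonneg) (auto dest!: subsetD slow_constants(2))

lemma conc_tendsto:
  assumes "S \<subseteq> slow K l R" "0 < \<theta>"
  shows "(%n. Mean n (%v. of_bool (~ conc S \<theta> n (G n v (n1 n))))) \<longlonglongrightarrow> 0"
  by (rule tiny_tendsto[OF tiny_conc[OF assms] always_eventually]) (intro allI Mean_nonneg, simp)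

text \<open>Where \<open>conc\<close> holds, the counts are \<open>DD S * sc n\<close> and
  \<open>DD T * sc n\<close> up to \<open>\<theta> * sc n\<close>, and \<open>factor_close\<close>
  applies to each factor. Elsewhere the trivial bound 1 is paid with a probability tending to
  0.\<close>

theorem start_gf_limit:
  assumes ST: "S \<subseteq> slow K l R" "T \<subseteq> slow K l R"
    and b: "(%n. real n * dec ex' n (Nb n)) \<longlonglongrightarrow> xb" "0 < xb"
    and a: "(%n. real n * dec ex' n (Na n)) \<longlonglongrightarrow> xa" "0 < xa"
  shows "(%n. start_gf n S T (Nb n) (Na n)) \<longlonglongrightarrow> exp (- (DD S * xb)) * exp (- (DD T * xa))"
proof -
  note rb = ev_rng[OF b] and ra = ev_rng[OF a]
  note lb = ps_sc_limit[OF b(1) rb] and la = ps_sc_limit[OF a(1) ra]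
  define er where "er S \<theta> N x n = ps n (N n) * sc n * \<theta> + DD S * \<bar>ps n (N n) * sc n - x\<bar>
      + 2 * ps n (N n) * (ps n (N n) * sc n * (DD S + \<theta>))" for S \<theta> and N :: "nat => nat" and x n
  have er: "er S \<theta> N x \<longlonglongrightarrow> x * \<theta> + DD S * \<bar>x - x\<bar> + 2 * 0 * (x * (DD S + \<theta>))"
    if "(%n. ps n (N n) * sc n) \<longlonglongrightarrow> x" "(%n. ps n (N n)) \<longlonglongrightarrow> 0" for S \<theta> N x
    unfolding er_def[abs_def] by (intro tendsto_intros that)
  let ?L = "exp (- (DD S * xb)) * exp (- (DD T * xa))"
  have bound: "\<forall>\<^sub>F n in sequentially. \<bar>start_gf n S T (Nb n) (Na n) - ?L\<bar> <= er S \<theta> Nb xb n + er T \<theta> Na xa n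
      + Mean n (%v. of_bool (~ conc S \<theta> n (G n v (n1 n)))) + Mean n (%v. of_bool (~ conc T \<theta> n (G n v (n1 n))))"
    if \<theta>: "0 < \<theta>" for \<theta>
    using rb ra ev_ok order_tendstoD(2)[OF lb(2), of "1/2", simplified] order_tendstoD(2)[OF la(2), of "1/2", simplified]
  proof eventually_elim
    case (elim n)
    note o = okD[OF elim(3)]
    have s: "0 < sc n" by (rule sc_pos[OF o(1)])
    have pb: "0 <= ps n (Nb n)" "ps n (Nb n) <= 1 / 2" and pa: "0 <= ps n (Na n)" "ps n (Na n) <= 1 / 2"
      using elim ps_bounds(1)[OF elim(3)] by (auto simp: rng_def)
    have D: "0 <= DD S" "0 <= DD T" using DD_nonneg ST by auto
    have e0: "0 <= er S \<theta> Nb xb n" "0 <= er T \<theta> Na xa n"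
      unfolding er_def using pb pa s D \<theta> by (auto intro!: add_nonneg_nonneg mult_nonneg_nonneg)
    define U W where "U = (%E. (1 - ps n (Nb n)) ^ cnt n E S)" and "W = (%E. (1 - ps n (Na n)) ^ cnt n E T)"
    have gf: "gf n S T (unroll n (Nb n - n1 n) 0) (unroll n (Na n - n1 n) 0) E = U E * W E" for E
      by (simp only: gf_def unroll_ps U_def W_def)
    have UW: "0 <= U E" "U E <= 1" "0 <= W E" "W E <= 1" for E
      using pb pa by (auto simp: U_def W_def intro!: power_le_one)
    have L1: "0 <= exp (- (DD S * xb))" "exp (- (DD S * xb)) <= 1" "0 <= exp (- (DD T * xa))" "exp (- (DD T * xa)) <= 1"
      using D a b by auto
    define cS cT where "cS = (%v. of_bool (~ conc S \<theta> n (G n v (n1 n))) :: real)"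
      and "cT = (%v. of_bool (~ conc T \<theta> n (G n v (n1 n))) :: real)"
    have aS: "adapted (n1 n) cS" "adapted (n1 n) cT"
      unfolding cS_def cT_def
      by (rule adapted_G'[where f = "%E. of_bool (~ conc S \<theta> n E)", OF order_refl],
          rule adapted_G'[where f = "%E. of_bool (~ conc T \<theta> n E)", OF order_refl])
    have aUW: "adapted (n1 n) (%v. U (G n v (n1 n)) * W (G n v (n1 n)))"
      by (rule adapted_G'[where f = "%E. U E * W E", OF order_refl])
    have aL: "adapted (n1 n) (%v. U (G n v (n1 n)) * W (G n v (n1 n)) - ?L)"
      by (rule adapted_G'[where f = "%E. U E * W E - ?L", OF order_refl])
    have pt: "\<bar>U E * W E - ?L\<bar> <= er S \<theta> Nb xb n + er T \<theta> Na xa n + of_bool (~ conc S \<theta> n E) + of_bool (~ conc T \<theta> n E)" for E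
    proof (cases "conc S \<theta> n E & conc T \<theta> n E")
      case True
      have "\<bar>U E - exp (- (DD S * xb))\<bar> <= er S \<theta> Nb xb n"
        unfolding U_def er_def using True b D by (intro factor_close[OF pb s]) (auto simp: conc_def)
      moreover have "\<bar>W E - exp (- (DD T * xa))\<bar> <= er T \<theta> Na xa n"
        unfolding W_def er_def using True a D by (intro factor_close[OF pa s]) (auto simp: conc_def)
      ultimately show ?thesis
        using True product_diff_le[of "U E" "exp (- (DD T * xa))" "W E" "exp (- (DD S * xb))"] UW[of E] L1 by simp
    next
      case False
      have "0 <= U E * W E" "U E * W E <= 1" "0 <= ?L" "?L <= 1"
        using mult_nonneg_nonneg[OF UW(1,3)] mult_le_one[OF UW(2,3,4)] mult_nonneg_nonneg[OF L1(1,3)] mult_le_one[OF L1(2,3,4)] by blast+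
      then have "\<bar>U E * W E - ?L\<bar> <= 1" by linarith
      moreover have "1 <= of_bool (~ conc S \<theta> n E) + (of_bool (~ conc T \<theta> n E) :: real)" using False by auto
      ultimately show ?thesis using e0 by linarith
    qed
    let ?e = "er S \<theta> Nb xb n + er T \<theta> Na xa n"
    have a1: "adapted (n1 n) (%v. ?e + cS v)" by (rule adapted_comp1[where h = "%y. ?e + y", OF aS(1)])
    have a2: "adapted (n1 n) (%v. ?e + cS v + cT v)" by (rule adapted_comp2[where h = "(+)", OF a1 aS(2)])
    have "\<bar>Mean n (%v. U (G n v (n1 n)) * W (G n v (n1 n)) - ?L)\<bar> <= Mean n (%v. ?e + cS v + cT v)"
      by (rule Mean_abs_le[OF o(1) aL a2]) (unfold cS_def cT_def, rule pt)
    also have "... = ?e + Mean n cS + Mean n cT"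
      by (simp only: Mean_add[OF o(1) a1 aS(2)] Mean_add[OF o(1) adapted_const[of 0] aS(1)] Mean_const[OF o(1)])
    also have "Mean n (%v. U (G n v (n1 n)) * W (G n v (n1 n)) - ?L) = start_gf n S T (Nb n) (Na n) - ?L"
      unfolding start_gf_def gf by (simp only: Mean_diff[OF o(1) aUW adapted_const[of 0]] Mean_const[OF o(1)])
    finally show ?case unfolding cS_def cT_def .
  qed
  show ?thesis
  proof (rule tendstoI)
    fix e :: real assume e: "0 < e"
    \<comment> \<open>In the limit the error is \<open>(xb + xa) * \<theta>\<close>, which this
      choice makes \<open>e / 2\<close>.\<close>
    define \<theta> where "\<theta> = e / 2 / (xb + xa)"
    have \<theta>: "0 < \<theta>" using e a b by (simp add: \<theta>_def)
    have "(%n. er S \<theta> Nb xb n + er T \<theta> Na xa n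
      + Mean n (%v. of_bool (~ conc S \<theta> n (G n v (n1 n)))) + Mean n (%v. of_bool (~ conc T \<theta> n (G n v (n1 n)))))
      \<longlonglongrightarrow> (xb * \<theta> + DD S * \<bar>xb - xb\<bar> + 2 * 0 * (xb * (DD S + \<theta>))) + (xa * \<theta> + DD T * \<bar>xa - xa\<bar> + 2 * 0 * (xa * (DD T + \<theta>))) + 0 + 0"
      by (intro tendsto_add er lb la conc_tendsto ST \<theta>)
    moreover have "(xb * \<theta> + DD S * \<bar>xb - xb\<bar> + 2 * 0 * (xb * (DD S + \<theta>))) + (xa * \<theta> + DD T * \<bar>xa - xa\<bar> + 2 * 0 * (xa * (DD T + \<theta>))) + 0 + 0 < e"
    proof -
      have "xb * \<theta> + xa * \<theta> = (xb + xa) * \<theta>" by (simp add: distrib_right)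
      also have "... = (xb + xa) * (e / 2) / (xb + xa)" by (simp only: \<theta>_def times_divide_eq_right)
      also have "... = e / 2" by (rule nonzero_mult_div_cancel_left) (use a b in linarith)
      finally have "xb * \<theta> + xa * \<theta> = e / 2" .
      then show ?thesis using e by simp
    qed
    ultimately have "\<forall>\<^sub>F n in sequentially. er S \<theta> Nb xb n + er T \<theta> Na xa n
      + Mean n (%v. of_bool (~ conc S \<theta> n (G n v (n1 n)))) + Mean n (%v. of_bool (~ conc T \<theta> n (G n v (n1 n)))) < e"
      by (rule order_tendstoD)
    then show "\<forall>\<^sub>F n in sequentially. dist (start_gf n S T (Nb n) (Na n)) ?L < e"
      using bound[OF \<theta>] by eventually_elim (simp add: dist_real_def)
  qed
qed

text \<open>In this parametrisation \<open>real n * dec ex' n (tm c n)\<close> tends to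
  \<open>exp (- c)\<close>, the mean number of surviving slow components up to the factor
  \<open>DD\<close>.\<close>

definition tm :: "real => nat => nat" where
  "tm c n = nat \<lfloor>(real n * ln (real n) + c * real n) / ex'\<rfloor>"

lemma ev_tm:
  "\<forall>\<^sub>F n in sequentially. 0 <= (real n * ln (real n) + c * real n) / ex' &
     exp (- c) <= real n * dec ex' n (tm c n) & real n * dec ex' n (tm c n) <= exp (- c) * exp (ex' / real n)"
  using ev_ln_ge[of "- c"] eventually_ge_at_top[of 1]
proof eventually_elim
  case (elim n)
  have n0: "0 < real n" using elim by simp
  let ?X = "(real n * ln (real n) + c * real n) / ex'"
  have X: "?X = real n * (ln (real n) + c) / ex'" by (simp add: algebra_simps)
  have X0: "0 <= ?X" unfolding X using elim ex'1 by (intro divide_nonneg_nonneg mult_nonneg_nonneg) auto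
  have t: "real (tm c n) <= ?X" "?X - 1 <= real (tm c n)" unfolding tm_def using X0 by linarith+
  have eX: "ex' * ?X / real n = ln (real n) + c" unfolding X using ex'1 n0 by simp
  have nd: "real n * dec ex' n (tm c n) = exp (ln (real n) - ex' * real (tm c n) / real n)"
    using n0 by (simp add: dec_def exp_diff exp_minus divide_inverse)
  have "ex' * real (tm c n) / real n <= ex' * ?X / real n"
    using t(1) ex'1 by (intro divide_right_mono mult_left_mono) auto
  then have 1: "- c <= ln (real n) - ex' * real (tm c n) / real n" using eX by linarith
  have "ex' * (?X - 1) / real n <= ex' * real (tm c n) / real n"
    using t(2) ex'1 by (intro divide_right_mono mult_left_mono) auto
  moreover have "ex' * (?X - 1) / real n = ex' * ?X / real n - ex' / real n" by (simp add: right_diff_distrib diff_divide_distrib)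
  ultimately have 2: "ln (real n) - ex' * real (tm c n) / real n <= - c + ex' / real n" using eX by linarith
  show ?case using X0 1 2 unfolding nd exp_add[symmetric] by simp
qed

lemma tm_dec: "(%n. real n * dec ex' n (tm c n)) \<longlonglongrightarrow> exp (- c)"
proof (rule tendsto_sandwich)
  show "\<forall>\<^sub>F n in sequentially. exp (- c) <= real n * dec ex' n (tm c n)"
    using ev_tm[of c] by eventually_elim simp
  show "\<forall>\<^sub>F n in sequentially. real n * dec ex' n (tm c n) <= exp (- c) * exp (ex' / real n)"
    using ev_tm[of c] by eventually_elim simp
  have "(%n::nat. exp (- c) * exp (ex' / real n)) \<longlonglongrightarrow> exp (- c) * exp 0"
    by (intro tendsto_intros lim_const_over_n)
  then show "(%n::nat. exp (- c) * exp (ex' / real n)) \<longlonglongrightarrow> exp (- c)" by simp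
qed simp

lemma ev_rng_tm: "\<forall>\<^sub>F n in sequentially. rng n (tm c n)"
  by (rule ev_rng[OF tm_dec]) simp

lemma tiny_smallo: "tiny f ==> \<forall>\<^sub>F n in sequentially. 0 <= f n ==> f \<in> o(%n. 1 / ln (real n))"
proof (rule smalloI_tendsto)
  assume "tiny f" "\<forall>\<^sub>F n in sequentially. 0 <= f n"
  from tiny_ln_tendsto[OF this] show "(%n. f n / (1 / ln (real n))) \<longlonglongrightarrow> 0" by (simp add: mult.commute)
  show "\<forall>\<^sub>F n in sequentially. 1 / ln (real n) ~= 0" using ev_ln_ge[of 1] by eventually_elim simp
qed

lemma prob_ge_clean:
  assumes ok: "ok n" and N: "rng n N" and S: "{v \<in> Om n. P v} \<in> sets (choice_space l n)"
    and imp: "!!v. v \<in> Om n ==> clean n N v ==> P v"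
  shows "1 - \<P>(v in choice_space l n. P v) <= tau n"
proof -
  note n = okD(1)[OF ok]
  note ac = adapted_clean[OF ok N]
  have "1 - tau n <= 1 - Mean n (%v. of_bool (~ clean n N v))" using not_clean_bound[OF ok N] by simp
  also have "... = Mean n (%v. 1 - of_bool (~ clean n N v))"
    by (simp only: Mean_diff[OF n adapted_const[of 0] adapted_comp1[where h = "%b. of_bool (~ b)", OF ac]] Mean_const[OF n])
  also have "... = Mean n (%v. of_bool (clean n N v))" by (rule Mean_cong) simp
  also have "... <= \<P>(v in choice_space l n. P v)" by (rule Mean_le_prob[OF n ac S imp])
  finally show ?thesis by simp
qed

theorem fast_components_vanish:
  "(%n. 1 - \<P>(v in choice_space l n. ALL N. real N >= (real n * ln (real n) + c * real n) / ex' -->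
       (ALL k:fast K l R. Y K l R n k v N = 0) & card (large_components K l R n v N) = 1))
    \<in> o(%n. 1 / ln (real n))"
proof (rule tiny_smallo)
  let ?P = "%n v. ALL N. real N >= (real n * ln (real n) + c * real n) / ex' -->
       (ALL k:fast K l R. Y K l R n k v N = 0) & card (large_components K l R n v N) = 1"
  show "\<forall>\<^sub>F n in sequentially. 0 <= 1 - \<P>(v in choice_space l n. ?P n v)"
    using eventually_ge_at_top[of 1]
  proof eventually_elim
    case (elim n)
    interpret prob_space "choice_space l n" by (rule prob_choice[OF elim])
    show ?case using prob_le_1 by simp
  qed
  have "\<forall>\<^sub>F n in sequentially. 1 - \<P>(v in choice_space l n. ?P n v) <= tau n"
    using ev_ok ev_rng_tm[of c] ev_tm[of c]
  proof eventually_elim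
    case (elim n)
    let ?X = "(real n * ln (real n) + c * real n) / ex'"
    show ?case
    proof (rule prob_ge_clean[OF elim(1,2)])
      have ad: "adapted N (%v. (ALL k:fast K l R. Y K l R n k v N = 0) & card (large_components K l R n v N) = 1)" for N
        unfolding Y_def large_components_def
        by (rule adapted_G'[where f = "%E. (ALL k:fast K l R. card {u \<in> {1..n}. card (component_of {1..n} E u) = k} = 0) &
             card {C \<in> graph_components {1..n} E. K < card C} = 1", OF order_refl])
      show "{v \<in> Om n. ?P n v} \<in> sets (choice_space l n)"
        by (intro sets.sets_Collect_countable_All sets.sets_Collect_imp sets.sets_Collect_const adapted_sets[OF ad])
      fix v assume v: "v \<in> Om n" "clean n (tm c n) v"
      show "?P n v"
      proof (intro allI impI conjI ballI)
        fix N assume "?X <= real N"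
        then have N: "tm c n <= N" using elim(3) unfolding tm_def by linarith
        show "card (large_components K l R n v N) = 1"
          unfolding card_large_components by (rule clean_counts(2)[OF elim(1,2) v N])
        fix k assume k: "k \<in> fast K l R"
        then have "1 <= k" by (auto simp: fast_def)
        then show "Y K l R n k v N = 0" using clean_fast[OF elim(1,2) v N k] by (simp add: Y_0_iff)
      qed
    qed
  qed
  then show "tiny (%n. 1 - \<P>(v in choice_space l n. ?P n v))" using tiny_tau by (rule tiny_mono)
qed

definition err :: "nat => real" where "err n = tau n + (2 * bad n + 2 * gerr n)"

lemma tiny_err: "tiny err"
  unfolding err_def[abs_def] by (intro tiny_add tiny_tau tiny_cmult tiny_bad tiny_gerr) auto

lemma ev_gerr_nonneg: "\<forall>\<^sub>F n in sequentially. 0 <= gerr n & 0 <= tau n & 0 <= bad n"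
  using ev_ok ev_rng_tm[of 0]
proof eventually_elim
  case (elim n)
  note o = okD[OF elim(1)]
  have "0 <= gerr n" unfolding gerr_def using gen_const_nonneg CH scale_bounds(1)[OF o(2)]
    by (intro mult_nonneg_nonneg add_nonneg_nonneg) auto
  moreover have "0 <= tau n" by (rule order_trans[OF Mean_nonneg not_clean_bound[OF elim]]) simp
  ultimately show ?case using bad_nonneg[OF o(1)] by simp
qed

lemma tau_tendsto: "tau \<longlonglongrightarrow> 0" and bad_tendsto: "bad \<longlonglongrightarrow> 0" and gerr_tendsto: "gerr \<longlonglongrightarrow> 0"
  and ev_err_nonneg: "\<forall>\<^sub>F n in sequentially. 0 <= err n" and err_tendsto: "err \<longlonglongrightarrow> 0"
proof -
  note e = ev_gerr_nonneg
  show "tau \<longlonglongrightarrow> 0" by (rule tiny_tendsto[OF tiny_tau]) (use e in \<open>auto elim: eventually_mono\<close>)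
  show "bad \<longlonglongrightarrow> 0" by (rule tiny_tendsto[OF tiny_bad]) (use e in \<open>auto elim: eventually_mono\<close>)
  show "gerr \<longlonglongrightarrow> 0" by (rule tiny_tendsto[OF tiny_gerr]) (use e in \<open>auto elim: eventually_mono\<close>)
  show n: "\<forall>\<^sub>F n in sequentially. 0 <= err n" using e by eventually_elim (simp add: err_def)
  show "err \<longlonglongrightarrow> 0" by (rule tiny_tendsto[OF tiny_err n])
qed

lemma close_tendsto:
  fixes f g :: "nat => real"
  assumes "\<forall>\<^sub>F n in sequentially. \<bar>f n - g n\<bar> <= e n" "e \<longlonglongrightarrow> 0" "g \<longlonglongrightarrow> L"
  shows "f \<longlonglongrightarrow> L"
proof -
  have "(%n. f n - g n) \<longlonglongrightarrow> 0"
    using assms(1) by (intro Lim_null_comparison[OF _ assms(2)]) simp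
  from tendsto_add[OF this assms(3)] show ?thesis by simp
qed

lemma T_con_prob:
  assumes n: "n >= 1" and X: "0 <= x"
  shows "\<P>(v in choice_space l n. ereal_of_enat (T_con K l R n v) <= ereal x) = Mean n (%v. of_bool (Q n (G n v (nat \<lfloor>x\<rfloor>)) = 0))"
proof -
  have "ereal_of_enat a <= ereal x \<longleftrightarrow> a <= enat (nat \<lfloor>x\<rfloor>)" for a
    using X by (cases a) (auto simp: le_nat_floor le_nat_iff le_floor_iff)
  then have "{v \<in> Om n. ereal_of_enat (T_con K l R n v) <= ereal x} = {v \<in> Om n. Q n (G n v (nat \<lfloor>x\<rfloor>)) = 0}"
    using T_con_le[OF n] by auto
  then show ?thesis
    using prob_adapted[OF n adapted_G'[where f = "%E. Q n E = 0", OF order_refl]] by simp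
qed

theorem T_con_limit_law:
  "(%n. \<P>(v in choice_space l n. ereal_of_enat (T_con K l R n v) <= ereal ((real n * ln (real n) + c * real n) / ex')))
    \<longlonglongrightarrow> (PROD k:slow K l R. exp (- (d k * exp (- c))))"
proof -
  have fin: "finite (slow K l R)" using finite_subset[OF slow_subset] by simp
  have "(%n. start_gf n (slow K l R) {} (tm c n) (tm c n)) \<longlonglongrightarrow> exp (- (DD (slow K l R) * exp (- c))) * exp (- (DD {} * exp (- c)))"
    by (intro start_gf_limit tm_dec) auto
  also have "exp (- (DD (slow K l R) * exp (- c))) * exp (- (DD {} * exp (- c))) = (PROD k:slow K l R. exp (- (d k * exp (- c))))"
    by (simp add: DD_def exp_sum[OF fin, symmetric] sum_negf sum_distrib_right)
  finally have L: "(%n. start_gf n (slow K l R) {} (tm c n) (tm c n)) \<longlonglongrightarrow> (PROD k:slow K l R. exp (- (d k * exp (- c))))" .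
  show ?thesis
  proof (rule close_tendsto[OF _ err_tendsto L])
    show "\<forall>\<^sub>F n in sequentially. \<bar>\<P>(v in choice_space l n. ereal_of_enat (T_con K l R n v) <= ereal ((real n * ln (real n) + c * real n) / ex')) -
         start_gf n (slow K l R) {} (tm c n) (tm c n)\<bar> <= err n"
      using ev_ok ev_rng_tm[of c] ev_tm[of c]
    proof eventually_elim
      case (elim n)
      then have X: "0 <= (real n * ln (real n) + c * real n) / ex'" by blast
      show ?case using T_con_law[OF elim(1,2)] unfolding T_con_prob[OF okD(1)[OF elim(1)] X] tm_def err_def .
    qed
  qed
qed

end

section \<open>The expected connection time\<close>

lemma power_Suc_diff_bounds:
  fixes x y :: real
  assumes "0 <= x" "x <= y"
  shows "real (Suc m) * (x ^ m * (y - x)) <= y ^ Suc m - x ^ Suc m"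
    "y ^ Suc m - x ^ Suc m <= real (Suc m) * (y ^ m * (y - x))"
proof (induction m)
  case (Suc m)
  {
    case 1
    have e: "y ^ Suc (Suc m) - x ^ Suc (Suc m) = y * (y ^ Suc m - x ^ Suc m) + x ^ Suc m * (y - x)"
      by (simp add: algebra_simps)
    have "x * (real (Suc m) * (x ^ m * (y - x))) <= y * (y ^ Suc m - x ^ Suc m)"
      using assms Suc.IH(1) power_mono[OF assms(2,1), of "Suc m"] by (intro mult_mono) auto
    moreover have "x * (real (Suc m) * (x ^ m * (y - x))) + x ^ Suc m * (y - x) = real (Suc (Suc m)) * (x ^ Suc m * (y - x))"
      by (simp add: algebra_simps)
    ultimately show ?case unfolding e by linarith
  next
    case 2
    have e: "y ^ Suc (Suc m) - x ^ Suc (Suc m) = y * (y ^ Suc m - x ^ Suc m) + x ^ Suc m * (y - x)"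
      by (simp add: algebra_simps)
    have "y * (y ^ Suc m - x ^ Suc m) <= y * (real (Suc m) * (y ^ m * (y - x)))"
      using assms Suc.IH(2) by (intro mult_left_mono) auto
    moreover have "x ^ Suc m * (y - x) <= y ^ Suc m * (y - x)"
      using assms by (intro mult_right_mono power_mono) auto
    moreover have "y * (real (Suc m) * (y ^ m * (y - x))) + y ^ Suc m * (y - x) = real (Suc (Suc m)) * (y ^ Suc m * (y - x))"
      by (simp add: algebra_simps)
    ultimately show ?case unfolding e by linarith
  }
qed auto

text \<open>The sum below is a truncated expectation of the maximum of \<open>m\<close> independent geometric variables.\<close>

definition gsum :: "nat => nat => real => real" where
  "gsum m J r = (SUM a<J. 1 - (1 - r ^ a) ^ m)"

text \<open>One more variable adds a sum of terms \<open>x a ^ m * (x (Suc a) - x a)\<close>, a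
  Riemann sum of \<open>x ^ m\<close> over \<open>[0, 1]\<close>, hence about
  \<open>1 / (m + 1)\<close>. Left end points give the upper bound; right end points give the lower
  bound after a shift of the index, which costs the factor \<open>r\<close> and the step from
  \<open>J\<close> to \<open>Suc J\<close>.\<close>

lemma gsum_step:
  assumes r: "0 <= r" "r <= 1"
  shows "(1 - r) * gsum (Suc m) J r <= (1 - r) * gsum m J r + 1 / real (Suc m)"
    "(1 - r) * gsum m (Suc J) r + (r / real (Suc m) - r * r ^ J) <= (1 - r) * gsum (Suc m) (Suc J) r"
proof -
  define x where "x a = 1 - r ^ a" for a
  have x01: "0 <= x a" "x a <= 1" for a using r by (auto simp: x_def power_le_one)
  have xd: "x (Suc a) - x a = r ^ a * (1 - r)" for a by (simp add: x_def algebra_simps)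
  have xm: "x a <= x (Suc a)" for a using xd[of a] r by (metis diff_ge_0_iff_ge mult_nonneg_nonneg zero_le_power)
  have df: "(1 - r) * gsum (Suc m) L r - (1 - r) * gsum m L r = (SUM a<L. x a ^ m * (r ^ a * (1 - r)))" for L
    unfolding gsum_def right_diff_distrib[symmetric] sum_subtractf[symmetric] sum_distrib_left
    by (rule sum.cong) (auto simp: x_def algebra_simps)
  have "(SUM a<J. x a ^ m * (r ^ a * (1 - r))) <= (SUM a<J. (x (Suc a) ^ Suc m - x a ^ Suc m) / real (Suc m))"
  proof (rule sum_mono)
    fix a
    show "x a ^ m * (r ^ a * (1 - r)) <= (x (Suc a) ^ Suc m - x a ^ Suc m) / real (Suc m)"
      using power_Suc_diff_bounds(1)[OF x01(1) xm, of m a] unfolding xd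
      by (subst pos_le_divide_eq) (auto simp: mult.commute)
  qed
  also have "... = (x J ^ Suc m - x 0 ^ Suc m) / real (Suc m)"
    unfolding sum_divide_distrib[symmetric] by (subst sum_lessThan_telescope[of "%a. x a ^ Suc m"]) simp
  also have "... <= 1 / real (Suc m)"
    using x01[of J] power_le_one[of "x J" "Suc m"] by (intro divide_right_mono) (auto simp: x_def)
  finally show "(1 - r) * gsum (Suc m) J r <= (1 - r) * gsum m J r + 1 / real (Suc m)" using df[of J] by linarith
  \<comment> \<open>The truncation at \<open>J\<close> stops the Riemann sum at \<open>x J\<close>
    instead of 1; Bernoulli bounds the missing piece.\<close>
  have "1 + real (Suc m) * (- (r ^ J)) <= (1 + - (r ^ J)) ^ Suc m"
    using x01[of J] by (intro Bernoulli_inequality) (auto simp: x_def)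
  then have bern: "1 - real (Suc m) * r ^ J <= x J ^ Suc m" by (simp add: x_def)
  have "r / real (Suc m) - r * r ^ J = r * ((1 - real (Suc m) * r ^ J) / real (Suc m))" by (simp add: field_simps)
  also have "... <= r * (x J ^ Suc m / real (Suc m))" using bern r by (intro mult_left_mono divide_right_mono) auto
  also have "... = r * ((x J ^ Suc m - x 0 ^ Suc m) / real (Suc m))" by (simp add: x_def)
  also have "... = (SUM a<J. r * ((x (Suc a) ^ Suc m - x a ^ Suc m) / real (Suc m)))"
    unfolding sum_distrib_left[symmetric] sum_divide_distrib[symmetric]
    by (subst sum_lessThan_telescope[of "%a. x a ^ Suc m"]) simp
  also have "... <= (SUM a<J. x (Suc a) ^ m * (r ^ Suc a * (1 - r)))"
  proof (rule sum_mono)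
    fix a
    have "(x (Suc a) ^ Suc m - x a ^ Suc m) / real (Suc m) <= x (Suc a) ^ m * (r ^ a * (1 - r))"
      using power_Suc_diff_bounds(2)[OF x01(1) xm, of a m] unfolding xd
      by (subst pos_divide_le_eq) (auto simp: mult.commute)
    then have "r * ((x (Suc a) ^ Suc m - x a ^ Suc m) / real (Suc m)) <= r * (x (Suc a) ^ m * (r ^ a * (1 - r)))"
      using r by (intro mult_left_mono)
    then show "r * ((x (Suc a) ^ Suc m - x a ^ Suc m) / real (Suc m)) <= x (Suc a) ^ m * (r ^ Suc a * (1 - r))"
      by (simp add: mult_ac)
  qed
  also have "... <= (SUM a<Suc J. x a ^ m * (r ^ a * (1 - r)))"
    unfolding sum.lessThan_Suc_shift[of _ J] using x01[of 0] r by simp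
  finally show "(1 - r) * gsum m (Suc J) r + (r / real (Suc m) - r * r ^ J) <= (1 - r) * gsum (Suc m) (Suc J) r"
    using df[of "Suc J"] by linarith
qed

lemma gsum_bounds:
  assumes r: "0 <= r" "r <= 1"
  shows "(1 - r) * gsum m J r <= harm m" "r * (harm m - real m * r ^ J) <= (1 - r) * gsum m (Suc J) r"
proof -
  show "(1 - r) * gsum m J r <= harm m"
  proof (induction m)
    case 0
    then show ?case by (simp add: gsum_def harm_expand)
  next
    case (Suc m)
    then show ?case using gsum_step(1)[OF r, of m J] unfolding harm_Suc inverse_eq_divide by simp
  qed
  show "r * (harm m - real m * r ^ J) <= (1 - r) * gsum m (Suc J) r"
  proof (induction m)
    case 0
    then show ?case by (simp add: gsum_def harm_expand)
  next
    case (Suc m)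
    have "r * (harm (Suc m) - real (Suc m) * r ^ J) = r * (harm m - real m * r ^ J) + (r / real (Suc m) - r * r ^ J)"
      unfolding harm_Suc inverse_eq_divide by (simp add: algebra_simps)
    then show ?case using Suc gsum_step(2)[OF r, of m J] by linarith
  qed
qed

lemma harm_le_ln: "m >= 1 ==> harm m <= 1 + ln (real m)"
  using euler_mascheroni_sequence_decreasing[of 1 m] by (simp add: harm_def)

lemma expectation_algebra:
  fixes m e :: real
  assumes "m ~= 0" "e ~= 0"
  shows "(S - (m * L + g * m + D * m) / e) / m
    = (S - a - b) / m + ((e / m * b - c) + (c - (L - e * a / m) - (D + g))) / e"
  using assms by (simp add: field_simps)

context rule_ode
begin

definition pT :: "nat => nat => real" where
  "pT n N = Mean n (%v. of_bool (Q n (G n v N) ~= 0))"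

lemma adapted_pT: "adapted N (%v. of_bool (Q n (G n v N) ~= 0) :: real)"
  by (rule adapted_G'[where f = "%E. of_bool (Q n E ~= 0)", OF order_refl])

lemma pT_compl: "n >= 1 ==> pT n N = 1 - Mean n (%v. of_bool (Q n (G n v N) = 0))"
proof -
  assume n: "n >= 1"
  have "pT n N = Mean n (%v. 1 - of_bool (Q n (G n v N) = 0))" unfolding pT_def by (rule Mean_cong) simp
  then show ?thesis
    by (simp only: Mean_diff[OF n adapted_const[of 0] adapted_G'[where f = "%E. of_bool (Q n E = 0)", OF order_refl]] Mean_const[OF n])
qed

lemma pT_nonneg: "0 <= pT n N"
  unfolding pT_def by (rule Mean_nonneg) simp

lemma pT_le_1: "n >= 1 ==> pT n N <= 1"
  using pT_compl[of n N] Mean_nonneg[of n "%v. of_bool (Q n (G n v N) = 0)"] by simp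

lemma pT_antimono: "n >= 1 ==> N <= M ==> pT n M <= pT n N"
  unfolding pT_def
proof (rule Mean_mono[OF _ adapted_pT adapted_pT])
  fix v assume n: "n >= 1" "N <= M" "v \<in> Om n"
  have "Q n (G n v N) = 0 ==> Q n (G n v M) = 0"
    using Q_path_mono[OF n(3,2)] Q_nonneg[OF n(1), of "G n v M"] by simp
  then show "of_bool (Q n (G n v M) ~= 0) <= (of_bool (Q n (G n v N) ~= 0) :: real)" by auto
qed

lemma pT_le:
  assumes "ok n"
  shows "pT n N <= real n * (1 - base_rate / real n) ^ N"
proof -
  note o = okD[OF assms]
  have "pT n N <= Mean n (%v. Q n (G n v N))"
    unfolding pT_def
  proof (rule Mean_mono[OF o(1) adapted_pT adapted_G'[OF order_refl]])
    fix v
    show "of_bool (Q n (G n v N) ~= 0) <= Q n (G n v N)"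
      using Q_dichotomy[of n "G n v N"] Q_nonneg[OF o(1), of "G n v N"] by auto
  qed
  also have "... <= real n * (1 - base_rate / real n) ^ N" by (rule Mean_Q_universal[OF o(7,1)])
  finally show ?thesis .
qed

lemma base_ratio: "n >= 1 ==> 0 <= 1 - base_rate / real n & 1 - base_rate / real n < 1"
  using base_rate by (auto simp: field_simps)

lemma summable_pT: "ok n ==> summable (pT n)"
proof -
  assume ok: "ok n"
  note o = okD[OF ok]
  have "summable (%N. real n * (1 - base_rate / real n) ^ N)"
    using base_ratio[OF o(1)] by (intro summable_mult summable_geometric) auto
  then show ?thesis by (rule summable_comparison_test_ev[rotated]) (use pT_le[OF ok] pT_nonneg in auto)
qed

text \<open>Beyond \<open>hz n\<close> the universal decay is a geometric series with ratio
  \<open>1 - base_rate / n\<close>. Its sum costs \<open>n / base_rate\<close>, while its first term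
  is at most \<open>n powr (- 2)\<close>.\<close>

lemma pT_tail:
  assumes ok: "ok n"
  shows "\<bar>(\<Sum>N. pT n N) - (SUM N<hz n. pT n N)\<bar> <= 1 / base_rate"
proof -
  note o = okD[OF ok]
  have n0: "0 < real n" using o(1) by simp
  let ?r = "1 - base_rate / real n"
  have r: "0 <= ?r" "?r < 1" using base_ratio[OF o(1)] by auto
  have geo: "(%N. real n * ?r ^ hz n * ?r ^ N) sums (real n * ?r ^ hz n * (1 / (1 - ?r)))"
    using r by (intro sums_mult geometric_sums) auto
  have "(\<Sum>N. pT n (N + hz n)) <= (\<Sum>N. real n * ?r ^ hz n * ?r ^ N)"
  proof (rule suminf_le)
    fix N
    show "pT n (N + hz n) <= real n * ?r ^ hz n * ?r ^ N"
      using pT_le[OF ok, of "N + hz n"] by (simp add: power_add mult_ac)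
  next
    show "summable (%N. pT n (N + hz n))" using summable_pT[OF ok] by (simp only: summable_iff_shift)
    show "summable (%N. real n * ?r ^ hz n * ?r ^ N)" using geo by (rule sums_summable)
  qed
  also have "... = real n * ?r ^ hz n * (1 / (1 - ?r))" using geo by (rule sums_unique[symmetric])
  also have "... = real n * ?r ^ hz n * (real n / base_rate)" by simp
  also have "... <= real n powr (- 2) * (real n / base_rate)"
    using Mean_Q_hz(2)[OF ok] base_rate by (intro mult_right_mono) auto
  also have "... <= (1 / real n) * (real n / base_rate)"
  proof (intro mult_right_mono)
    have "real n powr (- 2) <= real n powr (- 1)" using o(1) by (intro powr_mono) auto
    also have "... = 1 / real n" using n0 by (simp add: powr_minus divide_inverse)
    finally show "real n powr (- 2) <= 1 / real n" .
  qed (use base_rate in auto)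
  also have "... = 1 / base_rate" using n0 by simp
  finally have "(\<Sum>N. pT n (N + hz n)) <= 1 / base_rate" .
  moreover have "0 <= (\<Sum>N. pT n (N + hz n))"
    using summable_pT[OF ok] by (intro suminf_nonneg) (auto simp: pT_nonneg summable_iff_shift)
  moreover have "(\<Sum>N. pT n N) = (\<Sum>N. pT n (N + hz n)) + (SUM N<hz n. pT n N)"
    by (rule suminf_split_initial_segment[OF summable_pT[OF ok]])
  ultimately show ?thesis by linarith
qed

lemma expected_T_con:
  assumes ok: "ok n"
  shows "(\<integral>\<^sup>+ v. ennreal_of_enat (T_con K l R n v) \<partial>choice_space l n) = ennreal (\<Sum>N. pT n N)"
proof -
  note n = okD(1)[OF ok]
  interpret prob_space "choice_space l n" by (rule prob_choice[OF n])
  have e: "emeasure (choice_space l n) {v \<in> Om n. enat N < T_con K l R n v} = ennreal (pT n N)" for N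
  proof -
    have s: "{v \<in> Om n. enat N < T_con K l R n v} = {v \<in> Om n. Q n (G n v N) ~= 0}"
      using T_con_le[OF n] by (auto simp: not_le[symmetric])
    show ?thesis
      unfolding s emeasure_eq_measure pT_def
      using prob_adapted[OF n adapted_G'[where f = "%E. Q n E ~= 0", OF order_refl]] by simp
  qed
  show ?thesis
    unfolding nn_integral_enat_function[OF T_con_measurable[OF n]] e
    by (rule suminf_ennreal2[OF pT_nonneg summable_pT[OF ok]])
qed

text \<open>Before time \<open>Nm\<close> both the probability of not being connected and its approximation are close
  to \<open>1\<close>.\<close>

definition Nm :: "nat => nat" where "Nm n = nat \<lceil>(1 - sl / 6) * nl n / ex'\<rceil>"

text \<open>Up to rounding \<open>Nm n\<close> is where the bound \<open>n powr (sl / 6)\<close> of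
  \<open>rng\<close> begins to hold. The scale of surviving components is then still a power of
  \<open>n\<close>, so the graph is unlikely to be connected.\<close>

lemma Nm:
  assumes "ok n"
  shows "rng n (Nm n)" "real n powr (sl / 6) / 3 <= real n * dec ex' n (Nm n)"
proof -
  note o = okD[OF assms]
  note sb = scale_bounds[OF o(2)]
  have n0: "0 < real n" using o(1) by simp
  let ?y = "(1 - sl / 6) * nl n / ex'"
  have s: "0 <= 1 - sl / 6" "1 - sl / 6 <= 1" "sl <= 1 - sl / 6" using sl by auto
  have y0: "0 <= ?y" using s sb(1) ex'1 by (intro divide_nonneg_nonneg mult_nonneg_nonneg) auto
  have N: "?y <= real (Nm n)" "real (Nm n) <= ?y + 1" unfolding Nm_def using y0 by linarith+
  have e1: "ex' * ?y / real n = (1 - sl / 6) * ln (real n)" using ex'1 n0 by simp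
  have "dl * nl n = sl * nl n / ex'" using ex'1 by (simp add: sl_def)
  also have "... <= ?y" using s sb(2) ex'1 by (intro divide_right_mono mult_right_mono) auto
  finally have "real (n1 n) <= real (Nm n)" using sb(5) N(1) by linarith
  then have r1: "n1 n <= Nm n" by simp
  have "?y <= 1 * nl n / 1" using s sb(2) ex'1 by (intro frac_le mult_right_mono) auto
  moreover have "3 * nl n <= 3 / base_rate * nl n" using base_rate sb(2) by (intro mult_right_mono) (auto simp: field_simps)
  ultimately have "real (Nm n) <= real (hz n)" using N(2) sb(2,7) by linarith
  then have r2: "Nm n <= hz n" by simp
  have nd: "real n * dec ex' n (Nm n) = exp (ln (real n) - ex' * real (Nm n) / real n)"
    using n0 by (simp add: dec_def exp_diff exp_minus divide_inverse)
  have "ex' * ?y / real n <= ex' * real (Nm n) / real n"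
    using N(1) ex'1 by (intro divide_right_mono mult_left_mono) auto
  then have "ln (real n) - ex' * real (Nm n) / real n <= sl / 6 * ln (real n)" unfolding e1 by (simp add: algebra_simps)
  then have r3: "real n * dec ex' n (Nm n) <= real n powr (sl / 6)"
    unfolding nd exp_ln_powr[OF o(1), symmetric] by simp
  show "rng n (Nm n)" using r1 r2 r3 by (simp add: rng_def)
  have "ex' * real (Nm n) / real n <= ex' * (?y + 1) / real n"
    using N(2) ex'1 by (intro divide_right_mono mult_left_mono) auto
  also have "... = ex' * ?y / real n + ex' / real n" by (simp only: distrib_left add_divide_distrib mult_1_right)
  finally have "sl / 6 * ln (real n) - ex' / real n <= ln (real n) - ex' * real (Nm n) / real n"
    unfolding e1 by (simp add: algebra_simps)
  then have "exp (sl / 6 * ln (real n) - ex' / real n) <= real n * dec ex' n (Nm n)" unfolding nd by simp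
  moreover have "real n powr (sl / 6) / 3 <= real n powr (sl / 6) / exp (ex' / real n)"
    using exp_div_le_3[OF _ o(5,1)] ex'1 by (intro divide_left_mono) auto
  ultimately show "real n powr (sl / 6) / 3 <= real n * dec ex' n (Nm n)"
    unfolding exp_diff exp_ln_powr[OF o(1)] by linarith
qed

abbreviation slow_start :: "nat => (nat => nat => nat) => nat" where
  "slow_start n v \<equiv> cnt n (G n v (n1 n)) (slow K l R)"

lemma start_gf_slow: "start_gf n (slow K l R) {} N M = Mean n (%v. (1 - ps n N) ^ slow_start n v)"
  by (simp add: start_gf_def gf_def unroll_ps comp_count_empty)

lemma DD_pos: "0 < DD (slow K l R)"
  unfolding DD_def using slow_nonempty finite_subset[OF slow_subset] slow_constants(2)
  by (intro sum_pos) auto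

lemma ps_le_1: "ok n ==> ps n N <= 1"
  unfolding ps_def using okD(1,5)[of n] ex'1 by (intro power_le_one) (auto simp: field_simps)

text \<open>On \<open>conc\<close> the mean number of survivors is at least
  \<open>n powr (sl / 6) * D / 18\<close>. The 18 collects a factor 3 from rounding in
  \<open>Nm\<close>, 3 from the logarithm in \<open>ps_bounds\<close> and 2 from
  \<open>conc\<close>; then \<open>exp (- y) <= 1 / y\<close>.\<close>

lemma tiny_start_Nm: "tiny (%n. start_gf n (slow K l R) {} (Nm n) (Nm n))"
proof -
  let ?D = "DD (slow K l R)"
  let ?bc = "%n. Mean n (%v. of_bool (~ conc (slow K l R) (?D / 2) n (G n v (n1 n))))"
  have t: "tiny (%n. ?bc n + 18 / ?D * real n powr (- (sl / 6)))"
    using DD_pos sl by (intro tiny_add tiny_conc tiny_powr) auto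
  have "(%n::nat. 2 * ex'\<^sup>2 * CH * (ln (real n) / real n)) \<longlonglongrightarrow> 2 * ex'\<^sup>2 * CH * 0"
    by (intro tendsto_intros lim_ln_over_n)
  then have "\<forall>\<^sub>F n in sequentially. 2 * ex'\<^sup>2 * CH * (ln (real n) / real n) < 1" by (intro order_tendstoD) auto
  then have "\<forall>\<^sub>F n in sequentially. start_gf n (slow K l R) {} (Nm n) (Nm n) <= ?bc n + 18 / ?D * real n powr (- (sl / 6))"
    using ev_ok
  proof eventually_elim
    case (elim n)
    note o = okD[OF elim(2)]
    note Nm' = Nm[OF elim(2)]
    have n0: "0 < real n" using o(1) by simp
    let ?p = "ps n (Nm n)"
    let ?w = "real n powr (sl / 6)"
    have w0: "0 < ?w" using n0 by simp
    have rr: "n1 n <= Nm n" "Nm n <= hz n" using Nm'(1) by (auto simp: rng_def)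
    note pb = ps_bounds[OF elim(2) rr]
    have p1: "?p <= 1" by (rule ps_le_1[OF elim(2)])
    have "1 / 3 <= exp (- 1 :: real)" using exp_bounds(2) by (simp add: exp_minus inverse_eq_divide le_divide_eq)
    also have "... <= exp (- (2 * ex'\<^sup>2 * CH * (ln (real n) / real n)))" using elim(1) by (simp only: exp_le_cancel_iff neg_le_iff_le less_imp_le)
    finally have "?w / 3 * (1 / 3) <= real n * dec ex' n (Nm n) * exp (- (2 * ex'\<^sup>2 * CH * (ln (real n) / real n)))"
      using Nm'(2) w0 dec_pos by (intro mult_mono mult_nonneg_nonneg) (auto simp: less_imp_le)
    then have psw: "?w / 9 <= ?p * sc n" using pb(3) by simp
    have C0: "0 < 18 / ?D * real n powr (- (sl / 6))" using DD_pos n0 by simp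
    have pt: "(1 - ?p) ^ cnt n E (slow K l R) <= of_bool (~ conc (slow K l R) (?D / 2) n E) + 18 / ?D * real n powr (- (sl / 6))" for E
    proof (cases "conc (slow K l R) (?D / 2) n E")
      case False
      have "(1 - ?p) ^ cnt n E (slow K l R) <= 1" using pb(1) p1 by (intro power_le_one) auto
      then show ?thesis using False C0 by simp
    next
      case True
      then have "?D / 2 <= real (cnt n E (slow K l R)) / sc n" unfolding conc_def by linarith
      then have "?D / 2 * sc n <= real (cnt n E (slow K l R))" using sc_pos[OF o(1)] by (simp add: pos_le_divide_eq)
      then have "?p * (?D / 2 * sc n) <= ?p * real (cnt n E (slow K l R))" using pb(1) by (rule mult_left_mono)
      moreover have "?w / 9 * (?D / 2) <= ?p * sc n * (?D / 2)" using psw DD_pos by (intro mult_right_mono) auto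
      ultimately have y: "?w * ?D / 18 <= ?p * real (cnt n E (slow K l R))" by (simp add: mult_ac)
      let ?y = "?w * ?D / 18"
      have y0: "0 < ?y" using w0 DD_pos by simp
      have "(1 - ?p) ^ cnt n E (slow K l R) <= exp (- ?p * real (cnt n E (slow K l R)))"
        using p1 by (intro power_le_exp) simp
      also have "... <= exp (- ?y)" using y by simp
      also have "... <= 1 / ?y"
      proof -
        have "?y <= exp ?y" using exp_ge_add_one_self[of ?y] by linarith
        then show ?thesis using y0 by (simp only: exp_minus inverse_eq_divide) (intro divide_left_mono, auto)
      qed
      also have "... = 18 / ?D * (1 / ?w)" by simp
      also have "1 / ?w = real n powr (- (sl / 6))" by (simp only: powr_minus inverse_eq_divide)
      finally show ?thesis using True by simp
    qed
    let ?C = "18 / ?D * real n powr (- (sl / 6))"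
    have aB: "adapted (n1 n) (%v. of_bool (~ conc (slow K l R) (?D / 2) n (G n v (n1 n))) :: real)"
      by (rule adapted_G'[where f = "%E. of_bool (~ conc (slow K l R) (?D / 2) n E)", OF order_refl])
    have aC: "adapted (n1 n) (%v. of_bool (~ conc (slow K l R) (?D / 2) n (G n v (n1 n))) + ?C)"
      by (rule adapted_G'[where f = "%E. of_bool (~ conc (slow K l R) (?D / 2) n E) + ?C", OF order_refl])
    have "start_gf n (slow K l R) {} (Nm n) (Nm n) <= Mean n (%v. of_bool (~ conc (slow K l R) (?D / 2) n (G n v (n1 n))) + ?C)"
      unfolding start_gf_slow
      by (rule Mean_mono[OF o(1) adapted_G'[where f = "%E. (1 - ?p) ^ cnt n E (slow K l R)", OF order_refl] aC]) (rule pt)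
    then show ?case by (simp only: Mean_add[OF o(1) aB adapted_const[of 0]] Mean_const[OF o(1)])
  qed
  from tiny_mono[OF this t] show ?thesis .
qed

definition err2 :: "nat => real" where "err2 n = err n + start_gf n (slow K l R) {} (Nm n) (Nm n)"

lemma start_gf_bounds:
  assumes "ok n"
  shows "0 <= start_gf n (slow K l R) {} N M" "start_gf n (slow K l R) {} N M <= 1"
proof -
  note o = okD[OF assms]
  have ps: "0 <= ps n N" "ps n N <= 1"
    using ps_le_1[OF assms] o(1,5) by (auto simp: ps_def field_simps intro!: zero_le_power)
  show "0 <= start_gf n (slow K l R) {} N M" unfolding start_gf_slow using ps by (intro Mean_nonneg) auto
  have "start_gf n (slow K l R) {} N M <= Mean n (%_. 1)"
    unfolding start_gf_slow
    using ps by (intro Mean_mono[OF o(1) adapted_G'[where f = "%E. (1 - ps n N) ^ cnt n E (slow K l R)", OF order_refl] adapted_const[of 0]] power_le_one) auto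
  then show "start_gf n (slow K l R) {} N M <= 1" by (simp add: Mean_const[OF o(1)])
qed

lemma start_gf_mono:
  assumes "ok n" "N <= M"
  shows "start_gf n (slow K l R) {} N N <= start_gf n (slow K l R) {} M M"
proof -
  note o = okD[OF assms(1)]
  have h: "0 <= 1 - ex' / real n" "1 - ex' / real n <= 1" using o(1,5) by (auto simp: field_simps)
  have "ps n M <= ps n N" unfolding ps_def using h assms(2) by (intro power_decreasing) auto
  then show ?thesis
    unfolding start_gf_slow using ps_le_1[OF assms(1), of N]
    by (intro Mean_mono[OF o(1) adapted_G'[where f = "%E. (1 - ps n N) ^ cnt n E (slow K l R)", OF order_refl]
        adapted_G'[where f = "%E. (1 - ps n M) ^ cnt n E (slow K l R)", OF order_refl]] power_mono) auto
qed

text \<open>After \<open>Nm\<close> the limit law applies. Before \<open>Nm\<close> monotonicity in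
  time alone shows that both quantities are within \<open>err2\<close> of 1, so no estimate outside
  \<open>rng\<close> is required.\<close>

lemma pT_approx:
  assumes ok: "ok n" and N: "N <= hz n" and e: "0 <= err n"
  shows "N < n1 n ==> \<bar>pT n N - 1\<bar> <= err2 n"
    "n1 n <= N ==> \<bar>pT n N - (1 - start_gf n (slow K l R) {} N N)\<bar> <= err2 n"
proof -
  note o = okD[OF ok]
  note Nm' = Nm[OF ok]
  let ?s = "start_gf n (slow K l R) {} (Nm n) (Nm n)"
  have law: "\<bar>pT n M - (1 - start_gf n (slow K l R) {} M M)\<bar> <= err n" if "rng n M" for M
    using T_con_law[OF ok that] by (simp add: pT_compl[OF o(1)] err_def abs_minus_commute)
  have lowN: "1 - ?s - err n <= pT n N" if "N <= Nm n"
    using pT_antimono[OF o(1) that] law[OF Nm'(1)] by linarith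
  show "\<bar>pT n N - 1\<bar> <= err2 n" if "N < n1 n"
  proof -
    have "N <= Nm n" using that Nm'(1) by (simp add: rng_def)
    from lowN[OF this] show ?thesis using pT_le_1[OF o(1), of N] by (simp add: err2_def)
  qed
  show "\<bar>pT n N - (1 - start_gf n (slow K l R) {} N N)\<bar> <= err2 n" if n1: "n1 n <= N"
  proof (cases "N <= Nm n")
    case True
    then show ?thesis using lowN[OF True] pT_le_1[OF o(1), of N] start_gf_mono[OF ok True] start_gf_bounds[OF ok, of N N]
      e start_gf_bounds[OF ok, of "Nm n" "Nm n"] unfolding err2_def by linarith
  next
    case False
    then have "real n * dec ex' n N <= real n * dec ex' n (Nm n)" by (intro mult_left_mono dec_antimono) auto
    then have "rng n N" using Nm'(1) n1 N by (simp add: rng_def)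
    from law[OF this] show ?thesis using start_gf_bounds[OF ok, of "Nm n" "Nm n"] unfolding err2_def by linarith
  qed
qed

lemma adapted_slow_start: "adapted (n1 n) (%v. f (slow_start n v))"
  by (rule adapted_G'[where f = "%E. f (cnt n E (slow K l R))", OF order_refl])

text \<open>The rounds before \<open>n1\<close> contribute 1 each. From \<open>n1\<close> on, the
  approximated tail probabilities are those of the maximum of \<open>slow_start\<close> geometric
  variables, whose sum up to \<open>hz\<close> is \<open>gsum\<close>.\<close>

lemma expected_sum_approx:
  assumes ok: "ok n" and e: "0 <= err n"
  shows "\<bar>(\<Sum>N. pT n N) - real (n1 n) - Mean n (%v. gsum (slow_start n v) (hz n - n1 n) (1 - ex' / real n))\<bar>
    <= real (hz n) * err2 n + 1 / base_rate"
proof -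
  note o = okD[OF ok]
  note sb = scale_bounds[OF o(2)]
  define h where "h N = (if N < n1 n then 1 else 1 - start_gf n (slow K l R) {} N N)" for N
  have "\<bar>(SUM N<hz n. pT n N) - (SUM N<hz n. h N)\<bar> <= (SUM N<hz n. \<bar>pT n N - h N\<bar>)"
    unfolding sum_subtractf[symmetric] by (rule sum_abs)
  also have "... <= (SUM N<hz n. err2 n)"
    using pT_approx[OF ok _ e] by (intro sum_mono) (auto simp: h_def)
  finally have 1: "\<bar>(SUM N<hz n. pT n N) - (SUM N<hz n. h N)\<bar> <= real (hz n) * err2 n" by simp
  have "(SUM N<hz n. h N) = (SUM N<n1 n. h N) + (SUM N:{n1 n..<hz n}. h N)"
    using sum.atLeastLessThan_concat[of 0 "n1 n" "hz n" h] sb(10) by (simp add: atLeast0LessThan)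
  also have "(SUM N<n1 n. h N) = real (n1 n)" by (simp add: h_def)
  also have "(SUM N:{n1 n..<hz n}. h N) = (SUM a<hz n - n1 n. h (a + n1 n))"
    using sb(10) sum.shift_bounds_nat_ivl[of h 0 "n1 n" "hz n - n1 n"] by (simp add: atLeast0LessThan)
  also have "... = (SUM a<hz n - n1 n. Mean n (%v. 1 - (1 - (1 - ex' / real n) ^ a) ^ slow_start n v))"
  proof (rule sum.cong[OF refl])
    fix a
    have "h (a + n1 n) = 1 - Mean n (%v. (1 - (1 - ex' / real n) ^ a) ^ slow_start n v)"
      by (simp add: h_def start_gf_slow ps_def)
    then show "h (a + n1 n) = Mean n (%v. 1 - (1 - (1 - ex' / real n) ^ a) ^ slow_start n v)"
      by (simp only: Mean_diff[OF o(1) adapted_const[of 0] adapted_slow_start[of n "%m. (1 - (1 - ex' / real n) ^ a) ^ m"]] Mean_const[OF o(1)])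
  qed
  also have "... = Mean n (%v. gsum (slow_start n v) (hz n - n1 n) (1 - ex' / real n))"
    unfolding gsum_def
    by (rule Mean_sum[OF o(1), symmetric]) (rule adapted_slow_start[where f = "%m. 1 - (1 - (1 - ex' / real n) ^ i) ^ m" for i])
  finally show ?thesis using 1 pT_tail[OF ok] by linarith
qed

lemma slow_start_le: "n >= 1 ==> real (cnt n E (slow K l R)) <= real n"
proof -
  assume n: "n >= 1"
  have "cnt n E (slow K l R) <= cnt n E {1..K}" by (intro comp_count_mono slow_subset) auto
  then have "real (cnt n E (slow K l R)) <= real (cnt n E {1..K})" by simp
  also have "... <= real n * (1 - fr n E)" by (rule cnt_le_mass[OF n])
  also have "... <= real n * 1" using fr_bounds[OF n, of E] by (intro mult_left_mono) auto
  finally show ?thesis by simp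
qed

lemma harm_slow_start:
  assumes "n >= 3"
  shows "harm (cnt n E (slow K l R)) <= 1 + ln (real n)"
proof (cases "cnt n E (slow K l R) = 0")
  case True
  then show ?thesis using scale_bounds(1)[OF assms] by (simp add: harm_expand)
next
  case False
  then have "harm (cnt n E (slow K l R)) <= 1 + ln (real (cnt n E (slow K l R)))" by (intro harm_le_ln) simp
  also have "... <= 1 + ln (real n)" using False slow_start_le[of n E] assms by (intro add_left_mono) (simp add: ln_le_cancel_iff)
  finally show ?thesis .
qed

text \<open>The window has at least \<open>2 * n * ln n\<close> rounds, so \<open>r ^ J\<close> is
  at most \<open>1 / n ^ 2\<close> and the truncation is harmless against at most \<open>n\<close>
  components.\<close>

lemma gsum_approx:
  assumes ok: "ok n"
  shows "\<bar>ex' / real n * gsum (cnt n E (slow K l R)) (hz n - n1 n) (1 - ex' / real n) - harm (cnt n E (slow K l R))\<bar>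
    <= ex' * ((1 + ln (real n)) / real n) + 1 / real n"
proof -
  note o = okD[OF ok]
  note sb = scale_bounds[OF o(2)]
  have n0: "0 < real n" "1 <= real n" using o(1) by auto
  define A where "A = cnt n E (slow K l R)"
  define r where "r = 1 - ex' / real n"
  have r: "0 <= r" "r <= 1" "1 - r = ex' / real n" using n0 o(5) by (auto simp: r_def field_simps)
  have "3 * nl n <= 3 / base_rate * nl n" using base_rate sb(2) by (intro mult_right_mono) (auto simp: field_simps)
  moreover have "dl * nl n <= 1 / 16 * nl n" using dl(3) sb(2) by (intro mult_right_mono) auto
  ultimately have H: "2 * nl n + 1 <= real (hz n) - real (n1 n)" using sb(2,5,7) by linarith
  then have "n1 n < hz n" using sb(2) by linarith
  then obtain J where J: "hz n - n1 n = Suc J" by (metis Suc_diff_Suc)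
  have "real (Suc J) = real (hz n) - real (n1 n)" unfolding J[symmetric] using sb(10) by (rule of_nat_diff)
  then have J2: "2 * nl n <= real J" using H by simp
  have "r ^ J <= exp (- (ex' / real n) * real J)" unfolding r_def using r(1) by (intro power_le_exp) (simp add: r_def)
  also have "... <= exp (- 2 * ln (real n))"
  proof -
    have "1 * (2 * nl n) <= ex' * real J" using J2 ex'1 sb(2) by (intro mult_mono) auto
    then have "2 * nl n / real n <= ex' * real J / real n" by (intro divide_right_mono) auto
    then show ?thesis using n0 by simp
  qed
  also have "... = 1 / real n * (1 / real n)"
    using n0 by (simp add: exp_minus exp_double[of "ln (real n)"] power2_eq_square divide_inverse)
  finally have rJ: "r ^ J <= 1 / real n * (1 / real n)" .
  have A: "real A <= real n" unfolding A_def by (rule slow_start_le[OF o(1)])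
  have "real A * r ^ J <= real n * (1 / real n * (1 / real n))" using A rJ r by (intro mult_mono) auto
  then have ArJ: "real A * r ^ J <= 1 / real n" using n0 by simp
  have hA: "0 <= (harm A :: real)" "harm A <= 1 + ln (real n)"
    using harm_slow_start[OF o(2), of E] harm_nonneg[of A, where 'a = real] by (auto simp: A_def)
  have up: "(1 - r) * gsum A (Suc J) r <= harm A" by (rule gsum_bounds(1)[OF r(1,2)])
  have lo: "r * (harm A - real A * r ^ J) <= (1 - r) * gsum A (Suc J) r" by (rule gsum_bounds(2)[OF r(1,2)])
  have "r * (real A * r ^ J) <= 1 * (1 / real n)" using ArJ r n0 by (intro mult_mono) auto
  moreover have "r * (harm A - real A * r ^ J) = harm A - (1 - r) * harm A - r * (real A * r ^ J)" by (simp add: algebra_simps)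
  moreover have "(1 - r) * harm A <= (1 - r) * (1 + ln (real n))" using hA r by (intro mult_left_mono) auto
  moreover have "(1 - r) * (1 + ln (real n)) = ex' * ((1 + ln (real n)) / real n)" by (simp add: r(3))
  moreover have "0 <= ex' * ((1 + ln (real n)) / real n)" "0 <= 1 / real n" using ex'1 sb(1) n0 by auto
  ultimately have "\<bar>(1 - r) * gsum A (Suc J) r - harm A\<bar> <= ex' * ((1 + ln (real n)) / real n) + 1 / real n"
    using up lo by linarith
  then show ?thesis by (simp only: A_def[symmetric] J r_def[symmetric] r(3))
qed

lemma ln_sc:
  assumes "n >= 1"
  shows "ln (sc n) = ln (real n) - ex' * real (n1 n) / real n"
  using assms by (simp add: sc_def dec_def ln_mult)

text \<open>Where \<open>conc\<close> holds, \<open>harm\<close> is close to the logarithm plus the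
  Euler constant. Elsewhere the error may be of order \<open>ln n\<close>, so convergence of the
  exceptional probability to 0 would not do: its product with \<open>ln n\<close> has to
  vanish.\<close>

lemma harm_limit:
  "(%n. Mean n (%v. harm (slow_start n v)) - ln (sc n)) \<longlonglongrightarrow> ln (DD (slow K l R)) + euler_mascheroni"
proof (rule tendstoI)
  fix \<epsilon> :: real assume \<epsilon>: "0 < \<epsilon>"
  define D where "D = DD (slow K l R)"
  have D: "0 < D" unfolding D_def by (rule DD_pos)
  \<comment> \<open>Keeps \<open>y\<close> above \<open>D / 2\<close>, so a deviation of
    \<open>D * \<epsilon> / 8\<close> moves the logarithm by at most
    \<open>\<epsilon> / 4\<close>.\<close>
  define \<theta> where "\<theta> = min (D / 2) (D * \<epsilon> / 8)"
  have \<theta>: "0 < \<theta>" "\<theta> <= D / 2" "\<theta> <= D * \<epsilon> / 8" using D \<epsilon> by (auto simp: \<theta>_def)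
  have lnc: "\<bar>ln y - ln D\<bar> <= \<epsilon> / 4" "0 < y" if "\<bar>y - D\<bar> <= \<theta>" for y
  proof -
    have y: "D / 2 <= y" using that \<theta>(2) by linarith
    then show y0: "0 < y" using D by linarith
    have "ln y - ln D <= (y - D) / D" by (rule ln_diff_le[OF y0 D])
    also have "... <= (D * \<epsilon> / 8) / D" using that \<theta>(3) D by (intro divide_right_mono) auto
    also have "... = \<epsilon> / 8" using D by simp
    finally have 1: "ln y - ln D <= \<epsilon> / 8" .
    have "ln D - ln y <= (D - y) / y" by (rule ln_diff_le[OF D y0])
    also have "... <= (D * \<epsilon> / 8) / y" using that \<theta>(3) y0 by (intro divide_right_mono) auto
    also have "... <= (D * \<epsilon> / 8) / (D / 2)" using y D \<epsilon> y0 by (intro divide_left_mono) auto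
    also have "... = \<epsilon> / 4" using D by simp
    finally show "\<bar>ln y - ln D\<bar> <= \<epsilon> / 4" using 1 \<epsilon> by linarith
  qed
  obtain m0 where m0: "!!m. m >= m0 ==> \<bar>harm m - ln (real m) - euler_mascheroni\<bar> < \<epsilon> / 4"
    using tendstoD[OF euler_mascheroni_LIMSEQ, of "\<epsilon> / 4"] \<epsilon> by (auto simp: eventually_sequentially dist_real_def)
  define C where "C = 1 + \<bar>ln D\<bar> + \<bar>euler_mascheroni :: real\<bar>"
  let ?bc = "%n. Mean n (%v. of_bool (~ conc (slow K l R) \<theta> n (G n v (n1 n))))"
  have t1: "?bc \<longlonglongrightarrow> 0" by (rule conc_tendsto[OF order_refl \<theta>(1)])
  have t2: "(%n. ln (real n) * ?bc n) \<longlonglongrightarrow> 0"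
    by (rule tiny_ln_tendsto[OF tiny_conc[OF order_refl \<theta>(1)] always_eventually]) (intro allI Mean_nonneg, simp)
  have "(%n. \<epsilon> / 2 + (2 * (ln (real n) * ?bc n) + C * ?bc n)) \<longlonglongrightarrow> \<epsilon> / 2 + (2 * 0 + C * 0)"
    by (intro tendsto_intros t1 t2)
  then have ev: "\<forall>\<^sub>F n in sequentially. \<epsilon> / 2 + (2 * (ln (real n) * ?bc n) + C * ?bc n) < \<epsilon>"
    by (rule order_tendstoD(2)) (use \<epsilon> in simp)
  have big: "\<forall>\<^sub>F n in sequentially. max 1 (2 * real m0 / D) <= sc n" using sc_at_top unfolding filterlim_at_top by blast
  show "\<forall>\<^sub>F n in sequentially. dist (Mean n (%v. harm (slow_start n v)) - ln (sc n)) (ln (DD (slow K l R)) + euler_mascheroni) < \<epsilon>"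
    using ev big eventually_ge_at_top[of 3]
  proof eventually_elim
    case (elim n)
    have n: "n >= 1" using elim by simp
    note sb = scale_bounds[OF elim(3)]
    have s: "1 <= sc n" "2 * real m0 / D <= sc n" using elim by auto
    have ls: "0 <= ln (sc n)" using s(1) by (rule ln_ge_zero)
    have ls': "ln (sc n) <= ln (real n)" unfolding ln_sc[OF n] using ex'1 by simp
    let ?T = "ln (sc n) + (ln D + euler_mascheroni)"
    let ?b = "2 * ln (real n) + C"
    have b0: "0 <= ?b" using sb(1) by (simp add: C_def add_nonneg_nonneg)
    have pt: "\<bar>harm (cnt n E (slow K l R)) - ?T\<bar> <= \<epsilon> / 2 + ?b * of_bool (~ conc (slow K l R) \<theta> n E)" for E
    proof (cases "conc (slow K l R) \<theta> n E")
      case True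
      let ?A = "cnt n E (slow K l R)"
      have c: "\<bar>real ?A / sc n - D\<bar> <= \<theta>" using True by (simp add: conc_def D_def)
      have A0: "0 < real ?A" using lnc(2)[OF c] s by (simp add: zero_less_divide_iff)
      have "D / 2 <= real ?A / sc n" using c \<theta>(2) by linarith
      then have "D / 2 * sc n <= real ?A" using s by (simp add: pos_le_divide_eq)
      moreover have "real m0 <= D / 2 * sc n" using s(2) D by (simp add: pos_divide_le_eq mult.commute)
      ultimately have "m0 <= ?A" by simp
      from m0[OF this] have h: "\<bar>harm ?A - ln (real ?A) - euler_mascheroni\<bar> < \<epsilon> / 4" .
      have "ln (real ?A / sc n) = ln (real ?A) - ln (sc n)" using A0 s by (simp add: ln_div)
      then have "\<bar>harm ?A - ?T\<bar> <= \<epsilon> / 2" using h lnc(1)[OF c] by linarith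
      then show ?thesis using True by simp
    next
      case False
      have "0 <= (harm (cnt n E (slow K l R)) :: real)" "harm (cnt n E (slow K l R)) <= 1 + ln (real n)"
        using harm_slow_start[OF elim(3), of E] harm_nonneg[where 'a = real] by auto
      then have "\<bar>harm (cnt n E (slow K l R)) - ?T\<bar> <= ?b" using ls ls' unfolding C_def by linarith
      then show ?thesis using False \<epsilon> by simp
    qed
    let ?B = "%v. of_bool (~ conc (slow K l R) \<theta> n (G n v (n1 n))) :: real"
    have aB: "adapted (n1 n) (%v. ?b * ?B v)"
      by (rule adapted_G'[where f = "%E. ?b * of_bool (~ conc (slow K l R) \<theta> n E)", OF order_refl])
    have "\<bar>Mean n (%v. harm (slow_start n v) - ?T)\<bar> <= Mean n (%v. \<epsilon> / 2 + ?b * ?B v)"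
      by (rule Mean_abs_le[OF n adapted_slow_start[of n "%m. harm m - ?T"]
            adapted_comp1[where h = "%y. \<epsilon> / 2 + y", OF aB]]) (rule pt)
    also have "... = \<epsilon> / 2 + ?b * ?bc n"
      by (simp only: Mean_add[OF n adapted_const[of 0] aB] Mean_const[OF n] Mean_cmult)
    also have "... < \<epsilon>" using elim(1) by (simp add: algebra_simps)
    finally have "\<bar>Mean n (%v. harm (slow_start n v)) - ?T\<bar> < \<epsilon>"
      by (simp only: Mean_diff[OF n adapted_slow_start[of n harm] adapted_const[of 0]] Mean_const[OF n])
    then show ?case by (simp add: dist_real_def D_def algebra_simps)
  qed
qed

theorem T_con_expectation:
  "\<forall>\<^sub>F n in sequentially. (\<integral>\<^sup>+ v. ennreal_of_enat (T_con K l R n v) \<partial>choice_space l n) < \<infinity>"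
  "(%n. enn2real (\<integral>\<^sup>+ v. ennreal_of_enat (T_con K l R n v) \<partial>choice_space l n)
      - (real n * ln (real n) + euler_mascheroni * real n + ln (SUM k:slow K l R. d k) * real n) / ex') \<in> o(%n. real n)"
proof -
  show "\<forall>\<^sub>F n in sequentially. (\<integral>\<^sup>+ v. ennreal_of_enat (T_con K l R n v) \<partial>choice_space l n) < \<infinity>"
    using ev_ok by eventually_elim (simp add: expected_T_con)
  define D where "D = DD (slow K l R)"
  let ?ET = "%n. enn2real (\<integral>\<^sup>+ v. ennreal_of_enat (T_con K l R n v) \<partial>choice_space l n)"
  let ?tgt = "%n. (real n * ln (real n) + euler_mascheroni * real n + ln (SUM k:slow K l R. d k) * real n) / ex'"
  let ?MH = "%n. Mean n (%v. harm (slow_start n v))"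
  let ?e1 = "%n. CH * (ln (real n) * err2 n) + 1 / base_rate / real n"
  let ?e3 = "%n. ex' * ((1 + ln (real n)) / real n) + 1 / real n"
  let ?e4 = "%n. \<bar>?MH n - ln (sc n) - (ln D + euler_mascheroni)\<bar>"
  have ev0: "\<forall>\<^sub>F n in sequentially. 0 <= err2 n"
    using ev_err_nonneg ev_ok by eventually_elim (simp add: err2_def start_gf_bounds add_nonneg_nonneg)
  have "tiny err2" unfolding err2_def[abs_def] by (intro tiny_add tiny_err tiny_start_Nm)
  from tiny_ln_tendsto[OF this ev0] have l1: "(%n. ln (real n) * err2 n) \<longlonglongrightarrow> 0" .
  have l2: "(%n::nat. 1 / base_rate / real n) \<longlonglongrightarrow> 0" by (rule lim_const_over_n)
  have l3: "(%n::nat. (1 + ln (real n)) / real n) \<longlonglongrightarrow> 0 + 0"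
    unfolding add_divide_distrib by (intro tendsto_add lim_const_over_n lim_ln_over_n)
  have l5: "(%n::nat. 1 / real n) \<longlonglongrightarrow> 0" by (rule lim_const_over_n)
  have "(%n. \<bar>(?MH n - ln (sc n)) - (ln D + euler_mascheroni)\<bar>) \<longlonglongrightarrow> \<bar>(ln D + euler_mascheroni) - (ln D + euler_mascheroni)\<bar>"
    using harm_limit unfolding D_def by (intro tendsto_intros)
  then have l4: "?e4 \<longlonglongrightarrow> 0" by simp
  have "(%n. ?e1 n + (?e3 n + ?e4 n) / ex') \<longlonglongrightarrow> (CH * 0 + 0) + ((ex' * (0 + 0) + 0) + 0) / ex'"
    by (intro tendsto_intros l1 l2 l3 l4 l5) (use ex'1 in auto)
  then have lim: "(%n. ?e1 n + (?e3 n + ?e4 n) / ex') \<longlonglongrightarrow> 0" by simp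
  have "\<forall>\<^sub>F n in sequentially. norm ((?ET n - ?tgt n) / real n) <= ?e1 n + (?e3 n + ?e4 n) / ex'"
    using ev_ok ev_err_nonneg ev0
  proof eventually_elim
    case (elim n)
    note o = okD[OF elim(1)]
    note sb = scale_bounds[OF o(2)]
    have n0: "0 < real n" using o(1) by simp
    let ?S = "\<Sum>N. pT n N"
    let ?g = "%m. gsum m (hz n - n1 n) (1 - ex' / real n)"
    let ?MG = "Mean n (%v. ?g (slow_start n v))"
    have ET: "?ET n = ?S" unfolding expected_T_con[OF elim(1)]
      using suminf_nonneg[OF summable_pT[OF elim(1)] pT_nonneg] by simp
    have a: "\<bar>?S - real (n1 n) - ?MG\<bar> <= real (hz n) * err2 n + 1 / base_rate"
      by (rule expected_sum_approx[OF elim(1,2)])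
    have "real (hz n) * err2 n <= CH * nl n * err2 n"
      using hz_le[OF o(2)] elim(3) by (intro mult_right_mono) (auto simp: CH_def)
    with a have "\<bar>?S - real (n1 n) - ?MG\<bar> / real n <= (CH * nl n * err2 n + 1 / base_rate) / real n"
      using n0 by (intro divide_right_mono) auto
    also have "... = ?e1 n" using n0 by (simp add: add_divide_distrib)
    finally have A: "\<bar>(?S - real (n1 n) - ?MG) / real n\<bar> <= ?e1 n" using n0 by simp
    have aG: "adapted (n1 n) (%v. ex' / real n * ?g (slow_start n v))"
      by (rule adapted_slow_start[of n "%m. ex' / real n * ?g m"])
    have "\<bar>Mean n (%v. ex' / real n * ?g (slow_start n v) - harm (slow_start n v))\<bar> <= Mean n (%_. ?e3 n)"
      by (rule Mean_abs_le[OF o(1) adapted_slow_start[of n "%m. ex' / real n * ?g m - harm m"] adapted_const[of 0]])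
         (rule gsum_approx[OF elim(1)])
    then have B: "\<bar>ex' / real n * ?MG - ?MH n\<bar> <= ?e3 n"
      by (simp only: Mean_diff[OF o(1) aG adapted_slow_start[of n harm]] Mean_const[OF o(1)] Mean_cmult)
    \<comment> \<open>Since \<open>ln (sc n)\<close> is \<open>ln n\<close> minus
      \<open>ex' * n1 / n\<close>, the \<open>n1\<close> rounds already spent cancel and the target
      appears whatever \<open>n1\<close> is.\<close>
    have key: "(?S - ?tgt n) / real n = (?S - real (n1 n) - ?MG) / real n
        + ((ex' / real n * ?MG - ?MH n) + (?MH n - ln (sc n) - (ln D + euler_mascheroni))) / ex'"
      unfolding ln_sc[OF o(1)] D_def DD_def by (rule expectation_algebra) (use n0 ex'1 in auto)
    have "\<bar>(ex' / real n * ?MG - ?MH n) + (?MH n - ln (sc n) - (ln D + euler_mascheroni))\<bar> <= ?e3 n + ?e4 n"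
      using B by linarith
    then have "\<bar>((ex' / real n * ?MG - ?MH n) + (?MH n - ln (sc n) - (ln D + euler_mascheroni))) / ex'\<bar> <= (?e3 n + ?e4 n) / ex'"
      unfolding abs_divide using ex'1 by (intro frac_le) auto
    then show ?case using A unfolding real_norm_def ET key by linarith
  qed
  from Lim_null_comparison[OF this lim] have "(%n. (?ET n - ?tgt n) / real n) \<longlonglongrightarrow> 0" .
  then show "(%n. ?ET n - ?tgt n) \<in> o(%n. real n)"
    by (rule smalloI_tendsto) (use eventually_gt_at_top[of 0] in \<open>auto elim: eventually_mono\<close>)
qed

end

section \<open>The component size that disappears last\<close>

lemma exp_convexity:
  fixes d D x :: real
  assumes "0 < D" "0 <= d" "d <= D"
  shows "d / D * (1 - exp (- D * x)) <= 1 - exp (- d * x)"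
proof -
  have c: "convex_on UNIV (exp :: real => real)" by (rule convex_on_exp[of 1, simplified])
  have "exp ((1 - d / D) *\<^sub>R 0 + (d / D) *\<^sub>R (- D * x)) <= (1 - d / D) * exp 0 + d / D * exp (- D * x)"
    using assms by (intro convex_onD[OF c]) (auto simp: divide_le_eq_1)
  moreover have "(1 - d / D) *\<^sub>R 0 + (d / D) *\<^sub>R (- D * x) = - d * x" using assms by simp
  ultimately show ?thesis by (simp add: algebra_simps)
qed

text \<open>Comparison of the Riemann sum for \<open>\<integral> d exp (- (d + e) x) dx\<close> with its integral.\<close>

lemma exp_increment:
  fixes d e u :: real
  assumes "0 < d" "0 <= e" "0 <= \<delta>"
  shows "exp (- (e * \<delta>)) * (d / (d + e)) * (exp (- ((d + e) * u)) - exp (- ((d + e) * (u + \<delta>))))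
    <= exp (- (d * u)) * exp (- (e * (u + \<delta>))) - exp (- (d * (u + \<delta>))) * exp (- (e * (u + \<delta>)))"
proof -
  have "d / (d + e) * (1 - exp (- (d + e) * \<delta>)) <= 1 - exp (- d * \<delta>)"
    using assms by (intro exp_convexity) auto
  then have "exp (- (d * u)) * exp (- (e * (u + \<delta>))) * (d / (d + e) * (1 - exp (- (d + e) * \<delta>)))
    <= exp (- (d * u)) * exp (- (e * (u + \<delta>))) * (1 - exp (- d * \<delta>))"
    by (intro mult_left_mono) auto
  moreover have "exp (- (d * u)) * exp (- (e * (u + \<delta>))) * (1 - exp (- d * \<delta>))
    = exp (- (d * u)) * exp (- (e * (u + \<delta>))) - exp (- (d * (u + \<delta>))) * exp (- (e * (u + \<delta>)))"
    by (simp add: algebra_simps exp_add[symmetric])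
  moreover have "exp (- (d * u)) * exp (- (e * (u + \<delta>))) * (d / (d + e) * (1 - exp (- (d + e) * \<delta>)))
    = exp (- (e * \<delta>)) * (d / (d + e)) * (exp (- ((d + e) * u)) - exp (- ((d + e) * (u + \<delta>))))"
  proof -
    have a: "exp (- (d * u)) * exp (- (e * (u + \<delta>))) = exp (- (e * \<delta>)) * exp (- ((d + e) * u))"
      by (simp add: exp_add[symmetric] algebra_simps)
    have b: "exp (- ((d + e) * (u + \<delta>))) = exp (- ((d + e) * u)) * exp (- (d + e) * \<delta>)"
      by (simp add: exp_add[symmetric] algebra_simps)
    show ?thesis unfolding a b by (simp only: right_diff_distrib mult_1_right mult_ac)
  qed
  ultimately show ?thesis by linarith
qed

context rule_ode
begin

text \<open>The uniqueness clause makes these events disjoint for different \<open>k\<close>. Lower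
  bounds for them that add up to 1 therefore yield the upper bounds as well.\<close>

definition last_only :: "nat => nat => (nat => nat => nat) => bool" where
  "last_only n k v \<longleftrightarrow> T_last K l R n k v = T_con K l R n v &
     (ALL i:{1..K} - {k}. T_last K l R n i v ~= T_con K l R n v)"

lemma last_only_sets:
  assumes "n >= 1" "k \<in> {1..K}"
  shows "{v \<in> Om n. last_only n k v} \<in> sets (choice_space l n)"
  unfolding last_only_def using assms
  by (intro sets.sets_Collect_conj sets.sets_Collect_finite_All sets.sets_Collect_neg last_eq_con_sets) auto

lemma tm_antimono: "c' <= c ==> tm c' n <= tm c n"
  unfolding tm_def by (intro nat_mono floor_mono divide_right_mono add_left_mono mult_right_mono) auto

lemma clean_last_only:
  assumes ok: "ok n" and N: "rng n N" and v: "v \<in> Om n" "clean n N v" and k: "k \<in> slow K l R"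
    and M: "N <= M" "cnt n (G n v M) (slow K l R - {k}) = 0" "cnt n (G n v M) {k} ~= 0"
  shows "last_only n k v"
proof -
  note st = clean_zero_stays[OF ok N v] and tl = clean_T_last[OF ok N v] and tc = clean_T_con[OF ok N v]
  have kK: "k \<in> {1..K}" using k slow_subset by blast
  have slow: "cnt n E (slow K l R) = cnt n E {k} + cnt n E (slow K l R - {k})" for E
    using k comp_count_Un[of "{1..n}" "{k}" "slow K l R - {k}" E] by (simp add: insert_absorb)
  have sub: "slow K l R - {k} \<subseteq> {1..K}" using slow_subset by blast
  have nk: "~ T_last K l R n k v <= enat M" using tl[OF kK M(1)] M(3) by simp
  have nc: "~ T_con K l R n v <= enat M" using tc[OF M(1)] M(3) slow by simp
  have "T_last K l R n k v <= enat L \<longleftrightarrow> T_con K l R n v <= enat L" for L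
  proof (cases "M <= L")
    case True
    then have L: "N <= L" using M(1) by simp
    show ?thesis using st[OF M(1) True sub M(2)] slow by (simp add: tl[OF kK L] tc[OF L])
  next
    case False
    then have "enat L <= enat M" by simp
    then show ?thesis using nk nc by (meson order_trans)
  qed
  then have eq: "T_last K l R n k v = T_con K l R n v" by (subst enat_eq_iff_le) blast
  have "T_last K l R n i v ~= T_con K l R n v" if i: "i \<in> {1..K} - {k}" for i
  proof -
    have "cnt n (G n v M) {i} = 0"
    proof (cases "i \<in> slow K l R")
      case True
      then have "cnt n (G n v M) {i} <= cnt n (G n v M) (slow K l R - {k})" using i by (intro comp_count_mono) auto
      then show ?thesis using M(2) by simp
    next
      case False
      then have "i \<in> fast K l R" using i by (simp add: fast_def)
      then show ?thesis by (rule clean_fast[OF ok N v M(1)])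
    qed
    then have "T_last K l R n i v <= enat M" using tl[of i M] i M(1) by simp
    then show ?thesis using nc by auto
  qed
  then show ?thesis using eq by (simp add: last_only_def)
qed

text \<open>The times \<open>N i\<close> decrease in \<open>i\<close>, so \<open>N J\<close> is the
  earliest. Summand \<open>i\<close> is the probability that the other slow sizes are gone at
  \<open>N (Suc i)\<close> and that \<open>k\<close> vanishes between \<open>N (Suc i)\<close> and
  \<open>N i\<close>; on paths clean from \<open>N J\<close> on these events exclude each other and
  each implies \<open>last_only\<close>.\<close>

lemma last_only_prob:
  assumes ok: "ok n" and k: "k \<in> slow K l R"
    and N: "!!i. i <= J ==> rng n (N i)" "!!i j. i <= j ==> N j <= N i"
  shows "(SUM i<J. Mean n (%v. of_bool (cnt n (G n v (N (Suc i))) (slow K l R - {k}) = 0 & cnt n (G n v (N i)) {k} = 0))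
      - Mean n (%v. of_bool (cnt n (G n v (N (Suc i))) (slow K l R - {k}) = 0 & cnt n (G n v (N (Suc i))) {k} = 0)))
    <= \<P>(v in choice_space l n. last_only n k v) + real J * tau n"
proof -
  note n = okD(1)[OF ok]
  note rJ = N(1)[OF order_refl]
  let ?T = "slow K l R - {k}"
  have kK: "k \<in> {1..K}" using k slow_subset by blast
  let ?F = "%i v. cnt n (G n v (N (Suc i))) ?T = 0 & cnt n (G n v (N i)) {k} = 0"
  let ?F' = "%i v. cnt n (G n v (N (Suc i))) ?T = 0 & cnt n (G n v (N (Suc i))) {k} = 0"
  let ?E = "%i v. ?F i v & ~ cnt n (G n v (N (Suc i))) {k} = 0"
  let ?W = "%v. clean n (N J) v & (EX i:{..<J}. ?E i v)"
  have le: "N i <= hz n" if "i <= J" for i using N(1)[OF that] by (simp add: rng_def)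
  have aC: "adapted (hz n) (%v. cnt n (G n v (N i)) S)" if "i <= J" for i S
    by (rule adapted_G'[where f = "%E. cnt n E S", OF le[OF that]])
  have aF: "adapted (hz n) (%v. of_bool (?F i v) :: real)" "adapted (hz n) (%v. of_bool (?F' i v) :: real)"
    "adapted (hz n) (?E i)" if "i < J" for i
  proof -
    have i: "i <= J" "Suc i <= J" using that by auto
    show "adapted (hz n) (%v. of_bool (?F i v) :: real)"
      using i by (intro adapted_comp2[where h = "%a b. of_bool (a = 0 & b = 0)"] aC)
    show "adapted (hz n) (%v. of_bool (?F' i v) :: real)"
      using i by (intro adapted_comp2[where h = "%a b. of_bool (a = 0 & b = 0)"] aC)
    have "adapted (hz n) (?F i)"
      using i by (intro adapted_comp2[where h = "%a b. a = 0 & b = 0"] aC)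
    then show "adapted (hz n) (?E i)"
      by (rule adapted_comp2[where h = "%a b. a & ~ b = 0"]) (rule aC[OF i(2)])
  qed
  have aW: "adapted (hz n) ?W"
    using adapted_clean[OF ok rJ] aF(3) unfolding adapted_def by (smt (verit) bex_cong lessThan_iff)
  let ?s = "%v. SUM i<J. of_bool (?F i v) - of_bool (?F' i v) :: real"
  have aFd: "adapted (hz n) (%v. of_bool (?F i v) - of_bool (?F' i v) :: real)" if "i \<in> {..<J}" for i
    using that by (intro adapted_comp2[where h = "(-)", OF aF(1,2)]) auto
  have as: "adapted (hz n) ?s" by (rule adapted_sum[OF aFd])
  have aWr: "adapted (hz n) (%v. of_bool (?W v) :: real)" by (rule adapted_comp1[where h = of_bool, OF aW])
  have acr: "adapted (hz n) (%v. real J * of_bool (~ clean n (N J) v))"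
    by (rule adapted_comp1[where h = "%b. real J * of_bool (~ b)", OF adapted_clean[OF ok rJ]])
  have "Mean n ?s <= Mean n (%v. of_bool (?W v) + real J * of_bool (~ clean n (N J) v))"
  proof (rule Mean_mono[OF n as adapted_comp2[where h = "(+)", OF aWr acr]])
    fix v assume v: "v \<in> Om n"
    show "?s v <= of_bool (?W v) + real J * of_bool (~ clean n (N J) v)"
    proof (cases "clean n (N J) v")
      case False
      have "?s v <= (SUM i<J. 1)" by (intro sum_mono) auto
      then show ?thesis using False by simp
    next
      case True
      note st = clean_zero_stays[OF ok rJ v True]
      have "?s v <= (SUM i<J. of_bool (?E i v))" by (intro sum_mono) auto
      also have "... <= of_bool (EX i:{..<J}. ?E i v)"
      proof (rule eq_refl, rule sum_of_bool_unique)
        have lt: False if "i < j" "j < J" "?E i v" "?E j v" for i j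
        proof -
          have "N J <= N j" "N j <= N (Suc i)" using that N(2) by auto
          then have "cnt n (G n v (N (Suc i))) {k} = 0" using that(4) kK by (intro st[of "N j" "N (Suc i)" "{k}"]) auto
          then show False using that(3) by simp
        qed
        show "i = j" if "i \<in> {..<J}" "j \<in> {..<J}" "?E i v" "?E j v" for i j
          using lt[of i j] lt[of j i] that by (metis lessThan_iff linorder_neqE_nat)
      qed simp
      finally show ?thesis using True by simp
    qed
  qed
  also have "... = Mean n (%v. of_bool (?W v)) + real J * Mean n (%v. of_bool (~ clean n (N J) v))"
    by (simp only: Mean_add[OF n aWr acr] Mean_cmult)
  also have "... <= \<P>(v in choice_space l n. last_only n k v) + real J * tau n"
  proof (intro add_mono mult_left_mono not_clean_bound[OF ok rJ])
    show "Mean n (%v. of_bool (?W v)) <= \<P>(v in choice_space l n. last_only n k v)"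
    proof (rule Mean_le_prob[OF n aW last_only_sets[OF n kK]])
      fix v assume v: "v \<in> Om n" and W: "?W v"
      then obtain i where i: "i < J" "?E i v" by auto
      have "N J <= N (Suc i)" using i N(2) by simp
      then show "last_only n k v"
        using i W by (intro clean_last_only[OF ok rJ v _ k, of "N (Suc i)"]) auto
    qed
  qed simp
  also have "Mean n ?s = (SUM i<J. Mean n (%v. of_bool (?F i v)) - Mean n (%v. of_bool (?F' i v)))"
  proof -
    have "Mean n ?s = (SUM i<J. Mean n (%v. of_bool (?F i v) - of_bool (?F' i v)))" by (rule Mean_sum[OF n aFd])
    also have "... = (SUM i<J. Mean n (%v. of_bool (?F i v)) - Mean n (%v. of_bool (?F' i v)))"
      by (rule sum.cong[OF refl]) (simp only: lessThan_iff Mean_diff[OF n aF(1,2)])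
    finally show ?thesis .
  qed
  finally show ?thesis .
qed

lemma two_times_limit:
  assumes ST: "S \<subseteq> slow K l R" "T \<subseteq> slow K l R" "S \<inter> T = {}" and c: "ca <= cb"
  shows "(%n. Mean n (%v. of_bool (cnt n (G n v (tm ca n)) T = 0 & cnt n (G n v (tm cb n)) S = 0)))
    \<longlonglongrightarrow> exp (- (DD S * exp (- cb))) * exp (- (DD T * exp (- ca)))"
proof (rule close_tendsto)
  show "(%n. start_gf n S T (tm cb n) (tm ca n)) \<longlonglongrightarrow> exp (- (DD S * exp (- cb))) * exp (- (DD T * exp (- ca)))"
    by (intro start_gf_limit ST tm_dec) auto
  have "(%n. 2 * bad n + 2 * gerr n) \<longlonglongrightarrow> 2 * 0 + 2 * 0" by (intro tendsto_intros bad_tendsto gerr_tendsto)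
  then show "(%n. 2 * bad n + 2 * gerr n) \<longlonglongrightarrow> 0" by simp
  show "\<forall>\<^sub>F n in sequentially. \<bar>Mean n (%v. of_bool (cnt n (G n v (tm ca n)) T = 0 & cnt n (G n v (tm cb n)) S = 0))
      - start_gf n S T (tm cb n) (tm ca n)\<bar> <= 2 * bad n + 2 * gerr n"
    using ev_ok ev_rng_tm[of ca] ev_rng_tm[of cb] by eventually_elim (rule two_times[OF _ _ _ tm_antimono[OF c] ST])
qed

lemma DD_split: "k \<in> slow K l R ==> DD (slow K l R) = d k + DD (slow K l R - {k})"
  unfolding DD_def using finite_subset[OF slow_subset] by (intro sum.remove) auto

text \<open>For a fixed grid the joint laws at pairs of neighbouring times converge, and
  \<open>exp_increment\<close> compares the resulting sum with a telescoping one.\<close>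

lemma last_only_liminf_grid:
  assumes k: "k \<in> slow K l R" and \<delta>: "0 < \<delta>"
    and y: "y < exp (- (DD (slow K l R - {k}) * \<delta>)) * (d k / DD (slow K l R)) *
       (exp (- (DD (slow K l R) * \<delta>)) - exp (- (DD (slow K l R) * (real (Suc J) * \<delta>))))"
  shows "\<forall>\<^sub>F n in sequentially. y < \<P>(v in choice_space l n. last_only n k v)"
proof -
  let ?T = "slow K l R - {k}"
  let ?D = "DD (slow K l R)" and ?e = "DD ?T"
  have e0: "0 <= ?e" by (intro DD_nonneg) auto
  have d0: "0 < d k" by (rule slow_constants(2)[OF k])
  have Dk: "DD {k} = d k" by (simp add: DD_def)
  \<comment> \<open>Makes the grid equidistant in \<open>x = exp (- c)\<close>, with mesh
    \<open>\<delta>\<close>; increasing \<open>x\<close> means going back in time.\<close>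
  define c where "c i = - ln (real (Suc i) * \<delta>)" for i
  have ec: "exp (- c i) = real (Suc i) * \<delta>" for i unfolding c_def using \<delta> by simp
  have cm: "c j <= c i" if "i <= j" for i j
    unfolding c_def using that \<delta> by simp
  let ?F = "%n i. Mean n (%v. of_bool (cnt n (G n v (tm (c (Suc i)) n)) ?T = 0 & cnt n (G n v (tm (c i) n)) {k} = 0))
      - Mean n (%v. of_bool (cnt n (G n v (tm (c (Suc i)) n)) ?T = 0 & cnt n (G n v (tm (c (Suc i)) n)) {k} = 0))"
  let ?x = "%i. real (Suc i) * \<delta>"
  let ?L = "%i. exp (- (d k * ?x i)) * exp (- (?e * ?x (Suc i))) - exp (- (d k * ?x (Suc i))) * exp (- (?e * ?x (Suc i)))"
  have lim: "(%n. (SUM i<J. ?F n i) - real J * tau n) \<longlonglongrightarrow> (SUM i<J. ?L i) - real J * 0"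
  proof (intro tendsto_diff tendsto_sum tendsto_mult tendsto_const tau_tendsto)
    fix i
    show "(%n. Mean n (%v. of_bool (cnt n (G n v (tm (c (Suc i)) n)) ?T = 0 & cnt n (G n v (tm (c i) n)) {k} = 0)))
      \<longlonglongrightarrow> exp (- (d k * ?x i)) * exp (- (?e * ?x (Suc i)))"
      using two_times_limit[of "{k}" ?T "c (Suc i)" "c i"] k cm[of i "Suc i"] unfolding ec Dk by auto
    show "(%n. Mean n (%v. of_bool (cnt n (G n v (tm (c (Suc i)) n)) ?T = 0 & cnt n (G n v (tm (c (Suc i)) n)) {k} = 0)))
      \<longlonglongrightarrow> exp (- (d k * ?x (Suc i))) * exp (- (?e * ?x (Suc i)))"
      using two_times_limit[of "{k}" ?T "c (Suc i)" "c (Suc i)"] k unfolding ec Dk by auto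
  qed
  have "exp (- (?e * \<delta>)) * (d k / ?D) * (exp (- (?D * \<delta>)) - exp (- (?D * (real (Suc J) * \<delta>)))) <= (SUM i<J. ?L i)"
  proof -
    have "(SUM i<J. exp (- (?e * \<delta>)) * (d k / ?D) * (exp (- (?D * ?x i)) - exp (- (?D * ?x (Suc i))))) <= (SUM i<J. ?L i)"
    proof (rule sum_mono)
      fix i
      have "?x i + \<delta> = ?x (Suc i)" by (simp add: algebra_simps)
      then show "exp (- (?e * \<delta>)) * (d k / ?D) * (exp (- (?D * ?x i)) - exp (- (?D * ?x (Suc i)))) <= ?L i"
        using exp_increment[OF d0 e0 less_imp_le[OF \<delta>], of "?x i"] by (simp only: DD_split[OF k])
    qed
    also have "(SUM i<J. exp (- (?e * \<delta>)) * (d k / ?D) * (exp (- (?D * ?x i)) - exp (- (?D * ?x (Suc i)))))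
      = exp (- (?e * \<delta>)) * (d k / ?D) * (exp (- (?D * ?x 0)) - exp (- (?D * ?x J)))"
      unfolding sum_distrib_left[symmetric] by (subst sum_lessThan_telescope'[of "%i. exp (- (?D * ?x i))"]) simp
    finally show ?thesis by simp
  qed
  then have "y < (SUM i<J. ?L i) - real J * 0" using y by simp
  then have "\<forall>\<^sub>F n in sequentially. y < (SUM i<J. ?F n i) - real J * tau n" by (rule order_tendstoD(1)[OF lim])
  moreover have "\<forall>\<^sub>F n in sequentially. ALL i:{..J}. rng n (tm (c i) n)"
    by (intro eventually_ball_finite ballI ev_rng_tm) simp
  ultimately show ?thesis using ev_ok
  proof eventually_elim
    case (elim n)
    have "(SUM i<J. ?F n i) <= \<P>(v in choice_space l n. last_only n k v) + real J * tau n"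
      by (rule last_only_prob[OF elim(3) k, of J "%i. tm (c i) n"]) (use elim(2) tm_antimono[OF cm] in auto)
    then show ?case using elim(1) by linarith
  qed
qed

lemma last_only_liminf:
  assumes k: "k \<in> slow K l R" and y: "y < d k / DD (slow K l R)"
  shows "\<forall>\<^sub>F n in sequentially. y < \<P>(v in choice_space l n. last_only n k v)"
proof -
  let ?D = "DD (slow K l R)" and ?e = "DD (slow K l R - {k})"
  \<comment> \<open>Mesh \<open>1 / m\<close> with \<open>m * m\<close> cells: the mesh tends to 0
    while the covered range of \<open>x\<close>, about \<open>m\<close>, exhausts the half
    line.\<close>
  let ?f = "%m::nat. exp (- (?e * (1 / real m))) * (d k / ?D) * (exp (- (?D * (1 / real m))) - exp (- (?D * (real (Suc (m * m)) * (1 / real m)))))"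
  have i: "(%m::nat. 1 / real m) \<longlonglongrightarrow> 0" by (rule lim_const_over_n)
  have z: "(%m::nat. exp (- (?D * (real (Suc (m * m)) * (1 / real m))))) \<longlonglongrightarrow> 0"
  proof (rule tendsto_sandwich[OF _ _ tendsto_const])
    have "filterlim (%m::nat. ?D * real m) at_top sequentially"
      by (intro filterlim_tendsto_pos_mult_at_top[OF tendsto_const DD_pos] filterlim_real_sequentially)
    then have "filterlim (%m::nat. - (?D * real m)) at_bot sequentially" by (simp add: filterlim_uminus_at_bot)
    then show "(%m::nat. exp (- (?D * real m))) \<longlonglongrightarrow> 0" by (rule filterlim_compose[OF exp_at_bot])
    show "\<forall>\<^sub>F m::nat in sequentially. exp (- (?D * (real (Suc (m * m)) * (1 / real m)))) <= exp (- (?D * real m))"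
      using eventually_gt_at_top[of 0]
    proof eventually_elim
      case (elim m)
      have "real m <= real (Suc (m * m)) * (1 / real m)" using elim by (simp add: field_simps)
      then have "?D * real m <= ?D * (real (Suc (m * m)) * (1 / real m))" using DD_pos by (intro mult_left_mono) auto
      then show ?case by (simp only: exp_le_cancel_iff neg_le_iff_le)
    qed
  qed simp
  have "?f \<longlonglongrightarrow> exp (- (?e * 0)) * (d k / ?D) * (exp (- (?D * 0)) - 0)"
    by (intro tendsto_intros i z)
  then have "?f \<longlonglongrightarrow> d k / ?D" by simp
  then have "\<forall>\<^sub>F m in sequentially. y < ?f m" using y by (rule order_tendstoD(1))
  then have "\<forall>\<^sub>F m in sequentially. y < ?f m & 0 < m"
    using eventually_gt_at_top[of 0] by eventually_elim simp
  then obtain m where m: "y < ?f m" "0 < m" by (metis (mono_tags, lifting) eventually_sequentially order_refl)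
  show ?thesis by (rule last_only_liminf_grid[OF k _ m(1)]) (use m(2) in simp)
qed

lemma last_eq_con_upper:
  assumes n: "n >= 1" and k: "k \<in> {1..K}"
  shows "\<P>(v in choice_space l n. T_last K l R n k v = T_con K l R n v)
    <= 1 - (SUM i:slow K l R - {k}. \<P>(v in choice_space l n. last_only n i v))"
proof -
  interpret prob_space "choice_space l n" by (rule prob_choice[OF n])
  let ?A = "{v \<in> Om n. T_last K l R n k v = T_con K l R n v}"
  let ?B = "%i. {v \<in> Om n. last_only n i v}"
  let ?I = "slow K l R - {k}"
  have fin: "finite ?I" using finite_subset[OF slow_subset] by simp
  have IK: "i \<in> {1..K}" if "i \<in> ?I" for i using that slow_subset by blast
  have B: "?B i \<in> events" if "i \<in> ?I" for i by (rule last_only_sets[OF n IK[OF that]])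
  have A: "?A \<in> events" using k by (intro last_eq_con_sets n) auto
  have "prob (\<Union>i\<in>?I. ?B i) = (SUM i:?I. prob (?B i))"
  proof (rule finite_measure_finite_Union[OF fin])
    show "disjoint_family_on ?B ?I"
      unfolding disjoint_family_on_def last_only_def using IK by blast
  qed (use B in blast)
  moreover have "prob (?A \<union> (\<Union>i\<in>?I. ?B i)) = prob ?A + prob (\<Union>i\<in>?I. ?B i)"
  proof (rule finite_measure_Union[OF A])
    show "(\<Union>i\<in>?I. ?B i) \<in> events" using fin B by (intro sets.finite_UN) auto
    show "?A \<inter> (\<Union>i\<in>?I. ?B i) = {}" unfolding last_only_def using k by blast
  qed
  moreover have "prob (?A \<union> (\<Union>i\<in>?I. ?B i)) <= 1" by (rule prob_le_1)
  ultimately show ?thesis by linarith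
qed

lemma last_eq_con_upper_ev:
  assumes k: "k \<in> {1..K}" and \<epsilon>: "0 < \<epsilon>"
  shows "\<forall>\<^sub>F n in sequentially. \<P>(v in choice_space l n. T_last K l R n k v = T_con K l R n v)
    <= 1 - DD (slow K l R - {k}) / DD (slow K l R) + \<epsilon>"
proof -
  let ?I = "slow K l R - {k}"
  define \<eta> where "\<eta> = \<epsilon> / (real (card ?I) + 1)"
  have \<eta>: "0 < \<eta>" using \<epsilon> by (simp add: \<eta>_def add_nonneg_pos)
  have fin: "finite ?I" using finite_subset[OF slow_subset] by simp
  have "\<forall>\<^sub>F n in sequentially. ALL i:?I. d i / DD (slow K l R) - \<eta> < \<P>(v in choice_space l n. last_only n i v)"
    using fin \<eta> by (intro eventually_ball_finite ballI last_only_liminf) auto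
  then show ?thesis using eventually_ge_at_top[of 1]
  proof eventually_elim
    case (elim n)
    have "(SUM i:?I. d i / DD (slow K l R) - \<eta>) <= (SUM i:?I. \<P>(v in choice_space l n. last_only n i v))"
      using elim(1) by (intro sum_mono) (simp add: less_imp_le)
    moreover have "(SUM i:?I. d i / DD (slow K l R) - \<eta>) = DD ?I / DD (slow K l R) - real (card ?I) * \<eta>"
      by (simp add: sum_subtractf DD_def sum_divide_distrib)
    moreover have "real (card ?I) * \<eta> <= \<epsilon>"
    proof -
      have "real (card ?I) * \<eta> <= (real (card ?I) + 1) * \<eta>" using \<eta> by (intro mult_right_mono) auto
      also have "... = (real (card ?I) + 1) * \<epsilon> / (real (card ?I) + 1)" by (simp only: \<eta>_def times_divide_eq_right)
      also have "... = \<epsilon>" by (rule nonzero_mult_div_cancel_left) linarith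
      finally show ?thesis .
    qed
    ultimately show ?case using last_eq_con_upper[OF elim(2) k] by linarith
  qed
qed

text \<open>The events for the other slow sizes already take up
  \<open>DD (slow K l R - {k}) / DD (slow K l R)\<close> in the limit. This leaves at most
  \<open>d k / DD (slow K l R)\<close> for a slow \<open>k\<close>, matching the lower bound, and
  nothing for a fast one.\<close>

theorem last_vanishing_size:
  shows "k \<in> fast K l R ==> (%n. \<P>(v in choice_space l n. T_last K l R n k v = T_con K l R n v)) \<longlonglongrightarrow> 0"
    "k \<in> slow K l R ==> (%n. \<P>(v in choice_space l n. T_last K l R n k v = T_con K l R n v))
       \<longlonglongrightarrow> d k / (SUM i:slow K l R. d i)"
proof -
  let ?p = "%k n. \<P>(v in choice_space l n. T_last K l R n k v = T_con K l R n v)"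
  have D: "DD (slow K l R) ~= 0" using DD_pos by simp
  have upper: "\<forall>\<^sub>F n in sequentially. ?p k n < y" if k: "k \<in> {1..K}" and y: "1 - DD (slow K l R - {k}) / DD (slow K l R) < y" for k y
  proof -
    define q where "q = 1 - DD (slow K l R - {k}) / DD (slow K l R)"
    have "0 < (y - q) / 2" using y by (simp add: q_def)
    from last_eq_con_upper_ev[OF k this] show ?thesis
      unfolding q_def[symmetric]
    proof (rule eventually_mono)
      fix n assume "?p k n <= q + (y - q) / 2"
      then show "?p k n < y" using y[folded q_def] by argo
    qed
  qed
  show "(%n. ?p k n) \<longlonglongrightarrow> 0" if k: "k \<in> fast K l R"
  proof (rule order_tendstoI)
    fix y :: real assume "y < 0"
    then show "\<forall>\<^sub>F n in sequentially. y < ?p k n" by (auto intro: always_eventually less_le_trans[OF _ measure_nonneg])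
  next
    fix y :: real assume y: "0 < y"
    have "slow K l R - {k} = slow K l R" "k \<in> {1..K}" using k by (auto simp: fast_def)
    then show "\<forall>\<^sub>F n in sequentially. ?p k n < y" using y D by (intro upper) auto
  qed
  show "(%n. ?p k n) \<longlonglongrightarrow> d k / (SUM i:slow K l R. d i)" if k: "k \<in> slow K l R"
    unfolding DD_def[symmetric]
  proof (rule order_tendstoI)
    have kK: "k \<in> {1..K}" using k slow_subset by blast
    fix y
    {
      assume "y < d k / DD (slow K l R)"
      from last_only_liminf[OF k this] show "\<forall>\<^sub>F n in sequentially. y < ?p k n"
        using eventually_ge_at_top[of 1]
      proof eventually_elim
        case (elim n)
        interpret prob_space "choice_space l n" by (rule prob_choice[OF elim(2)])
        have "\<P>(v in choice_space l n. last_only n k v) <= ?p k n"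
          using kK elim(2) by (intro finite_measure_mono last_eq_con_sets) (auto simp: last_only_def)
        then show ?case using elim(1) by linarith
      qed
    next
      assume y: "d k / DD (slow K l R) < y"
      have "1 - DD (slow K l R - {k}) / DD (slow K l R) = d k / DD (slow K l R)"
        using D DD_split[OF k] by (simp add: field_simps)
      then show "\<forall>\<^sub>F n in sequentially. ?p k n < y" using y kK by (intro upper) auto
    }
  qed
qed

end

theorem theorem1:
  fixes K l :: nat
    and R :: "(nat \<Rightarrow> enat) \<Rightarrow> nat"
    and z :: "real \<Rightarrow> enat \<Rightarrow> real"
  assumes "K \<ge> 1" and "l \<ge> 1" and "even l"
    and "is_rule K l R"
    and "\<not> degenerate K l R"
    and "ex_rate K l R < 2 * K + 2"
    and "ode_solution K l R z"
  shows
    "(\<forall>k\<in>slow K l R. \<exists>L. (shifted_log K l R z k \<longlongrightarrow> L) at_top) \<and>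
     (\<forall>c :: real.
         (\<lambda>n. 1 - \<P>(v in choice_space l n.
             \<forall>N. real N \<ge> (real n * ln (real n) + c * real n) / real (ex_rate K l R) \<longrightarrow>
                 (\<forall>k\<in>fast K l R. Y K l R n k v N = 0) \<and>
                 card (large_components K l R n v N) = 1))
           \<in> o(\<lambda>n. 1 / ln (real n))) \<and>
     (\<forall>c :: real.
         (\<lambda>n. \<P>(v in choice_space l n.
             ereal_of_enat (T_con K l R n v)
               \<le> ereal ((real n * ln (real n) + c * real n) / real (ex_rate K l R))))
           \<longlonglongrightarrow> (\<Prod>k\<in>slow K l R. exp (- (d_const K l R z k * exp (- c))))) \<and>
     (\<forall>\<^sub>F n in sequentially.
         (\<integral>\<^sup>+ v. ennreal_of_enat (T_con K l R n v) \<partial>choice_space l n) < \<infinity>) \<and>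
     ((\<lambda>n. enn2real (\<integral>\<^sup>+ v. ennreal_of_enat (T_con K l R n v) \<partial>choice_space l n)
            - (real n * ln (real n) + euler_mascheroni * real n
                 + ln (\<Sum>k\<in>slow K l R. d_const K l R z k) * real n) / real (ex_rate K l R))
         \<in> o(\<lambda>n. real n)) \<and>
     (\<forall>k\<in>fast K l R.
         (\<lambda>n. \<P>(v in choice_space l n. T_last K l R n k v = T_con K l R n v)) \<longlonglongrightarrow> 0) \<and>
     (\<forall>k\<in>slow K l R.
         (\<lambda>n. \<P>(v in choice_space l n. T_last K l R n k v = T_con K l R n v))
           \<longlonglongrightarrow> d_const K l R z k / (\<Sum>i\<in>slow K l R. d_const K l R z i))"
proof -
  interpret rule_ode K l R z by unfold_locales (use assms in auto)
  show ?thesis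
    by (intro conjI ballI allI slow_constants(1) fast_components_vanish T_con_limit_law T_con_expectation last_vanishing_size)
qed

end
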